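(* Let $\mathcal{S}$ be a triangulated category containing all set-indexed coproducts. If $\mathcal{S}$ is a Brown category with a generating phantom projective class, then the Adams spectral sequence (with respect to the phantom projective class) collapses at the $E_2$-term and the composite of two phantom maps is zero. Moreover, if $\{X_\alpha\}$ is a filtered diagram of finite objects with minimal cone $X$, then there is a short exact sequence $$0\to\varprojlim\nolimits^1\mathcal{S}(\Sigma X_\alpha,Y)\to\mathcal{S}(X,Y)\to\varprojlim\mathcal{S}(X_\alpha,Y)\to 0$$ natural in $Y$. The kernel (of $\mathcal{S}(X,Y)\to\varprojlim\mathcal{S}(X_\alpha,Y)$) consists of the phantom maps from $X$ to $Y$, and $\varprojlim^i\mathcal{S}(\Sigma X_\alpha,Y)$ is zero for $i\ge 2$.
   Context: An object $W$ is finite if for any set-indexed collection $\{X_\alpha\}$ of objects the natural map $\bigoplus_\alpha\mathcal{S}(W,X_\alpha)\to\mathcal{S}(W,\coprod_\alpha X_\alpha)$ is an isomorphism. $\mathcal{P}$ denotes the class of retracts of coproducts of finite objects. A map $X\to Y$ is phantom if for each finite $W$ and each map $W\to X$ the composite $W\to X\to Y$ is zero; $\mathcal{I}$ denotes the class of phantom maps. A pair $(\mathcal{P},\mathcal{I})$ is a projective class if $\mathcal{I}$ is exactly the class of maps $X\to Y$ such that all composites $P\to X\to Y$ with $P$ in $\mathcal{P}$ vanish, $\mathcal{P}$ is exactly the class of objects $P$ such that all composites $P\to X\to Y$ with $X\to Y$ in $\mathcal{I}$ vanish, and each object $X$ lies in an exact triangle $P\to X\to Y\to\Sigma P$ with $P$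 in $\mathcal{P}$ and $X\to Y$ in $\mathcal{I}$. $\mathcal{S}$ has a generating phantom projective class if this pair of retracts of coproducts of finite objects and phantom maps is a projective class and it generates, i.e. for each non-zero $X$ there is $P$ in $\mathcal{P}$ with $\mathcal{S}(P,X)\neq 0$. $\mathcal{S}$ is a Brown category if for any two objects $X,Y$, regarding $\mathcal{S}(-,X)$ and $\mathcal{S}(-,Y)$ as functors from finite objects to abelian groups, any natural transformation $\mathcal{S}(-,X)\to\mathcal{S}(-,Y)$ is induced by a map $X\to Y$. Diagrams are indexed by small categories. A cone from a diagram $\{X_\alpha\}$ to $X$ is a natural transformation from the diagram to the constant diagram at $X$; it is a minimal cone if the induced map $\varinjlim\mathcal{S}(W,X_\alpha)\to\mathcal{S}(W,X)$ is an isomorphism for each finite $W$. $\varprojlim^i$ is the $i$th right derived functor of inverse limit. Write $\mathcal{S}(X,Y)_n=\mathcal{S}(\Sigma^nX,Y)$. An Adams resolution of $X$ is a sequence $X=X_0\to X_1\to X_2\to\cdots$ of maps in $\mathcal{I}$ together with exact triangles $P_n\to X_n\to X_{n+1}\to\Sigma P_n$ with each $P_n$ in $\mathcal{P}$. Applying $\mathcal{S}(-,Y)_*$ gives an exact couple with terms $\mathcal{S}(X_n,Y)_*$ and $\mathcal{S}(P_n,Y)_*$, whose spectral sequence (with $E_1^s=\mathcal{S}(P_s,Y)_*$) is the Adams spectral sequence abutting to $\mathcal{S}(X,Y)$. *)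

theory Defs
  imports "HOL-Algebra.Product_Groups" "HOL-Algebra.FiniteProduct"
begin

section \<open>Smallness\<close>

text \<open>
  ``Set-indexed'' and ``small'' are relative to a collection of small subsets of an index type.
  Only the closure properties below are imposed. They hold for the sets of cardinality less than an
  inaccessible cardinal (a Grothendieck universe), and also for the collection of all subsets of
  an infinite type.
\<close>

definition smallness :: "('i set \<Rightarrow> bool) \<Rightarrow> bool" where
  "smallness small \<longleftrightarrow>
     (\<forall>A B. small A \<longrightarrow> B \<subseteq> A \<longrightarrow> small B) \<and>
     (\<forall>A (f :: 'i \<Rightarrow> 'i). small A \<longrightarrow> small (f ` A)) \<and>
     (\<exists>A. small A \<and> infinite A)"


section \<open>Categories, functors, coproducts\<close>

record ('o, 'a) category_data =
  Ob :: "'o set"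
  Hom :: "'o \<Rightarrow> 'o \<Rightarrow> 'a set"
  Id :: "'o \<Rightarrow> 'a"
  Comp :: "'a \<Rightarrow> 'a \<Rightarrow> 'a"  (infixr \<open>\<cdot>\<index>\<close> 70)

text \<open>Hom-sets are disjoint, so that an arrow determines its source and target.\<close>

locale category =
  fixes C :: "('o, 'a, 'z) category_data_scheme" (structure)
  assumes hom_disjoint:
    "\<lbrakk> X \<in> Ob C; Y \<in> Ob C; X' \<in> Ob C; Y' \<in> Ob C; f \<in> Hom C X Y; f \<in> Hom C X' Y' \<rbrakk>
      \<Longrightarrow> X = X' \<and> Y = Y'"
  and id_hom: "X \<in> Ob C \<Longrightarrow> Id C X \<in> Hom C X X"
  and comp_hom:
    "\<lbrakk> X \<in> Ob C; Y \<in> Ob C; Z \<in> Ob C; f \<in> Hom C X Y; g \<in> Hom C Y Z \<rbrakk> \<Longrightarrow> g \<cdot> f \<in> Hom C X Z"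
  and comp_id_right: "\<lbrakk> X \<in> Ob C; Y \<in> Ob C; f \<in> Hom C X Y \<rbrakk> \<Longrightarrow> f \<cdot> Id C X = f"
  and comp_id_left: "\<lbrakk> X \<in> Ob C; Y \<in> Ob C; f \<in> Hom C X Y \<rbrakk> \<Longrightarrow> Id C Y \<cdot> f = f"
  and comp_assoc:
    "\<lbrakk> W \<in> Ob C; X \<in> Ob C; Y \<in> Ob C; Z \<in> Ob C;
       f \<in> Hom C W X; g \<in> Hom C X Y; h \<in> Hom C Y Z \<rbrakk> \<Longrightarrow> (h \<cdot> g) \<cdot> f = h \<cdot> (g \<cdot> f)"

definition arrows :: "('o, 'a, 'z) category_data_scheme \<Rightarrow> 'a set" where
  "arrows C = (\<Union>X\<in>Ob C. \<Union>Y\<in>Ob C. Hom C X Y)"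

definition opposite :: "('o, 'a, 'z) category_data_scheme \<Rightarrow> ('o, 'a) category_data" where
  "opposite C = \<lparr> Ob = Ob C, Hom = (\<lambda>X Y. Hom C Y X), Id = Id C, Comp = (\<lambda>g f. f \<cdot>\<^bsub>C\<^esub> g) \<rparr>"

definition small_category ::
  "('i set \<Rightarrow> bool) \<Rightarrow> ('i, 'i, 'z) category_data_scheme \<Rightarrow> bool" where
  "small_category small C \<longleftrightarrow> category C \<and> small (Ob C) \<and> small (arrows C)"

definition filtered :: "('o, 'a, 'z) category_data_scheme \<Rightarrow> bool" where
  "filtered C \<longleftrightarrow>
     Ob C \<noteq> {} \<and>
     (\<forall>X\<in>Ob C. \<forall>Y\<in>Ob C. \<exists>Z\<in>Ob C. Hom C X Z \<noteq> {} \<and> Hom C Y Z \<noteq> {}) \<and>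
     (\<forall>X\<in>Ob C. \<forall>Y\<in>Ob C. \<forall>f\<in>Hom C X Y. \<forall>g\<in>Hom C X Y.
        \<exists>Z\<in>Ob C. \<exists>h\<in>Hom C Y Z. h \<cdot>\<^bsub>C\<^esub> f = h \<cdot>\<^bsub>C\<^esub> g)"

definition is_functor ::
  "('p, 'b, 'y) category_data_scheme \<Rightarrow> ('o, 'a, 'z) category_data_scheme \<Rightarrow>
   ('p \<Rightarrow> 'o) \<Rightarrow> ('b \<Rightarrow> 'a) \<Rightarrow> bool" where
  "is_functor C S Do Da \<longleftrightarrow>
     (\<forall>\<alpha>\<in>Ob C. Do \<alpha> \<in> Ob S) \<and>
     (\<forall>\<alpha>\<in>Ob C. \<forall>\<beta>\<in>Ob C. \<forall>a\<in>Hom C \<alpha> \<beta>. Da a \<in> Hom S (Do \<alpha>) (Do \<beta>)) \<and>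
     (\<forall>\<alpha>\<in>Ob C. Da (Id C \<alpha>) = Id S (Do \<alpha>)) \<and>
     (\<forall>\<alpha>\<in>Ob C. \<forall>\<beta>\<in>Ob C. \<forall>\<gamma>\<in>Ob C. \<forall>a\<in>Hom C \<alpha> \<beta>. \<forall>b\<in>Hom C \<beta> \<gamma>.
        Da (b \<cdot>\<^bsub>C\<^esub> a) = Da b \<cdot>\<^bsub>S\<^esub> Da a)"

definition is_cone ::
  "('p, 'b, 'y) category_data_scheme \<Rightarrow> ('o, 'a, 'z) category_data_scheme \<Rightarrow>
   ('p \<Rightarrow> 'o) \<Rightarrow> ('b \<Rightarrow> 'a) \<Rightarrow> 'o \<Rightarrow> ('p \<Rightarrow> 'a) \<Rightarrow> bool" where
  "is_cone C S Do Da X c \<longleftrightarrow>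
     X \<in> Ob S \<and> (\<forall>\<alpha>\<in>Ob C. c \<alpha> \<in> Hom S (Do \<alpha>) X) \<and>
     (\<forall>\<alpha>\<in>Ob C. \<forall>\<beta>\<in>Ob C. \<forall>a\<in>Hom C \<alpha> \<beta>. c \<beta> \<cdot>\<^bsub>S\<^esub> Da a = c \<alpha>)"

definition is_coproduct ::
  "('o, 'a, 'z) category_data_scheme \<Rightarrow> 'j set \<Rightarrow> ('j \<Rightarrow> 'o) \<Rightarrow> 'o \<Rightarrow> ('j \<Rightarrow> 'a) \<Rightarrow> bool" where
  "is_coproduct C I X P \<iota> \<longleftrightarrow>
     P \<in> Ob C \<and> (\<forall>\<alpha>\<in>I. X \<alpha> \<in> Ob C \<and> \<iota> \<alpha> \<in> Hom C (X \<alpha>) P) \<and>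
     (\<forall>Z\<in>Ob C. \<forall>f. (\<forall>\<alpha>\<in>I. f \<alpha> \<in> Hom C (X \<alpha>) Z) \<longrightarrow>
        (\<exists>!g. g \<in> Hom C P Z \<and> (\<forall>\<alpha>\<in>I. g \<cdot>\<^bsub>C\<^esub> \<iota> \<alpha> = f \<alpha>)))"

definition has_small_coproducts ::
  "('i set \<Rightarrow> bool) \<Rightarrow> ('o, 'a, 'z) category_data_scheme \<Rightarrow> bool" where
  "has_small_coproducts small C \<longleftrightarrow>
     (\<forall>I X. small I \<longrightarrow> (\<forall>\<alpha>\<in>I. X \<alpha> \<in> Ob C) \<longrightarrow> (\<exists>P \<iota>. is_coproduct C I X P \<iota>))"

definition is_retract :: "('o, 'a, 'z) category_data_scheme \<Rightarrow> 'o \<Rightarrow> 'o \<Rightarrow> bool" where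
  "is_retract C X Y \<longleftrightarrow> X \<in> Ob C \<and> Y \<in> Ob C \<and>
     (\<exists>s\<in>Hom C X Y. \<exists>r\<in>Hom C Y X. r \<cdot>\<^bsub>C\<^esub> s = Id C X)"

definition is_iso_arrow :: "('o, 'a, 'z) category_data_scheme \<Rightarrow> 'o \<Rightarrow> 'o \<Rightarrow> 'a \<Rightarrow> bool" where
  "is_iso_arrow C X Y f \<longleftrightarrow> f \<in> Hom C X Y \<and>
     (\<exists>g\<in>Hom C Y X. g \<cdot>\<^bsub>C\<^esub> f = Id C X \<and> f \<cdot>\<^bsub>C\<^esub> g = Id C Y)"


section \<open>Additive and triangulated categories\<close>

record ('o, 'a) additive_data = "('o, 'a) category_data" +
  Add :: "'a \<Rightarrow> 'a \<Rightarrow> 'a"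
  Zero :: "'o \<Rightarrow> 'o \<Rightarrow> 'a"

text \<open>The abelian group $S(X,Y)$, written multiplicatively as everywhere in HOL-Algebra.\<close>

definition hom_group :: "('o, 'a, 'z) additive_data_scheme \<Rightarrow> 'o \<Rightarrow> 'o \<Rightarrow> 'a monoid" where
  "hom_group S X Y = \<lparr> carrier = Hom S X Y, monoid.mult = Add S, one = Zero S X Y \<rparr>"

definition zero_object :: "('o, 'a, 'z) additive_data_scheme \<Rightarrow> 'o \<Rightarrow> bool" where
  "zero_object S Z \<longleftrightarrow> Z \<in> Ob S \<and>
     (\<forall>X\<in>Ob S. Hom S X Z = {Zero S X Z} \<and> Hom S Z X = {Zero S Z X})"

locale additive_category = category S
  for S :: "('o, 'a, 'z) additive_data_scheme" (structure) +
  assumes hom_comm_group: "\<lbrakk> X \<in> Ob S; Y \<in> Ob S \<rbrakk> \<Longrightarrow> comm_group (hom_group S X Y)"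
  and comp_add_right:
    "\<lbrakk> X \<in> Ob S; Y \<in> Ob S; Z \<in> Ob S; f \<in> Hom S X Y; f' \<in> Hom S X Y; g \<in> Hom S Y Z \<rbrakk>
      \<Longrightarrow> g \<cdot> Add S f f' = Add S (g \<cdot> f) (g \<cdot> f')"
  and comp_add_left:
    "\<lbrakk> X \<in> Ob S; Y \<in> Ob S; Z \<in> Ob S; f \<in> Hom S X Y; g \<in> Hom S Y Z; g' \<in> Hom S Y Z \<rbrakk>
      \<Longrightarrow> Add S g g' \<cdot> f = Add S (g \<cdot> f) (g' \<cdot> f)"
  and ex_zero_object: "\<exists>Z. zero_object S Z"
  and ex_binary_coproduct:
    "\<lbrakk> X \<in> Ob S; Y \<in> Ob S \<rbrakk>
      \<Longrightarrow> \<exists>P \<iota>. is_coproduct S (UNIV :: bool set) (\<lambda>b. if b then X else Y) P \<iota>"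

text \<open>An exact triangle $X \to Y \to Z \to \Sigma X$ is recorded by its three maps.\<close>

record ('o, 'a) triangulated_data = "('o, 'a) additive_data" +
  Sus :: "'o \<Rightarrow> 'o"
  SusMap :: "'a \<Rightarrow> 'a"
  Triangles :: "('a \<times> 'a \<times> 'a) set"

definition exact_triangle ::
  "('o, 'a, 'z) triangulated_data_scheme \<Rightarrow> 'o \<Rightarrow> 'o \<Rightarrow> 'o \<Rightarrow> 'a \<Rightarrow> 'a \<Rightarrow> 'a \<Rightarrow> bool" where
  "exact_triangle S X Y Z u v w \<longleftrightarrow>
     X \<in> Ob S \<and> Y \<in> Ob S \<and> Z \<in> Ob S \<and>
     u \<in> Hom S X Y \<and> v \<in> Hom S Y Z \<and> w \<in> Hom S Z (Sus S X) \<and> (u, v, w) \<in> Triangles S"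

text \<open>
  Verdier's axioms. The suspension is an additive automorphism. In the octahedral axiom
  \<open>(u, a, a')\<close>, \<open>(v, b, b')\<close>, \<open>(v \<cdot> u, c, c')\<close> are the given triangles.
\<close>

locale triangulated_category = additive_category S
  for S :: "('o, 'a, 'z) triangulated_data_scheme" (structure) +
  assumes sus_bij: "bij_betw (Sus S) (Ob S) (Ob S)"
  and sus_map_bij:
    "\<lbrakk> X \<in> Ob S; Y \<in> Ob S \<rbrakk> \<Longrightarrow> bij_betw (SusMap S) (Hom S X Y) (Hom S (Sus S X) (Sus S Y))"
  and sus_map_id: "X \<in> Ob S \<Longrightarrow> SusMap S (Id S X) = Id S (Sus S X)"
  and sus_map_comp:
    "\<lbrakk> X \<in> Ob S; Y \<in> Ob S; Z \<in> Ob S; f \<in> Hom S X Y; g \<in> Hom S Y Z \<rbrakk>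
      \<Longrightarrow> SusMap S (g \<cdot> f) = SusMap S g \<cdot> SusMap S f"
  and sus_map_add:
    "\<lbrakk> X \<in> Ob S; Y \<in> Ob S; f \<in> Hom S X Y; g \<in> Hom S X Y \<rbrakk>
      \<Longrightarrow> SusMap S (Add S f g) = Add S (SusMap S f) (SusMap S g)"
  and triangle_id:
    "\<lbrakk> X \<in> Ob S; zero_object S Z \<rbrakk>
      \<Longrightarrow> exact_triangle S X X Z (Id S X) (Zero S X Z) (Zero S Z (Sus S X))"
  and triangle_iso:
    "\<lbrakk> exact_triangle S X Y Z u v w; X' \<in> Ob S; Y' \<in> Ob S; Z' \<in> Ob S;
       u' \<in> Hom S X' Y'; v' \<in> Hom S Y' Z'; w' \<in> Hom S Z' (Sus S X');
       is_iso_arrow S X X' f; is_iso_arrow S Y Y' g; is_iso_arrow S Z Z' h;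
       g \<cdot> u = u' \<cdot> f; h \<cdot> v = v' \<cdot> g; SusMap S f \<cdot> w = w' \<cdot> h \<rbrakk>
      \<Longrightarrow> exact_triangle S X' Y' Z' u' v' w'"
  and triangle_extend:
    "\<lbrakk> X \<in> Ob S; Y \<in> Ob S; u \<in> Hom S X Y \<rbrakk> \<Longrightarrow> \<exists>Z v w. exact_triangle S X Y Z u v w"
  and triangle_rotate:
    "\<lbrakk> X \<in> Ob S; Y \<in> Ob S; Z \<in> Ob S;
       u \<in> Hom S X Y; v \<in> Hom S Y Z; w \<in> Hom S Z (Sus S X) \<rbrakk>
      \<Longrightarrow> exact_triangle S X Y Z u v w \<longleftrightarrow>
          exact_triangle S Y Z (Sus S X) v w (inv\<^bsub>hom_group S (Sus S X) (Sus S Y)\<^esub> (SusMap S u))"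
  and triangle_fill_in:
    "\<lbrakk> exact_triangle S X Y Z u v w; exact_triangle S X' Y' Z' u' v' w';
       f \<in> Hom S X X'; g \<in> Hom S Y Y'; g \<cdot> u = u' \<cdot> f \<rbrakk>
      \<Longrightarrow> \<exists>h\<in>Hom S Z Z'. h \<cdot> v = v' \<cdot> g \<and> SusMap S f \<cdot> w = w' \<cdot> h"
  and octahedral:
    "\<lbrakk> exact_triangle S X Y U u a a'; exact_triangle S Y Z V v b b';
       exact_triangle S X Z W (v \<cdot> u) c c' \<rbrakk>
      \<Longrightarrow> \<exists>f g. exact_triangle S U W V f g (SusMap S a \<cdot> b') \<and>
            f \<cdot> a = c \<cdot> v \<and> c' \<cdot> f = a' \<and> g \<cdot> c = b \<and> b' \<cdot> g = SusMap S u \<cdot> c'"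

definition sus_pow :: "('o, 'a, 'z) triangulated_data_scheme \<Rightarrow> int \<Rightarrow> 'o \<Rightarrow> 'o" where
  "sus_pow S n = (if n \<ge> 0 then Sus S ^^ nat n else inv_into (Ob S) (Sus S) ^^ nat (- n))"

definition sus_map_pow :: "('o, 'a, 'z) triangulated_data_scheme \<Rightarrow> int \<Rightarrow> 'a \<Rightarrow> 'a" where
  "sus_map_pow S n =
     (if n \<ge> 0 then SusMap S ^^ nat n else inv_into (arrows S) (SusMap S) ^^ nat (- n))"


section \<open>Diagrams of abelian groups, limits and colimits\<close>

record ('p, 'b, 'g) ab_diagram =
  Grp :: "'p \<Rightarrow> 'g monoid"
  Map :: "'b \<Rightarrow> 'g \<Rightarrow> 'g"

definition is_ab_diagram ::
  "('p, 'b, 'z) category_data_scheme \<Rightarrow> ('p, 'b, 'g) ab_diagram \<Rightarrow> bool" where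
  "is_ab_diagram C F \<longleftrightarrow>
     (\<forall>\<alpha>\<in>Ob C. comm_group (Grp F \<alpha>)) \<and>
     (\<forall>\<alpha>\<in>Ob C. \<forall>\<beta>\<in>Ob C. \<forall>a\<in>Hom C \<alpha> \<beta>. Map F a \<in> hom (Grp F \<alpha>) (Grp F \<beta>)) \<and>
     (\<forall>\<alpha>\<in>Ob C. \<forall>x\<in>carrier (Grp F \<alpha>). Map F (Id C \<alpha>) x = x) \<and>
     (\<forall>\<alpha>\<in>Ob C. \<forall>\<beta>\<in>Ob C. \<forall>\<gamma>\<in>Ob C. \<forall>a\<in>Hom C \<alpha> \<beta>. \<forall>b\<in>Hom C \<beta> \<gamma>.
        \<forall>x\<in>carrier (Grp F \<alpha>). Map F (b \<cdot>\<^bsub>C\<^esub> a) x = Map F b (Map F a x))"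

definition is_ab_nat ::
  "('p, 'b, 'z) category_data_scheme \<Rightarrow> ('p, 'b, 'g) ab_diagram \<Rightarrow> ('p, 'b, 'h) ab_diagram \<Rightarrow>
   ('p \<Rightarrow> 'g \<Rightarrow> 'h) \<Rightarrow> bool" where
  "is_ab_nat C F G \<eta> \<longleftrightarrow>
     (\<forall>\<alpha>\<in>Ob C. \<eta> \<alpha> \<in> hom (Grp F \<alpha>) (Grp G \<alpha>)) \<and>
     (\<forall>\<alpha>\<in>Ob C. \<forall>\<beta>\<in>Ob C. \<forall>a\<in>Hom C \<alpha> \<beta>. \<forall>x\<in>carrier (Grp F \<alpha>).
        \<eta> \<beta> (Map F a x) = Map G a (\<eta> \<alpha> x))"

text \<open>
  The homomorphism out of a direct sum with components \<open>h \<alpha>\<close>. The product is taken over the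
  (finite) support because \<^const>\<open>finprod\<close> is trivial on infinite index sets.
\<close>

definition sum_map ::
  "'j set \<Rightarrow> ('j \<Rightarrow> 'g monoid) \<Rightarrow> 'h monoid \<Rightarrow> ('j \<Rightarrow> 'g \<Rightarrow> 'h) \<Rightarrow> ('j \<Rightarrow> 'g) \<Rightarrow> 'h" where
  "sum_map I G H h x = finprod H (\<lambda>\<alpha>. h \<alpha> (x \<alpha>)) {\<alpha>\<in>I. x \<alpha> \<noteq> \<one>\<^bsub>G \<alpha>\<^esub>}"

definition sum_incl :: "'j set \<Rightarrow> ('j \<Rightarrow> 'g monoid) \<Rightarrow> 'j \<Rightarrow> 'g \<Rightarrow> ('j \<Rightarrow> 'g)" where
  "sum_incl I G \<alpha> x = (\<lambda>\<gamma>\<in>I. if \<gamma> = \<alpha> then x else \<one>\<^bsub>G \<gamma>\<^esub>)"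

definition colim_relations ::
  "('p, 'b, 'z) category_data_scheme \<Rightarrow> ('p, 'b, 'g) ab_diagram \<Rightarrow> ('p \<Rightarrow> 'g) set" where
  "colim_relations C F = generate (sum_group (Ob C) (Grp F))
     {sum_incl (Ob C) (Grp F) \<alpha> x \<otimes>\<^bsub>sum_group (Ob C) (Grp F)\<^esub>
        inv\<^bsub>sum_group (Ob C) (Grp F)\<^esub> sum_incl (Ob C) (Grp F) \<beta> (Map F a x)
      | \<alpha> \<beta> a x. \<alpha> \<in> Ob C \<and> \<beta> \<in> Ob C \<and> a \<in> Hom C \<alpha> \<beta> \<and> x \<in> carrier (Grp F \<alpha>)}"

definition colim_group ::
  "('p, 'b, 'z) category_data_scheme \<Rightarrow> ('p, 'b, 'g) ab_diagram \<Rightarrow> ('p \<Rightarrow> 'g) set monoid" where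
  "colim_group C F = sum_group (Ob C) (Grp F) Mod colim_relations C F"

definition colim_induced ::
  "('p, 'b, 'z) category_data_scheme \<Rightarrow> ('p, 'b, 'g) ab_diagram \<Rightarrow> 'h monoid \<Rightarrow>
   ('p \<Rightarrow> 'g \<Rightarrow> 'h) \<Rightarrow> ('p \<Rightarrow> 'g) set \<Rightarrow> 'h" where
  "colim_induced C F H h K = the_elem (sum_map (Ob C) (Grp F) H h ` K)"

definition lim_group ::
  "('p, 'b, 'z) category_data_scheme \<Rightarrow> ('p, 'b, 'g) ab_diagram \<Rightarrow> ('p \<Rightarrow> 'g) monoid" where
  "lim_group C F = (product_group (Ob C) (Grp F))
     \<lparr>carrier := {x \<in> carrier (product_group (Ob C) (Grp F)).
        \<forall>\<alpha>\<in>Ob C. \<forall>\<beta>\<in>Ob C. \<forall>a\<in>Hom C \<alpha> \<beta>. Map F a (x \<alpha>) = x \<beta>}\<rparr>"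

definition lim_map ::
  "('p, 'b, 'z) category_data_scheme \<Rightarrow> ('p \<Rightarrow> 'g \<Rightarrow> 'h) \<Rightarrow> ('p \<Rightarrow> 'g) \<Rightarrow> ('p \<Rightarrow> 'h)" where
  "lim_map C \<eta> x = (\<lambda>\<alpha>\<in>Ob C. \<eta> \<alpha> (x \<alpha>))"


section \<open>Right derived functors of the inverse limit\<close>

text \<open>
  Injectivity in the category of \<open>C\<close>-diagrams of abelian groups with elements in the type \<open>'h\<close>.
  If \<open>'h\<close> is large enough to hold the subdiagrams of the diagrams $\mathbb{Z}[C(\alpha,-)]$, then,
  by Baer's criterion, this is injectivity with respect to diagrams of arbitrary abelian groups.
  If \<open>C\<close> has objects and arrows in an infinite type \<open>'i\<close>, this holds as soon as \<open>'i \<Rightarrow> int\<close> embeds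
  into \<open>'h\<close>. A diagram with elements in \<open>'m\<close> has an injective resolution with elements in \<open>'h\<close> as
  soon as \<open>'i \<Rightarrow> 'm \<times> int\<close> embeds into \<open>'h\<close>: divisible hulls of infinite groups do not raise the
  cardinality, and $F(\alpha)$ embeds into the product over $\alpha \to \beta$ of the divisible
  hulls of the $F(\beta)$, so that no term exceeds the cardinality of \<open>'i \<Rightarrow> 'm \<times> int\<close>.
\<close>

definition injective_diagram ::
  "('p, 'b, 'z) category_data_scheme \<Rightarrow> ('p, 'b, 'h) ab_diagram \<Rightarrow> bool" where
  "injective_diagram C J \<longleftrightarrow> is_ab_diagram C J \<and>
     (\<forall>(A :: ('p, 'b, 'h) ab_diagram) (B :: ('p, 'b, 'h) ab_diagram) m f.
        is_ab_diagram C A \<longrightarrow> is_ab_diagram C B \<longrightarrow> is_ab_nat C A B m \<longrightarrow>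
        (\<forall>\<alpha>\<in>Ob C. inj_on (m \<alpha>) (carrier (Grp A \<alpha>))) \<longrightarrow> is_ab_nat C A J f \<longrightarrow>
        (\<exists>g. is_ab_nat C B J g \<and> (\<forall>\<alpha>\<in>Ob C. \<forall>x\<in>carrier (Grp A \<alpha>). g \<alpha> (m \<alpha> x) = f \<alpha> x)))"

record ('p, 'b, 'g, 'h) resolution =
  Aug :: "'p \<Rightarrow> 'g \<Rightarrow> 'h"
  Term :: "nat \<Rightarrow> ('p, 'b, 'h) ab_diagram"
  Diff :: "nat \<Rightarrow> 'p \<Rightarrow> 'h \<Rightarrow> 'h"

definition injective_resolution ::
  "('p, 'b, 'z) category_data_scheme \<Rightarrow> ('p, 'b, 'g) ab_diagram \<Rightarrow>
   ('p, 'b, 'g, 'h) resolution \<Rightarrow> bool" where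
  "injective_resolution C F R \<longleftrightarrow>
     (\<forall>n. injective_diagram C (Term R n)) \<and>
     is_ab_nat C F (Term R 0) (Aug R) \<and>
     (\<forall>n. is_ab_nat C (Term R n) (Term R (Suc n)) (Diff R n)) \<and>
     (\<forall>\<alpha>\<in>Ob C.
        inj_on (Aug R \<alpha>) (carrier (Grp F \<alpha>)) \<and>
        Aug R \<alpha> ` carrier (Grp F \<alpha>) =
          kernel (Grp (Term R 0) \<alpha>) (Grp (Term R 1) \<alpha>) (Diff R 0 \<alpha>) \<and>
        (\<forall>n. Diff R n \<alpha> ` carrier (Grp (Term R n) \<alpha>) =
          kernel (Grp (Term R (Suc n)) \<alpha>) (Grp (Term R (Suc (Suc n))) \<alpha>) (Diff R (Suc n) \<alpha>)))"

definition lim_cocycles ::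
  "('p, 'b, 'z) category_data_scheme \<Rightarrow> ('p, 'b, 'g, 'h) resolution \<Rightarrow> nat \<Rightarrow> ('p \<Rightarrow> 'h) set" where
  "lim_cocycles C R n =
     kernel (lim_group C (Term R n)) (lim_group C (Term R (Suc n))) (lim_map C (Diff R n))"

fun lim_coboundaries ::
  "('p, 'b, 'z) category_data_scheme \<Rightarrow> ('p, 'b, 'g, 'h) resolution \<Rightarrow> nat \<Rightarrow> ('p \<Rightarrow> 'h) set" where
  "lim_coboundaries C R 0 = {\<one>\<^bsub>lim_group C (Term R 0)\<^esub>}"
| "lim_coboundaries C R (Suc n) = lim_map C (Diff R n) ` carrier (lim_group C (Term R n))"

text \<open>$\varprojlim^n F$, as computed from an injective resolution \<open>R\<close> of \<open>F\<close>.\<close>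

definition derived_lim ::
  "('p, 'b, 'z) category_data_scheme \<Rightarrow> ('p, 'b, 'g, 'h) resolution \<Rightarrow> nat \<Rightarrow>
   ('p \<Rightarrow> 'h) set monoid" where
  "derived_lim C R n =
     (lim_group C (Term R n))\<lparr>carrier := lim_cocycles C R n\<rparr> Mod lim_coboundaries C R n"

definition resolution_map ::
  "('p, 'b, 'z) category_data_scheme \<Rightarrow> ('p, 'b, 'g) ab_diagram \<Rightarrow>
   ('p, 'b, 'g, 'h) resolution \<Rightarrow> ('p, 'b, 'g, 'h) resolution \<Rightarrow>
   ('p \<Rightarrow> 'g \<Rightarrow> 'g) \<Rightarrow> (nat \<Rightarrow> 'p \<Rightarrow> 'h \<Rightarrow> 'h) \<Rightarrow> bool" where
  "resolution_map C F R R' \<eta> \<phi> \<longleftrightarrow>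
     (\<forall>n. is_ab_nat C (Term R n) (Term R' n) (\<phi> n)) \<and>
     (\<forall>\<alpha>\<in>Ob C. \<forall>x\<in>carrier (Grp F \<alpha>). \<phi> 0 \<alpha> (Aug R \<alpha> x) = Aug R' \<alpha> (\<eta> \<alpha> x)) \<and>
     (\<forall>n. \<forall>\<alpha>\<in>Ob C. \<forall>x\<in>carrier (Grp (Term R n) \<alpha>).
        \<phi> (Suc n) \<alpha> (Diff R n \<alpha> x) = Diff R' n \<alpha> (\<phi> n \<alpha> x))"

text \<open>
  The map induced on $\varprojlim^n$ by a map of resolutions into \<open>R'\<close>. For a cohomology class \<open>K\<close>
  the union consists of a single coset.
\<close>

definition derived_lim_map ::
  "('p, 'b, 'z) category_data_scheme \<Rightarrow> ('p, 'b, 'g, 'h) resolution \<Rightarrow>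
   (nat \<Rightarrow> 'p \<Rightarrow> 'h \<Rightarrow> 'h) \<Rightarrow> nat \<Rightarrow> ('p \<Rightarrow> 'h) set \<Rightarrow> ('p \<Rightarrow> 'h) set" where
  "derived_lim_map C R' \<phi> n K =
     (\<Union>x\<in>K. lim_coboundaries C R' n #>\<^bsub>lim_group C (Term R' n)\<^esub> lim_map C (\<phi> n) x)"

definition short_exact ::
  "'a monoid \<Rightarrow> ('a \<Rightarrow> 'b) \<Rightarrow> 'b monoid \<Rightarrow> ('b \<Rightarrow> 'c) \<Rightarrow> 'c monoid \<Rightarrow> bool" where
  "short_exact A f B g C \<longleftrightarrow> f \<in> mon A B \<and> g \<in> epi B C \<and> f ` carrier A = kernel B C g"


section \<open>Finite objects, phantom maps, projective classes\<close>

definition finite_objects ::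
  "('i set \<Rightarrow> bool) \<Rightarrow> ('o, 'a, 'z) additive_data_scheme \<Rightarrow> 'o set" where
  "finite_objects small S = {W \<in> Ob S.
     \<forall>I X P \<iota>. small I \<longrightarrow> is_coproduct S I X P \<iota> \<longrightarrow>
       sum_map I (\<lambda>\<alpha>. hom_group S W (X \<alpha>)) (hom_group S W P) (\<lambda>\<alpha> f. \<iota> \<alpha> \<cdot>\<^bsub>S\<^esub> f)
         \<in> iso (sum_group I (\<lambda>\<alpha>. hom_group S W (X \<alpha>))) (hom_group S W P)}"

definition phantom_projectives ::
  "('i set \<Rightarrow> bool) \<Rightarrow> ('o, 'a, 'z) additive_data_scheme \<Rightarrow> 'o set" where
  "phantom_projectives small S = {Q \<in> Ob S.
     \<exists>I X P \<iota>. small I \<and> (\<forall>\<alpha>\<in>I. X \<alpha> \<in> finite_objects small S) \<and>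
       is_coproduct S I X P \<iota> \<and> is_retract S Q P}"

definition phantom_maps ::
  "('i set \<Rightarrow> bool) \<Rightarrow> ('o, 'a, 'z) additive_data_scheme \<Rightarrow> 'a set" where
  "phantom_maps small S = {f.
     \<exists>X\<in>Ob S. \<exists>Y\<in>Ob S. f \<in> Hom S X Y \<and>
       (\<forall>W\<in>finite_objects small S. \<forall>g\<in>Hom S W X. f \<cdot>\<^bsub>S\<^esub> g = Zero S W Y)}"

definition projective_class ::
  "('o, 'a, 'z) triangulated_data_scheme \<Rightarrow> 'o set \<Rightarrow> 'a set \<Rightarrow> bool" where
  "projective_class S \<P> \<I> \<longleftrightarrow>
     \<I> = {f. \<exists>X\<in>Ob S. \<exists>Y\<in>Ob S. f \<in> Hom S X Y \<and>
             (\<forall>P\<in>\<P>. \<forall>g\<in>Hom S P X. f \<cdot>\<^bsub>S\<^esub> g = Zero S P Y)} \<and>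
     \<P> = {P \<in> Ob S. \<forall>X\<in>Ob S. \<forall>Y\<in>Ob S. \<forall>f\<in>Hom S X Y. f \<in> \<I> \<longrightarrow>
             (\<forall>g\<in>Hom S P X. f \<cdot>\<^bsub>S\<^esub> g = Zero S P Y)} \<and>
     (\<forall>X\<in>Ob S. \<exists>P Y p f q. exact_triangle S P X Y p f q \<and> P \<in> \<P> \<and> f \<in> \<I>)"

definition generates :: "('o, 'a, 'z) additive_data_scheme \<Rightarrow> 'o set \<Rightarrow> bool" where
  "generates S \<P> \<longleftrightarrow>
     (\<forall>X\<in>Ob S. \<not> zero_object S X \<longrightarrow> (\<exists>P\<in>\<P>. Hom S P X \<noteq> {Zero S P X}))"

definition generating_phantom_projective_class ::
  "('i set \<Rightarrow> bool) \<Rightarrow> ('o, 'a, 'z) triangulated_data_scheme \<Rightarrow> bool" where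
  "generating_phantom_projective_class small S \<longleftrightarrow>
     projective_class S (phantom_projectives small S) (phantom_maps small S) \<and>
     generates S (phantom_projectives small S)"

definition brown_category ::
  "('i set \<Rightarrow> bool) \<Rightarrow> ('o, 'a, 'z) additive_data_scheme \<Rightarrow> bool" where
  "brown_category small S \<longleftrightarrow>
     (\<forall>X\<in>Ob S. \<forall>Y\<in>Ob S. \<forall>\<tau>.
        (\<forall>W\<in>finite_objects small S. \<tau> W \<in> hom (hom_group S W X) (hom_group S W Y)) \<longrightarrow>
        (\<forall>V\<in>finite_objects small S. \<forall>W\<in>finite_objects small S.
           \<forall>g\<in>Hom S V W. \<forall>f\<in>Hom S W X. \<tau> V (f \<cdot>\<^bsub>S\<^esub> g) = \<tau> W f \<cdot>\<^bsub>S\<^esub> g) \<longrightarrow>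
        (\<exists>h\<in>Hom S X Y. \<forall>W\<in>finite_objects small S. \<forall>f\<in>Hom S W X. \<tau> W f = h \<cdot>\<^bsub>S\<^esub> f))"

definition cov_hom_diagram ::
  "('o, 'a, 'z) additive_data_scheme \<Rightarrow> 'o \<Rightarrow> ('p \<Rightarrow> 'o) \<Rightarrow> ('b \<Rightarrow> 'a) \<Rightarrow>
   ('p, 'b, 'a) ab_diagram" where
  "cov_hom_diagram S W Do Da =
     \<lparr> Grp = (\<lambda>\<alpha>. hom_group S W (Do \<alpha>)), Map = (\<lambda>a f. Da a \<cdot>\<^bsub>S\<^esub> f) \<rparr>"

text \<open>For a functor $C \to S$ this is a diagram on the opposite of \<open>C\<close>.\<close>

definition contra_hom_diagram ::
  "('o, 'a, 'z) additive_data_scheme \<Rightarrow> ('p \<Rightarrow> 'o) \<Rightarrow> ('b \<Rightarrow> 'a) \<Rightarrow> 'o \<Rightarrow>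
   ('p, 'b, 'a) ab_diagram" where
  "contra_hom_diagram S Do Da Y =
     \<lparr> Grp = (\<lambda>\<alpha>. hom_group S (Do \<alpha>) Y), Map = (\<lambda>a f. f \<cdot>\<^bsub>S\<^esub> Da a) \<rparr>"

definition minimal_cone ::
  "('i set \<Rightarrow> bool) \<Rightarrow> ('p, 'b, 'y) category_data_scheme \<Rightarrow> ('o, 'a, 'z) additive_data_scheme \<Rightarrow>
   ('p \<Rightarrow> 'o) \<Rightarrow> ('b \<Rightarrow> 'a) \<Rightarrow> 'o \<Rightarrow> ('p \<Rightarrow> 'a) \<Rightarrow> bool" where
  "minimal_cone small C S Do Da X c \<longleftrightarrow> is_cone C S Do Da X c \<and>
     (\<forall>W\<in>finite_objects small S.
        colim_induced C (cov_hom_diagram S W Do Da) (hom_group S W X) (\<lambda>\<alpha> f. c \<alpha> \<cdot>\<^bsub>S\<^esub> f)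
          \<in> iso (colim_group C (cov_hom_diagram S W Do Da)) (hom_group S W X))"

definition cone_restriction ::
  "('p, 'b, 'y) category_data_scheme \<Rightarrow> ('o, 'a, 'z) category_data_scheme \<Rightarrow>
   ('p \<Rightarrow> 'a) \<Rightarrow> 'a \<Rightarrow> ('p \<Rightarrow> 'a)" where
  "cone_restriction C S c f = (\<lambda>\<alpha>\<in>Ob C. f \<cdot>\<^bsub>S\<^esub> c \<alpha>)"


section \<open>Exact couples and the Adams spectral sequence\<close>

text \<open>
  The maps of the couple are $i : D^{s+1}_n \to D^s_n$, $j : D^s_n \to E^s_n$ and
  $k : E^s_n \to D^{s+1}_{n-1}$. The couple is extended to $s < 0$ by $D^s_n = D^0_n$, $i = 1$ and
  $E^s_n = 0$, which is why the iterate of $i$ in the definition of the boundaries below stops in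
  filtration 0.
\<close>

record 'a exact_couple =
  cplD :: "nat \<Rightarrow> int \<Rightarrow> 'a monoid"
  cplE :: "nat \<Rightarrow> int \<Rightarrow> 'a monoid"
  cplI :: "nat \<Rightarrow> int \<Rightarrow> 'a \<Rightarrow> 'a"
  cplJ :: "nat \<Rightarrow> int \<Rightarrow> 'a \<Rightarrow> 'a"
  cplK :: "nat \<Rightarrow> int \<Rightarrow> 'a \<Rightarrow> 'a"

text \<open>\<open>cplI_pow Q r s n\<close> is $i^r : D^{s+r}_n \to D^s_n$.\<close>

primrec cplI_pow :: "'a exact_couple \<Rightarrow> nat \<Rightarrow> nat \<Rightarrow> int \<Rightarrow> 'a \<Rightarrow> 'a" where
  "cplI_pow Q 0 s n x = x"
| "cplI_pow Q (Suc r) s n x = cplI_pow Q r s n (cplI Q (s + r) n x)"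

text \<open>
  For $r \geq 1$ the $(r-1)$st derived couple has
  $E_r = k^{-1}(\mathrm{im}\, i^{r-1}) / j(\ker i^{r-1})$ and $d_r = j \circ (i^{r-1})^{-1} \circ k$.
\<close>

definition ss_cycles :: "'a exact_couple \<Rightarrow> nat \<Rightarrow> nat \<Rightarrow> int \<Rightarrow> 'a set" where
  "ss_cycles Q r s n = {x \<in> carrier (cplE Q s n).
     cplK Q s n x \<in> cplI_pow Q (r - 1) (s + 1) (n - 1) ` carrier (cplD Q (s + r) (n - 1))}"

definition ss_boundaries :: "'a exact_couple \<Rightarrow> nat \<Rightarrow> nat \<Rightarrow> int \<Rightarrow> 'a set" where
  "ss_boundaries Q r s n = (let t = min s (r - 1) in
     cplJ Q s n ` kernel (cplD Q s n) (cplD Q (s - t) n) (cplI_pow Q t (s - t) n))"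

definition ss_term :: "'a exact_couple \<Rightarrow> nat \<Rightarrow> nat \<Rightarrow> int \<Rightarrow> 'a set monoid" where
  "ss_term Q r s n = (cplE Q s n)\<lparr>carrier := ss_cycles Q r s n\<rparr> Mod ss_boundaries Q r s n"

text \<open>$d_r : E_r^{s,n} \to E_r^{s+r,n-1}$. For a class \<open>K\<close> the union consists of a single coset.\<close>

definition ss_diff ::
  "'a exact_couple \<Rightarrow> nat \<Rightarrow> nat \<Rightarrow> int \<Rightarrow> 'a set \<Rightarrow> 'a set" where
  "ss_diff Q r s n K =
     (\<Union>x\<in>K. \<Union>y\<in>{y \<in> carrier (cplD Q (s + r) (n - 1)).
                       cplI_pow Q (r - 1) (s + 1) (n - 1) y = cplK Q s n x}.
        ss_boundaries Q r (s + r) (n - 1) #>\<^bsub>cplE Q (s + r) (n - 1)\<^esub> cplJ Q (s + r) (n - 1) y)"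

definition ss_collapses_at :: "'a exact_couple \<Rightarrow> nat \<Rightarrow> bool" where
  "ss_collapses_at Q r\<^sub>0 \<longleftrightarrow>
     (\<forall>r\<ge>r\<^sub>0. \<forall>s n. \<forall>K\<in>carrier (ss_term Q r s n).
        ss_diff Q r s n K = \<one>\<^bsub>ss_term Q r (s + r) (n - 1)\<^esub>)"

record ('o, 'a) adams_data =
  ResX :: "nat \<Rightarrow> 'o"
  ResP :: "nat \<Rightarrow> 'o"
  resp :: "nat \<Rightarrow> 'a"
  resi :: "nat \<Rightarrow> 'a"
  resq :: "nat \<Rightarrow> 'a"

definition adams_resolution ::
  "('o, 'a, 'z) triangulated_data_scheme \<Rightarrow> 'o set \<Rightarrow> 'a set \<Rightarrow> 'o \<Rightarrow> ('o, 'a) adams_data \<Rightarrow> bool" where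
  "adams_resolution S \<P> \<I> X A \<longleftrightarrow> ResX A 0 = X \<and>
     (\<forall>n. ResP A n \<in> \<P> \<and> resi A n \<in> \<I> \<and>
        exact_triangle S (ResP A n) (ResX A n) (ResX A (Suc n)) (resp A n) (resi A n) (resq A n))"

text \<open>
  The exact couple obtained by applying $S(\Sigma^n -, Y)$. Its third map is precomposition with
  $\Sigma^{n-1}$ of $X_{s+1} \to \Sigma P_s$, where $\Sigma^{n-1} \Sigma P_s = \Sigma^n P_s$.
\<close>

definition adams_couple ::
  "('o, 'a, 'z) triangulated_data_scheme \<Rightarrow> ('o, 'a) adams_data \<Rightarrow> 'o \<Rightarrow> 'a exact_couple" where
  "adams_couple S A Y =
     \<lparr> cplD = (\<lambda>s n. hom_group S (sus_pow S n (ResX A s)) Y),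
       cplE = (\<lambda>s n. hom_group S (sus_pow S n (ResP A s)) Y),
       cplI = (\<lambda>s n f. f \<cdot>\<^bsub>S\<^esub> sus_map_pow S n (resi A s)),
       cplJ = (\<lambda>s n f. f \<cdot>\<^bsub>S\<^esub> sus_map_pow S n (resp A s)),
       cplK = (\<lambda>s n f. f \<cdot>\<^bsub>S\<^esub> sus_map_pow S (n - 1) (resq A s)) \<rparr>"

end

theory Submission
  imports Defs "HOL-Algebra.Free_Abelian_Groups"
begin

text \<open>
  Let $P \to X \to X_1 \to \Sigma P$ be an exact triangle with \<open>P\<close> projective and $X \to X_1$
  phantom. In a Brown category every phantom map out of $X_1$ vanishes, so that Adams resolutions
  split after one step; this gives the collapse and the vanishing of composites of phantom maps.

  For a minimal cone \<open>X\<close> of a filtered diagram of finite objects $X_\alpha$ the bar complex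
  $P_n = \coprod_{\alpha_0 \to \dots \to \alpha_n} X_{\alpha_0}$, augmented by $P_0 \to X$, is exact on
  maps out of finite objects. There are no non-zero phantom maps out of the fibre \<open>Q\<close> of
  the augmentation, so \<open>Q\<close> is a retract of $P_1$ and from there on the complex is contractible. Injective diagrams are
  acyclic for the bar construction, so $\varprojlim^i S(\Sigma X_\alpha, Y)$ is the cohomology of
  $S(\Sigma P_\bullet, Y)$. It vanishes for $i \ge 2$, and for $i = 1$ it is the group of maps that
  factor through $X \to \Sigma Q$, which are exactly the phantom maps. A compatible family
  $X_\alpha \to Y$ extends to \<open>X\<close> because it defines a natural transformation on finite objects.
\<close>

section \<open>Additive and triangulated categories\<close>

text \<open>A natural transformation on finite objects is represented by a map only up to phantoms,
  so each appeal to the Brown property (\<open>brown_factor\<close>) needs a device that removes the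
  ambiguity. There are three: a projective source, on which phantoms vanish; a finite source, on
  which maps agree exactly; and generation, which turns an endomorphism acting as the identity on
  finite objects into a split epimorphism (\<open>split_epi_of_fin_id\<close>). Vanishing on X_1
  takes two rounds: generation first shows that the composite X -> X_1 -> Z is zero, and only then
  does the phantom factor through \<Sigma>P, where projectivity applies.

  On the side of derived limits the resolution is arbitrary, its terms live in a fixed type
  \<open>'h\<close>, and injectivity is tested only there. Acyclicity therefore needs copies in
  \<open>'h\<close> of the free groups on chains, and the comparison with bar cohomology is a
  diagram chase with preimages chosen objectwise. The suspension enters because Q sits to the left
  of X: a phantom map out of X factors through X -> \<Sigma>Q, and \<Sigma>Q is a retract of
  \<Sigma>P_1.\<close>

definition arr :: "('o, 'a, 'z) category_data_scheme \<Rightarrow> 'a \<Rightarrow> 'o \<Rightarrow> 'o \<Rightarrow> bool" where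
  "arr C f X Y \<longleftrightarrow> X \<in> Ob C \<and> Y \<in> Ob C \<and> f \<in> Hom C X Y"

lemma arr_Ob: "arr C f X Y \<Longrightarrow> X \<in> Ob C" "arr C f X Y \<Longrightarrow> Y \<in> Ob C"
  and arr_Hom: "arr C f X Y \<Longrightarrow> f \<in> Hom C X Y"
  by (auto simp: arr_def)

context category
begin

lemma arr_comp: "arr C f X Y \<Longrightarrow> arr C g Y Z \<Longrightarrow> arr C (g \<cdot> f) X Z"
  by (auto simp: arr_def intro: comp_hom)

lemma arr_id: "X \<in> Ob C \<Longrightarrow> arr C (Id C X) X X"
  by (auto simp: arr_def intro: id_hom)

lemma arr_assoc: "arr C f W X \<Longrightarrow> arr C g X Y \<Longrightarrow> arr C h Y Z \<Longrightarrow> (h \<cdot> g) \<cdot> f = h \<cdot> g \<cdot> f"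
  by (auto simp: arr_def intro: comp_assoc)

lemma arr_id_right: "arr C f X Y \<Longrightarrow> f \<cdot> Id C X = f"
  and arr_id_left: "arr C f X Y \<Longrightarrow> Id C Y \<cdot> f = f"
  by (auto simp: arr_def intro: comp_id_right comp_id_left)

lemma arr_unique: "arr C f X Y \<Longrightarrow> arr C f X' Y' \<Longrightarrow> X = X' \<and> Y = Y'"
  unfolding arr_def using hom_disjoint by blast

end

context
  fixes C :: "('o, 'a, 'z) category_data_scheme" (structure)
begin

lemma coproduct_incl: "is_coproduct C I X P \<iota> \<Longrightarrow> \<alpha> \<in> I \<Longrightarrow> arr C (\<iota> \<alpha>) (X \<alpha>) P"
  by (auto simp: is_coproduct_def arr_def)

lemma coproduct_induced:
  assumes "is_coproduct C I X P \<iota>" "Z \<in> Ob C" "\<And>\<alpha>. \<alpha> \<in> I \<Longrightarrow> arr C (f \<alpha>) (X \<alpha>) Z"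
  obtains g where "arr C g P Z" "\<And>\<alpha>. \<alpha> \<in> I \<Longrightarrow> g \<cdot> \<iota> \<alpha> = f \<alpha>"
proof -
  have "\<exists>!g. g \<in> Hom C P Z \<and> (\<forall>\<alpha>\<in>I. g \<cdot> \<iota> \<alpha> = f \<alpha>)"
    using assms unfolding is_coproduct_def arr_def by blast
  then obtain g where "g \<in> Hom C P Z" "\<And>\<alpha>. \<alpha> \<in> I \<Longrightarrow> g \<cdot> \<iota> \<alpha> = f \<alpha>"
    by blast
  with assms that show thesis
    by (auto simp: arr_def is_coproduct_def)
qed

end

context category
begin

lemma coproduct_eqI:
  assumes P: "is_coproduct C I X P \<iota>" and f: "arr C f P Z" and g: "arr C g P Z"
    and eq: "\<And>\<alpha>. \<alpha> \<in> I \<Longrightarrow> f \<cdot> \<iota> \<alpha> = g \<cdot> \<iota> \<alpha>"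
  shows "f = g"
proof -
  have "g \<cdot> \<iota> \<alpha> \<in> Hom C (X \<alpha>) Z" if "\<alpha> \<in> I" for \<alpha>
    using arr_comp[OF coproduct_incl[OF P that] g] by (simp add: arr_def)
  then have "\<exists>!h. h \<in> Hom C P Z \<and> (\<forall>\<alpha>\<in>I. h \<cdot> \<iota> \<alpha> = g \<cdot> \<iota> \<alpha>)"
    using P g by (simp add: is_coproduct_def arr_def)
  with eq f g show ?thesis
    unfolding arr_def by blast
qed

end

lemma hom_group_simps [simp]:
  "carrier (hom_group S X Y) = Hom S X Y"
  "monoid.mult (hom_group S X Y) = Add S"
  "one (hom_group S X Y) = Zero S X Y"
  by (simp_all add: hom_group_def)

section \<open>The abelian groups of maps and their bilinear composition\<close>

context additive_category
begin

abbreviation neg :: "'o \<Rightarrow> 'o \<Rightarrow> 'a \<Rightarrow> 'a" where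
  "neg X Y f \<equiv> inv\<^bsub>hom_group S X Y\<^esub> f"

lemma hom_group_group: "X \<in> Ob S \<Longrightarrow> Y \<in> Ob S \<Longrightarrow> group (hom_group S X Y)"
  using hom_comm_group comm_group.axioms(2) by blast

lemma arr_add: "arr S f X Y \<Longrightarrow> arr S g X Y \<Longrightarrow> arr S (Add S f g) X Y"
  using monoid.m_closed[OF group.is_monoid[OF hom_group_group]] by (fastforce simp: arr_def)

lemma arr_zero: "X \<in> Ob S \<Longrightarrow> Y \<in> Ob S \<Longrightarrow> arr S (Zero S X Y) X Y"
  using monoid.one_closed[OF group.is_monoid[OF hom_group_group]] by (fastforce simp: arr_def)

lemma arr_neg: "arr S f X Y \<Longrightarrow> arr S (neg X Y f) X Y"
  using group.inv_closed[OF hom_group_group] by (fastforce simp: arr_def)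

lemma post_hom:
  "arr S g Y Z \<Longrightarrow> X \<in> Ob S \<Longrightarrow> (\<lambda>f. g \<cdot> f) \<in> hom (hom_group S X Y) (hom_group S X Z)"
  by (auto simp: hom_def arr_def comp_add_right intro: comp_hom)

lemma pre_hom:
  "arr S f X Y \<Longrightarrow> Z \<in> Ob S \<Longrightarrow> (\<lambda>g. g \<cdot> f) \<in> hom (hom_group S Y Z) (hom_group S X Z)"
  by (auto simp: hom_def arr_def comp_add_left intro: comp_hom)

lemma comp_zero_right: "arr S g Y Z \<Longrightarrow> X \<in> Ob S \<Longrightarrow> g \<cdot> Zero S X Y = Zero S X Z"
  using hom_one[OF post_hom hom_group_group hom_group_group, of g Y Z X] by (auto simp: arr_def)

lemma comp_zero_left: "arr S f X Y \<Longrightarrow> Z \<in> Ob S \<Longrightarrow> Zero S Y Z \<cdot> f = Zero S X Z"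
  using hom_one[OF pre_hom hom_group_group hom_group_group, of f X Y Z] by (auto simp: arr_def)

lemma comp_neg_right: "arr S f X Y \<Longrightarrow> arr S g Y Z \<Longrightarrow> g \<cdot> neg X Y f = neg X Z (g \<cdot> f)"
  using group_hom.hom_inv[of "hom_group S X Y" "hom_group S X Z" "\<lambda>f. g \<cdot> f" f]
  by (simp add: arr_def group_hom_def group_hom_axioms_def hom_group_group post_hom)

lemma comp_neg_left: "arr S f X Y \<Longrightarrow> arr S g Y Z \<Longrightarrow> neg Y Z g \<cdot> f = neg X Z (g \<cdot> f)"
  using group_hom.hom_inv[of "hom_group S Y Z" "hom_group S X Z" "\<lambda>g. g \<cdot> f" g]
  by (simp add: arr_def group_hom_def group_hom_axioms_def hom_group_group pre_hom)

lemma arr_comp_add_right: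
  "arr S f X Y \<Longrightarrow> arr S f' X Y \<Longrightarrow> arr S g Y Z \<Longrightarrow> g \<cdot> Add S f f' = Add S (g \<cdot> f) (g \<cdot> f')"
  by (auto simp: arr_def intro: comp_add_right)

lemma arr_comp_add_left:
  "arr S f X Y \<Longrightarrow> arr S g Y Z \<Longrightarrow> arr S g' Y Z \<Longrightarrow> Add S g g' \<cdot> f = Add S (g \<cdot> f) (g' \<cdot> f)"
  by (auto simp: arr_def intro: comp_add_left)

lemma neg_neg: "arr S f X Y \<Longrightarrow> neg X Y (neg X Y f) = f"
  using group.inv_inv[OF hom_group_group, of X Y f] by (simp add: arr_def)

lemma neg_zero: "X \<in> Ob S \<Longrightarrow> Y \<in> Ob S \<Longrightarrow> neg X Y (Zero S X Y) = Zero S X Y"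
  using monoid.inv_one[OF group.is_monoid[OF hom_group_group], of X Y] by simp

lemma add_zero_left: "arr S f X Y \<Longrightarrow> Add S (Zero S X Y) f = f"
  using monoid.l_one[OF group.is_monoid[OF hom_group_group], of X Y f] by (simp add: arr_def)

lemma add_zero_right: "arr S f X Y \<Longrightarrow> Add S f (Zero S X Y) = f"
  using monoid.r_one[OF group.is_monoid[OF hom_group_group], of X Y f] by (simp add: arr_def)

lemma add_neg: "arr S f X Y \<Longrightarrow> Add S f (neg X Y f) = Zero S X Y"
  using group.r_inv[OF hom_group_group, of X Y f] by (simp add: arr_def)

lemma eq_if_diff_zero:
  "arr S f X Y \<Longrightarrow> arr S g X Y \<Longrightarrow> Add S f (neg X Y g) = Zero S X Y \<Longrightarrow> f = g"
  using group.inv_solve_right'[OF hom_group_group, of X Y "Zero S X Y" f g]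
  by (metis add_zero_left arr_def arr_zero hom_group_simps)

lemma neg_eq_zero_iff: "arr S f X Y \<Longrightarrow> neg X Y f = Zero S X Y \<longleftrightarrow> f = Zero S X Y"
  using group.inv_eq_1_iff[OF hom_group_group, of X Y f] by (simp add: arr_def)

lemma zero_object_arr: "zero_object S Z \<Longrightarrow> arr S f X Z \<Longrightarrow> f = Zero S X Z"
  by (auto simp: arr_def zero_object_def)

text \<open>Every map into or out of \<open>Z\<close> is its own composite with the identity of
  \<open>Z\<close>, hence a composite with zero.\<close>

lemma zero_objectI: "Z \<in> Ob S \<Longrightarrow> Id S Z = Zero S Z Z \<Longrightarrow> zero_object S Z"
  unfolding zero_object_def
proof (intro conjI ballI)
  fix X assume Z: "Z \<in> Ob S" "Id S Z = Zero S Z Z" and X: "X \<in> Ob S"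
  have "f = Zero S X Z" if "f \<in> Hom S X Z" for f
    using arr_id_left[of f X Z] comp_zero_left[of f X Z Z] that Z X by (simp add: arr_def)
  moreover have "f = Zero S Z X" if "f \<in> Hom S Z X" for f
    using arr_id_right[of f Z X] comp_zero_right[of f Z X Z] that Z X by (simp add: arr_def)
  ultimately show "Hom S X Z = {Zero S X Z}" "Hom S Z X = {Zero S Z X}"
    using arr_Hom[OF arr_zero[OF X Z(1)]] arr_Hom[OF arr_zero[OF Z(1) X]] by blast+
qed

end

section \<open>Suspension as an automorphism, and the exact sequences of a triangle\<close>

context triangulated_category
begin

lemma sus_Ob: "X \<in> Ob S \<Longrightarrow> Sus S X \<in> Ob S"
  using sus_bij by (auto simp: bij_betw_def)

lemma sus_Ob_ex:
  assumes "X \<in> Ob S"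
  obtains X' where "X' \<in> Ob S" "Sus S X' = X"
  using sus_bij assms unfolding bij_betw_def by (metis imageE)

lemma sus_Ob_inj: "X \<in> Ob S \<Longrightarrow> Y \<in> Ob S \<Longrightarrow> Sus S X = Sus S Y \<Longrightarrow> X = Y"
  using sus_bij by (auto simp: bij_betw_def inj_on_def)

lemma sus_arr: "arr S f X Y \<Longrightarrow> arr S (SusMap S f) (Sus S X) (Sus S Y)"
  using sus_map_bij sus_Ob by (auto simp: arr_def bij_betw_def)

lemma sus_arr_ex:
  assumes "arr S f (Sus S X) (Sus S Y)" "X \<in> Ob S" "Y \<in> Ob S"
  obtains g where "arr S g X Y" "f = SusMap S g"
  using sus_map_bij[of X Y] assms by (auto simp: arr_def bij_betw_def)

lemma sus_arr_inj: "arr S f X Y \<Longrightarrow> arr S g X Y \<Longrightarrow> SusMap S f = SusMap S g \<Longrightarrow> f = g"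
  using sus_map_bij by (auto simp: arr_def bij_betw_def inj_on_def)

lemma sus_comp: "arr S f X Y \<Longrightarrow> arr S g Y Z \<Longrightarrow> SusMap S (g \<cdot> f) = SusMap S g \<cdot> SusMap S f"
  by (auto simp: arr_def intro: sus_map_comp)

lemma sus_hom:
  "X \<in> Ob S \<Longrightarrow> Y \<in> Ob S \<Longrightarrow> SusMap S \<in> hom (hom_group S X Y) (hom_group S (Sus S X) (Sus S Y))"
  using sus_map_bij by (auto simp: hom_def sus_map_add bij_betw_def)

lemma sus_zero: "X \<in> Ob S \<Longrightarrow> Y \<in> Ob S \<Longrightarrow> SusMap S (Zero S X Y) = Zero S (Sus S X) (Sus S Y)"
  using hom_one[OF sus_hom hom_group_group hom_group_group, of X Y] sus_Ob by simp

lemma sus_eq_zero: "arr S f X Y \<Longrightarrow> SusMap S f = Zero S (Sus S X) (Sus S Y) \<Longrightarrow> f = Zero S X Y"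
  by (metis arr_def arr_zero sus_arr_inj sus_zero)

lemma sus_zero_object: "zero_object S Z \<Longrightarrow> zero_object S (Sus S Z)"
  by (metis arr_id sus_Ob sus_map_id sus_zero zero_object_arr zero_object_def zero_objectI)

lemma triangle_arr:
  assumes "exact_triangle S X Y Z u v w"
  shows "arr S u X Y" "arr S v Y Z" "arr S w Z (Sus S X)"
  using assms sus_Ob by (auto simp: exact_triangle_def arr_def)

lemma triangle_rot:
  assumes "exact_triangle S X Y Z u v w"
  shows "exact_triangle S Y Z (Sus S X) v w (neg (Sus S X) (Sus S Y) (SusMap S u))"
  using assms triangle_rotate[of X Y Z u v w] by (auto simp: exact_triangle_def)

text \<open>Exactness of maps out of \<open>A\<close> at the middle term. The fill-in axiom produces
  the third map of a morphism of triangles, so both triangles are rotated once: comparing A -> 0 ->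
  \<Sigma>A with Y -> Z -> \<Sigma>X gives a map \<Sigma>A -> \<Sigma>X, which desuspends to the
  lift.\<close>

lemma triangle_lift1:
  assumes T: "exact_triangle S X Y Z u v w" and y: "arr S y A Y" and vy: "v \<cdot> y = Zero S A Z"
  obtains x where "arr S x A X" "u \<cdot> x = y"
proof -
  note T3 = triangle_arr[OF T]
  obtain O0 where O0: "zero_object S O0"
    using ex_zero_object by blast
  then have O1: "O0 \<in> Ob S" by (simp add: zero_object_def)
  have A: "A \<in> Ob S" "X \<in> Ob S" "Z \<in> Ob S" "Y \<in> Ob S"
    using y T3 by (auto simp: arr_def)
  have T2: "exact_triangle S A O0 (Sus S A) (Zero S A O0) (Zero S O0 (Sus S A))
      (neg (Sus S A) (Sus S A) (SusMap S (Id S A)))"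
    using triangle_rot[OF triangle_id[OF A(1) O0]] .
  have "Zero S O0 Z \<cdot> Zero S A O0 = v \<cdot> y"
    by (simp add: vy A O1 arr_zero comp_zero_left[where X=A])
  from triangle_fill_in[OF T2 triangle_rot[OF T] arr_Hom[OF y] arr_Hom[OF arr_zero[OF O1 A(3)]] this]
  obtain h where h: "h \<in> Hom S (Sus S A) (Sus S X)"
    and hw: "SusMap S y \<cdot> neg (Sus S A) (Sus S A) (SusMap S (Id S A))
       = neg (Sus S X) (Sus S Y) (SusMap S u) \<cdot> h"
    by blast
  have "arr S h (Sus S A) (Sus S X)"
    using h A sus_Ob by (simp add: arr_def)
  then obtain x where x: "arr S x A X" and hx: "h = SusMap S x"
    using A sus_arr_ex by blast
  \<comment> \<open>Both rotated triangles end in a negated suspension, so the two signs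
    cancel.\<close>
  have "neg (Sus S A) (Sus S Y) (SusMap S y) = SusMap S y \<cdot> neg (Sus S A) (Sus S A) (SusMap S (Id S A))"
    using comp_neg_right[OF sus_arr[OF arr_id[OF A(1)]] sus_arr[OF y]]
      sus_comp[OF arr_id[OF A(1)] y] arr_id_right[OF y] by simp
  also have "\<dots> = neg (Sus S A) (Sus S Y) (SusMap S (u \<cdot> x))"
    using hw comp_neg_left[OF sus_arr[OF x] sus_arr[OF T3(1)]] sus_comp[OF x T3(1)] hx by simp
  finally have "SusMap S y = SusMap S (u \<cdot> x)"
    using neg_neg[OF sus_arr[OF y]] neg_neg[OF sus_arr[OF arr_comp[OF x T3(1)]]] by metis
  then have "u \<cdot> x = y"
    using sus_arr_inj[OF y arr_comp[OF x T3(1)]] by simp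
  with x that show thesis by blast
qed

lemma triangle_lift2:
  assumes "exact_triangle S X Y Z u v w" "arr S z A Z" "w \<cdot> z = Zero S A (Sus S X)"
  obtains y where "arr S y A Y" "v \<cdot> y = z"
  using triangle_lift1[OF triangle_rot] assms by blast

lemma triangle_lift3:
  assumes T: "exact_triangle S X Y Z u v w" and x: "arr S x A (Sus S X)"
    and ux: "SusMap S u \<cdot> x = Zero S A (Sus S Y)"
  obtains z where "arr S z A Z" "w \<cdot> z = x"
proof (rule triangle_lift2[OF triangle_rot[OF T] x _ that])
  show "neg (Sus S X) (Sus S Y) (SusMap S u) \<cdot> x = Zero S A (Sus S Y)"
    using comp_neg_left[OF x sus_arr[OF triangle_arr(1)[OF T]]] ux neg_zero x
      sus_arr[OF triangle_arr(1)[OF T]]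
    by (simp add: arr_def)
qed

text \<open>A morphism from the triangle X = X -> 0 with second component \<open>u\<close> makes the
  composite factor through a zero object.\<close>

lemma triangle_comp1:
  assumes T: "exact_triangle S X Y Z u v w"
  shows "v \<cdot> u = Zero S X Z"
proof -
  note T3 = triangle_arr[OF T]
  obtain O0 where O0: "zero_object S O0"
    using ex_zero_object by blast
  then have O1: "O0 \<in> Ob S" by (simp add: zero_object_def)
  have A: "X \<in> Ob S" "Z \<in> Ob S" "Y \<in> Ob S"
    using T3 by (auto simp: arr_def)
  from triangle_fill_in[OF triangle_id[OF A(1) O0] T arr_Hom[OF arr_id[OF A(1)]] arr_Hom[OF T3(1)]]
  obtain h where h: "h \<in> Hom S O0 Z" "h \<cdot> Zero S X O0 = v \<cdot> u"
    by blast
  then show ?thesis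
    using comp_zero_right[of h O0 Z X] A O1 by (simp add: arr_def)
qed

lemma triangle_comp2:
  "exact_triangle S X Y Z u v w \<Longrightarrow> w \<cdot> v = Zero S Y (Sus S X)"
  by (rule triangle_comp1[OF triangle_rot])

lemma triangle_comp3:
  assumes T: "exact_triangle S X Y Z u v w"
  shows "SusMap S u \<cdot> w = Zero S Z (Sus S Y)"
proof -
  have "neg (Sus S X) (Sus S Y) (SusMap S u) \<cdot> w = Zero S Z (Sus S Y)"
    by (rule triangle_comp2[OF triangle_rot[OF T]])
  then show ?thesis
    using comp_neg_left[OF triangle_arr(3)[OF T] sus_arr[OF triangle_arr(1)[OF T]]]
      neg_eq_zero_iff[OF arr_comp[OF triangle_arr(3)[OF T] sus_arr[OF triangle_arr(1)[OF T]]]]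
    by simp
qed

text \<open>Exactness of maps into \<open>B\<close>, dual to \<open>triangle_lift1\<close>: the
  given triangle is mapped to 0 -> B = B, and the third component is the extension.\<close>

lemma triangle_extend1:
  assumes T: "exact_triangle S X Y Z u v w" and f: "arr S f Y B" and fu: "f \<cdot> u = Zero S X B"
  obtains g where "arr S g Z B" "g \<cdot> v = f"
proof -
  note T3 = triangle_arr[OF T]
  obtain O0 where O0: "zero_object S O0"
    using ex_zero_object by blast
  then have O1: "O0 \<in> Ob S" by (simp add: zero_object_def)
  have A: "X \<in> Ob S" "Z \<in> Ob S" "Y \<in> Ob S" "B \<in> Ob S"
    using T3 f by (auto simp: arr_def)
  \<comment> \<open>The third object is taken to be a suspended zero object, because the triangle
    can then be rotated backwards to 0 -> B = B -> \<Sigma>0.\<close>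
  have "exact_triangle S B B (Sus S O0) (Id S B) (Zero S B (Sus S O0))
     (neg (Sus S O0) (Sus S B) (SusMap S (Zero S O0 B)))"
    using triangle_id[OF A(4) sus_zero_object[OF O0]] A O1 sus_Ob
    by (simp add: sus_zero neg_zero)
  then have T2: "exact_triangle S O0 B B (Zero S O0 B) (Id S B) (Zero S B (Sus S O0))"
    using triangle_rotate[of O0 B B "Zero S O0 B" "Id S B" "Zero S B (Sus S O0)"]
      arr_zero[of O0 B] arr_id[of B] arr_zero[of B "Sus S O0"] A O1 sus_Ob by (simp add: arr_def)
  have "f \<cdot> u = Zero S O0 B \<cdot> Zero S X O0"
    using fu comp_zero_left[OF arr_zero[OF A(1) O1] A(4)] by simp
  from triangle_fill_in[OF T T2 arr_Hom[OF arr_zero] arr_Hom[OF f] this] A O1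
  obtain h where "h \<in> Hom S Z B" "h \<cdot> v = Id S B \<cdot> f"
    by blast
  then show thesis
    using that[of h] A f by (simp add: arr_def arr_id_left[OF f])
qed

lemma triangle_extend2:
  assumes "exact_triangle S X Y Z u v w" "arr S f Z B" "f \<cdot> v = Zero S Y B"
  obtains g where "arr S g (Sus S X) B" "g \<cdot> w = f"
  using triangle_extend1[OF triangle_rot] assms by blast

end

section \<open>Finite objects and phantom maps\<close>

lemma hom_finprod:
  assumes G: "comm_group G" and H: "comm_group H" and h: "h \<in> hom G H" and f: "f \<in> A \<rightarrow> carrier G"
  shows "h (finprod G f A) = finprod H (\<lambda>x. h (f x)) A"
proof -
  interpret G: comm_group G by (fact G)
  interpret H: comm_group H by (fact H)
  show ?thesis using f
  proof (induction A rule: infinite_finite_induct)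
    case (insert x A)
    then have "(\<lambda>x. h (f x)) \<in> insert x A \<rightarrow> carrier H"
      using hom_carrier[OF h] by blast
    with insert show ?case
      using h by (simp add: hom_mult Pi_iff)
  qed (use h hom_one[OF h] G.is_group H.is_group in auto)
qed

lemma sum_group_cong:
  assumes "\<And>i. i \<in> I \<Longrightarrow> G i = H i"
  shows "sum_group I G = sum_group I H"
proof -
  have "product_group I G = product_group I H"
    unfolding product_group_def using assms by (auto cong: restrict_cong PiE_cong intro!: ext)
  moreover have "{x \<in> \<Pi>\<^sub>E i\<in>I. carrier (G i). finite {i \<in> I. x i \<noteq> \<one>\<^bsub>G i\<^esub>}}
      = {x \<in> \<Pi>\<^sub>E i\<in>I. carrier (H i). finite {i \<in> I. x i \<noteq> \<one>\<^bsub>H i\<^esub>}}"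
    using assms by (simp cong: conj_cong PiE_cong)
  ultimately show ?thesis
    by (simp add: sum_group_def)
qed

lemma sum_group_map_hom:
  assumes G: "\<And>i. i \<in> I \<Longrightarrow> group (G i)" and H: "\<And>i. i \<in> I \<Longrightarrow> group (H i)"
    and h: "\<And>i. i \<in> I \<Longrightarrow> h i \<in> hom (G i) (H i)"
  shows "(\<lambda>x. \<lambda>i\<in>I. h i (x i)) \<in> hom (sum_group I G) (sum_group I H)"
proof (rule homI)
  fix x assume x: "x \<in> carrier (sum_group I G)"
  have "{i \<in> I. h i (x i) \<noteq> \<one>\<^bsub>H i\<^esub>} \<subseteq> {i \<in> I. x i \<noteq> \<one>\<^bsub>G i\<^esub>}"
    using hom_one[OF h G H] by auto
  then have "finite {i \<in> I. h i (x i) \<noteq> \<one>\<^bsub>H i\<^esub>}"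
    using x G by (auto simp: carrier_sum_group intro: finite_subset)
  moreover have "h i (x i) \<in> carrier (H i)" if "i \<in> I" for i
    using x G that hom_in_carrier[OF h] by (auto simp: carrier_sum_group)
  ultimately show "(\<lambda>i\<in>I. h i (x i)) \<in> carrier (sum_group I H)"
    using H by (simp add: carrier_sum_group conj_commute cong: conj_cong)
next
  fix x y assume "x \<in> carrier (sum_group I G)" "y \<in> carrier (sum_group I G)"
  then show "(\<lambda>i\<in>I. h i ((x \<otimes>\<^bsub>sum_group I G\<^esub> y) i))
      = (\<lambda>i\<in>I. h i (x i)) \<otimes>\<^bsub>sum_group I H\<^esub> (\<lambda>i\<in>I. h i (y i))"
    using G by (intro ext) (auto simp: carrier_sum_group PiE_iff intro!: hom_mult[OF h])
qed

lemma sum_group_map_iso: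
  assumes G: "\<And>i. i \<in> I \<Longrightarrow> group (G i)" and H: "\<And>i. i \<in> I \<Longrightarrow> group (H i)"
    and h: "\<And>i. i \<in> I \<Longrightarrow> h i \<in> iso (G i) (H i)"
  shows "(\<lambda>x. \<lambda>i\<in>I. h i (x i)) \<in> iso (sum_group I G) (sum_group I H)"
proof (rule isoI)
  have hh: "h i \<in> hom (G i) (H i)" if "i \<in> I" for i
    using h[OF that] by (simp add: iso_def)
  have bij: "bij_betw (h i) (carrier (G i)) (carrier (H i))" if "i \<in> I" for i
    using h[OF that] by (simp add: iso_def)
  define g where "g i = inv_into (carrier (G i)) (h i)" for i
  have gh: "g i \<in> hom (H i) (G i)" if "i \<in> I" for i
    using group.iso_set_sym[OF G h, OF that that] that by (simp add: iso_def g_def)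
  show 1: "(\<lambda>x. \<lambda>i\<in>I. h i (x i)) \<in> hom (sum_group I G) (sum_group I H)"
    using G H hh by (rule sum_group_map_hom)
  have 2: "(\<lambda>x. \<lambda>i\<in>I. g i (x i)) \<in> hom (sum_group I H) (sum_group I G)"
    using H G gh by (rule sum_group_map_hom)
  show "bij_betw (\<lambda>x. \<lambda>i\<in>I. h i (x i)) (carrier (sum_group I G)) (carrier (sum_group I H))"
  proof (rule bij_betw_byWitness[where f' = "\<lambda>x. \<lambda>i\<in>I. g i (x i)"])
    show "\<forall>a\<in>carrier (sum_group I G). (\<lambda>i\<in>I. g i ((\<lambda>i\<in>I. h i (a i)) i)) = a"
    proof
      fix a assume "a \<in> carrier (sum_group I G)"
      then have a: "\<And>i. i \<in> I \<Longrightarrow> a i \<in> carrier (G i)" "a \<in> extensional I"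
        using G by (auto simp: carrier_sum_group PiE_iff)
      show "(\<lambda>i\<in>I. g i ((\<lambda>i\<in>I. h i (a i)) i)) = a"
        using a by (intro extensionalityI[OF restrict_extensional a(2)])
          (simp add: g_def bij_betw_inv_into_left[OF bij])
    qed
    show "\<forall>a\<in>carrier (sum_group I H). (\<lambda>i\<in>I. h i ((\<lambda>i\<in>I. g i (a i)) i)) = a"
    proof
      fix a assume "a \<in> carrier (sum_group I H)"
      then have a: "\<And>i. i \<in> I \<Longrightarrow> a i \<in> carrier (H i)" "a \<in> extensional I"
        using H by (auto simp: carrier_sum_group PiE_iff)
      show "(\<lambda>i\<in>I. h i ((\<lambda>i\<in>I. g i (a i)) i)) = a"
        using a by (intro extensionalityI[OF restrict_extensional a(2)])
          (simp add: g_def bij_betw_inv_into_right[OF bij])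
    qed
  qed (use hom_carrier[OF 1] hom_carrier[OF 2] in auto)
qed

lemma iso_cong:
  assumes "group G" "T \<in> iso G H" and eq: "\<And>x. x \<in> carrier G \<Longrightarrow> T x = T' x"
  shows "T' \<in> iso G H"
proof (rule isoI)
  interpret group G by fact
  show "T' \<in> hom G H"
    using assms(2) by (auto simp: iso_def hom_def eq[symmetric] Pi_iff)
  show "bij_betw T' (carrier G) (carrier H)"
    using assms(2) bij_betw_cong[OF eq, of "carrier G"] by (auto simp: iso_def)
qed

text \<open>Conjugation with the isomorphisms \<open>a\<close> and \<open>b\<close> turns one
  horizontal map into the other. This will compare the test map of finiteness before and after
  suspension.\<close>

lemma iso_square:
  assumes A: "a \<in> iso G G'" and B: "b \<in> iso H H'" and G: "group G" and H: "group H"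
    and G': "group G'" and T: "T \<in> carrier G \<rightarrow> carrier H" and sq: "\<And>x. x \<in> carrier G \<Longrightarrow> b (T x) = T' (a x)"
  shows "T \<in> iso G H \<longleftrightarrow> T' \<in> iso G' H'"
proof
  assume "T \<in> iso G H"
  then have "b \<circ> T \<circ> inv_into (carrier G) a \<in> iso G' H'"
    using A B group.iso_set_sym[OF G A] iso_set_trans by (metis comp_assoc)
  moreover have "(b \<circ> T \<circ> inv_into (carrier G) a) x = T' x" if "x \<in> carrier G'" for x
  proof -
    have "x \<in> a ` carrier G" using A that by (auto simp: iso_def bij_betw_def)
    then show ?thesis using sq by (auto simp: inv_into_into f_inv_into_f)
  qed
  ultimately show "T' \<in> iso G' H'"
    using G' iso_cong by blast
next
  assume "T' \<in> iso G' H'"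
  then have "inv_into (carrier H) b \<circ> T' \<circ> a \<in> iso G H"
    using A B group.iso_set_sym[OF H B] iso_set_trans by (metis comp_assoc)
  moreover have "(inv_into (carrier H) b \<circ> T' \<circ> a) x = T x" if "x \<in> carrier G" for x
    using sq[OF that, symmetric] B funcset_mem[OF T that] by (simp add: iso_def bij_betw_def)
  ultimately show "T \<in> iso G H"
    using G iso_cong by blast
qed

section \<open>Finiteness is invariant under suspension\<close>

context triangulated_category
begin

text \<open>An automorphism preserves universal properties: a test object is the suspension of some
  \<open>Z'\<close>, the test maps are suspensions too, and the problem is solved before
  suspending.\<close>

lemma coproduct_sus:
  assumes P: "is_coproduct S I X P \<iota>"
  shows "is_coproduct S I (\<lambda>\<alpha>. Sus S (X \<alpha>)) (Sus S P) (\<lambda>\<alpha>. SusMap S (\<iota> \<alpha>))"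
  unfolding is_coproduct_def
proof (intro conjI ballI allI impI)
  have P0: "P \<in> Ob S" "\<And>\<alpha>. \<alpha> \<in> I \<Longrightarrow> X \<alpha> \<in> Ob S"
    using P by (auto simp: is_coproduct_def)
  then show "Sus S P \<in> Ob S" "\<And>\<alpha>. \<alpha> \<in> I \<Longrightarrow> Sus S (X \<alpha>) \<in> Ob S"
    by (auto intro: sus_Ob)
  show "\<And>\<alpha>. \<alpha> \<in> I \<Longrightarrow> SusMap S (\<iota> \<alpha>) \<in> Hom S (Sus S (X \<alpha>)) (Sus S P)"
    by (rule arr_Hom[OF sus_arr[OF coproduct_incl[OF P]]])
  fix Z f assume Z: "Z \<in> Ob S" and f: "\<forall>\<alpha>\<in>I. f \<alpha> \<in> Hom S (Sus S (X \<alpha>)) Z"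
  obtain Z' where Z': "Z' \<in> Ob S" "Sus S Z' = Z"
    using Z by (rule sus_Ob_ex)
  have "\<exists>f'. arr S f' (X \<alpha>) Z' \<and> SusMap S f' = f \<alpha>" if "\<alpha> \<in> I" for \<alpha>
    using sus_arr_ex[of "f \<alpha>" "X \<alpha>" Z'] that f Z' P0 sus_Ob by (metis arr_def)
  then obtain f' where f': "\<And>\<alpha>. \<alpha> \<in> I \<Longrightarrow> arr S (f' \<alpha>) (X \<alpha>) Z'"
    "\<And>\<alpha>. \<alpha> \<in> I \<Longrightarrow> SusMap S (f' \<alpha>) = f \<alpha>"
    by metis
  obtain g where g: "arr S g P Z'" "\<And>\<alpha>. \<alpha> \<in> I \<Longrightarrow> g \<cdot> \<iota> \<alpha> = f' \<alpha>"
    using coproduct_induced[where f=f', OF P Z'(1) f'(1)] by blast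
  show "\<exists>!g. g \<in> Hom S (Sus S P) Z \<and> (\<forall>\<alpha>\<in>I. g \<cdot> SusMap S (\<iota> \<alpha>) = f \<alpha>)"
  proof (intro ex1I[of _ "SusMap S g"] conjI ballI)
    show "SusMap S g \<in> Hom S (Sus S P) Z"
      using arr_Hom[OF sus_arr[OF g(1)]] Z' by simp
    show "SusMap S g \<cdot> SusMap S (\<iota> \<alpha>) = f \<alpha>" if "\<alpha> \<in> I" for \<alpha>
      using sus_comp[OF coproduct_incl[OF P that] g(1)] g(2)[OF that] f'(2)[OF that] by simp
    fix h assume h: "h \<in> Hom S (Sus S P) Z \<and> (\<forall>\<alpha>\<in>I. h \<cdot> SusMap S (\<iota> \<alpha>) = f \<alpha>)"
    then have "arr S h (Sus S P) (Sus S Z')"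
      using Z Z' P0 sus_Ob by (simp add: arr_def)
    then obtain h' where h': "arr S h' P Z'" "h = SusMap S h'"
      using P0 Z' by (metis sus_arr_ex)
    have "h' \<cdot> \<iota> \<alpha> = g \<cdot> \<iota> \<alpha>" if "\<alpha> \<in> I" for \<alpha>
    proof (rule sus_arr_inj)
      note i = coproduct_incl[OF P that]
      show "arr S (h' \<cdot> \<iota> \<alpha>) (X \<alpha>) Z'" "arr S (g \<cdot> \<iota> \<alpha>) (X \<alpha>) Z'"
        using arr_comp[OF i h'(1)] arr_comp[OF i g(1)] by auto
      show "SusMap S (h' \<cdot> \<iota> \<alpha>) = SusMap S (g \<cdot> \<iota> \<alpha>)"
        using sus_comp[OF i h'(1)] h h' g(2)[OF that] f'(2)[OF that] that by simp
    qed
    then show "h = SusMap S g"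
      using coproduct_eqI[OF P h'(1) g(1)] h' by simp
  qed
qed

lemma coproduct_desus:
  assumes SP: "is_coproduct S I (\<lambda>\<alpha>. Sus S (X \<alpha>)) (Sus S P) (\<lambda>\<alpha>. SusMap S (\<iota> \<alpha>))"
    and P: "P \<in> Ob S" and i: "\<And>\<alpha>. \<alpha> \<in> I \<Longrightarrow> arr S (\<iota> \<alpha>) (X \<alpha>) P"
  shows "is_coproduct S I X P \<iota>"
  unfolding is_coproduct_def
proof (intro conjI ballI allI impI)
  show "P \<in> Ob S" "\<And>\<alpha>. \<alpha> \<in> I \<Longrightarrow> X \<alpha> \<in> Ob S" "\<And>\<alpha>. \<alpha> \<in> I \<Longrightarrow> \<iota> \<alpha> \<in> Hom S (X \<alpha>) P"
    using P i by (auto simp: arr_def)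
  fix Z f assume Z: "Z \<in> Ob S" and f: "\<forall>\<alpha>\<in>I. f \<alpha> \<in> Hom S (X \<alpha>) Z"
  have fa: "arr S (f \<alpha>) (X \<alpha>) Z" if "\<alpha> \<in> I" for \<alpha>
    using that f Z i[OF that] by (simp add: arr_def)
  obtain h where h: "arr S h (Sus S P) (Sus S Z)"
    "\<And>\<alpha>. \<alpha> \<in> I \<Longrightarrow> h \<cdot> SusMap S (\<iota> \<alpha>) = SusMap S (f \<alpha>)"
    using coproduct_induced[where f="\<lambda>\<alpha>. SusMap S (f \<alpha>)", OF SP sus_Ob[OF Z] sus_arr[OF fa]] by blast
  obtain g where g: "arr S g P Z" "h = SusMap S g"
    using h(1) P Z by (metis sus_arr_ex)
  show "\<exists>!g. g \<in> Hom S P Z \<and> (\<forall>\<alpha>\<in>I. g \<cdot> \<iota> \<alpha> = f \<alpha>)"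
  proof (intro ex1I[of _ g] conjI ballI)
    show "g \<in> Hom S P Z" using g by (simp add: arr_def)
    show "g \<cdot> \<iota> \<alpha> = f \<alpha>" if "\<alpha> \<in> I" for \<alpha>
      using sus_arr_inj[OF arr_comp[OF i[OF that] g(1)] fa[OF that]]
        sus_comp[OF i[OF that] g(1)] g(2) h(2)[OF that] by simp
    fix g' assume g': "g' \<in> Hom S P Z \<and> (\<forall>\<alpha>\<in>I. g' \<cdot> \<iota> \<alpha> = f \<alpha>)"
    then have g'a: "arr S g' P Z" using P Z by (simp add: arr_def)
    have "SusMap S g' = SusMap S g"
    proof (rule coproduct_eqI[OF SP sus_arr[OF g'a] sus_arr[OF g(1)]])
      fix \<alpha> assume a: "\<alpha> \<in> I"
      then show "SusMap S g' \<cdot> SusMap S (\<iota> \<alpha>) = SusMap S g \<cdot> SusMap S (\<iota> \<alpha>)"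
        using sus_comp[OF i[OF a] g'a] g' h(2)[OF a] g by simp
    qed
    then show "g' = g"
      by (rule sus_arr_inj[OF g'a g(1)])
  qed
qed

text \<open>Suspension is an isomorphism on every Hom group, so the two comparison maps are the
  horizontal sides of a commutative square with invertible vertical sides
  (\<open>iso_square\<close>).\<close>

lemma sum_map_sus_iso:
  assumes W: "W \<in> Ob S" and P: "is_coproduct S I X P \<iota>"
  shows "sum_map I (\<lambda>\<alpha>. hom_group S W (X \<alpha>)) (hom_group S W P) (\<lambda>\<alpha> f. \<iota> \<alpha> \<cdot> f)
         \<in> iso (sum_group I (\<lambda>\<alpha>. hom_group S W (X \<alpha>))) (hom_group S W P)
     \<longleftrightarrow> sum_map I (\<lambda>\<alpha>. hom_group S (Sus S W) (Sus S (X \<alpha>))) (hom_group S (Sus S W) (Sus S P))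
           (\<lambda>\<alpha> f. SusMap S (\<iota> \<alpha>) \<cdot> f)
         \<in> iso (sum_group I (\<lambda>\<alpha>. hom_group S (Sus S W) (Sus S (X \<alpha>)))) (hom_group S (Sus S W) (Sus S P))"
proof (rule iso_square)
  have P0: "P \<in> Ob S" and X0: "\<And>\<alpha>. \<alpha> \<in> I \<Longrightarrow> X \<alpha> \<in> Ob S"
    using P by (auto simp: is_coproduct_def)
  have grp: "\<And>i. i \<in> I \<Longrightarrow> group (hom_group S W (X i))"
    using X0 W hom_group_group by auto
  show "(\<lambda>x. \<lambda>i\<in>I. SusMap S (x i)) \<in> iso (sum_group I (\<lambda>\<alpha>. hom_group S W (X \<alpha>)))
     (sum_group I (\<lambda>\<alpha>. hom_group S (Sus S W) (Sus S (X \<alpha>))))"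
    using X0 W sus_Ob hom_group_group sus_map_bij
    by (intro sum_group_map_iso) (auto intro!: isoI sus_hom)
  show "SusMap S \<in> iso (hom_group S W P) (hom_group S (Sus S W) (Sus S P))"
    using P0 W sus_map_bij by (auto intro!: isoI sus_hom)
  show "group (sum_group I (\<lambda>\<alpha>. hom_group S W (X \<alpha>)))" "group (hom_group S W P)"
    "group (sum_group I (\<lambda>\<alpha>. hom_group S (Sus S W) (Sus S (X \<alpha>))))"
    using X0 P0 W hom_group_group sus_Ob by auto
  note cg = hom_comm_group[OF W P0] hom_comm_group[OF sus_Ob[OF W] sus_Ob[OF P0]]
  have i: "(\<lambda>\<alpha>. \<iota> \<alpha> \<cdot> x \<alpha>) \<in> {\<alpha> \<in> I. x \<alpha> \<noteq> \<one>\<^bsub>hom_group S W (X \<alpha>)\<^esub>} \<rightarrow> carrier (hom_group S W P)"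
    if "x \<in> carrier (sum_group I (\<lambda>\<alpha>. hom_group S W (X \<alpha>)))" for x
  proof
    fix \<alpha> assume a: "\<alpha> \<in> {\<alpha> \<in> I. x \<alpha> \<noteq> \<one>\<^bsub>hom_group S W (X \<alpha>)\<^esub>}"
    then have "arr S (x \<alpha>) W (X \<alpha>)"
      using that W X0 by (auto simp: carrier_sum_group grp arr_def)
    then show "\<iota> \<alpha> \<cdot> x \<alpha> \<in> carrier (hom_group S W P)"
      using arr_comp coproduct_incl[OF P] a by (fastforce simp: arr_def)
  qed
  show "sum_map I (\<lambda>\<alpha>. hom_group S W (X \<alpha>)) (hom_group S W P) (\<lambda>\<alpha> f. \<iota> \<alpha> \<cdot> f)
      \<in> carrier (sum_group I (\<lambda>\<alpha>. hom_group S W (X \<alpha>))) \<rightarrow> carrier (hom_group S W P)"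
    unfolding sum_map_def using comm_monoid.finprod_closed[OF comm_group.axioms(1)[OF cg(1)] i] by blast
  fix x assume x: "x \<in> carrier (sum_group I (\<lambda>\<alpha>. hom_group S W (X \<alpha>)))"
  have xa: "arr S (x \<alpha>) W (X \<alpha>)" if "\<alpha> \<in> I" for \<alpha>
    using x that W X0 by (auto simp: carrier_sum_group grp arr_def)
  \<comment> \<open>\<open>sum_map\<close> multiplies over the support, so suspension must not
    change it: only zero maps suspend to zero.\<close>
  have supp: "{\<alpha> \<in> I. (\<lambda>i\<in>I. SusMap S (x i)) \<alpha> \<noteq> \<one>\<^bsub>hom_group S (Sus S W) (Sus S (X \<alpha>))\<^esub>}
     = {\<alpha> \<in> I. x \<alpha> \<noteq> \<one>\<^bsub>hom_group S W (X \<alpha>)\<^esub>}"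
    using xa sus_eq_zero sus_zero W X0 by fastforce
  have "SusMap S (\<iota> \<alpha> \<cdot> x \<alpha>) = SusMap S (\<iota> \<alpha>) \<cdot> (\<lambda>i\<in>I. SusMap S (x i)) \<alpha>" if "\<alpha> \<in> I" for \<alpha>
    using sus_comp[OF xa coproduct_incl[OF P]] that by simp
  then show "SusMap S (sum_map I (\<lambda>\<alpha>. hom_group S W (X \<alpha>)) (hom_group S W P) (\<lambda>\<alpha> f. \<iota> \<alpha> \<cdot> f) x)
    = sum_map I (\<lambda>\<alpha>. hom_group S (Sus S W) (Sus S (X \<alpha>))) (hom_group S (Sus S W) (Sus S P))
       (\<lambda>\<alpha> f. SusMap S (\<iota> \<alpha>) \<cdot> f) (\<lambda>i\<in>I. SusMap S (x i))"
    unfolding sum_map_def supp hom_finprod[OF cg sus_hom[OF W P0] i[OF x]]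
    using hom_in_carrier[OF sus_hom[OF W P0]] i[OF x]
    by (intro comm_monoid.finprod_cong[OF comm_group.axioms(1)[OF cg(2)]])
      (auto simp: simp_implies_def simp flip: hom_group_simps(1))
qed

lemma sum_map_cong:
  "(\<And>\<alpha>. \<alpha> \<in> I \<Longrightarrow> G \<alpha> = G' \<alpha>) \<Longrightarrow> (\<And>\<alpha> f. \<alpha> \<in> I \<Longrightarrow> h \<alpha> f = h' \<alpha> f) \<Longrightarrow> comm_group H
    \<Longrightarrow> (\<And>\<alpha> f. \<alpha> \<in> I \<Longrightarrow> f \<in> carrier (G \<alpha>) \<Longrightarrow> h \<alpha> f \<in> carrier H)
    \<Longrightarrow> x \<in> (\<Pi> \<alpha>\<in>I. carrier (G \<alpha>)) \<Longrightarrow> sum_map I G H h x = sum_map I G' H h' x"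
  unfolding sum_map_def
  by (rule comm_monoid.finprod_cong[OF comm_group.axioms(1)]) (auto simp: simp_implies_def Pi_iff)

lemma finite_objects_Ob: "W \<in> finite_objects small S \<Longrightarrow> W \<in> Ob S"
  by (simp add: finite_objects_def)

lemma finite_objects_desus:
  assumes W: "W \<in> Ob S" and SW: "Sus S W \<in> finite_objects small S"
  shows "W \<in> finite_objects small S"
  unfolding finite_objects_def
proof (intro CollectI conjI W allI impI)
  fix I X P \<iota> assume "small I" and P: "is_coproduct S I X P \<iota>"
  then show "sum_map I (\<lambda>\<alpha>. hom_group S W (X \<alpha>)) (hom_group S W P) (\<lambda>\<alpha> f. \<iota> \<alpha> \<cdot> f)
         \<in> iso (sum_group I (\<lambda>\<alpha>. hom_group S W (X \<alpha>))) (hom_group S W P)"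
    using SW coproduct_sus[OF P] sum_map_sus_iso[OF W P] by (auto simp: finite_objects_def)
qed

text \<open>A coproduct that tests \<open>Sus S W\<close> is not given as a suspension. Its objects
  and injections are therefore desuspended first, with inverses chosen index by index in
  \<open>X'\<close> and \<open>\<iota>'\<close>.\<close>

lemma finite_objects_sus:
  assumes W: "W \<in> finite_objects small S"
  shows "Sus S W \<in> finite_objects small S"
  unfolding finite_objects_def
proof (intro CollectI conjI allI impI)
  note W0 = finite_objects_Ob[OF W]
  show "Sus S W \<in> Ob S" using W0 by (rule sus_Ob)
  fix I X P \<iota> assume I: "small I" and P: "is_coproduct S I X P \<iota>"
  have P0: "P \<in> Ob S" and X0: "\<And>\<alpha>. \<alpha> \<in> I \<Longrightarrow> X \<alpha> \<in> Ob S"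
    using P by (auto simp: is_coproduct_def)
  obtain P' where P': "P' \<in> Ob S" "Sus S P' = P" using P0 by (rule sus_Ob_ex)
  define X' where "X' \<alpha> = inv_into (Ob S) (Sus S) (X \<alpha>)" for \<alpha>
  have X': "X' \<alpha> \<in> Ob S" "Sus S (X' \<alpha>) = X \<alpha>" if "\<alpha> \<in> I" for \<alpha>
    using X0[OF that] sus_bij by (auto simp: X'_def bij_betw_def inv_into_into f_inv_into_f)
  define \<iota>' where "\<iota>' \<alpha> = inv_into (Hom S (X' \<alpha>) P') (SusMap S) (\<iota> \<alpha>)" for \<alpha>
  have \<iota>': "\<iota>' \<alpha> \<in> Hom S (X' \<alpha>) P'" "SusMap S (\<iota>' \<alpha>) = \<iota> \<alpha>" if "\<alpha> \<in> I" for \<alpha>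
  proof -
    have "\<iota> \<alpha> \<in> SusMap S ` Hom S (X' \<alpha>) P'"
      using sus_map_bij[of "X' \<alpha>" P'] X'[OF that] P' arr_Hom[OF coproduct_incl[OF P that]]
      by (simp add: bij_betw_def)
    then show "\<iota>' \<alpha> \<in> Hom S (X' \<alpha>) P'" "SusMap S (\<iota>' \<alpha>) = \<iota> \<alpha>"
      by (simp_all add: \<iota>'_def inv_into_into f_inv_into_f)
  qed
  have cop: "is_coproduct S I X' P' \<iota>'"
  proof (rule coproduct_desus)
    show "is_coproduct S I (\<lambda>\<alpha>. Sus S (X' \<alpha>)) (Sus S P') (\<lambda>\<alpha>. SusMap S (\<iota>' \<alpha>))"
      using P X' \<iota>' P' by (simp add: is_coproduct_def)
  qed (use X' \<iota>' P' in \<open>auto simp: arr_def\<close>)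
  let ?T = "sum_map I (\<lambda>\<alpha>. hom_group S (Sus S W) (X \<alpha>)) (hom_group S (Sus S W) P) (\<lambda>\<alpha> f. \<iota> \<alpha> \<cdot> f)"
  have "sum_map I (\<lambda>\<alpha>. hom_group S W (X' \<alpha>)) (hom_group S W P') (\<lambda>\<alpha> f. \<iota>' \<alpha> \<cdot> f)
         \<in> iso (sum_group I (\<lambda>\<alpha>. hom_group S W (X' \<alpha>))) (hom_group S W P')"
    using W I cop by (auto simp: finite_objects_def)
  then have *: "sum_map I (\<lambda>\<alpha>. hom_group S (Sus S W) (Sus S (X' \<alpha>))) (hom_group S (Sus S W) (Sus S P'))
           (\<lambda>\<alpha> f. SusMap S (\<iota>' \<alpha>) \<cdot> f)
         \<in> iso (sum_group I (\<lambda>\<alpha>. hom_group S (Sus S W) (Sus S (X' \<alpha>)))) (hom_group S (Sus S W) (Sus S P'))"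
    by (rule sum_map_sus_iso[OF W0 cop, THEN iffD1])
  have eq: "sum_map I (\<lambda>\<alpha>. hom_group S (Sus S W) (Sus S (X' \<alpha>))) (hom_group S (Sus S W) (Sus S P'))
           (\<lambda>\<alpha> f. SusMap S (\<iota>' \<alpha>) \<cdot> f) x = ?T x"
    if "x \<in> carrier (sum_group I (\<lambda>\<alpha>. hom_group S (Sus S W) (X \<alpha>)))" for x
    unfolding P'(2)
  proof (rule sum_map_cong)
    show "comm_group (hom_group S (Sus S W) P)"
      using W0 P0 sus_Ob by (intro hom_comm_group)
    show "x \<in> (\<Pi> \<alpha>\<in>I. carrier (hom_group S (Sus S W) (Sus S (X' \<alpha>))))"
      using that X0 W0 sus_Ob hom_group_group X' by (auto simp: carrier_sum_group)
    fix \<alpha> f assume "\<alpha> \<in> I" "f \<in> carrier (hom_group S (Sus S W) (Sus S (X' \<alpha>)))"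
    then show "SusMap S (\<iota>' \<alpha>) \<cdot> f \<in> carrier (hom_group S (Sus S W) P)"
      using X' \<iota>' W0 sus_Ob X0 arr_comp[of f "Sus S W" "X \<alpha>" "\<iota> \<alpha>" P] coproduct_incl[OF P] by (simp add: arr_def)
  qed (use X' \<iota>' in auto)
  have seq: "sum_group I (\<lambda>\<alpha>. hom_group S (Sus S W) (Sus S (X' \<alpha>))) = sum_group I (\<lambda>\<alpha>. hom_group S (Sus S W) (X \<alpha>))"
    by (rule sum_group_cong) (simp add: X')
  have "group (sum_group I (\<lambda>\<alpha>. hom_group S (Sus S W) (X \<alpha>)))"
    using X0 W0 sus_Ob hom_group_group by auto
  from iso_cong[OF this *[unfolded seq P'(2)] eq[unfolded P'(2)]]
  show "?T \<in> iso (sum_group I (\<lambda>\<alpha>. hom_group S (Sus S W) (X \<alpha>))) (hom_group S (Sus S W) P)" .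
qed

end

section \<open>Phantom maps in a Brown category\<close>

locale brown_phantom_category = triangulated_category S
  for S :: "('o, 'a, 'z) triangulated_data_scheme" (structure) and small :: "'i set \<Rightarrow> bool" +
  assumes small: "smallness small"
    and small_coproducts: "has_small_coproducts small S"
    and brown: "brown_category small S"
    and phantom_class: "generating_phantom_projective_class small S"
begin

abbreviation Fin :: "'o set" where
  "Fin \<equiv> finite_objects small S"

definition phantom :: "'a \<Rightarrow> 'o \<Rightarrow> 'o \<Rightarrow> bool" where
  "phantom f X Y \<longleftrightarrow> arr S f X Y \<and> (\<forall>W\<in>Fin. \<forall>g. arr S g W X \<longrightarrow> f \<cdot> g = Zero S W Y)"

text \<open>Surjectivity of the map that \<open>p\<close> induces between functors on finite
  objects. These are the maps whose cofibre map is phantom, see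
  \<open>fin_epi_triangle\<close>.\<close>

definition fin_epi :: "'a \<Rightarrow> 'o \<Rightarrow> 'o \<Rightarrow> bool" where
  "fin_epi p X Y \<longleftrightarrow> arr S p X Y \<and> (\<forall>W\<in>Fin. \<forall>y. arr S y W Y \<longrightarrow> (\<exists>x. arr S x W X \<and> p \<cdot> x = y))"

text \<open>Only phantoms that start at \<open>P\<close> itself are tested; by
  \<open>proj_iff\<close> this is membership in \<open>phantom_projectives\<close>.\<close>

definition proj :: "'o \<Rightarrow> bool" where
  "proj P \<longleftrightarrow> P \<in> Ob S \<and> (\<forall>Y f. phantom f P Y \<longrightarrow> f = Zero S P Y)"

lemma phantom_maps_iff: "arr S f X Y \<Longrightarrow> f \<in> phantom_maps small S \<longleftrightarrow> phantom f X Y"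
  unfolding phantom_maps_def phantom_def mem_Collect_eq
  using arr_unique finite_objects_Ob unfolding arr_def by (metis (no_types, lifting))

lemma phantom_comp_left:
  assumes f: "phantom f X Y" and g: "arr S g Y Z"
  shows "phantom (g \<cdot> f) X Z"
  unfolding phantom_def
proof (intro conjI ballI allI impI)
  have fa: "arr S f X Y" using f by (simp add: phantom_def)
  show "arr S (g \<cdot> f) X Z" by (rule arr_comp[OF fa g])
  fix W x assume W: "W \<in> Fin" and x: "arr S x W X"
  then show "(g \<cdot> f) \<cdot> x = Zero S W Z"
    using f arr_assoc[OF x fa g] comp_zero_right[OF g arr_Ob(1)[OF x]] by (simp add: phantom_def)
qed

lemma phantom_comp_right:
  assumes f: "phantom f X Y" and g: "arr S g W X"
  shows "phantom (f \<cdot> g) W Y"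
  unfolding phantom_def
proof (intro conjI ballI allI impI)
  have fa: "arr S f X Y" using f by (simp add: phantom_def)
  show "arr S (f \<cdot> g) W Y" by (rule arr_comp[OF g fa])
  fix V x assume W: "V \<in> Fin" and x: "arr S x V W"
  then show "(f \<cdot> g) \<cdot> x = Zero S V Y"
    using f arr_assoc[OF x g fa] arr_comp[OF x g] by (simp add: phantom_def)
qed

lemma phantom_diff:
  assumes "arr S f X Y" "arr S g X Y" "\<And>W x. W \<in> Fin \<Longrightarrow> arr S x W X \<Longrightarrow> f \<cdot> x = g \<cdot> x"
  shows "phantom (Add S f (neg X Y g)) X Y"
  unfolding phantom_def
proof (intro conjI ballI allI impI)
  show "arr S (Add S f (neg X Y g)) X Y"
    using assms by (simp add: arr_add arr_neg)
  fix W x assume W: "W \<in> Fin" and x: "arr S x W X"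
  have "Add S f (neg X Y g) \<cdot> x = Add S (f \<cdot> x) (neg W Y (g \<cdot> x))"
    using arr_comp_add_left[OF x assms(1) arr_neg[OF assms(2)]] comp_neg_left[OF x assms(2)] by simp
  then show "Add S f (neg X Y g) \<cdot> x = Zero S W Y"
    using assms(3)[OF W x] add_neg[OF arr_comp[OF x assms(2)]] by simp
qed

lemma phantom_neg:
  assumes f: "phantom f X Y"
  shows "phantom (neg X Y f) X Y"
  unfolding phantom_def
proof (intro conjI ballI allI impI)
  have fa: "arr S f X Y" using f by (simp add: phantom_def)
  show "arr S (neg X Y f) X Y" by (rule arr_neg[OF fa])
  fix W x assume "W \<in> Fin" and x: "arr S x W X"
  then show "neg X Y f \<cdot> x = Zero S W Y"
    using f comp_neg_left[OF x fa] neg_zero[OF arr_Ob(1)[OF x] arr_Ob(2)[OF fa]] by (simp add: phantom_def)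
qed

lemma phantom_sus:
  assumes f: "phantom f X Y"
  shows "phantom (SusMap S f) (Sus S X) (Sus S Y)"
  unfolding phantom_def
proof (intro conjI ballI allI impI)
  have fa: "arr S f X Y" using f by (simp add: phantom_def)
  then show "arr S (SusMap S f) (Sus S X) (Sus S Y)" by (rule sus_arr)
  fix W g assume W: "W \<in> Fin" and g: "arr S g W (Sus S X)"
  obtain W' where W': "W' \<in> Ob S" "Sus S W' = W"
    using finite_objects_Ob[OF W] by (rule sus_Ob_ex)
  then have W'F: "W' \<in> Fin"
    using W finite_objects_desus by blast
  obtain g' where g': "arr S g' W' X" "g = SusMap S g'"
    using g W' fa arr_Ob by (metis sus_arr_ex)
  have "f \<cdot> g' = Zero S W' Y"
    using f W'F g' by (simp add: phantom_def)
  then show "SusMap S f \<cdot> g = Zero S W (Sus S Y)"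
    using g' W' sus_comp[OF g'(1) fa] sus_zero[OF W'(1) arr_Ob(2)[OF fa]] by simp
qed

text \<open>The second clause of a projective class describes projectives by all composites P -> X
  -> Y with phantom second map. Such a composite is itself a phantom out of \<open>P\<close>;
  conversely, a phantom out of \<open>P\<close> is composed with the identity.\<close>

lemma proj_iff: "proj P \<longleftrightarrow> P \<in> phantom_projectives small S"
proof -
  let ?P = "phantom_projectives small S" and ?I = "phantom_maps small S"
  have "?P = {P \<in> Ob S. \<forall>X\<in>Ob S. \<forall>Y\<in>Ob S. \<forall>f\<in>Hom S X Y. f \<in> ?I \<longrightarrow>
             (\<forall>g\<in>Hom S P X. f \<cdot> g = Zero S P Y)}"
    using phantom_class unfolding generating_phantom_projective_class_def projective_class_def by blast
  from eqset_imp_iff[OF this, of P]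
  have *: "P \<in> ?P \<longleftrightarrow> P \<in> Ob S \<and> (\<forall>X\<in>Ob S. \<forall>Y\<in>Ob S. \<forall>f\<in>Hom S X Y. f \<in> ?I \<longrightarrow>
             (\<forall>g\<in>Hom S P X. f \<cdot> g = Zero S P Y))"
    by simp
  show ?thesis
  proof
    assume P: "proj P"
    have "f \<cdot> g = Zero S P Y" if "arr S f X Y" "f \<in> ?I" "arr S g P X" for X Y f g
      using P that phantom_comp_right phantom_maps_iff by (simp add: proj_def)
    then show "P \<in> ?P"
      unfolding * using P by (simp add: proj_def arr_def)
  next
    assume "P \<in> ?P"
    then have P: "P \<in> Ob S"
      "\<And>X Y f g. arr S f X Y \<Longrightarrow> f \<in> ?I \<Longrightarrow> g \<in> Hom S P X \<Longrightarrow> f \<cdot> g = Zero S P Y"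
      unfolding * arr_def by blast+
    have "f = Zero S P Y" if "phantom f P Y" for f Y
      using P(2)[of f P Y "Id S P"] that phantom_maps_iff[of f P Y] arr_id_right[of f P Y]
        arr_id[OF P(1)] by (simp add: phantom_def arr_def)
    with P(1) show "proj P" by (simp add: proj_def)
  qed
qed

lemma ex_triangle:
  assumes "X \<in> Ob S"
  obtains P Y p f q where "exact_triangle S P X Y p f q" "proj P" "phantom f X Y"
proof -
  have "\<exists>P Y p f q. exact_triangle S P X Y p f q \<and> P \<in> phantom_projectives small S
      \<and> f \<in> phantom_maps small S"
    using phantom_class assms
    unfolding generating_phantom_projective_class_def projective_class_def by blast
  then obtain P Y p f q where T: "exact_triangle S P X Y p f q"
    and "P \<in> phantom_projectives small S" "f \<in> phantom_maps small S"
    by blast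
  then show thesis
    using that[OF T] proj_iff phantom_maps_iff[OF triangle_arr(2)[OF T]] by blast
qed

text \<open>A phantom out of \<Sigma>P desuspends to a phantom out of \<open>P\<close>, because the
  suspension of a finite object is finite.\<close>

lemma proj_sus:
  assumes P: "proj P"
  shows "proj (Sus S P)"
  unfolding proj_def
proof (intro conjI allI impI)
  show "Sus S P \<in> Ob S" using P sus_Ob by (simp add: proj_def)
  fix Y f assume f: "phantom f (Sus S P) Y"
  then have fa: "arr S f (Sus S P) Y" by (simp add: phantom_def)
  obtain Y' where Y': "Y' \<in> Ob S" "Sus S Y' = Y"
    using sus_Ob_ex[OF arr_Ob(2)[OF fa]] by blast
  obtain f' where f': "arr S f' P Y'" "f = SusMap S f'"
    using fa Y' P by (metis sus_arr_ex proj_def)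
  have "phantom f' P Y'"
    unfolding phantom_def
  proof (intro conjI ballI allI impI f')
    fix W g assume W: "W \<in> Fin" and g: "arr S g W P"
    have "SusMap S (f' \<cdot> g) = Zero S (Sus S W) (Sus S Y')"
      using f finite_objects_sus[OF W] sus_arr[OF g] sus_comp[OF g f'(1)] f' Y'
      by (simp add: phantom_def)
    then show "f' \<cdot> g = Zero S W Y'"
      using sus_eq_zero arr_comp[OF g f'(1)] by blast
  qed
  then have "f' = Zero S P Y'"
    using P by (simp add: proj_def)
  then show "f = Zero S (Sus S P) Y"
    using f' Y' sus_zero P by (simp add: proj_def)
qed

text \<open>Exactness at \<open>Y\<close>: a map from a finite object lifts through \<open>p\<close>
  iff \<open>f\<close> kills it.\<close>

lemma fin_epi_triangle:
  assumes T: "exact_triangle S X Y Z p f q"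
  shows "fin_epi p X Y \<longleftrightarrow> phantom f Y Z"
proof
  note T3 = triangle_arr[OF T]
  assume p: "fin_epi p X Y"
  show "phantom f Y Z"
    unfolding phantom_def
  proof (intro conjI ballI allI impI T3)
    fix W y assume W: "W \<in> Fin" and y: "arr S y W Y"
    then obtain x where x: "arr S x W X" "p \<cdot> x = y"
      using p by (auto simp: fin_epi_def)
    then show "f \<cdot> y = Zero S W Z"
      using arr_assoc[OF x(1) T3(1,2)] triangle_comp1[OF T] comp_zero_left[OF x(1)] arr_Ob(2)[OF T3(2)]
      by simp
  qed
next
  assume f: "phantom f Y Z"
  show "fin_epi p X Y"
    unfolding fin_epi_def
  proof (intro conjI ballI allI impI triangle_arr(1)[OF T])
    fix W y assume "W \<in> Fin" "arr S y W Y"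
    then show "\<exists>x. arr S x W X \<and> p \<cdot> x = y"
      using f triangle_lift1[OF T, of y W] by (metis phantom_def)
  qed
qed

text \<open>Three rotations give the suspended triangle with all three maps negated. The sign is
  kept because the once rotated triangle X -> X_1 -> \<Sigma>P -> \<Sigma>X ends in exactly this
  map.\<close>

lemma fin_epi_rotated:
  assumes T: "exact_triangle S P X X1 p f q" and f: "phantom f X X1"
  shows "fin_epi (neg (Sus S P) (Sus S X) (SusMap S p)) (Sus S P) (Sus S X)"
  using fin_epi_triangle[OF triangle_rot[OF triangle_rot[OF triangle_rot[OF T]]]]
    phantom_neg[OF phantom_sus[OF f]] by blast

text \<open>The form in which the Brown property is used. On finite objects \<open>m\<close> factors
  through the surjection induced by \<open>e\<close>, and the natural transformation so obtained is
  represented by \<open>t\<close>. The conclusion speaks of maps from finite objects, because t e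
  and m may still differ by a phantom.\<close>

lemma brown_factor:
  assumes e: "fin_epi e A B" and m: "arr S m A Z"
    and ker: "\<And>W x. W \<in> Fin \<Longrightarrow> arr S x W A \<Longrightarrow> e \<cdot> x = Zero S W B \<Longrightarrow> m \<cdot> x = Zero S W Z"
  obtains t where "arr S t B Z" "\<And>W x. W \<in> Fin \<Longrightarrow> arr S x W A \<Longrightarrow> t \<cdot> e \<cdot> x = m \<cdot> x"
proof -
  have ea: "arr S e A B" using e by (simp add: fin_epi_def)
  define \<tau> where "\<tau> W y = m \<cdot> (SOME x. arr S x W A \<and> e \<cdot> x = y)" for W y
  \<comment> \<open>\<open>\<tau>\<close> takes an arbitrary preimage; two preimages differ by a map
    that \<open>e\<close> kills, so the value does not depend on the choice.\<close>
  have \<tau>: "\<tau> W (e \<cdot> x) = m \<cdot> x" if W: "W \<in> Fin" and x: "arr S x W A" for W x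
  proof -
    define x' where "x' = (SOME x'. arr S x' W A \<and> e \<cdot> x' = e \<cdot> x)"
    have x': "arr S x' W A" "e \<cdot> x' = e \<cdot> x"
      using someI[of "\<lambda>x'. arr S x' W A \<and> e \<cdot> x' = e \<cdot> x" x] x by (auto simp: x'_def)
    have d: "arr S (Add S x' (neg W A x)) W A"
      using x x' by (simp add: arr_add arr_neg)
    have "e \<cdot> Add S x' (neg W A x) = Zero S W B"
      using arr_comp_add_right[OF x'(1) arr_neg[OF x] ea] comp_neg_right[OF x ea] x'(2)
        add_neg[OF arr_comp[OF x ea]] by simp
    from ker[OF W d this] have "Add S (m \<cdot> x') (neg W Z (m \<cdot> x)) = Zero S W Z"
      using arr_comp_add_right[OF x'(1) arr_neg[OF x] m] comp_neg_right[OF x m] by simp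
    then show ?thesis
      using eq_if_diff_zero[OF arr_comp[OF x'(1) m] arr_comp[OF x m]] by (simp add: \<tau>_def x'_def)
  qed
  have lift: "\<exists>x. arr S x W A \<and> e \<cdot> x = y" if "W \<in> Fin" "y \<in> Hom S W B" for W y
    using e that finite_objects_Ob arr_Ob(2)[OF ea] by (auto simp: fin_epi_def arr_def)
  have "\<exists>h\<in>Hom S B Z. \<forall>W\<in>Fin. \<forall>y\<in>Hom S W B. \<tau> W y = h \<cdot> y"
  proof (rule brown[unfolded brown_category_def, rule_format])
    show "B \<in> Ob S" "Z \<in> Ob S" using ea m by (simp_all add: arr_def)
    fix W assume W: "W \<in> Fin"
    show "\<tau> W \<in> hom (hom_group S W B) (hom_group S W Z)"
    proof (rule homI)
      fix y assume "y \<in> carrier (hom_group S W B)"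
      then obtain x where x: "arr S x W A" "e \<cdot> x = y"
        using lift[OF W] by auto
      then show "\<tau> W y \<in> carrier (hom_group S W Z)"
        using \<tau>[OF W x(1)] arr_Hom[OF arr_comp[OF x(1) m]] by simp
    next
      fix y y' assume "y \<in> carrier (hom_group S W B)" "y' \<in> carrier (hom_group S W B)"
      then obtain x x' where x: "arr S x W A" "e \<cdot> x = y" and x': "arr S x' W A" "e \<cdot> x' = y'"
        using lift[OF W] by (metis hom_group_simps(1))
      then show "\<tau> W (y \<otimes>\<^bsub>hom_group S W B\<^esub> y') = \<tau> W y \<otimes>\<^bsub>hom_group S W Z\<^esub> \<tau> W y'"
        using \<tau>[OF W x(1)] \<tau>[OF W x'(1)] \<tau>[OF W arr_add[OF x(1) x'(1)]]
          arr_comp_add_right[OF x(1) x'(1) ea] arr_comp_add_right[OF x(1) x'(1) m] by simp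
    qed
  next
    fix V W g f assume V: "V \<in> Fin" and W: "W \<in> Fin" and g: "g \<in> Hom S V W" and f: "f \<in> Hom S W B"
    obtain x where x: "arr S x W A" "e \<cdot> x = f"
      using lift[OF W f] by auto
    have g: "arr S g V W" using g finite_objects_Ob[OF V] finite_objects_Ob[OF W] by (simp add: arr_def)
    show "\<tau> V (f \<cdot> g) = \<tau> W f \<cdot> g"
      using \<tau>[OF W x(1)] \<tau>[OF V arr_comp[OF g x(1)]] x(2) arr_assoc[OF g x(1) ea] arr_assoc[OF g x(1) m]
      by simp
  qed
  then obtain h where h: "h \<in> Hom S B Z" "\<And>W y. W \<in> Fin \<Longrightarrow> y \<in> Hom S W B \<Longrightarrow> \<tau> W y = h \<cdot> y"
    by blast
  show thesis
  proof (rule that)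
    show "arr S h B Z" using h ea m by (simp add: arr_def)
    show "h \<cdot> e \<cdot> x = m \<cdot> x" if "W \<in> Fin" "arr S x W A" for W x
      using h(2)[OF that(1) arr_Hom[OF arr_comp[OF that(2) ea]]] \<tau>[OF that] by simp
  qed
qed

text \<open>On finite objects \<open>e\<close> is bijective, so its cofibre \<open>N\<close>
  receives no non-zero map from them. Every map from a projective to \<open>N\<close> is then
  phantom, hence zero, and generation forces \<open>N\<close> to vanish.\<close>

lemma split_epi_of_fin_id:
  assumes e: "arr S e A A" and fin_id: "\<And>W y. W \<in> Fin \<Longrightarrow> arr S y W A \<Longrightarrow> e \<cdot> y = y"
  obtains r where "arr S r A A" "e \<cdot> r = Id S A"
proof -
  have A: "A \<in> Ob S" using e by (simp add: arr_def)
  obtain N v w where T: "exact_triangle S A A N e v w"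
    using triangle_extend[OF A A arr_Hom[OF e]] by blast
  note T3 = triangle_arr[OF T]
  have N: "N \<in> Ob S" using T3 by (simp add: arr_def)
  \<comment> \<open>\<open>w n\<close> desuspends to a map killed by \<open>e\<close>, thus to zero.
    So \<open>n\<close> lifts along \<open>v\<close> to some \<open>y\<close>, and y = e y is sent
    to zero by \<open>v\<close>.\<close>
  have fin: "n = Zero S W N" if W: "W \<in> Fin" and n: "arr S n W N" for W n
  proof -
    have W0: "W \<in> Ob S" using W by (rule finite_objects_Ob)
    obtain W' where W': "W' \<in> Ob S" "Sus S W' = W"
      using W0 by (rule sus_Ob_ex)
    then have W'F: "W' \<in> Fin" using W finite_objects_desus by blast
    obtain y' where y': "arr S y' W' A" "w \<cdot> n = SusMap S y'"
      using arr_comp[OF n T3(3)] W' A by (metis sus_arr_ex)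
    have "SusMap S (e \<cdot> y') = (SusMap S e \<cdot> w) \<cdot> n"
      using sus_comp[OF y'(1) e] y'(2) arr_assoc[OF n T3(3) sus_arr[OF e]] by simp
    then have "SusMap S (e \<cdot> y') = Zero S (Sus S W') (Sus S A)"
      using triangle_comp3[OF T] comp_zero_left[OF n sus_Ob[OF A]] W' by simp
    then have "e \<cdot> y' = Zero S W' A"
      by (rule sus_eq_zero[OF arr_comp[OF y'(1) e]])
    then have "y' = Zero S W' A"
      using fin_id[OF W'F y'(1)] by simp
    then have "w \<cdot> n = Zero S W (Sus S A)"
      using y' sus_zero W' A by simp
    then obtain y where y: "arr S y W A" "v \<cdot> y = n"
      using triangle_lift2[OF T n] by blast
    have "v \<cdot> (e \<cdot> y) = Zero S W N"
      using arr_assoc[OF y(1) e T3(2)] triangle_comp1[OF T] comp_zero_left[OF y(1) N] by simp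
    then show ?thesis
      using fin_id[OF W y(1)] y by simp
  qed
  have "zero_object S N"
  proof (rule ccontr)
    assume "\<not> zero_object S N"
    then obtain P where P: "proj P" "Hom S P N \<noteq> {Zero S P N}"
      using phantom_class N proj_iff
      unfolding generating_phantom_projective_class_def generates_def by blast
    have "f = Zero S P N" if "f \<in> Hom S P N" for f
    proof -
      have f: "arr S f P N" using that P N by (simp add: arr_def proj_def)
      have "phantom f P N"
        unfolding phantom_def using f fin arr_comp by blast
      then show ?thesis using P by (simp add: proj_def)
    qed
    then show False
      using P arr_Hom[OF arr_zero[OF _ N]] unfolding proj_def by blast
  qed
  then have "v \<cdot> Id S A = Zero S A N"
    using zero_object_arr[OF _ T3(2)] arr_id_right[OF T3(2)] by simp
  then show thesis
    using triangle_lift1[OF T arr_id[OF A]] that by blast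
qed

text \<open>g f vanishes as soon as the map c' : W' -> \<Sigma>X out of its cofibre is a split
  epimorphism. The fill-in axiom lifts -\<Sigma>p to h : \<Sigma>P -> W'. On finite objects h
  descends along -\<Sigma>p because \<open>g\<close> is phantom, and the map \<Sigma>X -> W'
  representing the descent splits c' there.\<close>

lemma phantom_comp_resolution:
  assumes T: "exact_triangle S P X X1 p f q" and f: "phantom f X X1" and g: "phantom g X1 Z"
  shows "g \<cdot> f = Zero S X Z"
proof -
  note T3 = triangle_arr[OF T]
  have ga: "arr S g X1 Z" using g by (simp add: phantom_def)
  have gf: "arr S (g \<cdot> f) X Z" using arr_comp[OF T3(2) ga] .
  obtain W' c c' where T': "exact_triangle S X Z W' (g \<cdot> f) c c'"
    using triangle_extend[OF arr_Ob[OF gf] arr_Hom[OF gf]] by blast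
  note T'3 = triangle_arr[OF T']
  note Sp = sus_arr[OF T3(1)]
  have X: "X \<in> Ob S" "P \<in> Ob S" using T3 by (simp_all add: arr_def)
  let ?e = "neg (Sus S P) (Sus S X) (SusMap S p)"
  note e = fin_epi_rotated[OF T f]
  have "g \<cdot> f = (g \<cdot> f) \<cdot> Id S X"
    using arr_id_right[OF gf] by simp
  from triangle_fill_in[OF triangle_rot[OF T] T' arr_Hom[OF arr_id[OF X(1)]] arr_Hom[OF ga] this]
  obtain h where h: "h \<in> Hom S (Sus S P) W'" "h \<cdot> q = c \<cdot> g"
    "SusMap S (Id S X) \<cdot> neg (Sus S P) (Sus S X) (SusMap S p) = c' \<cdot> h"
    by blast
  then have ha: "arr S h (Sus S P) W'"
    using X sus_Ob arr_Ob(2)[OF T'3(2)] by (simp add: arr_def)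
  have c'h: "c' \<cdot> h = ?e"
    using h(3) sus_map_id[OF X(1)] arr_id_left[OF arr_neg[OF Sp]] by simp
  \<comment> \<open>A map killed by -\<Sigma>p comes from X_1 through \<open>q\<close>, and h q = c
    g vanishes on finite objects.\<close>
  have ker: "h \<cdot> x = Zero S W W'"
    if W: "W \<in> Fin" and x: "arr S x W (Sus S P)" and 0: "?e \<cdot> x = Zero S W (Sus S X)" for W x
  proof -
    obtain y where y: "arr S y W X1" "q \<cdot> y = x"
      using triangle_lift2[OF triangle_rot[OF T] x 0] by blast
    have "h \<cdot> x = c \<cdot> (g \<cdot> y)"
      using arr_assoc[OF y(1) T3(3) ha] arr_assoc[OF y(1) ga T'3(2)] h(2) y(2) by simp
    also have "g \<cdot> y = Zero S W Z"
      using g W y by (simp add: phantom_def)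
    finally show ?thesis
      using comp_zero_right[OF T'3(2) finite_objects_Ob[OF W]] by simp
  qed
  obtain s where s: "arr S s (Sus S X) W'"
    "\<And>W x. W \<in> Fin \<Longrightarrow> arr S x W (Sus S P) \<Longrightarrow> s \<cdot> ?e \<cdot> x = h \<cdot> x"
    using brown_factor[OF e ha ker] by blast
  \<comment> \<open>At this point c' s is the identity on finite objects only; generation then
    provides a genuine right inverse \<open>r\<close>.\<close>
  have "(c' \<cdot> s) \<cdot> y = y" if W: "W \<in> Fin" and y: "arr S y W (Sus S X)" for W y
  proof -
    obtain x where x: "arr S x W (Sus S P)" "?e \<cdot> x = y"
      using e W y by (auto simp: fin_epi_def)
    have "(c' \<cdot> s) \<cdot> y = c' \<cdot> h \<cdot> x"
      using arr_assoc[OF y s(1) T'3(3)] s(2)[OF W x(1)] x(2) by simp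
    also have "\<dots> = (c' \<cdot> h) \<cdot> x"
      using arr_assoc[OF x(1) ha T'3(3)] by simp
    finally show ?thesis
      using c'h x(2) by simp
  qed
  then obtain r where r: "arr S r (Sus S X) (Sus S X)" "(c' \<cdot> s) \<cdot> r = Id S (Sus S X)"
    using split_epi_of_fin_id[OF arr_comp[OF s(1) T'3(3)]] by blast
  have sr: "arr S (s \<cdot> r) (Sus S X) W'"
    using r s arr_comp by blast
  note Sgf = sus_arr[OF gf]
  have "SusMap S (g \<cdot> f) \<cdot> (c' \<cdot> (s \<cdot> r)) = Zero S (Sus S X) (Sus S Z)"
    using arr_assoc[OF sr T'3(3) Sgf] triangle_comp3[OF T'] comp_zero_left[OF sr arr_Ob(2)[OF Sgf]] by simp
  moreover have "c' \<cdot> (s \<cdot> r) = Id S (Sus S X)"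
    using arr_assoc[OF r(1) s(1) T'3(3)] r(2) by simp
  ultimately have "SusMap S (g \<cdot> f) = Zero S (Sus S X) (Sus S Z)"
    using arr_id_right[OF Sgf] by simp
  then show ?thesis
    by (rule sus_eq_zero[OF gf])
qed

text \<open>\<open>f\<close> vanishes on the projective cover \<open>P\<close>, so it factors
  through X_1 as f' u, and the special case applies to \<open>u\<close> followed by the phantom g
  f'.\<close>

theorem phantom_comp_phantom:
  assumes f: "phantom f X Y" and g: "phantom g Y Z"
  shows "g \<cdot> f = Zero S X Z"
proof -
  have fa: "arr S f X Y" and ga: "arr S g Y Z" using f g by (auto simp: phantom_def)
  obtain P X1 p u q where T: "exact_triangle S P X X1 p u q" and P: "proj P" and u: "phantom u X X1"
    using ex_triangle[OF arr_Ob(1)[OF fa]] by blast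
  have "f \<cdot> p = Zero S P Y"
    using P phantom_comp_right[OF f triangle_arr(1)[OF T]] by (simp add: proj_def)
  then obtain f' where f': "arr S f' X1 Y" "f' \<cdot> u = f"
    using triangle_extend1[OF T fa] by blast
  have "(g \<cdot> f') \<cdot> u = Zero S X Z"
    by (rule phantom_comp_resolution[OF T u phantom_comp_right[OF g f'(1)]])
  then show ?thesis
    using arr_assoc[OF triangle_arr(2)[OF T] f'(1) ga] f' by simp
qed

text \<open>On finite objects \<open>m\<close> below factors through \<open>\<Sigma>p\<close>; correcting \<open>m\<close> by the map that represents
  the factorization leaves a phantom map out of a projective object.\<close>

theorem phantom_from_resolution:
  assumes T: "exact_triangle S P X X1 p f q" and P: "proj P" and f: "phantom f X X1"
    and g: "phantom g X1 Z"
  shows "g = Zero S X1 Z"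
proof -
  note T3 = triangle_arr[OF T]
  have ga: "arr S g X1 Z" using g by (simp add: phantom_def)
  \<comment> \<open>g f = 0 by the preceding theorem, so \<open>g\<close> factors through
    \<open>q\<close>; this moves the problem to the projective object \<Sigma>P.\<close>
  obtain m where m: "arr S m (Sus S P) Z" "m \<cdot> q = g"
    using triangle_extend2[OF T ga phantom_comp_phantom[OF f g]] by blast
  note Sp = sus_arr[OF T3(1)]
  note e = fin_epi_rotated[OF T f]
  have ker: "m \<cdot> x = Zero S W Z" if W: "W \<in> Fin" and x: "arr S x W (Sus S P)"
    and 0: "neg (Sus S P) (Sus S X) (SusMap S p) \<cdot> x = Zero S W (Sus S X)" for W x
  proof -
    obtain y where y: "arr S y W X1" "q \<cdot> y = x"
      using triangle_lift2[OF triangle_rot[OF T] x 0] by blast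
    have "m \<cdot> x = g \<cdot> y"
      using arr_assoc[OF y(1) T3(3) m(1)] m(2) y(2) by simp
    then show ?thesis
      using g W y by (simp add: phantom_def)
  qed
  obtain t where t: "arr S t (Sus S X) Z"
    "\<And>W x. W \<in> Fin \<Longrightarrow> arr S x W (Sus S P) \<Longrightarrow>
      t \<cdot> neg (Sus S P) (Sus S X) (SusMap S p) \<cdot> x = m \<cdot> x"
    using brown_factor[OF e m(1) ker] by blast
  let ?t = "t \<cdot> neg (Sus S P) (Sus S X) (SusMap S p)"
  have ta: "arr S ?t (Sus S P) Z"
    using arr_comp[OF arr_neg[OF Sp] t(1)] .
  have "phantom (Add S m (neg (Sus S P) Z ?t)) (Sus S P) Z"
    using phantom_diff[OF m(1) ta] t(2) arr_assoc[OF _ arr_neg[OF Sp] t(1)] by simp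
  then have "Add S m (neg (Sus S P) Z ?t) = Zero S (Sus S P) Z"
    using proj_sus[OF P] by (simp add: proj_def)
  then have "m = ?t"
    by (rule eq_if_diff_zero[OF m(1) ta])
  then have "g = t \<cdot> (neg (Sus S P) (Sus S X) (SusMap S p) \<cdot> q)"
    using m(2) arr_assoc[OF T3(3) arr_neg[OF Sp] t(1)] by simp
  \<comment> \<open>-\<Sigma>p and \<open>q\<close> are consecutive maps of the rotated triangle, so
    their composite is zero.\<close>
  then show ?thesis
    using triangle_comp2[OF triangle_rot[OF T]] comp_zero_right[OF t(1) arr_Ob(1)[OF ga]] by simp
qed

end

section \<open>Collapse of the Adams spectral sequence\<close>

context triangulated_category
begin

text \<open>Stated for abstract \<open>F\<close> and \<open>m\<close> so that the suspension and its
  inverse, the two cases of \<open>sus_pow\<close>, share one induction.\<close>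

lemma funpow_zero_functor:
  assumes "\<And>X. X \<in> Ob S \<Longrightarrow> F X \<in> Ob S"
    and "\<And>f X Y. arr S f X Y \<Longrightarrow> arr S (m f) (F X) (F Y)"
    and "\<And>X Y. X \<in> Ob S \<Longrightarrow> Y \<in> Ob S \<Longrightarrow> m (Zero S X Y) = Zero S (F X) (F Y)"
  shows "X \<in> Ob S \<Longrightarrow> (F ^^ k) X \<in> Ob S"
    and "arr S f X Y \<Longrightarrow> arr S ((m ^^ k) f) ((F ^^ k) X) ((F ^^ k) Y)"
    and "X \<in> Ob S \<Longrightarrow> Y \<in> Ob S \<Longrightarrow> (m ^^ k) (Zero S X Y) = Zero S ((F ^^ k) X) ((F ^^ k) Y)"
proof -
  have 1: "X \<in> Ob S \<Longrightarrow> (F ^^ k) X \<in> Ob S" for X k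
    by (induction k) (auto simp: assms(1))
  then show "X \<in> Ob S \<Longrightarrow> (F ^^ k) X \<in> Ob S" .
  show "arr S f X Y \<Longrightarrow> arr S ((m ^^ k) f) ((F ^^ k) X) ((F ^^ k) Y)"
    by (induction k) (auto simp: assms(2))
  show "X \<in> Ob S \<Longrightarrow> Y \<in> Ob S \<Longrightarrow> (m ^^ k) (Zero S X Y) = Zero S ((F ^^ k) X) ((F ^^ k) Y)"
    by (induction k) (auto simp: assms(3) 1)
qed

text \<open>\<open>sus_map_pow\<close> inverts the suspension on all arrows at once. Injectivity
  across different Hom sets rests on their disjointness and on injectivity of \<open>Sus\<close> on
  objects.\<close>

lemma sus_map_inj_arrows: "inj_on (SusMap S) (arrows S)"
proof (rule inj_onI)
  fix f g assume f: "f \<in> arrows S" and g: "g \<in> arrows S" and eq: "SusMap S f = SusMap S g"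
  obtain X Y X' Y' where fa: "arr S f X Y" and ga: "arr S g X' Y'"
    using f g by (auto simp: arrows_def arr_def)
  have "X = X'" "Y = Y'"
    using arr_unique[OF sus_arr[OF fa], of "Sus S X'" "Sus S Y'"] sus_arr[OF ga] eq
      sus_Ob_inj fa ga by (auto simp: arr_def)
  then show "f = g"
    using sus_arr_inj[OF fa] ga eq by simp
qed

lemma desus_functor:
  fixes F m
  defines "F \<equiv> inv_into (Ob S) (Sus S)" and "m \<equiv> inv_into (arrows S) (SusMap S)"
  shows "X \<in> Ob S \<Longrightarrow> F X \<in> Ob S"
    and "arr S f X Y \<Longrightarrow> arr S (m f) (F X) (F Y)"
    and "X \<in> Ob S \<Longrightarrow> Y \<in> Ob S \<Longrightarrow> m (Zero S X Y) = Zero S (F X) (F Y)"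
proof -
  have F: "F X \<in> Ob S" "Sus S (F X) = X" if "X \<in> Ob S" for X
    using that sus_bij by (auto simp: F_def bij_betw_def inv_into_into f_inv_into_f)
  have m: "m (SusMap S f) = f" if "arr S f X Y" for f X Y
    using that sus_map_inj_arrows unfolding m_def
    by (intro inv_into_f_f) (auto simp: arrows_def arr_def)
  show "X \<in> Ob S \<Longrightarrow> F X \<in> Ob S"
    by (rule F)
  show "arr S (m f) (F X) (F Y)" if f: "arr S f X Y"
  proof -
    have XY: "X \<in> Ob S" "Y \<in> Ob S" using f by (auto simp: arr_def)
    obtain g where g: "arr S g (F X) (F Y)" "f = SusMap S g"
      using sus_arr_ex[of f "F X" "F Y"] f F XY by auto
    then show ?thesis using m by simp
  qed
  show "m (Zero S X Y) = Zero S (F X) (F Y)" if "X \<in> Ob S" "Y \<in> Ob S"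
    using m[OF arr_zero[OF F(1)[OF that(1)] F(1)[OF that(2)]]] sus_zero[of "F X" "F Y"] F that by simp
qed

lemma sus_pow_Ob: "X \<in> Ob S \<Longrightarrow> sus_pow S n X \<in> Ob S"
  unfolding sus_pow_def
  using funpow_zero_functor(1)[of "Sus S" "SusMap S", OF sus_Ob sus_arr sus_zero]
    funpow_zero_functor(1)[of "inv_into (Ob S) (Sus S)" "inv_into (arrows S) (SusMap S)",
      OF desus_functor] by auto

lemma sus_map_pow_arr: "arr S f X Y \<Longrightarrow> arr S (sus_map_pow S n f) (sus_pow S n X) (sus_pow S n Y)"
  unfolding sus_pow_def sus_map_pow_def
  using funpow_zero_functor(2)[of "Sus S" "SusMap S", OF sus_Ob sus_arr sus_zero]
    funpow_zero_functor(2)[of "inv_into (Ob S) (Sus S)" "inv_into (arrows S) (SusMap S)",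
      OF desus_functor] by auto

lemma sus_map_pow_zero:
  "X \<in> Ob S \<Longrightarrow> Y \<in> Ob S \<Longrightarrow>
    sus_map_pow S n (Zero S X Y) = Zero S (sus_pow S n X) (sus_pow S n Y)"
  unfolding sus_pow_def sus_map_pow_def
  using funpow_zero_functor(3)[of "Sus S" "SusMap S", OF sus_Ob sus_arr sus_zero]
    funpow_zero_functor(3)[of "inv_into (Ob S) (Sus S)" "inv_into (arrows S) (SusMap S)",
      OF desus_functor] by auto

end

context brown_phantom_category
begin

lemma adams_resolution_triangle:
  assumes "adams_resolution S (phantom_projectives small S) (phantom_maps small S) X A"
  shows "exact_triangle S (ResP A n) (ResX A n) (ResX A (Suc n)) (resp A n) (resi A n) (resq A n)"
    and "proj (ResP A n)" and "phantom (resi A n) (ResX A n) (ResX A (Suc n))"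
proof -
  show T: "exact_triangle S (ResP A n) (ResX A n) (ResX A (Suc n)) (resp A n) (resi A n) (resq A n)"
    using assms by (simp add: adams_resolution_def)
  show "proj (ResP A n)"
    using assms proj_iff by (simp add: adams_resolution_def)
  show "phantom (resi A n) (ResX A n) (ResX A (Suc n))"
    using assms phantom_maps_iff[OF triangle_arr(2)[OF T]] by (simp add: adams_resolution_def)
qed

text \<open>X_(n+1) is itself the cofibre of a phantom cover, so
  \<open>phantom_from_resolution\<close> applies. The map \<open>resi A 0\<close> is different: it
  may be a non-zero phantom.\<close>

lemma adams_resolution_zero:
  assumes A: "adams_resolution S (phantom_projectives small S) (phantom_maps small S) X A"
  shows "resi A (Suc n) = Zero S (ResX A (Suc n)) (ResX A (Suc (Suc n)))"
  using phantom_from_resolution[OF adams_resolution_triangle[OF A] adams_resolution_triangle(3)[OF A]] .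

text \<open>The maps i vanish from filtration 1 on. For r \<ge> 2 a differential d_r takes values
  represented by j y with y in D^(s+r), and all of j(D^(s+r)) consists of boundaries, since i^(r-1)
  kills D^(s+r).\<close>

theorem adams_collapse:
  assumes Y: "Y \<in> Ob S"
    and A: "adams_resolution S (phantom_projectives small S) (phantom_maps small S) X A"
  shows "ss_collapses_at (adams_couple S A Y) 2"
  unfolding ss_collapses_at_def
proof (intro allI impI ballI)
  fix r s n K
  let ?Q = "adams_couple S A Y"
  assume r: "2 \<le> (r::nat)" and K: "K \<in> carrier (ss_term ?Q r s n)"
  obtain r' where r': "r - 1 = Suc r'" "r = Suc (Suc r')"
    using r by (metis add_2_eq_Suc' diff_Suc_1 le_Suc_ex add.commute)
  note tri = adams_resolution_triangle[OF A]
  let ?X = "\<lambda>s n. sus_pow S n (ResX A s)" and ?P = "\<lambda>s n. sus_pow S n (ResP A s)"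
  have X: "?X s n \<in> Ob S" and P: "?P s n \<in> Ob S" for s n
    using triangle_arr[OF tri(1)[of s]] by (auto simp: arr_def intro: sus_pow_Ob)
  have ia: "arr S (sus_map_pow S n (resi A s)) (?X s n) (?X (Suc s) n)"
    and pa: "arr S (sus_map_pow S n (resp A s)) (?P s n) (?X s n)" for s n
    using sus_map_pow_arr triangle_arr[OF tri(1)] by blast+
  have I1: "cplI_pow ?Q k s n (Zero S (?X (s + k) n) Y) = Zero S (?X s n) Y" for k s n
    by (induction k) (simp_all add: adams_couple_def comp_zero_left[OF ia Y])
  \<comment> \<open>The map applied first belongs to filtration Suc s + k, which is positive, so
    \<open>resi\<close> is already zero there; \<open>I1\<close> carries this zero down.\<close>
  have I0: "cplI_pow ?Q (Suc k) (Suc s) n y = Zero S (?X (Suc s) n) Y"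
    if "y \<in> Hom S (?X (Suc s + Suc k) n) Y" for k s n y
  proof -
    have y: "arr S y (?X (Suc s + Suc k) n) Y"
      using that X Y by (simp add: arr_def)
    have "cplI ?Q (Suc s + k) n y = Zero S (?X (Suc s + k) n) Y"
      using adams_resolution_zero[OF A, of "s + k"] sus_map_pow_zero comp_zero_right[OF y X]
        triangle_arr[OF tri(1)[of "Suc (s + k)"]]
      by (simp add: adams_couple_def arr_def)
    then show ?thesis
      using I1[of k "Suc s" n] by simp
  qed
  define H where "H = ss_boundaries ?Q r (s + r) (n - 1)"
  have J: "cplJ ?Q s n \<in> hom (cplD ?Q s n) (cplE ?Q s n)" for s n
    using pre_hom[OF pa Y] by (simp add: adams_couple_def)
  have gD: "group (cplD ?Q s n)" and gE: "group (cplE ?Q s n)" for s n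
    using hom_group_group[OF X Y] hom_group_group[OF P Y] by (simp_all add: adams_couple_def)
  \<comment> \<open>Here min (s + r) (r - 1) = r - 1: the iterate starts in filtration s + r and
    stops in s + 1 \<ge> 1, so it never meets the possibly non-zero \<open>resi A 0\<close>.\<close>
  have H: "H = cplJ ?Q (s + r) (n - 1) ` carrier (cplD ?Q (s + r) (n - 1))"
    using I0[where s=s and k=r' and n="n - 1"] r' unfolding H_def ss_boundaries_def Let_def kernel_def
    by (auto simp: min_def adams_couple_def)
  have subgrp: "subgroup H (cplE ?Q (s + r) (n - 1))"
    unfolding H
    using group_hom.img_is_subgroup[OF group_hom.intro[OF gD gE group_hom_axioms.intro[OF J]]] .
  have "cplJ ?Q (s + r) (n - 1) y \<in> H" if "y \<in> carrier (cplD ?Q (s + r) (n - 1))" for y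
    using that H by simp
  then have "H #>\<^bsub>cplE ?Q (s + r) (n - 1)\<^esub> cplJ ?Q (s + r) (n - 1) y = H"
    if "y \<in> carrier (cplD ?Q (s + r) (n - 1))" for y
    using that subgroup.rcos_const[OF subgrp gE] by blast
  \<comment> \<open>\<open>ss_diff\<close> is a union, so besides the equality of its members the
    existence of one is needed; a cycle representing \<open>K\<close> supplies it.\<close>
  moreover have "\<exists>x\<in>K. \<exists>y\<in>carrier (cplD ?Q (s + r) (n - 1)).
      cplI_pow ?Q (r - 1) (s + 1) (n - 1) y = cplK ?Q s n x"
  proof -
    obtain x where x: "x \<in> ss_cycles ?Q r s n"
      and Kx: "K = ss_boundaries ?Q r s n #>\<^bsub>cplE ?Q s n\<lparr>carrier := ss_cycles ?Q r s n\<rparr>\<^esub> x"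
      using K by (auto simp: ss_term_def FactGroup_def RCOSETS_def)
    have "\<one>\<^bsub>cplE ?Q s n\<^esub> \<in> ss_boundaries ?Q r s n"
    proof -
      have "cplJ ?Q s n \<one>\<^bsub>cplD ?Q s n\<^esub> = \<one>\<^bsub>cplE ?Q s n\<^esub>"
        by (rule hom_one[OF J gD gE])
      moreover have "\<one>\<^bsub>cplD ?Q s n\<^esub> \<in> kernel (cplD ?Q s n) (cplD ?Q (s - t) n) (cplI_pow ?Q t (s - t) n)"
        if "t \<le> s" for t
        using I1[of t "s - t" n] that arr_Hom[OF arr_zero[OF X Y]]
        by (simp add: kernel_def adams_couple_def)
      ultimately show ?thesis
        unfolding ss_boundaries_def Let_def by (metis image_eqI min.cobounded1)
    qed
    then have "x \<in> K"
      unfolding Kx r_coset_def using x gE[of s n]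
      by (auto simp: ss_cycles_def intro!: bexI[of _ "\<one>\<^bsub>cplE ?Q s n\<^esub>"]
          monoid.l_one[symmetric] group.is_monoid)
    with x show ?thesis
      by (auto simp: ss_cycles_def image_iff) metis
  qed
  ultimately have "ss_diff ?Q r s n K = H"
    unfolding ss_diff_def H_def by blast
  then show "ss_diff ?Q r s n K = \<one>\<^bsub>ss_term ?Q r (s + r) (n - 1)\<^esub>"
    by (simp add: ss_term_def FactGroup_def H_def)
qed

end

section \<open>The bar complex of a category\<close>

text \<open>The linear extension of \<open>f\<close> to the free abelian group, in multiplicative
  notation.\<close>

definition ev :: "('g, 'z) monoid_scheme \<Rightarrow> ('x \<Rightarrow> 'g) \<Rightarrow> ('x \<Rightarrow>\<^sub>0 int) \<Rightarrow> 'g" where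
  "ev G f c = finprod G (\<lambda>x. f x [^]\<^bsub>G\<^esub> Poly_Mapping.lookup c x) (Poly_Mapping.keys c)"

context comm_group
begin

lemma ev_superset:
  assumes "finite A" "Poly_Mapping.keys c \<subseteq> A" "f \<in> A \<rightarrow> carrier G"
  shows "ev G f c = finprod G (\<lambda>x. f x [^] Poly_Mapping.lookup c x) A"
  unfolding ev_def
proof (rule finprod_mono_neutral_cong_left)
  show "\<And>x. x \<in> A - Poly_Mapping.keys c \<Longrightarrow> f x [^] Poly_Mapping.lookup c x = \<one>"
    by (simp add: in_keys_iff)
qed (use assms in auto)

lemma ev_closed: "f \<in> Poly_Mapping.keys c \<rightarrow> carrier G \<Longrightarrow> ev G f c \<in> carrier G"
  unfolding ev_def by (rule finprod_closed) auto

lemma ev_0 [simp]: "ev G f 0 = \<one>"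
  by (simp add: ev_def)

lemma ev_of: "f x \<in> carrier G \<Longrightarrow> ev G f (frag_of x) = f x"
  by (simp add: ev_def)

lemma ev_add:
  assumes "f \<in> Poly_Mapping.keys c \<rightarrow> carrier G" "f \<in> Poly_Mapping.keys d \<rightarrow> carrier G"
  shows "ev G f (c + d) = ev G f c \<otimes> ev G f d"
proof -
  let ?A = "Poly_Mapping.keys c \<union> Poly_Mapping.keys d"
  have A: "finite ?A" "f \<in> ?A \<rightarrow> carrier G" using assms by auto
  have "ev G f (c + d) = finprod G (\<lambda>x. f x [^] Poly_Mapping.lookup (c + d) x) ?A"
    using ev_superset[OF A(1) keys_add A(2)] .
  also have "\<dots> = finprod G (\<lambda>x. f x [^] Poly_Mapping.lookup c x \<otimes> f x [^] Poly_Mapping.lookup d x) ?A"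
    using A by (intro finprod_cong') (auto simp: Poly_Mapping.lookup_add Pi_iff int_pow_mult)
  also have "\<dots> = ev G f c \<otimes> ev G f d"
    using A ev_superset[OF A(1) _ A(2), of c] ev_superset[OF A(1) _ A(2), of d]
    by (subst finprod_multf) auto
  finally show ?thesis .
qed

lemma ev_minus:
  assumes "f \<in> Poly_Mapping.keys c \<rightarrow> carrier G"
  shows "ev G f (- c) = inv (ev G f c)"
proof (rule inv_equality[symmetric])
  show "ev G f (- c) \<otimes> ev G f c = \<one>"
    using ev_add[of f "- c" c] assms by simp
  show "ev G f (- c) \<in> carrier G"
    using ev_closed[of f "- c"] assms by simp
qed (rule ev_closed[OF assms])

lemma ev_diff:
  assumes "f \<in> Poly_Mapping.keys c \<rightarrow> carrier G" "f \<in> Poly_Mapping.keys d \<rightarrow> carrier G"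
  shows "ev G f (c - d) = ev G f c \<otimes> inv (ev G f d)"
  using ev_add[of f c "- d"] assms ev_minus[of f d] by simp

lemma ev_cong:
  assumes "f \<in> Poly_Mapping.keys c \<rightarrow> carrier G" "\<And>x. x \<in> Poly_Mapping.keys c \<Longrightarrow> f x = g x"
  shows "ev G f c = ev G g c"
  unfolding ev_def using assms by (intro finprod_cong') (auto simp: Pi_iff)

lemma ev_mult:
  assumes "f \<in> Poly_Mapping.keys c \<rightarrow> carrier G" "g \<in> Poly_Mapping.keys c \<rightarrow> carrier G"
  shows "ev G (\<lambda>x. f x \<otimes> g x) c = ev G f c \<otimes> ev G g c"
proof -
  have "ev G (\<lambda>x. f x \<otimes> g x) c
      = finprod G (\<lambda>x. f x [^] Poly_Mapping.lookup c x \<otimes> g x [^] Poly_Mapping.lookup c x) (Poly_Mapping.keys c)"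
    unfolding ev_def using assms by (intro finprod_cong') (auto simp: int_pow_distrib Pi_iff)
  also have "\<dots> = ev G f c \<otimes> ev G g c"
    unfolding ev_def using assms by (intro finprod_multf) auto
  finally show ?thesis .
qed

lemma ev_one: "ev G (\<lambda>x. \<one>) c = \<one>"
  unfolding ev_def by (simp add: int_pow_one)

lemma ev_frag_extend:
  assumes "\<And>x. x \<in> Poly_Mapping.keys c \<Longrightarrow> f \<in> Poly_Mapping.keys (g x) \<rightarrow> carrier G"
  shows "ev G f (frag_extend g c) = ev G (\<lambda>x. ev G f (g x)) c"
proof -
  let ?S = "{x. f \<in> Poly_Mapping.keys (g x) \<rightarrow> carrier G}"
  have f: "f \<in> Poly_Mapping.keys (frag_extend g d) \<rightarrow> carrier G" if "Poly_Mapping.keys d \<subseteq> ?S" for d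
  proof
    fix x assume "x \<in> Poly_Mapping.keys (frag_extend g d)"
    then obtain y where "y \<in> Poly_Mapping.keys d" "x \<in> Poly_Mapping.keys (g y)"
      using keys_frag_extend by fastforce
    then show "f x \<in> carrier G" using that by blast
  qed
  have e: "(\<lambda>x. ev G f (g x)) \<in> Poly_Mapping.keys d \<rightarrow> carrier G" if "Poly_Mapping.keys d \<subseteq> ?S" for d
    by (intro Pi_I ev_closed) (use that in blast)
  have "Poly_Mapping.keys c \<subseteq> ?S" using assms by blast
  then show ?thesis
  proof (rule free_Abelian_group_induct)
    fix x y assume xy: "Poly_Mapping.keys x \<subseteq> ?S" "Poly_Mapping.keys y \<subseteq> ?S"
      and "ev G f (frag_extend g x) = ev G (\<lambda>x. ev G f (g x)) x"
      and "ev G f (frag_extend g y) = ev G (\<lambda>x. ev G f (g x)) y"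
    then show "ev G f (frag_extend g (x - y)) = ev G (\<lambda>x. ev G f (g x)) (x - y)"
      using ev_diff[OF f[OF xy(1)] f[OF xy(2)]] ev_diff[OF e[OF xy(1)] e[OF xy(2)]]
      by (simp add: frag_extend_diff)
  next
    fix a assume "a \<in> ?S"
    then show "ev G f (frag_extend g (frag_of a)) = ev G (\<lambda>x. ev G f (g x)) (frag_of a)"
      using ev_of[of "\<lambda>x. ev G f (g x)" a] ev_closed[of f "g a"] by simp
  qed simp
qed

lemma hom_ev:
  assumes H: "comm_group H" and h: "h \<in> hom G H" and f: "f \<in> Poly_Mapping.keys c \<rightarrow> carrier G"
  shows "h (ev G f c) = ev H (\<lambda>x. h (f x)) c"
proof -
  interpret H: comm_group H by fact
  interpret group_hom G H h
    using h by unfold_locales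
  have "(\<lambda>x. f x [^] Poly_Mapping.lookup c x) \<in> Poly_Mapping.keys c \<rightarrow> carrier G"
    using f by auto
  then have "h (ev G f c) = finprod H (\<lambda>x. h (f x [^] Poly_Mapping.lookup c x)) (Poly_Mapping.keys c)"
    unfolding ev_def by (rule hom_finprod[OF comm_group_axioms H h])
  also have "\<dots> = ev H (\<lambda>x. h (f x)) c"
    unfolding ev_def using f by (intro H.finprod_cong') (auto simp: Pi_iff hom_int_pow)
  finally show ?thesis .
qed

end

section \<open>Chains of composable arrows and their boundary\<close>

primrec path :: "('p, 'b, 'z) category_data_scheme \<Rightarrow> 'p \<Rightarrow> 'b list \<Rightarrow> 'p \<Rightarrow> bool" where
  "path C \<alpha> [] \<gamma> \<longleftrightarrow> \<alpha> \<in> Ob C \<and> \<gamma> = \<alpha>"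
| "path C \<alpha> (a # l) \<gamma> \<longleftrightarrow> (\<exists>\<beta>. arr C a \<alpha> \<beta> \<and> path C \<beta> l \<gamma>)"

text \<open>The start is kept beside the list because a chain of length 0 has no arrow from which to
  recover it.\<close>

definition chain :: "('p, 'b, 'z) category_data_scheme \<Rightarrow> nat \<Rightarrow> 'p \<Rightarrow> 'b list \<Rightarrow> bool" where
  "chain C n \<alpha> l \<longleftrightarrow> length l = n \<and> (\<exists>\<gamma>. path C \<alpha> l \<gamma>)"

definition tgt :: "('p, 'b, 'z) category_data_scheme \<Rightarrow> 'b \<Rightarrow> 'p" where
  "tgt C a = (THE \<beta>. \<exists>\<alpha>. arr C a \<alpha> \<beta>)"

text \<open>The faces of a chain \<open>\<alpha>\<^sub>0 \<rightarrow> \<dots> \<rightarrow> \<alpha>\<^sub>n\<close> that start at \<open>\<alpha>\<^sub>0\<close>. The remaining face, which drops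
  \<open>\<alpha>\<^sub>0\<close>, is treated separately because coefficients are attached to the initial object.\<close>

fun bd :: "('p, 'b, 'z) category_data_scheme \<Rightarrow> 'b list \<Rightarrow> 'b list \<Rightarrow>\<^sub>0 int" where
  "bd C [] = 0"
| "bd C [a] = frag_of []"
| "bd C (a # b # l) = frag_of ((b \<cdot>\<^bsub>C\<^esub> a) # l) - frag_extend (\<lambda>l'. frag_of (a # l')) (bd C (b # l))"

abbreviation "consf a \<equiv> frag_extend (\<lambda>l. frag_of (a # l))"
abbreviation "bds C \<equiv> frag_extend (bd C)"

text \<open>The contravariant action of an arrow on chains that start at its target. Only the first
  arrow changes, so it is meant for chains of positive length.\<close>

definition precomp :: "('p, 'b, 'z) category_data_scheme \<Rightarrow> 'b \<Rightarrow> ('b list \<Rightarrow>\<^sub>0 int) \<Rightarrow> 'b list \<Rightarrow>\<^sub>0 int" where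
  "precomp C a = frag_extend (\<lambda>l. frag_of ((hd l \<cdot>\<^bsub>C\<^esub> a) # tl l))"

definition cochain :: "('p, 'b, 'z) category_data_scheme \<Rightarrow> ('p, 'b, 'g) ab_diagram \<Rightarrow> nat \<Rightarrow>
   ('p \<Rightarrow> 'b list \<Rightarrow> 'g) \<Rightarrow> bool" where
  "cochain C F n \<phi> \<longleftrightarrow> (\<forall>\<alpha> l. chain C n \<alpha> l \<longrightarrow> \<phi> \<alpha> l \<in> carrier (Grp F \<alpha>))"

text \<open>The alternating sum over all faces, written multiplicatively. The face without the
  initial object carries \<open>Map F\<close>; the others have their relative signs in
  \<open>bd\<close> and their common sign from the inverse.\<close>

definition cobd :: "('p, 'b, 'z) category_data_scheme \<Rightarrow> ('p, 'b, 'g) ab_diagram \<Rightarrow>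
   ('p \<Rightarrow> 'b list \<Rightarrow> 'g) \<Rightarrow> 'p \<Rightarrow> 'b list \<Rightarrow> 'g" where
  "cobd C F \<phi> \<alpha> l = Map F (hd l) (\<phi> (tgt C (hd l)) (tl l)) \<otimes>\<^bsub>Grp F \<alpha>\<^esub> inv\<^bsub>Grp F \<alpha>\<^esub> ev (Grp F \<alpha>) (\<phi> \<alpha>) (bd C l)"

lemma path_Ob: "path C \<alpha> l \<gamma> \<Longrightarrow> \<alpha> \<in> Ob C" "path C \<alpha> l \<gamma> \<Longrightarrow> \<gamma> \<in> Ob C"
  by (induction l arbitrary: \<alpha>) (auto simp: arr_def)

lemma chain_Ob: "chain C n \<alpha> l \<Longrightarrow> \<alpha> \<in> Ob C"
  by (auto simp: chain_def path_Ob)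

lemma chain_0: "chain C 0 \<alpha> l \<longleftrightarrow> \<alpha> \<in> Ob C \<and> l = []"
  by (auto simp: chain_def)

lemma chain_Suc: "chain C (Suc n) \<alpha> l \<longleftrightarrow> (\<exists>a \<beta> l'. l = a # l' \<and> arr C a \<alpha> \<beta> \<and> chain C n \<beta> l')"
  by (cases l) (auto simp: chain_def)

lemma chain_Cons: "chain C (Suc n) \<alpha> (a # l) \<longleftrightarrow> (\<exists>\<beta>. arr C a \<alpha> \<beta> \<and> chain C n \<beta> l)"
  by (auto simp: chain_Suc)

lemma keys_frag_diff: "x \<in> Poly_Mapping.keys (c - d) \<Longrightarrow> x \<in> Poly_Mapping.keys c \<or> x \<in> Poly_Mapping.keys d"
  using keys_diff by fastforce

lemma keys_consf: "l \<in> Poly_Mapping.keys (consf a c) \<Longrightarrow> \<exists>l'\<in>Poly_Mapping.keys c. l = a # l'"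
  using keys_frag_extend by fastforce

lemma keys_precomp:
  "l \<in> Poly_Mapping.keys (precomp C a c) \<Longrightarrow> \<exists>l'\<in>Poly_Mapping.keys c. l = (hd l' \<cdot>\<^bsub>C\<^esub> a) # tl l'"
  unfolding precomp_def using keys_frag_extend by fastforce

context category
begin

lemma tgt_eq: "arr C a \<alpha> \<beta> \<Longrightarrow> tgt C a = \<beta>"
  unfolding tgt_def using arr_unique by blast

lemma cobd_Cons:
  "arr C a \<alpha> \<beta> \<Longrightarrow> cobd C F \<phi> \<alpha> (a # l) =
    Map F a (\<phi> \<beta> l) \<otimes>\<^bsub>Grp F \<alpha>\<^esub> inv\<^bsub>Grp F \<alpha>\<^esub> ev (Grp F \<alpha>) (\<phi> \<alpha>) (bd C (a # l))"
  by (simp add: cobd_def tgt_eq)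

lemma keys_bd:
  "chain C (Suc n) \<alpha> l \<Longrightarrow> l' \<in> Poly_Mapping.keys (bd C l) \<Longrightarrow> chain C n \<alpha> l'"
proof (induction l arbitrary: n \<alpha> l')
  case (Cons a t)
  show ?case
  proof (cases t)
    case Nil
    then show ?thesis using Cons.prems by (auto simp: chain_def arr_def)
  next
    case (Cons b l)
    obtain m where n: "n = Suc m" using Cons Cons.prems(1) by (cases n) (auto simp: chain_def)
    obtain \<beta> \<gamma> where ab: "arr C a \<alpha> \<beta>" "arr C b \<beta> \<gamma>" "chain C m \<gamma> l"
      using Cons.prems(1) n Cons by (auto simp: chain_Cons)
    have "l' = (b \<cdot> a) # l \<or> (\<exists>l''\<in>Poly_Mapping.keys (bd C t). l' = a # l'')"
      using Cons.prems(2) keys_consf Cons by (fastforce dest: keys_frag_diff)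
    moreover have "chain C m \<beta> l''" if "l'' \<in> Poly_Mapping.keys (bd C t)" for l''
      using Cons.IH[OF _ that] ab Cons by (auto simp: chain_Cons)
    ultimately show ?thesis
      using ab n arr_comp[OF ab(1,2)] by (auto simp: chain_Cons) blast+
  qed
qed simp

lemma length_keys_bd: "l' \<in> Poly_Mapping.keys (bd C l) \<Longrightarrow> length l = Suc (length l')"
proof (induction l arbitrary: l')
  case (Cons a t)
  show ?case
  proof (cases t)
    case Nil
    then show ?thesis using Cons.prems by auto
  next
    case (Cons b l)
    then show ?thesis
      using Cons.prems Cons.IH keys_consf by (fastforce dest: keys_frag_diff)
  qed
qed simp

text \<open>This is the recursion of \<open>bd\<close>, made linear. The term \<open>precomp\<close>
  collects the faces that compose \<open>a\<close> with the next arrow, which is why empty lists are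
  excluded.\<close>

lemma bds_consf:
  assumes "\<And>l. l \<in> Poly_Mapping.keys c \<Longrightarrow> l \<noteq> []"
  shows "bds C (consf a c) = precomp C a c - consf a (bds C c)"
proof -
  have "Poly_Mapping.keys c \<subseteq> {l. l \<noteq> []}" using assms by blast
  then show ?thesis
  proof (rule free_Abelian_group_induct)
    fix l :: "'a list" assume "l \<in> {l. l \<noteq> []}"
    then show "bds C (consf a (frag_of l)) = precomp C a (frag_of l) - consf a (bds C (frag_of l))"
      by (cases l) (auto simp: precomp_def)
  qed (simp_all add: frag_extend_diff precomp_def)
qed

lemma precomp_consf: "precomp C a (consf b c) = consf (b \<cdot> a) c"
  by (rule free_Abelian_group_induct[OF subset_UNIV, of _ c])
    (simp_all add: frag_extend_diff precomp_def)

text \<open>A face either composes the first two arrows or leaves the first one in front, so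
  associativity suffices. For a single arrow the face would be the empty list, on which
  \<open>precomp\<close> has no meaning.\<close>

lemma precomp_bd:
  assumes "arr C a \<alpha> \<beta>" "chain C (Suc n) \<beta> (b # d # l)"
  shows "precomp C a (bd C (b # d # l)) = bd C ((b \<cdot> a) # d # l)"
proof -
  obtain \<gamma> \<delta> where "arr C b \<beta> \<gamma>" "arr C d \<gamma> \<delta>"
    using assms(2) by (auto simp: chain_def)
  then have "(d \<cdot> b) \<cdot> a = d \<cdot> b \<cdot> a"
    using assms(1) arr_assoc by blast
  then show ?thesis
    using precomp_consf[of a b] by (simp add: precomp_def frag_extend_diff)
qed

text \<open>By \<open>bds_consf\<close> and the induction hypothesis, the boundary of the faces that
  keep a1 in front equals the boundary of the chain with a1 and a2 composed; the two occur with
  opposite signs.\<close>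

lemma bds_bd: "chain C (Suc (Suc n)) \<alpha> l \<Longrightarrow> bds C (bd C l) = 0"
proof (induction n arbitrary: \<alpha> l)
  case 0
  then show ?case
    by (auto simp: chain_Suc chain_0 frag_extend_diff)
next
  case (Suc n)
  then obtain a1 a2 a3 k \<beta> \<gamma> \<delta> where l: "l = a1 # a2 # a3 # k" and
    a: "arr C a1 \<alpha> \<beta>" "arr C a2 \<beta> \<gamma>" "arr C a3 \<gamma> \<delta>" "chain C n \<delta> k"
    by (auto simp: chain_Suc)
  then have c: "chain C (Suc (Suc n)) \<beta> (a2 # a3 # k)"
    by (auto simp: chain_Cons)
  have "bds C (consf a1 (bd C (a2 # a3 # k)))
      = precomp C a1 (bd C (a2 # a3 # k)) - consf a1 (bds C (bd C (a2 # a3 # k)))"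
    by (rule bds_consf) (use length_keys_bd in fastforce)
  also have "\<dots> = bd C ((a2 \<cdot> a1) # a3 # k)"
    using Suc.IH[OF c] precomp_bd[OF a(1) c] by simp
  finally show ?case
    by (simp add: l frag_extend_diff)
qed

text \<open>In lowest degree \<open>bds\<close> is the augmentation: every one-arrow chain goes to
  the empty list, with or without precomposition.\<close>

lemma bds_precomp:
  assumes "arr C a \<alpha> \<beta>" "\<And>l. l \<in> Poly_Mapping.keys c \<Longrightarrow> chain C (Suc n) \<beta> l"
  shows "bds C (precomp C a c) = (if n = 0 then bds C c else precomp C a (bds C c))"
proof -
  have "Poly_Mapping.keys c \<subseteq> {l. chain C (Suc n) \<beta> l}" using assms(2) by blast
  then show ?thesis
  proof (rule free_Abelian_group_induct)
    fix l assume l: "l \<in> {l. chain C (Suc n) \<beta> l}"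
    show "bds C (precomp C a (frag_of l)) = (if n = 0 then bds C (frag_of l) else precomp C a (bds C (frag_of l)))"
    proof (cases n)
      case 0
      with l show ?thesis by (auto simp: precomp_def chain_Suc chain_0)
    next
      case (Suc m)
      then obtain b d k where lk: "l = b # d # k"
        using l by (auto simp: chain_Suc)
      then show ?thesis
        using precomp_bd[OF assms(1)] l Suc by (simp add: precomp_def)
    qed
  qed (simp_all add: frag_extend_diff precomp_def)
qed

lemma opposite_simps [simp]: "Ob (opposite C) = Ob C" "Hom (opposite C) X Y = Hom C Y X"
    "Id (opposite C) = Id C" "Comp (opposite C) = (\<lambda>g f. f \<cdot> g)"
  by (simp_all add: opposite_def)

section \<open>Cochains with values in a contravariant diagram\<close>

context
  fixes F :: "('o, 'a, 'g) ab_diagram"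
  assumes F: "is_ab_diagram (opposite C) F"
begin

lemma diagram_group: "\<alpha> \<in> Ob C \<Longrightarrow> comm_group (Grp F \<alpha>)"
  using F by (simp add: is_ab_diagram_def)

lemma diagram_hom: "arr C a \<alpha> \<beta> \<Longrightarrow> Map F a \<in> hom (Grp F \<beta>) (Grp F \<alpha>)"
  using F by (simp add: is_ab_diagram_def arr_def)

lemma diagram_comp:
  "arr C a \<alpha> \<beta> \<Longrightarrow> arr C b \<beta> \<gamma> \<Longrightarrow> x \<in> carrier (Grp F \<gamma>) \<Longrightarrow> Map F (b \<cdot> a) x = Map F a (Map F b x)"
  using F unfolding is_ab_diagram_def arr_def opposite_simps by blast

lemma diagram_id: "\<alpha> \<in> Ob C \<Longrightarrow> x \<in> carrier (Grp F \<alpha>) \<Longrightarrow> Map F (Id C \<alpha>) x = x"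
  using F by (simp add: is_ab_diagram_def)

lemma cochain_bd:
  "cochain C F n \<phi> \<Longrightarrow> chain C (Suc n) \<alpha> l \<Longrightarrow> \<phi> \<alpha> \<in> Poly_Mapping.keys (bd C l) \<rightarrow> carrier (Grp F \<alpha>)"
  using keys_bd by (auto simp: cochain_def)

lemma cobd_closed:
  assumes "cochain C F n \<phi>" "chain C (Suc n) \<alpha> l"
  shows "cobd C F \<phi> \<alpha> l \<in> carrier (Grp F \<alpha>)"
proof -
  obtain a \<beta> l' where l: "l = a # l'" and a: "arr C a \<alpha> \<beta>" and l': "chain C n \<beta> l'"
    using assms(2) by (auto simp: chain_Suc)
  interpret G: comm_group "Grp F \<alpha>"
    using diagram_group chain_Ob[OF assms(2)] .
  show ?thesis
    using hom_in_carrier[OF diagram_hom[OF a]] G.ev_closed[OF cochain_bd[OF assms]] l' assms(1)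
    by (simp add: l cobd_Cons[OF a] cochain_def)
qed

lemma cochain_cobd: "cochain C F n \<phi> \<Longrightarrow> cochain C F (Suc n) (cobd C F \<phi>)"
  using cobd_closed by (simp add: cochain_def)

lemma cobd_cong:
  assumes \<phi>: "cochain C F n \<phi>" and eq: "\<And>\<alpha> l. chain C n \<alpha> l \<Longrightarrow> \<phi> \<alpha> l = \<psi> \<alpha> l"
    and l: "chain C (Suc n) \<alpha> l"
  shows "cobd C F \<phi> \<alpha> l = cobd C F \<psi> \<alpha> l"
proof -
  interpret G: comm_group "Grp F \<alpha>"
    using diagram_group chain_Ob[OF l] .
  have "ev (Grp F \<alpha>) (\<phi> \<alpha>) (bd C l) = ev (Grp F \<alpha>) (\<psi> \<alpha>) (bd C l)"
    using keys_bd[OF l] eq by (intro G.ev_cong cochain_bd[OF \<phi> l]) auto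
  moreover obtain a \<beta> l' where "l = a # l'" "arr C a \<alpha> \<beta>" "chain C n \<beta> l'"
    using l by (auto simp: chain_Suc)
  ultimately show ?thesis
    using eq by (simp add: cobd_Cons)
qed

lemma cobd_mult:
  assumes \<phi>: "cochain C F n \<phi>" and \<psi>: "cochain C F n \<psi>" and l: "chain C (Suc n) \<alpha> l"
  shows "cobd C F (\<lambda>\<alpha> l. \<phi> \<alpha> l \<otimes>\<^bsub>Grp F \<alpha>\<^esub> \<psi> \<alpha> l) \<alpha> l = cobd C F \<phi> \<alpha> l \<otimes>\<^bsub>Grp F \<alpha>\<^esub> cobd C F \<psi> \<alpha> l"
proof -
  interpret G: comm_group "Grp F \<alpha>"
    using diagram_group chain_Ob[OF l] .
  obtain a \<beta> l' where l': "l = a # l'" "arr C a \<alpha> \<beta>" "chain C n \<beta> l'"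
    using l by (auto simp: chain_Suc)
  note h = diagram_hom[OF l'(2)]
  have c: "\<phi> \<beta> l' \<in> carrier (Grp F \<beta>)" "\<psi> \<beta> l' \<in> carrier (Grp F \<beta>)"
    using \<phi> \<psi> l' by (auto simp: cochain_def)
  show ?thesis
    using G.ev_mult[OF cochain_bd[OF \<phi> l] cochain_bd[OF \<psi> l]] hom_mult[OF h c]
      hom_in_carrier[OF h c(1)] hom_in_carrier[OF h c(2)]
      G.ev_closed[OF cochain_bd[OF \<phi> l]] G.ev_closed[OF cochain_bd[OF \<psi> l]]
    by (simp add: l' cobd_Cons[OF l'(2)] G.inv_mult G.m_ac)
qed

text \<open>Three terms occur: \<open>x\<close> transports the value at the tail along b a,
  \<open>y\<close> transports the linear part at \<beta> along a, and \<open>z\<close> is the linear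
  part on the composed chain. Each enters twice with opposite signs.\<close>

lemma cobd_cobd:
  assumes \<phi>: "cochain C F n \<phi>" and l: "chain C (Suc (Suc n)) \<alpha> l"
  shows "cobd C F (cobd C F \<phi>) \<alpha> l = \<one>\<^bsub>Grp F \<alpha>\<^esub>"
proof -
  obtain a b \<beta> \<gamma> k where lk: "l = a # b # k" and a: "arr C a \<alpha> \<beta>" and b: "arr C b \<beta> \<gamma>"
    and k: "chain C n \<gamma> k"
    using l by (auto simp: chain_Suc)
  interpret A: comm_group "Grp F \<alpha>" using diagram_group arr_Ob(1)[OF a] .
  interpret B: comm_group "Grp F \<beta>" using diagram_group arr_Ob(2)[OF a] .
  interpret AB: group_hom "Grp F \<beta>" "Grp F \<alpha>" "Map F a"
    using diagram_hom[OF a] by unfold_locales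
  note ba = arr_comp[OF a b]
  have bk: "chain C (Suc n) \<beta> (b # k)" and bak: "chain C (Suc n) \<alpha> ((b \<cdot> a) # k)"
    using a b k ba by (auto simp: chain_Cons)
  let ?c = "bd C (b # k)"
  have kc: "chain C n \<beta> l'" if "l' \<in> Poly_Mapping.keys ?c" for l'
    using keys_bd[OF bk that] .
  have kac: "chain C (Suc n) \<alpha> (a # l')" if "l' \<in> Poly_Mapping.keys ?c" for l'
    using kc[OF that] a by (auto simp: chain_Cons)
  define x where "x = Map F (b \<cdot> a) (\<phi> \<gamma> k)"
  define y where "y = Map F a (ev (Grp F \<beta>) (\<phi> \<beta>) ?c)"
  define z where "z = ev (Grp F \<alpha>) (\<phi> \<alpha>) (bd C ((b \<cdot> a) # k))"
  have \<phi>k: "\<phi> \<gamma> k \<in> carrier (Grp F \<gamma>)" using \<phi> k by (simp add: cochain_def)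
  have x: "x \<in> carrier (Grp F \<alpha>)"
    unfolding x_def using hom_in_carrier[OF diagram_hom[OF ba] \<phi>k] .
  have y: "y \<in> carrier (Grp F \<alpha>)"
    unfolding y_def using B.ev_closed[OF cochain_bd[OF \<phi> bk]] by simp
  have z: "z \<in> carrier (Grp F \<alpha>)"
    unfolding z_def using A.ev_closed[OF cochain_bd[OF \<phi> bak]] .
  have 1: "Map F a (cobd C F \<phi> \<beta> (b # k)) = x \<otimes>\<^bsub>Grp F \<alpha>\<^esub> inv\<^bsub>Grp F \<alpha>\<^esub> y"
    using hom_in_carrier[OF diagram_hom[OF b] \<phi>k] B.ev_closed[OF cochain_bd[OF \<phi> bk]]
    by (simp add: cobd_Cons[OF b] x_def y_def diagram_comp[OF a b \<phi>k])
  have 2: "cobd C F \<phi> \<alpha> ((b \<cdot> a) # k) = x \<otimes>\<^bsub>Grp F \<alpha>\<^esub> inv\<^bsub>Grp F \<alpha>\<^esub> z"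
    by (simp add: cobd_Cons[OF ba] x_def z_def)
  have kk: "\<phi> \<alpha> \<in> Poly_Mapping.keys (bd C (a # l')) \<rightarrow> carrier (Grp F \<alpha>)"
    if "l' \<in> Poly_Mapping.keys ?c" for l'
    using cochain_bd[OF \<phi> kac[OF that]] .
  \<comment> \<open>Vanishing of the double boundary is used in this form; it identifies the last
    sum with \<open>z\<close>.\<close>
  have eqz: "bds C (consf a ?c) = bd C ((b \<cdot> a) # k)"
    using bds_bd[OF l] by (simp add: lk frag_extend_diff)
  have "ev (Grp F \<alpha>) (cobd C F \<phi> \<alpha>) (consf a ?c) = ev (Grp F \<alpha>) (\<lambda>l'. cobd C F \<phi> \<alpha> (a # l')) ?c"
    using kac cobd_closed[OF \<phi>] by (subst A.ev_frag_extend) (auto intro!: A.ev_cong A.ev_of simp: A.ev_of Pi_iff)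
  also have "\<dots> = ev (Grp F \<alpha>) (\<lambda>l'. Map F a (\<phi> \<beta> l') \<otimes>\<^bsub>Grp F \<alpha>\<^esub>
      ev (Grp F \<alpha>) (\<phi> \<alpha>) (- bd C (a # l'))) ?c"
  proof (rule A.ev_cong)
    show "(\<lambda>l'. cobd C F \<phi> \<alpha> (a # l')) \<in> Poly_Mapping.keys ?c \<rightarrow> carrier (Grp F \<alpha>)"
      using kac cobd_closed[OF \<phi>] by blast
  qed (use kk in \<open>simp add: cobd_Cons[OF a] A.ev_minus\<close>)
  also have "\<dots> = ev (Grp F \<alpha>) (\<lambda>l'. Map F a (\<phi> \<beta> l')) ?c \<otimes>\<^bsub>Grp F \<alpha>\<^esub>
      ev (Grp F \<alpha>) (\<lambda>l'. ev (Grp F \<alpha>) (\<phi> \<alpha>) (- bd C (a # l'))) ?c"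
  proof (rule A.ev_mult)
    show "(\<lambda>l'. Map F a (\<phi> \<beta> l')) \<in> Poly_Mapping.keys ?c \<rightarrow> carrier (Grp F \<alpha>)"
      using kc \<phi> by (auto simp: cochain_def)
    show "(\<lambda>l'. ev (Grp F \<alpha>) (\<phi> \<alpha>) (- bd C (a # l'))) \<in> Poly_Mapping.keys ?c \<rightarrow> carrier (Grp F \<alpha>)"
      by (rule Pi_I, rule A.ev_closed) (simp add: kk)
  qed
  also have "ev (Grp F \<alpha>) (\<lambda>l'. Map F a (\<phi> \<beta> l')) ?c = y"
    unfolding y_def by (rule B.hom_ev[symmetric, OF A.comm_group_axioms diagram_hom[OF a] cochain_bd[OF \<phi> bk]])
  also have "ev (Grp F \<alpha>) (\<lambda>l'. ev (Grp F \<alpha>) (\<phi> \<alpha>) (- bd C (a # l'))) ?c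
      = ev (Grp F \<alpha>) (\<phi> \<alpha>) (frag_extend (\<lambda>l'. - bd C (a # l')) ?c)"
    using kk by (intro A.ev_frag_extend[symmetric]) simp
  also have "frag_extend (\<lambda>l'. - bd C (a # l')) ?c = - bds C (consf a ?c)"
    by (rule free_Abelian_group_induct[OF subset_UNIV, of _ ?c]) (simp_all add: frag_extend_diff)
  also have "ev (Grp F \<alpha>) (\<phi> \<alpha>) (- bds C (consf a ?c)) = inv\<^bsub>Grp F \<alpha>\<^esub> z"
    unfolding eqz z_def using A.ev_minus[OF cochain_bd[OF \<phi> bak]] .
  finally have 3: "ev (Grp F \<alpha>) (cobd C F \<phi> \<alpha>) (consf a ?c) = y \<otimes>\<^bsub>Grp F \<alpha>\<^esub> inv\<^bsub>Grp F \<alpha>\<^esub> z" .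
  have "ev (Grp F \<alpha>) (cobd C F \<phi> \<alpha>) (bd C l) = cobd C F \<phi> \<alpha> ((b \<cdot> a) # k) \<otimes>\<^bsub>Grp F \<alpha>\<^esub>
      inv\<^bsub>Grp F \<alpha>\<^esub> ev (Grp F \<alpha>) (cobd C F \<phi> \<alpha>) (consf a ?c)"
    using cobd_closed[OF \<phi>] bak kac keys_consf[of _ a ?c] unfolding lk bd.simps
    by (subst A.ev_diff) (fastforce simp: A.ev_of)+
  then show ?thesis
    using x y z 1 2 3 cobd_closed[OF \<phi> bk]
    by (simp add: lk cobd_Cons[OF a] A.inv_mult A.m_ac)
      (simp add: A.m_assoc[symmetric] A.m_comm)
qed

end

lemma cobd_nat:
  assumes F: "is_ab_diagram (opposite C) F" and G: "is_ab_diagram (opposite C) G"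
    and \<eta>: "is_ab_nat (opposite C) F G \<eta>" and \<phi>: "cochain C F n \<phi>" and l: "chain C (Suc n) \<alpha> l"
  shows "\<eta> \<alpha> (cobd C F \<phi> \<alpha> l) = cobd C G (\<lambda>\<alpha> l. \<eta> \<alpha> (\<phi> \<alpha> l)) \<alpha> l"
proof -
  obtain a \<beta> k where lk: "l = a # k" and a: "arr C a \<alpha> \<beta>" and k: "chain C n \<beta> k"
    using l by (auto simp: chain_Suc)
  interpret A: comm_group "Grp F \<alpha>" using diagram_group[OF F] arr_Ob(1)[OF a] .
  interpret B: comm_group "Grp G \<alpha>" using diagram_group[OF G] arr_Ob(1)[OF a] .
  have h: "\<eta> \<alpha> \<in> hom (Grp F \<alpha>) (Grp G \<alpha>)"
    using \<eta> a by (simp add: is_ab_nat_def arr_def)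
  interpret AB: group_hom "Grp F \<alpha>" "Grp G \<alpha>" "\<eta> \<alpha>"
    using h by unfold_locales
  have \<phi>k: "\<phi> \<beta> k \<in> carrier (Grp F \<beta>)" using \<phi> k by (simp add: cochain_def)
  have "\<eta> \<alpha> (Map F a (\<phi> \<beta> k)) = Map G a (\<eta> \<beta> (\<phi> \<beta> k))"
    using \<eta> a \<phi>k by (simp add: is_ab_nat_def arr_def)
  then show ?thesis
    using hom_in_carrier[OF diagram_hom[OF F a] \<phi>k] A.ev_closed[OF cochain_bd[OF F \<phi> l]]
      A.hom_ev[OF B.comm_group_axioms h cochain_bd[OF F \<phi> l]]
    by (simp add: lk cobd_Cons[OF a])
qed

end

section \<open>Injective diagrams are acyclic for the bar complex\<close>

text \<open>A copy inside \<open>'h\<close> of the group \<open>U\<close> of integral combinations.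
  Injectivity of a diagram is tested only against diagrams with elements in \<open>'h\<close>, so
  the free groups have to be placed there.\<close>

definition encoded_group :: "(('x \<Rightarrow>\<^sub>0 int) \<Rightarrow> 'h) \<Rightarrow> ('x \<Rightarrow>\<^sub>0 int) set \<Rightarrow> 'h monoid" where
  "encoded_group e U = \<lparr>carrier = e ` U, monoid.mult = (\<lambda>x y. e (inv_into UNIV e x + inv_into UNIV e y)), one = e 0\<rparr>"

lemma encoded_group_simps [simp]:
  "carrier (encoded_group e U) = e ` U"
  "\<one>\<^bsub>encoded_group e U\<^esub> = e 0"
  "inj e \<Longrightarrow> e x \<otimes>\<^bsub>encoded_group e U\<^esub> e y = e (x + y)"
  by (simp_all add: encoded_group_def)

lemma comm_group_encoded_group:
  assumes e: "inj e" and U: "0 \<in> U" "\<And>x y. x \<in> U \<Longrightarrow> y \<in> U \<Longrightarrow> x + y \<in> U" "\<And>x. x \<in> U \<Longrightarrow> - x \<in> U"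
  shows "comm_group (encoded_group e U)"
proof (rule comm_groupI)
  fix x assume "x \<in> carrier (encoded_group e U)"
  then obtain c where c: "x = e c" "c \<in> U" by auto
  then show "\<exists>y\<in>carrier (encoded_group e U). y \<otimes>\<^bsub>encoded_group e U\<^esub> x = \<one>\<^bsub>encoded_group e U\<^esub>"
    using U(3)[OF c(2)] e by (intro bexI[of _ "e (- c)"]) auto
qed (use U e in \<open>auto simp: add_ac\<close>)

lemma keys_subset_closed:
  "Poly_Mapping.keys c \<subseteq> A \<Longrightarrow> Poly_Mapping.keys d \<subseteq> A \<Longrightarrow> Poly_Mapping.keys (c + d) \<subseteq> A"
  "Poly_Mapping.keys c \<subseteq> A \<Longrightarrow> Poly_Mapping.keys d \<subseteq> A \<Longrightarrow> Poly_Mapping.keys (c - d) \<subseteq> A"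
  using keys_add[of c d] keys_diff[of c d] by blast+

lemma ev_hom_free_group:
  assumes H: "comm_group H" and h: "h \<in> hom (free_Abelian_group S) H"
    and k: "\<And>x. x \<in> Poly_Mapping.keys c \<Longrightarrow> Poly_Mapping.keys (k x) \<subseteq> S"
  shows "ev H (\<lambda>x. h (k x)) c = h (frag_extend k c)"
proof -
  interpret H: comm_group H by fact
  interpret group_hom "free_Abelian_group S" H h
    by (intro group_hom.intro group_hom_axioms.intro group_free_Abelian_group H.is_group h)
  let ?T = "{x. Poly_Mapping.keys (k x) \<subseteq> S}"
  have ext: "Poly_Mapping.keys (frag_extend k d) \<subseteq> S" if "Poly_Mapping.keys d \<subseteq> ?T" for d
    using keys_frag_extend[of k d] that by blast
  have cl: "(\<lambda>x. h (k x)) \<in> Poly_Mapping.keys d \<rightarrow> carrier H" if "Poly_Mapping.keys d \<subseteq> ?T" for d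
    using that by (intro Pi_I hom_closed) auto
  have "Poly_Mapping.keys c \<subseteq> ?T" using k by blast
  then show ?thesis
  proof (rule free_Abelian_group_induct)
    show "ev H (\<lambda>x. h (k x)) 0 = h (frag_extend k 0)"
      using hom_one by simp
  next
    fix x y assume xy: "Poly_Mapping.keys x \<subseteq> ?T" "Poly_Mapping.keys y \<subseteq> ?T"
      and IH: "ev H (\<lambda>x. h (k x)) x = h (frag_extend k x)" "ev H (\<lambda>x. h (k x)) y = h (frag_extend k y)"
    have "h (frag_extend k (x - y)) = h (frag_extend k x) \<otimes>\<^bsub>H\<^esub> inv\<^bsub>H\<^esub> h (frag_extend k y)"
      using hom_mult[of "frag_extend k x" "- frag_extend k y"] hom_inv[of "frag_extend k y"] ext[OF xy(1)] ext[OF xy(2)]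
      by (simp add: frag_extend_diff)
    then show "ev H (\<lambda>x. h (k x)) (x - y) = h (frag_extend k (x - y))"
      using H.ev_diff[OF cl[OF xy(1)] cl[OF xy(2)]] IH by simp
  next
    fix a assume "a \<in> ?T"
    then show "ev H (\<lambda>x. h (k x)) (frag_of a) = h (frag_extend k (frag_of a))"
      by (simp add: H.ev_of)
  qed
qed

context category
begin

text \<open>If \<open>U \<alpha>\<close> is all combinations of chains of a fixed positive length
  starting at \<alpha>, this is the free diagram on chains; if it is the cycles among them, the
  corresponding subdiagram.\<close>

definition encoded_diagram :: "(('a list \<Rightarrow>\<^sub>0 int) \<Rightarrow> 'h) \<Rightarrow> ('o \<Rightarrow> ('a list \<Rightarrow>\<^sub>0 int) set) \<Rightarrow> ('o, 'a, 'h) ab_diagram" where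
  "encoded_diagram e U = \<lparr>Grp = (\<lambda>\<alpha>. encoded_group e (U \<alpha>)), Map = (\<lambda>a x. e (precomp C a (inv_into UNIV e x)))\<rparr>"

lemma keys_precomp_chain:
  assumes a: "arr C a \<alpha> \<beta>" and c: "Poly_Mapping.keys c \<subseteq> {l. chain C (Suc n) \<beta> l}"
  shows "Poly_Mapping.keys (precomp C a c) \<subseteq> {l. chain C (Suc n) \<alpha> l}"
proof
  fix l assume "l \<in> Poly_Mapping.keys (precomp C a c)"
  then obtain l' where l': "l' \<in> Poly_Mapping.keys c" "l = (hd l' \<cdot> a) # tl l'"
    using keys_precomp[of l C a c] by auto
  then have "chain C (Suc n) \<beta> l'"
    using c by blast
  then obtain b \<gamma> k where "l' = b # k" "arr C b \<beta> \<gamma>" "chain C n \<gamma> k"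
    by (auto simp: chain_Suc)
  then show "l \<in> {l. chain C (Suc n) \<alpha> l}"
    using l' arr_comp[OF a] by (auto simp: chain_Suc)
qed

lemma precomp_id:
  assumes "Poly_Mapping.keys c \<subseteq> {l. chain C (Suc n) \<alpha> l}"
  shows "precomp C (Id C \<alpha>) c = c"
proof -
  have "precomp C (Id C \<alpha>) c = frag_extend frag_of c"
    unfolding precomp_def using assms
    by (intro frag_extend_eq) (fastforce simp: chain_Suc arr_id_right)
  then show ?thesis by (simp flip: frag_expansion)
qed

lemma precomp_comp:
  assumes a: "arr C a \<alpha> \<beta>" and b: "arr C b \<beta> \<gamma>" and "Poly_Mapping.keys c \<subseteq> {l. chain C (Suc n) \<gamma> l}"
  shows "precomp C (b \<cdot> a) c = precomp C a (precomp C b c)"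
  using assms(3)
proof (rule free_Abelian_group_induct)
  fix l assume "l \<in> {l. chain C (Suc n) \<gamma> l}"
  then show "precomp C (b \<cdot> a) (frag_of l) = precomp C a (precomp C b (frag_of l))"
    using arr_assoc[OF a b] by (auto simp: chain_Suc precomp_def)
qed (simp_all add: precomp_def frag_extend_diff)

lemma precomp_add: "precomp C a (c + d) = precomp C a c + precomp C a d"
  by (simp add: precomp_def frag_extend_add)

lemma is_ab_diagram_encoded:
  assumes e: "inj e"
    and U: "\<And>\<alpha>. U \<alpha> \<subseteq> {c. Poly_Mapping.keys c \<subseteq> {l. chain C (Suc n) \<alpha> l}}"
    and U0: "\<And>\<alpha>. 0 \<in> U \<alpha>" and Uadd: "\<And>\<alpha> c d. c \<in> U \<alpha> \<Longrightarrow> d \<in> U \<alpha> \<Longrightarrow> c + d \<in> U \<alpha>"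
    and Um: "\<And>\<alpha> c. c \<in> U \<alpha> \<Longrightarrow> - c \<in> U \<alpha>"
    and Up: "\<And>a \<alpha> \<beta> c. arr C a \<alpha> \<beta> \<Longrightarrow> c \<in> U \<beta> \<Longrightarrow> precomp C a c \<in> U \<alpha>"
  shows "is_ab_diagram (opposite C) (encoded_diagram e U)"
  unfolding is_ab_diagram_def opposite_simps encoded_diagram_def ab_diagram.simps
proof (intro conjI ballI)
  fix \<alpha>
  show "comm_group (encoded_group e (U \<alpha>))"
    using comm_group_encoded_group[OF e U0 Uadd Um] .
next
  fix \<alpha> x assume "\<alpha> \<in> Ob C" "x \<in> carrier (encoded_group e (U \<alpha>))"
  then obtain c where "x = e c" "c \<in> U \<alpha>" by auto
  then show "e (precomp C (Id C \<alpha>) (inv_into UNIV e x)) = x"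
    using e precomp_id[of c n \<alpha>] U[of \<alpha>] by auto
next
  fix \<alpha> \<beta> a assume "\<alpha> \<in> Ob C" "\<beta> \<in> Ob C" "a \<in> Hom C \<beta> \<alpha>"
  then have "arr C a \<beta> \<alpha>" by (simp add: arr_def)
  then show "(\<lambda>x. e (precomp C a (inv_into UNIV e x))) \<in> hom (encoded_group e (U \<alpha>)) (encoded_group e (U \<beta>))"
    using e Up by (auto simp: hom_def precomp_add)
next
  fix \<alpha> \<beta> \<gamma> a b x assume "\<alpha> \<in> Ob C" "\<beta> \<in> Ob C" "\<gamma> \<in> Ob C" "a \<in> Hom C \<beta> \<alpha>" "b \<in> Hom C \<gamma> \<beta>"
    and x: "x \<in> carrier (encoded_group e (U \<alpha>))"
  then have ab: "arr C b \<gamma> \<beta>" "arr C a \<beta> \<alpha>" by (simp_all add: arr_def)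
  obtain c where c: "x = e c" "Poly_Mapping.keys c \<subseteq> {l. chain C (Suc n) \<alpha> l}"
    using x U[of \<alpha>] by auto
  show "e (precomp C (a \<cdot> b) (inv_into UNIV e x)) = e (precomp C b (inv_into UNIV e (e (precomp C a (inv_into UNIV e x)))))"
    using c(1) e precomp_comp[OF ab c(2)] by simp
qed

text \<open>A cocycle on \<open>(n+1)\<close>-chains is a natural map on the kernel of the boundary of the free diagram on
  \<open>(n+1)\<close>-chains; an extension of it to the free diagram is a cochain that bounds the cocycle.\<close>

theorem injective_acyclic:
  fixes J :: "('o, 'a, 'h) ab_diagram"
  assumes J: "injective_diagram (opposite C) J"
    and emb: "(UNIV :: ('a list \<Rightarrow>\<^sub>0 int) set) \<lesssim> (UNIV :: 'h set)"
    and \<phi>: "cochain C J (Suc n) \<phi>"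
    and cocycle: "\<And>\<alpha> l. chain C (Suc (Suc n)) \<alpha> l \<Longrightarrow> cobd C J \<phi> \<alpha> l = \<one>\<^bsub>Grp J \<alpha>\<^esub>"
  obtains \<kappa> where "cochain C J n \<kappa>" "\<And>\<alpha> l. chain C (Suc n) \<alpha> l \<Longrightarrow> \<phi> \<alpha> l = cobd C J \<kappa> \<alpha> l"
proof -
  obtain e :: "('a list \<Rightarrow>\<^sub>0 int) \<Rightarrow> 'h" where e: "inj e"
    using emb by (auto simp: lepoll_def)
  have JD: "is_ab_diagram (opposite C) J"
    using J by (simp add: injective_diagram_def)
  \<comment> \<open>The cocycle condition, solved for the face that carries
    \<open>Map\<close>.\<close>
  have cocycle': "Map J a (\<phi> \<beta> l) = ev (Grp J \<alpha>) (\<phi> \<alpha>) (bd C (a # l))"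
    if a: "arr C a \<alpha> \<beta>" and l: "chain C (Suc n) \<beta> l" for a \<alpha> \<beta> l
  proof -
    have al: "chain C (Suc (Suc n)) \<alpha> (a # l)" using a l by (auto simp: chain_Cons)
    interpret G: comm_group "Grp J \<alpha>" using diagram_group[OF JD arr_Ob(1)[OF a]] .
    have "Map J a (\<phi> \<beta> l) \<in> carrier (Grp J \<alpha>)"
      using hom_in_carrier[OF diagram_hom[OF JD a]] \<phi> l by (simp add: cochain_def)
    then show ?thesis
      using cocycle[OF al] G.ev_closed[OF cochain_bd[OF JD \<phi> al]] cobd_Cons[OF a, of J \<phi> l]
        G.inv_solve_right'[of "\<one>\<^bsub>Grp J \<alpha>\<^esub>" "Map J a (\<phi> \<beta> l)"] by auto
  qed
  define U where "U \<alpha> = {c :: 'a list \<Rightarrow>\<^sub>0 int. Poly_Mapping.keys c \<subseteq> {l. chain C (Suc n) \<alpha> l}}" for \<alpha>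
  define Z where "Z \<alpha> = {c \<in> U \<alpha>. bds C c = 0}" for \<alpha>
  have BD: "is_ab_diagram (opposite C) (encoded_diagram e U)"
    using e by (rule is_ab_diagram_encoded[where n=n]) (auto simp: U_def keys_subset_closed keys_precomp_chain)
  have Zp: "precomp C a c \<in> Z \<alpha>" if a: "arr C a \<alpha> \<beta>" and c: "c \<in> Z \<beta>" for a \<alpha> \<beta> c
  proof -
    have "bds C (precomp C a c) = (if n = 0 then bds C c else precomp C a (bds C c))"
      using c by (intro bds_precomp[OF a]) (auto simp: Z_def U_def)
    then show ?thesis
      using c keys_precomp_chain[OF a] by (auto simp: Z_def U_def precomp_def)
  qed
  have AD: "is_ab_diagram (opposite C) (encoded_diagram e Z)"
    using e by (rule is_ab_diagram_encoded[where n=n])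
      (use Zp in \<open>auto simp: Z_def U_def keys_subset_closed frag_extend_add frag_extend_minus\<close>)
  define f where "f \<alpha> x = ev (Grp J \<alpha>) (\<phi> \<alpha>) (inv_into UNIV e x)" for \<alpha> x
  have \<phi>U: "\<phi> \<alpha> \<in> Poly_Mapping.keys c \<rightarrow> carrier (Grp J \<alpha>)" if "c \<in> U \<alpha>" for c \<alpha>
    using \<phi> that by (auto simp: cochain_def U_def)
  have f: "is_ab_nat (opposite C) (encoded_diagram e Z) J f"
    unfolding is_ab_nat_def opposite_simps
  proof (intro conjI ballI)
    fix \<alpha> assume "\<alpha> \<in> Ob C"
    then interpret G: comm_group "Grp J \<alpha>" using diagram_group[OF JD] by blast
    show "f \<alpha> \<in> hom (Grp (encoded_diagram e Z) \<alpha>) (Grp J \<alpha>)"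
      using e G.ev_closed[OF \<phi>U] G.ev_add[OF \<phi>U \<phi>U]
      by (auto simp: hom_def encoded_diagram_def f_def Z_def)
  next
    fix \<beta> \<alpha> a x assume ab: "\<beta> \<in> Ob C" "\<alpha> \<in> Ob C" "a \<in> Hom C \<alpha> \<beta>"
      and x: "x \<in> carrier (Grp (encoded_diagram e Z) \<beta>)"
    then have a: "arr C a \<alpha> \<beta>" by (simp add: arr_def)
    interpret A: comm_group "Grp J \<alpha>" using diagram_group[OF JD ab(2)] .
    interpret B: comm_group "Grp J \<beta>" using diagram_group[OF JD ab(1)] .
    obtain c where c: "x = e c" "c \<in> U \<beta>" "bds C c = 0"
      using x by (auto simp: encoded_diagram_def Z_def)
    have ch: "chain C (Suc n) \<beta> l" if "l \<in> Poly_Mapping.keys c" for l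
      using that c by (auto simp: U_def)
    have "Map J a (f \<beta> x) = ev (Grp J \<alpha>) (\<lambda>l. Map J a (\<phi> \<beta> l)) c"
      using B.hom_ev[OF A.comm_group_axioms diagram_hom[OF JD a] \<phi>U[OF c(2)]] c e by (simp add: f_def)
    also have "\<dots> = ev (Grp J \<alpha>) (\<lambda>l. ev (Grp J \<alpha>) (\<phi> \<alpha>) (bd C (a # l))) c"
    proof (rule A.ev_cong)
      show "(\<lambda>l. Map J a (\<phi> \<beta> l)) \<in> Poly_Mapping.keys c \<rightarrow> carrier (Grp J \<alpha>)"
        using hom_in_carrier[OF diagram_hom[OF JD a]] \<phi>U[OF c(2)] by blast
    qed (use cocycle'[OF a] ch in blast)
    also have "\<dots> = ev (Grp J \<alpha>) (\<phi> \<alpha>) (frag_extend (\<lambda>l. bd C (a # l)) c)"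
    proof (rule A.ev_frag_extend[symmetric])
      fix l assume "l \<in> Poly_Mapping.keys c"
      then have "chain C (Suc (Suc n)) \<alpha> (a # l)"
        using ch a by (auto simp: chain_Cons)
      then show "\<phi> \<alpha> \<in> Poly_Mapping.keys (bd C (a # l)) \<rightarrow> carrier (Grp J \<alpha>)"
        by (rule cochain_bd[OF JD \<phi>])
    qed
    also have "frag_extend (\<lambda>l. bd C (a # l)) c = bds C (consf a c)"
      by (rule free_Abelian_group_induct[OF subset_UNIV, of _ c]) (simp_all add: frag_extend_diff)
    \<comment> \<open>Here it matters that \<open>c\<close> is a cycle: the term with
      \<open>bds C c\<close> drops out. This is why the linear extension of \<open>\<phi>\<close> is
      taken on \<open>Z\<close> and has to be extended to \<open>U\<close> by injectivity.\<close>
    also have "\<dots> = precomp C a c"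
      using bds_consf[of c a] ch c(3) by (fastforce simp: chain_def)
    finally show "f \<alpha> (Map (encoded_diagram e Z) a x) = Map J a (f \<beta> x)"
      using c e by (simp add: f_def encoded_diagram_def)
  qed
  have m: "is_ab_nat (opposite C) (encoded_diagram e Z) (encoded_diagram e U) (\<lambda>\<alpha> x. x)"
    by (auto simp: is_ab_nat_def encoded_diagram_def hom_def Z_def encoded_group_def)
  have "\<forall>\<alpha>\<in>Ob (opposite C). inj_on (\<lambda>x. x) (carrier (Grp (encoded_diagram e Z) \<alpha>))"
    by simp
  from J[unfolded injective_diagram_def, THEN conjunct2, rule_format, OF AD BD m _ f] this
  obtain g where g: "is_ab_nat (opposite C) (encoded_diagram e U) J g"
    and gf: "\<And>\<alpha> x. \<alpha> \<in> Ob C \<Longrightarrow> x \<in> carrier (Grp (encoded_diagram e Z) \<alpha>) \<Longrightarrow> g \<alpha> x = f \<alpha> x"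
    by auto
  have gh: "(\<lambda>c. g \<alpha> (e c)) \<in> hom (free_Abelian_group {l. chain C (Suc n) \<alpha> l}) (Grp J \<alpha>)" if "\<alpha> \<in> Ob C" for \<alpha>
  proof -
    have "g \<alpha> \<in> hom (encoded_group e (U \<alpha>)) (Grp J \<alpha>)"
      using g that by (simp add: is_ab_nat_def encoded_diagram_def)
    then show ?thesis
      using e by (auto simp: hom_def U_def)
  qed
  \<comment> \<open>In the free diagram every chain a # k is the restriction along \<open>a\<close>
    of the chain Id # k. Chains that begin with an identity therefore generate it, and
    \<open>g\<close> is read off on them.\<close>
  define \<kappa> where "\<kappa> \<alpha> l = g \<alpha> (e (frag_of (Id C \<alpha> # l)))" for \<alpha> l
  have Idl: "chain C (Suc k) \<alpha> (Id C \<alpha> # l)" if "chain C k \<alpha> l" for \<alpha> l k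
    using that arr_id[OF chain_Ob[OF that]] by (auto simp: chain_Cons)
  have "cochain C J n \<kappa>"
    unfolding cochain_def \<kappa>_def
    using hom_in_carrier[OF gh] Idl chain_Ob by fastforce
  moreover have "\<phi> \<alpha> l = cobd C J \<kappa> \<alpha> l" if l: "chain C (Suc n) \<alpha> l" for \<alpha> l
  proof -
    obtain a \<beta> k where lk: "l = a # k" and a: "arr C a \<alpha> \<beta>" and k: "chain C n \<beta> k"
      using l by (auto simp: chain_Suc)
    interpret A: comm_group "Grp J \<alpha>" using diagram_group[OF JD arr_Ob(1)[OF a]] .
    have \<alpha>: "\<alpha> \<in> Ob C" "\<beta> \<in> Ob C" using a by (auto simp: arr_def)
    interpret gh: group_hom "free_Abelian_group {l. chain C (Suc n) \<alpha> l}" "Grp J \<alpha>" "\<lambda>c. g \<alpha> (e c)"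
      by (intro group_hom.intro group_hom_axioms.intro group_free_Abelian_group A.is_group gh[OF \<alpha>(1)])
    have "frag_of (Id C \<beta> # k) \<in> U \<beta>"
      using Idl[OF k] by (simp add: U_def)
    moreover have "\<forall>x\<in>carrier (Grp (encoded_diagram e U) \<beta>).
        g \<alpha> (Map (encoded_diagram e U) a x) = Map J a (g \<beta> x)"
      using g a unfolding is_ab_nat_def arr_def opposite_simps by blast
    ultimately have "Map J a (\<kappa> \<beta> k) = g \<alpha> (e (precomp C a (frag_of (Id C \<beta> # k))))"
      using e by (auto simp: \<kappa>_def encoded_diagram_def)
    then have 1: "Map J a (\<kappa> \<beta> k) = g \<alpha> (e (frag_of l))"
      using arr_id_left[OF a] by (simp add: precomp_def lk)
    have Idk: "Poly_Mapping.keys (frag_of (Id C \<alpha> # l')) \<subseteq> {l. chain C (Suc n) \<alpha> l}"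
      if "l' \<in> Poly_Mapping.keys (bd C l)" for l'
      using Idl[OF keys_bd[OF l that]] by simp
    have 2: "ev (Grp J \<alpha>) (\<kappa> \<alpha>) (bd C l) = g \<alpha> (e (consf (Id C \<alpha>) (bd C l)))"
      unfolding \<kappa>_def using ev_hom_free_group[OF A.comm_group_axioms gh[OF \<alpha>(1)] Idk] .
    \<comment> \<open>Prepending an identity contracts the free complex. The coboundary of
      \<open>\<kappa>\<close> at \<open>l\<close> is thus \<open>g\<close> on a boundary, hence on a
      cycle, where \<open>g\<close> agrees with \<open>f\<close>.\<close>
    have bdI: "bd C (Id C \<alpha> # l) = frag_of l - consf (Id C \<alpha>) (bd C l)"
      using arr_id_right[OF a] by (simp add: lk)
    have kc: "Poly_Mapping.keys (consf (Id C \<alpha>) (bd C l)) \<subseteq> {l. chain C (Suc n) \<alpha> l}"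
      using keys_frag_extend[of "\<lambda>l. frag_of (Id C \<alpha> # l)" "bd C l"] Idk by fastforce
    have "cobd C J \<kappa> \<alpha> l = g \<alpha> (e (bd C (Id C \<alpha> # l)))"
      using gh.hom_mult[of "frag_of l" "- consf (Id C \<alpha>) (bd C l)"] gh.hom_inv[of "consf (Id C \<alpha>) (bd C l)"] kc l
      unfolding bdI by (simp add: lk cobd_Cons[OF a]  1[unfolded lk] 2[unfolded lk])
    also have "\<dots> = f \<alpha> (e (bd C (Id C \<alpha> # l)))"
    proof (rule gf[OF \<alpha>(1)])
      show "e (bd C (Id C \<alpha> # l)) \<in> carrier (Grp (encoded_diagram e Z) \<alpha>)"
        using keys_bd[OF Idl[OF l]] bds_bd[OF Idl[OF l]] by (auto simp: encoded_diagram_def Z_def U_def)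
    qed
    also have "\<dots> = Map J (Id C \<alpha>) (\<phi> \<alpha> l)"
      using cocycle'[OF arr_id[OF \<alpha>(1)] l] e by (simp add: f_def)
    also have "\<dots> = \<phi> \<alpha> l"
      using diagram_id[OF JD \<alpha>(1)] \<phi> l by (simp add: cochain_def)
    finally show ?thesis by simp
  qed
  ultimately show thesis by (rule that)
qed

end

section \<open>Derived limits from the bar complex\<close>

lemma (in comm_group) ev_inv:
  assumes "f \<in> Poly_Mapping.keys c \<rightarrow> carrier G"
  shows "ev G (\<lambda>x. inv (f x)) c = inv (ev G f c)"
proof (rule inv_equality[symmetric])
  have i: "(\<lambda>x. inv (f x)) \<in> Poly_Mapping.keys c \<rightarrow> carrier G" using assms by auto
  have "ev G (\<lambda>x. inv (f x)) c \<otimes> ev G f c = ev G (\<lambda>x. inv (f x) \<otimes> f x) c"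
    using ev_mult[OF i assms] by simp
  also have "\<dots> = ev G (\<lambda>x. \<one>) c"
    using assms by (intro ev_cong) (auto simp: Pi_iff)
  finally show "ev G (\<lambda>x. inv (f x)) c \<otimes> ev G f c = \<one>"
    by (simp add: ev_one)
  show "ev G f c \<in> carrier G" "ev G (\<lambda>x. inv (f x)) c \<in> carrier G"
    using ev_closed[OF assms] ev_closed[OF i] by auto
qed

section \<open>Limits of diagrams of abelian groups\<close>

lemma ab_diagram_group: "is_ab_diagram K F \<Longrightarrow> \<alpha> \<in> Ob K \<Longrightarrow> comm_group (Grp F \<alpha>)"
  by (simp add: is_ab_diagram_def)

lemma ab_diagram_hom:
  "is_ab_diagram K F \<Longrightarrow> \<alpha> \<in> Ob K \<Longrightarrow> \<beta> \<in> Ob K \<Longrightarrow> a \<in> Hom K \<alpha> \<beta> \<Longrightarrow> Map F a \<in> hom (Grp F \<alpha>) (Grp F \<beta>)"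
  by (simp add: is_ab_diagram_def)

lemma lim_group_simps:
  "x \<in> carrier (lim_group K F) \<longleftrightarrow> x \<in> (\<Pi>\<^sub>E \<alpha>\<in>Ob K. carrier (Grp F \<alpha>)) \<and>
     (\<forall>\<alpha>\<in>Ob K. \<forall>\<beta>\<in>Ob K. \<forall>a\<in>Hom K \<alpha> \<beta>. Map F a (x \<alpha>) = x \<beta>)"
  "\<one>\<^bsub>lim_group K F\<^esub> = (\<lambda>\<alpha>\<in>Ob K. \<one>\<^bsub>Grp F \<alpha>\<^esub>)"
  "x \<otimes>\<^bsub>lim_group K F\<^esub> y = (\<lambda>\<alpha>\<in>Ob K. x \<alpha> \<otimes>\<^bsub>Grp F \<alpha>\<^esub> y \<alpha>)"
  by (simp_all add: lim_group_def)

lemma comm_group_lim_group: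
  assumes F: "is_ab_diagram K F"
  shows "comm_group (lim_group K F)"
proof (rule comm_groupI)
  note G = ab_diagram_group[OF F]
  have grp: "group (Grp F \<alpha>)" "monoid (Grp F \<alpha>)" if "\<alpha> \<in> Ob K" for \<alpha>
    using G[OF that] by (auto simp: comm_group_def group.is_monoid)
  note h = ab_diagram_hom[OF F]
  show "\<one>\<^bsub>lim_group K F\<^esub> \<in> carrier (lim_group K F)"
    using grp hom_one[OF h] by (auto simp: lim_group_simps monoid.one_closed)
  fix x assume x: "x \<in> carrier (lim_group K F)"
  then have x1: "x \<alpha> \<in> carrier (Grp F \<alpha>)" if "\<alpha> \<in> Ob K" for \<alpha>
    using that by (auto simp: lim_group_simps)
  have x2: "Map F a (x \<alpha>) = x \<beta>" if "\<alpha> \<in> Ob K" "\<beta> \<in> Ob K" "a \<in> Hom K \<alpha> \<beta>" for \<alpha> \<beta> a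
    using that x by (auto simp: lim_group_simps)
  show "\<one>\<^bsub>lim_group K F\<^esub> \<otimes>\<^bsub>lim_group K F\<^esub> x = x"
    using x grp x1 by (intro ext) (auto simp: lim_group_simps monoid.l_one PiE_iff extensional_def)
  have "Map F a (inv\<^bsub>Grp F \<alpha>\<^esub> x \<alpha>) = inv\<^bsub>Grp F \<beta>\<^esub> x \<beta>"
    if "\<alpha> \<in> Ob K" "\<beta> \<in> Ob K" "a \<in> Hom K \<alpha> \<beta>" for \<alpha> \<beta> a
    using group_hom.hom_inv[OF group_hom.intro[OF grp(1)[OF that(1)] grp(1)[OF that(2)]
        group_hom_axioms.intro[OF h[OF that]]] x1[OF that(1)]] x2[OF that] by simp
  then have "(\<lambda>\<alpha>\<in>Ob K. inv\<^bsub>Grp F \<alpha>\<^esub> x \<alpha>) \<in> carrier (lim_group K F)"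
    using x1 grp by (auto simp: lim_group_simps group.inv_closed)
  moreover have "(\<lambda>\<alpha>\<in>Ob K. inv\<^bsub>Grp F \<alpha>\<^esub> x \<alpha>) \<otimes>\<^bsub>lim_group K F\<^esub> x = \<one>\<^bsub>lim_group K F\<^esub>"
    using grp x1 by (auto simp: lim_group_simps group.l_inv)
  ultimately show "\<exists>y\<in>carrier (lim_group K F). y \<otimes>\<^bsub>lim_group K F\<^esub> x = \<one>\<^bsub>lim_group K F\<^esub>"
    by blast
  fix y assume y: "y \<in> carrier (lim_group K F)"
  then have y1: "y \<alpha> \<in> carrier (Grp F \<alpha>)" if "\<alpha> \<in> Ob K" for \<alpha>
    using that by (auto simp: lim_group_simps)
  have y2: "Map F a (y \<alpha>) = y \<beta>" if "\<alpha> \<in> Ob K" "\<beta> \<in> Ob K" "a \<in> Hom K \<alpha> \<beta>" for \<alpha> \<beta> a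
    using that y by (auto simp: lim_group_simps)
  show "x \<otimes>\<^bsub>lim_group K F\<^esub> y \<in> carrier (lim_group K F)"
    using x1 y1 grp x2 y2 hom_mult[OF h] by (auto simp: lim_group_simps monoid.m_closed)
  show "x \<otimes>\<^bsub>lim_group K F\<^esub> y = y \<otimes>\<^bsub>lim_group K F\<^esub> x"
    using x1 y1 G comm_monoid.m_comm[OF comm_group.axioms(1)[OF G]] by (auto simp: lim_group_simps)
  fix z assume z: "z \<in> carrier (lim_group K F)"
  then have "z \<alpha> \<in> carrier (Grp F \<alpha>)" if "\<alpha> \<in> Ob K" for \<alpha>
    using that by (auto simp: lim_group_simps)
  then show "x \<otimes>\<^bsub>lim_group K F\<^esub> y \<otimes>\<^bsub>lim_group K F\<^esub> z = x \<otimes>\<^bsub>lim_group K F\<^esub> (y \<otimes>\<^bsub>lim_group K F\<^esub> z)"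
    using x1 y1 monoid.m_assoc[OF grp(2)] by (auto simp: lim_group_simps)
qed

lemma lim_map_hom:
  assumes F: "is_ab_diagram K F" and n: "is_ab_nat K F G \<eta>"
  shows "lim_map K \<eta> \<in> hom (lim_group K F) (lim_group K G)"
proof (rule homI)
  have h: "\<eta> \<alpha> \<in> hom (Grp F \<alpha>) (Grp G \<alpha>)" if "\<alpha> \<in> Ob K" for \<alpha>
    using n that by (simp add: is_ab_nat_def)
  fix x assume x: "x \<in> carrier (lim_group K F)"
  then show "lim_map K \<eta> x \<in> carrier (lim_group K G)"
  proof -
    have x1: "x \<alpha> \<in> carrier (Grp F \<alpha>)" if "\<alpha> \<in> Ob K" for \<alpha>
      using that x by (auto simp: lim_group_simps)
    have "Map G a (\<eta> \<alpha> (x \<alpha>)) = \<eta> \<beta> (x \<beta>)" if "\<alpha> \<in> Ob K" "\<beta> \<in> Ob K" "a \<in> Hom K \<alpha> \<beta>" for \<alpha> \<beta> a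
    proof -
      have "\<eta> \<beta> (Map F a (x \<alpha>)) = Map G a (\<eta> \<alpha> (x \<alpha>))"
        using n that x1 by (simp add: is_ab_nat_def)
      moreover have "Map F a (x \<alpha>) = x \<beta>"
        using x that by (auto simp: lim_group_simps)
      ultimately show ?thesis by simp
    qed
    then show ?thesis
      using hom_in_carrier[OF h x1] by (simp add: lim_group_simps lim_map_def)
  qed
  fix y assume "y \<in> carrier (lim_group K F)"
  then show "lim_map K \<eta> (x \<otimes>\<^bsub>lim_group K F\<^esub> y) = lim_map K \<eta> x \<otimes>\<^bsub>lim_group K G\<^esub> lim_map K \<eta> y"
    using x h hom_mult[OF h] by (auto simp: lim_group_simps lim_map_def PiE_iff)
qed

context category
begin

lemma cobd_inv:
  assumes F: "is_ab_diagram (opposite C) F" and \<phi>: "cochain C F n \<phi>" and l: "chain C (Suc n) \<alpha> l"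
  shows "cobd C F (\<lambda>\<alpha> l. inv\<^bsub>Grp F \<alpha>\<^esub> \<phi> \<alpha> l) \<alpha> l = inv\<^bsub>Grp F \<alpha>\<^esub> cobd C F \<phi> \<alpha> l"
proof -
  obtain a \<beta> k where lk: "l = a # k" and a: "arr C a \<alpha> \<beta>" and k: "chain C n \<beta> k"
    using l by (auto simp: chain_Suc)
  interpret A: comm_group "Grp F \<alpha>" using diagram_group[OF F arr_Ob(1)[OF a]] .
  interpret B: comm_group "Grp F \<beta>" using diagram_group[OF F arr_Ob(2)[OF a]] .
  interpret AB: group_hom "Grp F \<beta>" "Grp F \<alpha>" "Map F a"
    using diagram_hom[OF F a] by unfold_locales
  have c: "\<phi> \<beta> k \<in> carrier (Grp F \<beta>)" using \<phi> k by (simp add: cochain_def)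
  show ?thesis
    using A.ev_inv[OF cochain_bd[OF F \<phi> l]] A.ev_closed[OF cochain_bd[OF F \<phi> l]] c
    by (simp add: lk cobd_Cons[OF a] A.inv_mult)
qed

lemma cobd_0: "arr C a \<alpha> \<beta> \<Longrightarrow> is_ab_diagram (opposite C) F \<Longrightarrow> x \<alpha> \<in> carrier (Grp F \<alpha>) \<Longrightarrow>
    cobd C F (\<lambda>\<alpha> l. x \<alpha>) \<alpha> [a] = Map F a (x \<beta>) \<otimes>\<^bsub>Grp F \<alpha>\<^esub> inv\<^bsub>Grp F \<alpha>\<^esub> x \<alpha>"
  using comm_group.ev_of[OF diagram_group, of F \<alpha> "\<lambda>l. x \<alpha>" "[] :: 'a list"] arr_Ob(1)[of C a \<alpha> \<beta>]
  by (simp add: cobd_Cons)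

text \<open>In degree 0 the bar complex computes the limit: the coboundary of a family of elements
  measures its failure to be compatible.\<close>

lemma lim_iff_cobd:
  assumes F: "is_ab_diagram (opposite C) F" and x: "\<And>\<alpha>. \<alpha> \<in> Ob C \<Longrightarrow> x \<alpha> \<in> carrier (Grp F \<alpha>)"
  shows "(\<lambda>\<alpha>\<in>Ob C. x \<alpha>) \<in> carrier (lim_group (opposite C) F) \<longleftrightarrow>
    (\<forall>\<alpha> l. chain C (Suc 0) \<alpha> l \<longrightarrow> cobd C F (\<lambda>\<alpha> l. x \<alpha>) \<alpha> l = \<one>\<^bsub>Grp F \<alpha>\<^esub>)"
proof -
  have "cobd C F (\<lambda>\<alpha> l. x \<alpha>) \<alpha> [a] = \<one>\<^bsub>Grp F \<alpha>\<^esub> \<longleftrightarrow> Map F a (x \<beta>) = x \<alpha>"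
    if a: "arr C a \<alpha> \<beta>" for a \<alpha> \<beta>
  proof -
    interpret A: comm_group "Grp F \<alpha>" using diagram_group[OF F arr_Ob(1)[OF a]] .
    have "Map F a (x \<beta>) \<in> carrier (Grp F \<alpha>)"
      using hom_in_carrier[OF diagram_hom[OF F a] x[OF arr_Ob(2)[OF a]]] .
    then show ?thesis
      using A.inv_solve_right'[of "\<one>\<^bsub>Grp F \<alpha>\<^esub>" "Map F a (x \<beta>)" "x \<alpha>"] x[OF arr_Ob(1)[OF a]]
      by (simp add: cobd_0[OF a F])
  qed
  moreover have "(\<lambda>\<alpha>\<in>Ob C. x \<alpha>) \<in> carrier (lim_group (opposite C) F) \<longleftrightarrow>
    (\<forall>\<alpha> \<beta> a. arr C a \<alpha> \<beta> \<longrightarrow> Map F a (x \<beta>) = x \<alpha>)"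
    using x by (auto simp: lim_group_simps arr_def)
  ultimately show ?thesis
    by (auto simp: chain_Suc chain_0 arr_Ob) (blast dest: arr_Ob)
qed

end

text \<open>\<open>embedding\<close> is what \<open>injective_acyclic\<close> asks for:
  \<open>'h\<close> must hold the free groups on chains.\<close>

locale diagram_resolution = category C
  for C :: "('p, 'b, 'z) category_data_scheme" (structure) +
  fixes F :: "('p, 'b, 'g) ab_diagram" and R :: "('p, 'b, 'g, 'h) resolution"
  assumes F: "is_ab_diagram (opposite C) F" and R: "injective_resolution (opposite C) F R"
    and embedding: "(UNIV :: ('b list \<Rightarrow>\<^sub>0 int) set) \<lesssim> (UNIV :: 'h set)"
begin

abbreviation J :: "nat \<Rightarrow> ('p, 'b, 'h) ab_diagram" where "J \<equiv> Term R"
abbreviation d :: "nat \<Rightarrow> 'p \<Rightarrow> 'h \<Rightarrow> 'h" where "d \<equiv> Diff R"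
abbreviation lim_J :: "nat \<Rightarrow> ('p \<Rightarrow> 'h) monoid" where "lim_J n \<equiv> lim_group (opposite C) (J n)"

lemma J_injective: "injective_diagram (opposite C) (J n)"
  using R by (simp add: injective_resolution_def)

lemma J: "is_ab_diagram (opposite C) (J n)"
  using J_injective by (simp add: injective_diagram_def)

lemma d_nat: "is_ab_nat (opposite C) (J n) (J (Suc n)) (d n)"
  using R by (simp add: injective_resolution_def)

lemma d_hom: "\<alpha> \<in> Ob C \<Longrightarrow> d n \<alpha> \<in> hom (Grp (J n) \<alpha>) (Grp (J (Suc n)) \<alpha>)"
  using d_nat by (simp add: is_ab_nat_def)

lemma d_closed: "\<alpha> \<in> Ob C \<Longrightarrow> x \<in> carrier (Grp (J n) \<alpha>) \<Longrightarrow> d n \<alpha> x \<in> carrier (Grp (J (Suc n)) \<alpha>)"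
  using hom_in_carrier[OF d_hom] .

lemma aug_nat: "is_ab_nat (opposite C) F (J 0) (Aug R)"
  using R by (simp add: injective_resolution_def)

lemma aug_hom: "\<alpha> \<in> Ob C \<Longrightarrow> Aug R \<alpha> \<in> hom (Grp F \<alpha>) (Grp (J 0) \<alpha>)"
  using aug_nat by (simp add: is_ab_nat_def)

lemma d_group_hom: "\<alpha> \<in> Ob C \<Longrightarrow> group_hom (Grp (J n) \<alpha>) (Grp (J (Suc n)) \<alpha>) (d n \<alpha>)"
  by (intro group_hom.intro group_hom_axioms.intro d_hom) (auto intro: diagram_group[OF J] comm_group.axioms(2))

lemma aug_group_hom: "\<alpha> \<in> Ob C \<Longrightarrow> group_hom (Grp F \<alpha>) (Grp (J 0) \<alpha>) (Aug R \<alpha>)"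
  by (intro group_hom.intro group_hom_axioms.intro aug_hom)
    (auto intro: diagram_group[OF J] diagram_group[OF F] comm_group.axioms(2))

lemma aug_inj: "\<alpha> \<in> Ob C \<Longrightarrow> x \<in> carrier (Grp F \<alpha>) \<Longrightarrow> y \<in> carrier (Grp F \<alpha>) \<Longrightarrow> Aug R \<alpha> x = Aug R \<alpha> y \<Longrightarrow> x = y"
  using R by (auto simp: injective_resolution_def inj_on_def)

lemma d_aug: "\<alpha> \<in> Ob C \<Longrightarrow> x \<in> carrier (Grp F \<alpha>) \<Longrightarrow> d 0 \<alpha> (Aug R \<alpha> x) = \<one>\<^bsub>Grp (J 1) \<alpha>\<^esub>"
proof -
  assume "\<alpha> \<in> Ob C" "x \<in> carrier (Grp F \<alpha>)"
  moreover from this have "Aug R \<alpha> ` carrier (Grp F \<alpha>) = kernel (Grp (J 0) \<alpha>) (Grp (J 1) \<alpha>) (d 0 \<alpha>)"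
    using R by (simp add: injective_resolution_def)
  ultimately show ?thesis
    unfolding kernel_def by blast
qed

lemma aug_exact:
  assumes "\<alpha> \<in> Ob C" "y \<in> carrier (Grp (J 0) \<alpha>)" "d 0 \<alpha> y = \<one>\<^bsub>Grp (J 1) \<alpha>\<^esub>"
  shows "\<exists>x\<in>carrier (Grp F \<alpha>). Aug R \<alpha> x = y"
proof -
  have "Aug R \<alpha> ` carrier (Grp F \<alpha>) = kernel (Grp (J 0) \<alpha>) (Grp (J 1) \<alpha>) (d 0 \<alpha>)"
    using R assms(1) by (simp add: injective_resolution_def)
  moreover have "y \<in> kernel (Grp (J 0) \<alpha>) (Grp (J 1) \<alpha>) (d 0 \<alpha>)"
    using assms by (simp add: kernel_def)
  ultimately have "y \<in> Aug R \<alpha> ` carrier (Grp F \<alpha>)"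
    by simp
  then show ?thesis
    by auto
qed

lemma d_image: "\<alpha> \<in> Ob C \<Longrightarrow> d n \<alpha> ` carrier (Grp (J n) \<alpha>) =
    kernel (Grp (J (Suc n)) \<alpha>) (Grp (J (Suc (Suc n))) \<alpha>) (d (Suc n) \<alpha>)"
  using R by (simp add: injective_resolution_def)

lemma d_d: "\<alpha> \<in> Ob C \<Longrightarrow> x \<in> carrier (Grp (J n) \<alpha>) \<Longrightarrow> d (Suc n) \<alpha> (d n \<alpha> x) = \<one>\<^bsub>Grp (J (Suc (Suc n))) \<alpha>\<^esub>"
  using d_image unfolding kernel_def by blast

lemma d_exact:
  assumes "\<alpha> \<in> Ob C" "y \<in> carrier (Grp (J (Suc n)) \<alpha>)" "d (Suc n) \<alpha> y = \<one>\<^bsub>Grp (J (Suc (Suc n))) \<alpha>\<^esub>"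
  shows "\<exists>x\<in>carrier (Grp (J n) \<alpha>). d n \<alpha> x = y"
proof -
  have "y \<in> kernel (Grp (J (Suc n)) \<alpha>) (Grp (J (Suc (Suc n))) \<alpha>) (d (Suc n) \<alpha>)"
    using assms by (simp add: kernel_def)
  then have "y \<in> d n \<alpha> ` carrier (Grp (J n) \<alpha>)"
    using d_image[OF assms(1), of n] by simp
  then show ?thesis
    by auto
qed

lemma d_cobd:
  "cochain C (J n) k \<phi> \<Longrightarrow> chain C (Suc k) \<alpha> l \<Longrightarrow>
    d n \<alpha> (cobd C (J n) \<phi> \<alpha> l) = cobd C (J (Suc n)) (\<lambda>\<alpha> l. d n \<alpha> (\<phi> \<alpha> l)) \<alpha> l"
  by (rule cobd_nat[OF J J d_nat])

lemma cochain_d: "cochain C (J n) k \<phi> \<Longrightarrow> cochain C (J (Suc n)) k (\<lambda>\<alpha> l. d n \<alpha> (\<phi> \<alpha> l))"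
  using d_closed chain_Ob by (fastforce simp: cochain_def)

lemma cochain_aug: "cochain C F k \<phi> \<Longrightarrow> cochain C (J 0) k (\<lambda>\<alpha> l. Aug R \<alpha> (\<phi> \<alpha> l))"
  using hom_in_carrier[OF aug_hom] chain_Ob by (fastforce simp: cochain_def)

text \<open>A chase through the double complex of bar cochains with values in the resolution. A
  cocycle with values in the kernel of a differential is lifted through the preceding one; the
  coboundary of the lift is a cocycle one bar degree higher, with values in the previous kernel. At
  q = 0 that kernel is F, where \<open>vanish\<close> applies, and acyclicity of the injective terms
  brings the solution back.\<close>

lemma dimension_shift:
  assumes vanish: "\<And>p \<phi>. cochain C F (Suc (Suc p)) \<phi> \<Longrightarrow>
      (\<And>\<alpha> l. chain C (Suc (Suc (Suc p))) \<alpha> l \<Longrightarrow> cobd C F \<phi> \<alpha> l = \<one>\<^bsub>Grp F \<alpha>\<^esub>) \<Longrightarrow>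
      \<exists>\<kappa>. cochain C F (Suc p) \<kappa> \<and> (\<forall>\<alpha> l. chain C (Suc (Suc p)) \<alpha> l \<longrightarrow> \<phi> \<alpha> l = cobd C F \<kappa> \<alpha> l)"
    and pq: "1 \<le> q + p"
    and \<phi>: "cochain C (J q) (Suc p) \<phi>"
    and d\<phi>: "\<And>\<alpha> l. chain C (Suc p) \<alpha> l \<Longrightarrow> d q \<alpha> (\<phi> \<alpha> l) = \<one>\<^bsub>Grp (J (Suc q)) \<alpha>\<^esub>"
    and cocycle: "\<And>\<alpha> l. chain C (Suc (Suc p)) \<alpha> l \<Longrightarrow> cobd C (J q) \<phi> \<alpha> l = \<one>\<^bsub>Grp (J q) \<alpha>\<^esub>"
  shows "\<exists>\<kappa>. cochain C (J q) p \<kappa> \<and> (\<forall>\<alpha> l. chain C p \<alpha> l \<longrightarrow> d q \<alpha> (\<kappa> \<alpha> l) = \<one>\<^bsub>Grp (J (Suc q)) \<alpha>\<^esub>)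
     \<and> (\<forall>\<alpha> l. chain C (Suc p) \<alpha> l \<longrightarrow> \<phi> \<alpha> l = cobd C (J q) \<kappa> \<alpha> l)"
  using pq \<phi> d\<phi> cocycle
proof (induction q arbitrary: p \<phi>)
  case 0
  \<comment> \<open>q = 0 forces p \<ge> 1, so the cocycle has bar degree at least 2, the range of
    \<open>vanish\<close>.\<close>
  then obtain p' where p: "p = Suc p'" by (cases p) auto
  have "\<exists>x\<in>carrier (Grp F \<alpha>). Aug R \<alpha> x = \<phi> \<alpha> l" if "chain C (Suc p) \<alpha> l" for \<alpha> l
    using aug_exact[OF chain_Ob[OF that]] 0(2,3) that by (simp add: cochain_def)
  then obtain \<psi> where \<psi>: "\<And>\<alpha> l. chain C (Suc p) \<alpha> l \<Longrightarrow> \<psi> \<alpha> l \<in> carrier (Grp F \<alpha>) \<and> Aug R \<alpha> (\<psi> \<alpha> l) = \<phi> \<alpha> l"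
    by metis
  have \<psi>c: "cochain C F (Suc p) \<psi>" using \<psi> by (simp add: cochain_def)
  have "cobd C F \<psi> \<alpha> l = \<one>\<^bsub>Grp F \<alpha>\<^esub>" if l: "chain C (Suc (Suc p)) \<alpha> l" for \<alpha> l
  proof (rule aug_inj[OF chain_Ob[OF l]])
    interpret group_hom "Grp F \<alpha>" "Grp (J 0) \<alpha>" "Aug R \<alpha>" using aug_group_hom[OF chain_Ob[OF l]] .
    show "cobd C F \<psi> \<alpha> l \<in> carrier (Grp F \<alpha>)" using cobd_closed[OF F \<psi>c l] .
    show "\<one>\<^bsub>Grp F \<alpha>\<^esub> \<in> carrier (Grp F \<alpha>)" by simp
    have "Aug R \<alpha> (cobd C F \<psi> \<alpha> l) = cobd C (J 0) (\<lambda>\<alpha> l. Aug R \<alpha> (\<psi> \<alpha> l)) \<alpha> l"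
      by (rule cobd_nat[OF F J aug_nat \<psi>c l])
    also have "\<dots> = cobd C (J 0) \<phi> \<alpha> l"
      using \<psi> by (intro cobd_cong[OF J cochain_aug[OF \<psi>c] _ l]) auto
    finally show "Aug R \<alpha> (cobd C F \<psi> \<alpha> l) = Aug R \<alpha> \<one>\<^bsub>Grp F \<alpha>\<^esub>"
      using 0(4)[OF l] by simp
  qed
  then obtain \<kappa> where \<kappa>: "cochain C F p \<kappa>" "\<And>\<alpha> l. chain C (Suc p) \<alpha> l \<Longrightarrow> \<psi> \<alpha> l = cobd C F \<kappa> \<alpha> l"
    using vanish[of p' \<psi>] \<psi>c p by blast
  show ?case
  proof (intro exI[of _ "\<lambda>\<alpha> l. Aug R \<alpha> (\<kappa> \<alpha> l)"] conjI allI impI)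
    show "cochain C (J 0) p (\<lambda>\<alpha> l. Aug R \<alpha> (\<kappa> \<alpha> l))" using cochain_aug[OF \<kappa>(1)] .
    show "d 0 \<alpha> (Aug R \<alpha> (\<kappa> \<alpha> l)) = \<one>\<^bsub>Grp (J (Suc 0)) \<alpha>\<^esub>" if "chain C p \<alpha> l" for \<alpha> l
      using d_aug[OF chain_Ob[OF that]] \<kappa>(1) that by (simp add: cochain_def)
    show "\<phi> \<alpha> l = cobd C (J 0) (\<lambda>\<alpha> l. Aug R \<alpha> (\<kappa> \<alpha> l)) \<alpha> l" if l: "chain C (Suc p) \<alpha> l" for \<alpha> l
      using cobd_nat[OF F J aug_nat \<kappa>(1) l] \<psi>[OF l] \<kappa>(2)[OF l] by simp
  qed
next
  case (Suc q)
  have "\<exists>x\<in>carrier (Grp (J q) \<alpha>). d q \<alpha> x = \<phi> \<alpha> l" if "chain C (Suc p) \<alpha> l" for \<alpha> l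
    using d_exact[OF chain_Ob[OF that]] Suc(3,4) that by (simp add: cochain_def)
  then obtain \<eta> where \<eta>: "\<And>\<alpha> l. chain C (Suc p) \<alpha> l \<Longrightarrow> \<eta> \<alpha> l \<in> carrier (Grp (J q) \<alpha>) \<and> d q \<alpha> (\<eta> \<alpha> l) = \<phi> \<alpha> l"
    by metis
  have \<eta>c: "cochain C (J q) (Suc p) \<eta>" using \<eta> by (simp add: cochain_def)
  \<comment> \<open>The lift \<open>\<eta>\<close> of \<open>\<phi>\<close> need not be a cocycle,
    but its coboundary lies in the kernel of \<open>d q\<close>, and the induction hypothesis bounds
    it within that kernel.\<close>
  have "d q \<alpha> (cobd C (J q) \<eta> \<alpha> l) = \<one>\<^bsub>Grp (J (Suc q)) \<alpha>\<^esub>" if l: "chain C (Suc (Suc p)) \<alpha> l" for \<alpha> l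
    using d_cobd[OF \<eta>c l] cobd_cong[OF J cochain_d[OF \<eta>c] _ l, of \<phi>] \<eta> Suc(5)[OF l] by simp
  then obtain \<zeta> where \<zeta>: "cochain C (J q) (Suc p) \<zeta>"
    "\<And>\<alpha> l. chain C (Suc p) \<alpha> l \<Longrightarrow> d q \<alpha> (\<zeta> \<alpha> l) = \<one>\<^bsub>Grp (J (Suc q)) \<alpha>\<^esub>"
    "\<And>\<alpha> l. chain C (Suc (Suc p)) \<alpha> l \<Longrightarrow> cobd C (J q) \<eta> \<alpha> l = cobd C (J q) \<zeta> \<alpha> l"
    using Suc.IH[of "Suc p" "cobd C (J q) \<eta>"] cochain_cobd[OF J \<eta>c] cobd_cobd[OF J \<eta>c] by auto
  \<comment> \<open>Dividing by \<open>\<zeta>\<close> makes the lift a cocycle without changing its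
    image under \<open>d q\<close>.\<close>
  define \<xi> where "\<xi> \<alpha> l = \<eta> \<alpha> l \<otimes>\<^bsub>Grp (J q) \<alpha>\<^esub> inv\<^bsub>Grp (J q) \<alpha>\<^esub> \<zeta> \<alpha> l" for \<alpha> l
  have grp: "group (Grp (J q) \<alpha>)" if "\<alpha> \<in> Ob C" for \<alpha>
    using diagram_group[OF J that] by (rule comm_group.axioms(2))
  have i\<zeta>: "cochain C (J q) (Suc p) (\<lambda>\<alpha> l. inv\<^bsub>Grp (J q) \<alpha>\<^esub> \<zeta> \<alpha> l)"
    using \<zeta>(1) group.inv_closed[OF grp] chain_Ob by (fastforce simp: cochain_def)
  have \<xi>c: "cochain C (J q) (Suc p) \<xi>"
    unfolding cochain_def
  proof (intro allI impI)
    fix \<alpha> l assume l: "chain C (Suc p) \<alpha> l"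
    then show "\<xi> \<alpha> l \<in> carrier (Grp (J q) \<alpha>)"
      using \<eta>c i\<zeta> monoid.m_closed[OF group.is_monoid[OF grp[OF chain_Ob[OF l]]]]
      by (simp add: cochain_def \<xi>_def)
  qed
  have "cobd C (J q) \<xi> \<alpha> l = \<one>\<^bsub>Grp (J q) \<alpha>\<^esub>" if l: "chain C (Suc (Suc p)) \<alpha> l" for \<alpha> l
    unfolding \<xi>_def using cobd_mult[OF J \<eta>c i\<zeta> l] cobd_inv[OF J \<zeta>(1) l] \<zeta>(3)[OF l]
      group.r_inv[OF grp[OF chain_Ob[OF l]] cobd_closed[OF J \<zeta>(1) l]] by simp
  then obtain \<kappa> where \<kappa>: "cochain C (J q) p \<kappa>" "\<And>\<alpha> l. chain C (Suc p) \<alpha> l \<Longrightarrow> \<xi> \<alpha> l = cobd C (J q) \<kappa> \<alpha> l"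
    using injective_acyclic[OF J_injective embedding \<xi>c] by blast
  show ?case
  proof (intro exI[of _ "\<lambda>\<alpha> l. d q \<alpha> (\<kappa> \<alpha> l)"] conjI allI impI)
    show "cochain C (J (Suc q)) p (\<lambda>\<alpha> l. d q \<alpha> (\<kappa> \<alpha> l))" using cochain_d[OF \<kappa>(1)] .
    show "d (Suc q) \<alpha> (d q \<alpha> (\<kappa> \<alpha> l)) = \<one>\<^bsub>Grp (J (Suc (Suc q))) \<alpha>\<^esub>" if "chain C p \<alpha> l" for \<alpha> l
      using d_d[OF chain_Ob[OF that]] \<kappa>(1) that by (simp add: cochain_def)
    show "\<phi> \<alpha> l = cobd C (J (Suc q)) (\<lambda>\<alpha> l. d q \<alpha> (\<kappa> \<alpha> l)) \<alpha> l" if l: "chain C (Suc p) \<alpha> l" for \<alpha> l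
    proof -
      interpret group_hom "Grp (J q) \<alpha>" "Grp (J (Suc q)) \<alpha>" "d q \<alpha>" using d_group_hom[OF chain_Ob[OF l]] .
      have "\<zeta> \<alpha> l \<in> carrier (Grp (J q) \<alpha>)" using \<zeta>(1) l by (simp add: cochain_def)
      moreover have "\<phi> \<alpha> l \<in> carrier (Grp (J (Suc q)) \<alpha>)" using Suc(3) l by (simp add: cochain_def)
      ultimately have "d q \<alpha> (\<xi> \<alpha> l) = \<phi> \<alpha> l"
        using \<eta>[OF l] \<zeta>(2)[OF l] by (simp add: \<xi>_def)
      then show ?thesis
        using d_cobd[OF \<kappa>(1) l] \<kappa>(2)[OF l] by simp
    qed
  qed
qed

lemma lim_J_comm_group: "comm_group (lim_J n)"
  by (rule comm_group_lim_group[OF J])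

lemma lim_d_hom: "lim_map (opposite C) (d n) \<in> hom (lim_J n) (lim_J (Suc n))"
  by (rule lim_map_hom[OF J d_nat])

lemma lim_d_group_hom: "group_hom (lim_J n) (lim_J (Suc n)) (lim_map (opposite C) (d n))"
  by (intro group_hom.intro group_hom_axioms.intro lim_d_hom comm_group.axioms(2)[OF lim_J_comm_group])

lemma lim_J_closed: "z \<in> carrier (lim_J n) \<Longrightarrow> \<alpha> \<in> Ob C \<Longrightarrow> z \<alpha> \<in> carrier (Grp (J n) \<alpha>)"
  by (auto simp: lim_group_simps)

lemma lim_J_restrict: "z \<in> carrier (lim_J n) \<Longrightarrow> (\<lambda>\<alpha>\<in>Ob C. z \<alpha>) = z"
  by (auto simp: lim_group_simps PiE_restrict)

lemma lim_cocycles_iff: "z \<in> lim_cocycles (opposite C) R n \<longleftrightarrow>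
    z \<in> carrier (lim_J n) \<and> (\<forall>\<alpha>\<in>Ob C. d n \<alpha> (z \<alpha>) = \<one>\<^bsub>Grp (J (Suc n)) \<alpha>\<^esub>)"
  by (auto simp: lim_cocycles_def kernel_def lim_group_simps lim_map_def fun_eq_iff restrict_def)

lemma cocycles_subgroup: "subgroup (lim_cocycles (opposite C) R n) (lim_J n)"
  unfolding lim_cocycles_def by (rule group_hom.subgroup_kernel[OF lim_d_group_hom])

lemma coboundaries_le_cocycles:
  "lim_coboundaries (opposite C) R n \<subseteq> lim_cocycles (opposite C) R n"
proof (cases n)
  case 0
  then show ?thesis
    using subgroup.one_closed[OF cocycles_subgroup] by simp
next
  case (Suc m)
  have "lim_map (opposite C) (d m) x \<in> lim_cocycles (opposite C) R (Suc m)" if "x \<in> carrier (lim_J m)" for x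
    using hom_in_carrier[OF lim_d_hom that] d_d lim_J_closed[OF that]
    by (simp add: lim_cocycles_iff lim_map_def)
  then show ?thesis using Suc by auto
qed

abbreviation cocycle_group :: "nat \<Rightarrow> ('p \<Rightarrow> 'h) monoid" where
  "cocycle_group n \<equiv> (lim_J n)\<lparr>carrier := lim_cocycles (opposite C) R n\<rparr>"

lemma cocycle_comm_group: "comm_group (cocycle_group n)"
proof (rule group.group_comm_groupI)
  show "group (cocycle_group n)"
    using subgroup.subgroup_is_group[OF cocycles_subgroup comm_group.axioms(2)[OF lim_J_comm_group]] .
  fix x y assume "x \<in> carrier (cocycle_group n)" "y \<in> carrier (cocycle_group n)"
  then show "x \<otimes>\<^bsub>cocycle_group n\<^esub> y = y \<otimes>\<^bsub>cocycle_group n\<^esub> x"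
    using comm_monoid.m_comm[OF comm_group.axioms(1)[OF lim_J_comm_group]]
    by (simp add: lim_cocycles_iff)
qed

lemma coboundaries_subgroup: "subgroup (lim_coboundaries (opposite C) R n) (cocycle_group n)"
proof -
  have "subgroup (lim_coboundaries (opposite C) R n) (lim_J n)"
  proof (cases n)
    case 0
    then show ?thesis
      using group.triv_subgroup[OF comm_group.axioms(2)[OF lim_J_comm_group]] by simp
  next
    case (Suc m)
    then show ?thesis
      using group_hom.img_is_subgroup[OF lim_d_group_hom] by simp
  qed
  then show ?thesis
    using group.subgroup_incl[OF comm_group.axioms(2)[OF lim_J_comm_group] _ cocycles_subgroup
        coboundaries_le_cocycles] by blast
qed

lemma coboundaries_normal: "normal (lim_coboundaries (opposite C) R n) (cocycle_group n)"
  by (rule comm_group.subgroup_imp_normal[OF cocycle_comm_group coboundaries_subgroup])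

lemma derived_lim_group: "group (derived_lim (opposite C) R n)"
  unfolding derived_lim_def by (rule normal.factorgroup_is_group[OF coboundaries_normal])

text \<open>A cocycle of degree Suc q in the limit is the image under \<open>d q\<close> of a family
  \<open>x\<close>, whose failure to be compatible is \<open>cobd\<close> of \<open>x\<close>. This
  defect has values in the kernel of \<open>d q\<close>, so for q \<ge> 1
  \<open>dimension_shift\<close> writes it as the coboundary of some \<open>\<zeta>\<close> with
  values in the same kernel. Dividing \<open>x\<close> by \<open>\<zeta>\<close> makes it compatible
  and keeps its image.\<close>

lemma derived_lim_trivial:
  assumes vanish: "\<And>p \<phi>. cochain C F (Suc (Suc p)) \<phi> \<Longrightarrow>
      (\<And>\<alpha> l. chain C (Suc (Suc (Suc p))) \<alpha> l \<Longrightarrow> cobd C F \<phi> \<alpha> l = \<one>\<^bsub>Grp F \<alpha>\<^esub>) \<Longrightarrow>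
      \<exists>\<kappa>. cochain C F (Suc p) \<kappa> \<and> (\<forall>\<alpha> l. chain C (Suc (Suc p)) \<alpha> l \<longrightarrow> \<phi> \<alpha> l = cobd C F \<kappa> \<alpha> l)"
    and i: "2 \<le> i"
  shows "trivial_group (derived_lim (opposite C) R i)"
proof -
  obtain q where q: "i = Suc q" "1 \<le> q" using i by (cases i) auto
  have "z \<in> lim_coboundaries (opposite C) R i" if z: "z \<in> lim_cocycles (opposite C) R i" for z
  proof -
    have zl: "z \<in> carrier (lim_J (Suc q))" and dz: "\<And>\<alpha>. \<alpha> \<in> Ob C \<Longrightarrow> d (Suc q) \<alpha> (z \<alpha>) = \<one>\<^bsub>Grp (J (Suc (Suc q))) \<alpha>\<^esub>"
      using z q by (auto simp: lim_cocycles_iff)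
    have "\<exists>x\<in>carrier (Grp (J q) \<alpha>). d q \<alpha> x = z \<alpha>" if "\<alpha> \<in> Ob C" for \<alpha>
      using d_exact[OF that lim_J_closed[OF zl that] dz[OF that]] .
    then obtain x where x: "\<And>\<alpha>. \<alpha> \<in> Ob C \<Longrightarrow> x \<alpha> \<in> carrier (Grp (J q) \<alpha>) \<and> d q \<alpha> (x \<alpha>) = z \<alpha>"
      by metis
    have xc: "cochain C (J q) 0 (\<lambda>\<alpha> l. x \<alpha>)" using x by (simp add: cochain_def chain_0)
    have "d q \<alpha> (cobd C (J q) (\<lambda>\<alpha> l. x \<alpha>) \<alpha> l) = \<one>\<^bsub>Grp (J (Suc q)) \<alpha>\<^esub>" if l: "chain C (Suc 0) \<alpha> l" for \<alpha> l
    proof -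
      have "d q \<alpha> (cobd C (J q) (\<lambda>\<alpha> l. x \<alpha>) \<alpha> l) = cobd C (J (Suc q)) (\<lambda>\<alpha> l. z \<alpha>) \<alpha> l"
        using d_cobd[OF xc l] cobd_cong[OF J cochain_d[OF xc] _ l, of "\<lambda>\<alpha> l. z \<alpha>"] x by (simp add: chain_0)
      also have "\<dots> = \<one>\<^bsub>Grp (J (Suc q)) \<alpha>\<^esub>"
        using lim_iff_cobd[OF J lim_J_closed[OF zl]] zl l lim_J_restrict[OF zl] by simp
      finally show ?thesis .
    qed
    then obtain \<zeta> where \<zeta>: "cochain C (J q) 0 \<zeta>"
      "\<And>\<alpha> l. chain C 0 \<alpha> l \<Longrightarrow> d q \<alpha> (\<zeta> \<alpha> l) = \<one>\<^bsub>Grp (J (Suc q)) \<alpha>\<^esub>"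
      "\<And>\<alpha> l. chain C (Suc 0) \<alpha> l \<Longrightarrow> cobd C (J q) (\<lambda>\<alpha> l. x \<alpha>) \<alpha> l = cobd C (J q) \<zeta> \<alpha> l"
      using dimension_shift[OF vanish, of q 0 "cobd C (J q) (\<lambda>\<alpha> l. x \<alpha>)"] q(2)
        cochain_cobd[OF J xc] cobd_cobd[OF J xc] by auto
    \<comment> \<open>The only 0-chain at an object is the empty list, so \<open>\<zeta>\<close>
      amounts to a family of elements.\<close>
    define w where "w \<alpha> = inv\<^bsub>Grp (J q) \<alpha>\<^esub> \<zeta> \<alpha> []" for \<alpha>
    have grp: "group (Grp (J q) \<alpha>)" if "\<alpha> \<in> Ob C" for \<alpha>
      using diagram_group[OF J that] by (rule comm_group.axioms(2))
    have \<zeta>0: "\<zeta> \<alpha> [] \<in> carrier (Grp (J q) \<alpha>)" "d q \<alpha> (\<zeta> \<alpha> []) = \<one>\<^bsub>Grp (J (Suc q)) \<alpha>\<^esub>" if "\<alpha> \<in> Ob C" for \<alpha>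
      using \<zeta>(1,2) that by (auto simp: cochain_def chain_0)
    have wc: "cochain C (J q) 0 (\<lambda>\<alpha> l. w \<alpha>)"
      using \<zeta>0 group.inv_closed[OF grp] by (simp add: cochain_def chain_0 w_def)
    define y where "y \<alpha> = x \<alpha> \<otimes>\<^bsub>Grp (J q) \<alpha>\<^esub> w \<alpha>" for \<alpha>
    have y: "y \<alpha> \<in> carrier (Grp (J q) \<alpha>)" if "\<alpha> \<in> Ob C" for \<alpha>
      using x wc that monoid.m_closed[OF group.is_monoid[OF grp]] by (simp add: y_def cochain_def chain_0)
    have "cobd C (J q) (\<lambda>\<alpha> l. y \<alpha>) \<alpha> l = \<one>\<^bsub>Grp (J q) \<alpha>\<^esub>" if l: "chain C (Suc 0) \<alpha> l" for \<alpha> l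
    proof -
      have i\<zeta>: "cochain C (J q) 0 (\<lambda>\<alpha> l. inv\<^bsub>Grp (J q) \<alpha>\<^esub> \<zeta> \<alpha> l)"
        using \<zeta>0 group.inv_closed[OF grp] by (simp add: cochain_def chain_0)
      have "cobd C (J q) (\<lambda>\<alpha> l. w \<alpha>) \<alpha> l = cobd C (J q) (\<lambda>\<alpha> l. inv\<^bsub>Grp (J q) \<alpha>\<^esub> \<zeta> \<alpha> l) \<alpha> l"
        by (rule cobd_cong[OF J wc _ l]) (simp add: w_def chain_0)
      then have "cobd C (J q) (\<lambda>\<alpha> l. w \<alpha>) \<alpha> l = inv\<^bsub>Grp (J q) \<alpha>\<^esub> cobd C (J q) \<zeta> \<alpha> l"
        using cobd_inv[OF J \<zeta>(1) l] by simp
      then show ?thesis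
        unfolding y_def using cobd_mult[OF J xc wc l] \<zeta>(3)[OF l]
          group.r_inv[OF grp[OF chain_Ob[OF l]] cobd_closed[OF J \<zeta>(1) l]] by simp
    qed
    then have yl: "(\<lambda>\<alpha>\<in>Ob C. y \<alpha>) \<in> carrier (lim_J q)"
      using lim_iff_cobd[OF J y] by blast
    have "d q \<alpha> (y \<alpha>) = z \<alpha>" if \<alpha>: "\<alpha> \<in> Ob C" for \<alpha>
    proof -
      interpret group_hom "Grp (J q) \<alpha>" "Grp (J (Suc q)) \<alpha>" "d q \<alpha>" using d_group_hom[OF \<alpha>] .
      show ?thesis
        using x[OF \<alpha>] \<zeta>0[OF \<alpha>] lim_J_closed[OF zl \<alpha>] by (simp add: y_def w_def)
    qed
    then have "lim_map (opposite C) (d q) (\<lambda>\<alpha>\<in>Ob C. y \<alpha>) = (\<lambda>\<alpha>\<in>Ob C. z \<alpha>)"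
      by (auto simp: lim_map_def)
    then show ?thesis
      using yl lim_J_restrict[OF zl] q by (auto simp: image_iff)
  qed
  then have eq: "lim_coboundaries (opposite C) R i = lim_cocycles (opposite C) R i"
    using coboundaries_le_cocycles by blast
  interpret N: normal "lim_coboundaries (opposite C) R i" "cocycle_group i"
    by (rule coboundaries_normal)
  have "carrier (derived_lim (opposite C) R i) = {\<one>\<^bsub>derived_lim (opposite C) R i\<^esub>}"
  proof -
    have "lim_coboundaries (opposite C) R i #>\<^bsub>cocycle_group i\<^esub> z = lim_coboundaries (opposite C) R i"
      if "z \<in> carrier (cocycle_group i)" for z
      using that N.rcos_const[OF N.is_group] eq by simp
    moreover have "carrier (cocycle_group i) \<noteq> {}"
      using N.one_closed by blast
    ultimately show ?thesis
      unfolding derived_lim_def FactGroup_def RCOSETS_def by auto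
  qed
  then show ?thesis
    using derived_lim_group by (simp add: trivial_group_def)
qed

end

section \<open>The first derived limit and bar cocycles of degree 1\<close>

context diagram_resolution
begin

text \<open>\<open>rep z \<phi>\<close>: the 1-cocycle \<open>\<phi>\<close> with values in \<open>F\<close> arises from the cocycle \<open>z\<close> of \<open>lim J\<close> by
  choosing preimages of \<open>z\<close> in \<open>J 0\<close> objectwise.\<close>

definition rep :: "('p \<Rightarrow> 'h) \<Rightarrow> ('p \<Rightarrow> 'b list \<Rightarrow> 'g) \<Rightarrow> bool" where
  "rep z \<phi> \<longleftrightarrow> cochain C F (Suc 0) \<phi> \<and>
     (\<exists>x. (\<forall>\<alpha>\<in>Ob C. x \<alpha> \<in> carrier (Grp (J 0) \<alpha>) \<and> d 0 \<alpha> (x \<alpha>) = z \<alpha>) \<and>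
       (\<forall>\<alpha> l. chain C (Suc 0) \<alpha> l \<longrightarrow> Aug R \<alpha> (\<phi> \<alpha> l) = cobd C (J 0) (\<lambda>\<alpha> l. x \<alpha>) \<alpha> l))"

definition cocycle1 :: "('p \<Rightarrow> 'b list \<Rightarrow> 'g) \<Rightarrow> bool" where
  "cocycle1 \<phi> \<longleftrightarrow> cochain C F (Suc 0) \<phi> \<and>
     (\<forall>\<alpha> l. chain C (Suc (Suc 0)) \<alpha> l \<longrightarrow> cobd C F \<phi> \<alpha> l = \<one>\<^bsub>Grp F \<alpha>\<^esub>)"

definition coboundary1 :: "('p \<Rightarrow> 'b list \<Rightarrow> 'g) \<Rightarrow> bool" where
  "coboundary1 \<phi> \<longleftrightarrow> (\<exists>\<kappa>. cochain C F 0 \<kappa> \<and> (\<forall>\<alpha> l. chain C (Suc 0) \<alpha> l \<longrightarrow> \<phi> \<alpha> l = cobd C F \<kappa> \<alpha> l))"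

abbreviation cmult :: "('p \<Rightarrow> 'b list \<Rightarrow> 'g) \<Rightarrow> ('p \<Rightarrow> 'b list \<Rightarrow> 'g) \<Rightarrow> 'p \<Rightarrow> 'b list \<Rightarrow> 'g" where
  "cmult \<phi> \<psi> \<equiv> \<lambda>\<alpha> l. \<phi> \<alpha> l \<otimes>\<^bsub>Grp F \<alpha>\<^esub> \<psi> \<alpha> l"

abbreviation cinv :: "('p \<Rightarrow> 'b list \<Rightarrow> 'g) \<Rightarrow> 'p \<Rightarrow> 'b list \<Rightarrow> 'g" where
  "cinv \<phi> \<equiv> \<lambda>\<alpha> l. inv\<^bsub>Grp F \<alpha>\<^esub> \<phi> \<alpha> l"

lemma F_group: "\<alpha> \<in> Ob C \<Longrightarrow> group (Grp F \<alpha>)"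
  using diagram_group[OF F] by (auto dest: comm_group.axioms(2))

lemma J_group: "\<alpha> \<in> Ob C \<Longrightarrow> group (Grp (J n) \<alpha>)"
  using diagram_group[OF J] by (auto dest: comm_group.axioms(2))

lemma cochain_cmult: "cochain C F n \<phi> \<Longrightarrow> cochain C F n \<psi> \<Longrightarrow> cochain C F n (cmult \<phi> \<psi>)"
  using monoid.m_closed[OF group.is_monoid[OF F_group[OF chain_Ob]]] by (simp add: cochain_def)

lemma cochain_cinv: "cochain C F n \<phi> \<Longrightarrow> cochain C F n (cinv \<phi>)"
  using group.inv_closed[OF F_group[OF chain_Ob]] by (simp add: cochain_def)

text \<open>\<open>d 0\<close> sends the coboundary of the preimages to the coboundary of the
  compatible family \<open>z\<close>, which is trivial; hence it comes from F along the
  augmentation.\<close>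

lemma rep_ex:
  assumes z: "z \<in> lim_cocycles (opposite C) R (Suc 0)"
  shows "\<exists>\<phi>. rep z \<phi>"
proof -
  have zl: "z \<in> carrier (lim_J (Suc 0))" and dz: "\<And>\<alpha>. \<alpha> \<in> Ob C \<Longrightarrow> d (Suc 0) \<alpha> (z \<alpha>) = \<one>\<^bsub>Grp (J (Suc (Suc 0))) \<alpha>\<^esub>"
    using z by (auto simp: lim_cocycles_iff)
  have "\<exists>x\<in>carrier (Grp (J 0) \<alpha>). d 0 \<alpha> x = z \<alpha>" if "\<alpha> \<in> Ob C" for \<alpha>
    using d_exact[OF that lim_J_closed[OF zl that] dz[OF that]] .
  then obtain x where x: "\<And>\<alpha>. \<alpha> \<in> Ob C \<Longrightarrow> x \<alpha> \<in> carrier (Grp (J 0) \<alpha>) \<and> d 0 \<alpha> (x \<alpha>) = z \<alpha>"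
    by metis
  have xc: "cochain C (J 0) 0 (\<lambda>\<alpha> l. x \<alpha>)" using x by (simp add: cochain_def chain_0)
  have "\<exists>y\<in>carrier (Grp F \<alpha>). Aug R \<alpha> y = cobd C (J 0) (\<lambda>\<alpha> l. x \<alpha>) \<alpha> l" if l: "chain C (Suc 0) \<alpha> l" for \<alpha> l
  proof (rule aug_exact[OF chain_Ob[OF l] cobd_closed[OF J xc l]])
    have "d 0 \<alpha> (cobd C (J 0) (\<lambda>\<alpha> l. x \<alpha>) \<alpha> l) = cobd C (J (Suc 0)) (\<lambda>\<alpha> l. z \<alpha>) \<alpha> l"
      using d_cobd[OF xc l] cobd_cong[OF J cochain_d[OF xc] _ l, of "\<lambda>\<alpha> l. z \<alpha>"] x by (simp add: chain_0)
    also have "\<dots> = \<one>\<^bsub>Grp (J (Suc 0)) \<alpha>\<^esub>"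
      using lim_iff_cobd[OF J lim_J_closed[OF zl]] zl l lim_J_restrict[OF zl] by simp
    finally show "d 0 \<alpha> (cobd C (J 0) (\<lambda>\<alpha> l. x \<alpha>) \<alpha> l) = \<one>\<^bsub>Grp (J 1) \<alpha>\<^esub>" by simp
  qed
  then obtain \<phi> where \<phi>: "\<And>\<alpha> l. chain C (Suc 0) \<alpha> l \<Longrightarrow>
      \<phi> \<alpha> l \<in> carrier (Grp F \<alpha>) \<and> Aug R \<alpha> (\<phi> \<alpha> l) = cobd C (J 0) (\<lambda>\<alpha> l. x \<alpha>) \<alpha> l"
    by metis
  then have "rep z \<phi>"
    unfolding rep_def using x by (auto simp: cochain_def)
  then show ?thesis by blast
qed

lemma rep_cocycle:
  assumes "rep z \<phi>"
  shows "cocycle1 \<phi>"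
proof -
  obtain x where x: "\<And>\<alpha>. \<alpha> \<in> Ob C \<Longrightarrow> x \<alpha> \<in> carrier (Grp (J 0) \<alpha>)"
    and eq: "\<And>\<alpha> l. chain C (Suc 0) \<alpha> l \<Longrightarrow> Aug R \<alpha> (\<phi> \<alpha> l) = cobd C (J 0) (\<lambda>\<alpha> l. x \<alpha>) \<alpha> l"
    and \<phi>: "cochain C F (Suc 0) \<phi>"
    using assms by (auto simp: rep_def)
  have xc: "cochain C (J 0) 0 (\<lambda>\<alpha> l. x \<alpha>)" using x by (simp add: cochain_def chain_0)
  have "cobd C F \<phi> \<alpha> l = \<one>\<^bsub>Grp F \<alpha>\<^esub>" if l: "chain C (Suc (Suc 0)) \<alpha> l" for \<alpha> l
  proof (rule aug_inj[OF chain_Ob[OF l] cobd_closed[OF F \<phi> l]])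
    interpret group_hom "Grp F \<alpha>" "Grp (J 0) \<alpha>" "Aug R \<alpha>" using aug_group_hom[OF chain_Ob[OF l]] .
    show "\<one>\<^bsub>Grp F \<alpha>\<^esub> \<in> carrier (Grp F \<alpha>)" by simp
    have "Aug R \<alpha> (cobd C F \<phi> \<alpha> l) = cobd C (J 0) (\<lambda>\<alpha> l. Aug R \<alpha> (\<phi> \<alpha> l)) \<alpha> l"
      by (rule cobd_nat[OF F J aug_nat \<phi> l])
    also have "\<dots> = cobd C (J 0) (cobd C (J 0) (\<lambda>\<alpha> l. x \<alpha>)) \<alpha> l"
      by (rule cobd_cong[OF J cochain_aug[OF \<phi>] eq l])
    finally show "Aug R \<alpha> (cobd C F \<phi> \<alpha> l) = Aug R \<alpha> \<one>\<^bsub>Grp F \<alpha>\<^esub>"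
      using cobd_cobd[OF J xc l] by simp
  qed
  with \<phi> show ?thesis by (simp add: cocycle1_def)
qed

lemma rep_mult:
  assumes "rep z \<phi>" "rep z' \<phi>'"
  shows "rep (z \<otimes>\<^bsub>lim_J (Suc 0)\<^esub> z') (cmult \<phi> \<phi>')"
proof -
  obtain x where x: "\<And>\<alpha>. \<alpha> \<in> Ob C \<Longrightarrow> x \<alpha> \<in> carrier (Grp (J 0) \<alpha>) \<and> d 0 \<alpha> (x \<alpha>) = z \<alpha>"
    and eq: "\<And>\<alpha> l. chain C (Suc 0) \<alpha> l \<Longrightarrow> Aug R \<alpha> (\<phi> \<alpha> l) = cobd C (J 0) (\<lambda>\<alpha> l. x \<alpha>) \<alpha> l"
    and \<phi>: "cochain C F (Suc 0) \<phi>"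
    using assms(1) by (auto simp: rep_def)
  obtain x' where x': "\<And>\<alpha>. \<alpha> \<in> Ob C \<Longrightarrow> x' \<alpha> \<in> carrier (Grp (J 0) \<alpha>) \<and> d 0 \<alpha> (x' \<alpha>) = z' \<alpha>"
    and eq': "\<And>\<alpha> l. chain C (Suc 0) \<alpha> l \<Longrightarrow> Aug R \<alpha> (\<phi>' \<alpha> l) = cobd C (J 0) (\<lambda>\<alpha> l. x' \<alpha>) \<alpha> l"
    and \<phi>': "cochain C F (Suc 0) \<phi>'"
    using assms(2) by (auto simp: rep_def)
  have xc: "cochain C (J 0) 0 (\<lambda>\<alpha> l. x \<alpha>)" "cochain C (J 0) 0 (\<lambda>\<alpha> l. x' \<alpha>)"
    using x x' by (simp_all add: cochain_def chain_0)
  let ?y = "\<lambda>\<alpha>. x \<alpha> \<otimes>\<^bsub>Grp (J 0) \<alpha>\<^esub> x' \<alpha>"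
  show ?thesis
    unfolding rep_def
  proof (intro conjI exI[of _ ?y] ballI allI impI)
    show "cochain C F (Suc 0) (cmult \<phi> \<phi>')" using \<phi> \<phi>' by (rule cochain_cmult)
    fix \<alpha> assume \<alpha>: "\<alpha> \<in> Ob C"
    show "?y \<alpha> \<in> carrier (Grp (J 0) \<alpha>)"
      using x[OF \<alpha>] x'[OF \<alpha>] monoid.m_closed[OF group.is_monoid[OF J_group[OF \<alpha>]]] by simp
    show "d 0 \<alpha> (?y \<alpha>) = (z \<otimes>\<^bsub>lim_J (Suc 0)\<^esub> z') \<alpha>"
      using x[OF \<alpha>] x'[OF \<alpha>] hom_mult[OF d_hom[OF \<alpha>]] \<alpha> by (simp add: lim_group_simps)
  next
    fix \<alpha> l assume l: "chain C (Suc 0) \<alpha> l"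
    then have "\<phi> \<alpha> l \<in> carrier (Grp F \<alpha>)" "\<phi>' \<alpha> l \<in> carrier (Grp F \<alpha>)"
      using \<phi> \<phi>' by (auto simp: cochain_def)
    then show "Aug R \<alpha> (cmult \<phi> \<phi>' \<alpha> l) = cobd C (J 0) (\<lambda>\<alpha> l. ?y \<alpha>) \<alpha> l"
      using cobd_mult[OF J xc l] eq[OF l] eq'[OF l] hom_mult[OF aug_hom[OF chain_Ob[OF l]]] by simp
  qed
qed

lemma rep_inv:
  assumes "rep z \<phi>" and z: "z \<in> lim_cocycles (opposite C) R (Suc 0)"
  shows "rep (inv\<^bsub>cocycle_group (Suc 0)\<^esub> z) (cinv \<phi>)"
proof -
  obtain x where x: "\<And>\<alpha>. \<alpha> \<in> Ob C \<Longrightarrow> x \<alpha> \<in> carrier (Grp (J 0) \<alpha>) \<and> d 0 \<alpha> (x \<alpha>) = z \<alpha>"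
    and eq: "\<And>\<alpha> l. chain C (Suc 0) \<alpha> l \<Longrightarrow> Aug R \<alpha> (\<phi> \<alpha> l) = cobd C (J 0) (\<lambda>\<alpha> l. x \<alpha>) \<alpha> l"
    and \<phi>: "cochain C F (Suc 0) \<phi>"
    using assms(1) by (auto simp: rep_def)
  interpret Z: comm_group "cocycle_group (Suc 0)" by (rule cocycle_comm_group)
  have xc: "cochain C (J 0) 0 (\<lambda>\<alpha> l. x \<alpha>)"
    using x by (simp_all add: cochain_def chain_0)
  let ?y = "\<lambda>\<alpha>. inv\<^bsub>Grp (J 0) \<alpha>\<^esub> x \<alpha>"
  show ?thesis
    unfolding rep_def
  proof (intro conjI exI[of _ ?y] ballI allI impI)
    show "cochain C F (Suc 0) (cinv \<phi>)" using \<phi> by (rule cochain_cinv)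
    fix \<alpha> assume \<alpha>: "\<alpha> \<in> Ob C"
    interpret group_hom "Grp (J 0) \<alpha>" "Grp (J (Suc 0)) \<alpha>" "d 0 \<alpha>" using d_group_hom[OF \<alpha>] .
    show "?y \<alpha> \<in> carrier (Grp (J 0) \<alpha>)"
      using x[OF \<alpha>] by simp
    have iz: "inv\<^bsub>cocycle_group (Suc 0)\<^esub> z \<in> lim_cocycles (opposite C) R (Suc 0)"
      using Z.inv_closed[of z] z by simp
    have "inv\<^bsub>cocycle_group (Suc 0)\<^esub> z \<otimes>\<^bsub>lim_J (Suc 0)\<^esub> z = \<one>\<^bsub>lim_J (Suc 0)\<^esub>"
      using Z.l_inv[of z] z by simp
    from fun_cong[OF this, of \<alpha>]
    have "(inv\<^bsub>cocycle_group (Suc 0)\<^esub> z) \<alpha> \<otimes>\<^bsub>Grp (J (Suc 0)) \<alpha>\<^esub> z \<alpha> = \<one>\<^bsub>Grp (J (Suc 0)) \<alpha>\<^esub>"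
      using \<alpha> by (simp add: lim_group_simps)
    moreover have "(inv\<^bsub>cocycle_group (Suc 0)\<^esub> z) \<alpha> \<in> carrier (Grp (J (Suc 0)) \<alpha>)" "z \<alpha> \<in> carrier (Grp (J (Suc 0)) \<alpha>)"
      using lim_J_closed[OF _ \<alpha>] iz z by (auto simp: lim_cocycles_iff)
    ultimately have "inv\<^bsub>Grp (J (Suc 0)) \<alpha>\<^esub> z \<alpha> = (inv\<^bsub>cocycle_group (Suc 0)\<^esub> z) \<alpha>"
      using H.inv_equality by blast
    then show "d 0 \<alpha> (?y \<alpha>) = (inv\<^bsub>cocycle_group (Suc 0)\<^esub> z) \<alpha>"
      using x[OF \<alpha>] hom_inv[of "x \<alpha>"] by simp
  next
    fix \<alpha> l assume l: "chain C (Suc 0) \<alpha> l"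
    interpret group_hom "Grp F \<alpha>" "Grp (J 0) \<alpha>" "Aug R \<alpha>" using aug_group_hom[OF chain_Ob[OF l]] .
    have "\<phi> \<alpha> l \<in> carrier (Grp F \<alpha>)"
      using \<phi> l by (auto simp: cochain_def)
    then show "Aug R \<alpha> (cinv \<phi> \<alpha> l) = cobd C (J 0) (\<lambda>\<alpha> l. ?y \<alpha>) \<alpha> l"
      using cobd_inv[OF J xc l] eq[OF l] by simp
  qed
qed

text \<open>Acyclicity of the first injective term writes the image of \<open>\<phi>\<close> as the
  coboundary of a family \<open>x\<close>. Applying \<open>d 0\<close> to \<open>x\<close> yields a
  compatible family, and this is \<open>z\<close>.\<close>

lemma rep_surj:
  assumes \<phi>: "cocycle1 \<phi>"
  shows "\<exists>z\<in>lim_cocycles (opposite C) R (Suc 0). rep z \<phi>"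
proof -
  have \<phi>c: "cochain C F (Suc 0) \<phi>" using \<phi> by (simp add: cocycle1_def)
  let ?\<psi> = "\<lambda>\<alpha> l. Aug R \<alpha> (\<phi> \<alpha> l)"
  have \<psi>c: "cochain C (J 0) (Suc 0) ?\<psi>" using cochain_aug[OF \<phi>c] .
  have "cobd C (J 0) ?\<psi> \<alpha> l = \<one>\<^bsub>Grp (J 0) \<alpha>\<^esub>" if l: "chain C (Suc (Suc 0)) \<alpha> l" for \<alpha> l
    using cobd_nat[OF F J aug_nat \<phi>c l] \<phi> l group_hom.hom_one[OF aug_group_hom[OF chain_Ob[OF l]]]
    by (simp add: cocycle1_def)
  then obtain \<kappa> where \<kappa>: "cochain C (J 0) 0 \<kappa>" "\<And>\<alpha> l. chain C (Suc 0) \<alpha> l \<Longrightarrow> ?\<psi> \<alpha> l = cobd C (J 0) \<kappa> \<alpha> l"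
    using injective_acyclic[OF J_injective embedding \<psi>c] by blast
  define x where "x \<alpha> = \<kappa> \<alpha> []" for \<alpha>
  have x: "x \<alpha> \<in> carrier (Grp (J 0) \<alpha>)" if "\<alpha> \<in> Ob C" for \<alpha>
    using \<kappa>(1) that by (simp add: x_def cochain_def chain_0)
  have xc: "cochain C (J 0) 0 (\<lambda>\<alpha> l. x \<alpha>)"
    using x by (simp_all add: cochain_def chain_0)
  have eq: "?\<psi> \<alpha> l = cobd C (J 0) (\<lambda>\<alpha> l. x \<alpha>) \<alpha> l" if l: "chain C (Suc 0) \<alpha> l" for \<alpha> l
    using \<kappa>(2)[OF l] cobd_cong[OF J \<kappa>(1) _ l, of "\<lambda>\<alpha> l. x \<alpha>"] by (simp add: x_def chain_0)
  define z where "z = (\<lambda>\<alpha>\<in>Ob C. d 0 \<alpha> (x \<alpha>))"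
  have "cobd C (J (Suc 0)) (\<lambda>\<alpha> l. d 0 \<alpha> (x \<alpha>)) \<alpha> l = \<one>\<^bsub>Grp (J (Suc 0)) \<alpha>\<^esub>" if l: "chain C (Suc 0) \<alpha> l" for \<alpha> l
  proof -
    have "\<phi> \<alpha> l \<in> carrier (Grp F \<alpha>)" using \<phi>c l by (simp add: cochain_def)
    then show ?thesis
      using d_cobd[OF xc l] eq[OF l] d_aug[OF chain_Ob[OF l], of "\<phi> \<alpha> l"] by simp
  qed
  then have "z \<in> carrier (lim_J (Suc 0))"
    unfolding z_def using lim_iff_cobd[OF J d_closed[OF _ x]] by blast
  then have "z \<in> lim_cocycles (opposite C) R (Suc 0)"
    using d_d[OF _ x] by (simp add: lim_cocycles_iff z_def)
  moreover have "rep z \<phi>"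
    unfolding rep_def using \<phi>c x eq by (auto simp: z_def)
  ultimately show ?thesis by blast
qed

text \<open>If \<open>z\<close> is the image of a compatible \<open>y\<close>, the quotient of
  \<open>x\<close> by \<open>y\<close> comes from F and has the same coboundary as \<open>x\<close>.
  Conversely, a cochain bounding \<open>\<phi>\<close> corrects \<open>x\<close> to a compatible
  family with the same image.\<close>

lemma rep_coboundary_iff:
  assumes "rep z \<phi>" and z: "z \<in> carrier (lim_J (Suc 0))"
  shows "z \<in> lim_coboundaries (opposite C) R (Suc 0) \<longleftrightarrow> coboundary1 \<phi>"
proof
  obtain x where x: "\<And>\<alpha>. \<alpha> \<in> Ob C \<Longrightarrow> x \<alpha> \<in> carrier (Grp (J 0) \<alpha>) \<and> d 0 \<alpha> (x \<alpha>) = z \<alpha>"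
    and eq: "\<And>\<alpha> l. chain C (Suc 0) \<alpha> l \<Longrightarrow> Aug R \<alpha> (\<phi> \<alpha> l) = cobd C (J 0) (\<lambda>\<alpha> l. x \<alpha>) \<alpha> l"
    and \<phi>: "cochain C F (Suc 0) \<phi>"
    using assms(1) by (auto simp: rep_def)
  have xc: "cochain C (J 0) 0 (\<lambda>\<alpha> l. x \<alpha>)" using x by (simp add: cochain_def chain_0)
  {
    assume "z \<in> lim_coboundaries (opposite C) R (Suc 0)"
    then obtain y where y: "y \<in> carrier (lim_J 0)" "z = lim_map (opposite C) (d 0) y" by auto
    note y1 = lim_J_closed[OF y(1)]
    have yc: "cochain C (J 0) 0 (\<lambda>\<alpha> l. y \<alpha>)" using y1 by (simp add: cochain_def chain_0)
    have iyc: "cochain C (J 0) 0 (\<lambda>\<alpha> l. inv\<^bsub>Grp (J 0) \<alpha>\<^esub> y \<alpha>)"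
      using y1 group.inv_closed[OF J_group] by (simp add: cochain_def chain_0)
    have "\<exists>k\<in>carrier (Grp F \<alpha>). Aug R \<alpha> k = x \<alpha> \<otimes>\<^bsub>Grp (J 0) \<alpha>\<^esub> inv\<^bsub>Grp (J 0) \<alpha>\<^esub> y \<alpha>" if \<alpha>: "\<alpha> \<in> Ob C" for \<alpha>
    proof -
      interpret group_hom "Grp (J 0) \<alpha>" "Grp (J (Suc 0)) \<alpha>" "d 0 \<alpha>" using d_group_hom[OF \<alpha>] .
      show ?thesis
        using x[OF \<alpha>] y1[OF \<alpha>] y(2) \<alpha> lim_J_closed[OF z \<alpha>]
        by (intro aug_exact[OF \<alpha>]) (auto simp: lim_map_def)
    qed
    then obtain k where k: "\<And>\<alpha>. \<alpha> \<in> Ob C \<Longrightarrow> k \<alpha> \<in> carrier (Grp F \<alpha>)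
        \<and> Aug R \<alpha> (k \<alpha>) = x \<alpha> \<otimes>\<^bsub>Grp (J 0) \<alpha>\<^esub> inv\<^bsub>Grp (J 0) \<alpha>\<^esub> y \<alpha>"
      by metis
    have kc: "cochain C F 0 (\<lambda>\<alpha> l. k \<alpha>)" using k by (simp add: cochain_def chain_0)
    have "\<phi> \<alpha> l = cobd C F (\<lambda>\<alpha> l. k \<alpha>) \<alpha> l" if l: "chain C (Suc 0) \<alpha> l" for \<alpha> l
    proof (rule aug_inj[OF chain_Ob[OF l]])
      interpret J0: group "Grp (J 0) \<alpha>" using J_group[OF chain_Ob[OF l]] .
      show "\<phi> \<alpha> l \<in> carrier (Grp F \<alpha>)" using \<phi> l by (simp add: cochain_def)
      show "cobd C F (\<lambda>\<alpha> l. k \<alpha>) \<alpha> l \<in> carrier (Grp F \<alpha>)" using cobd_closed[OF F kc l] .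
      have "cobd C (J 0) (\<lambda>\<alpha> l. y \<alpha>) \<alpha> l = \<one>\<^bsub>Grp (J 0) \<alpha>\<^esub>"
        using lim_iff_cobd[OF J y1] y(1) lim_J_restrict[OF y(1)] l by simp
      then have "cobd C (J 0) (\<lambda>\<alpha> l. x \<alpha> \<otimes>\<^bsub>Grp (J 0) \<alpha>\<^esub> inv\<^bsub>Grp (J 0) \<alpha>\<^esub> y \<alpha>) \<alpha> l = cobd C (J 0) (\<lambda>\<alpha> l. x \<alpha>) \<alpha> l"
        using cobd_mult[OF J xc iyc l] cobd_inv[OF J yc l] cobd_closed[OF J xc l] by simp
      moreover have "Aug R \<alpha> (cobd C F (\<lambda>\<alpha> l. k \<alpha>) \<alpha> l) = cobd C (J 0) (\<lambda>\<alpha> l. x \<alpha> \<otimes>\<^bsub>Grp (J 0) \<alpha>\<^esub> inv\<^bsub>Grp (J 0) \<alpha>\<^esub> y \<alpha>) \<alpha> l"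
        unfolding cobd_nat[OF F J aug_nat kc l] using k
        by (intro cobd_cong[OF J cochain_aug[OF kc] _ l]) (simp add: chain_0)
      ultimately show "Aug R \<alpha> (\<phi> \<alpha> l) = Aug R \<alpha> (cobd C F (\<lambda>\<alpha> l. k \<alpha>) \<alpha> l)"
        using eq[OF l] by simp
    qed
    then show "coboundary1 \<phi>"
      unfolding coboundary1_def using kc by blast
  }
  assume "coboundary1 \<phi>"
  then obtain \<kappa> where \<kappa>: "cochain C F 0 \<kappa>" "\<And>\<alpha> l. chain C (Suc 0) \<alpha> l \<Longrightarrow> \<phi> \<alpha> l = cobd C F \<kappa> \<alpha> l"
    by (auto simp: coboundary1_def)
  define w where "w \<alpha> = inv\<^bsub>Grp (J 0) \<alpha>\<^esub> Aug R \<alpha> (\<kappa> \<alpha> [])" for \<alpha>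
  have \<kappa>0: "\<kappa> \<alpha> [] \<in> carrier (Grp F \<alpha>)" "Aug R \<alpha> (\<kappa> \<alpha> []) \<in> carrier (Grp (J 0) \<alpha>)" if "\<alpha> \<in> Ob C" for \<alpha>
    using \<kappa>(1) cochain_aug[OF \<kappa>(1)] that by (auto simp: cochain_def chain_0)
  have wc: "cochain C (J 0) 0 (\<lambda>\<alpha> l. w \<alpha>)"
    using \<kappa>0 group.inv_closed[OF J_group] by (simp add: cochain_def chain_0 w_def)
  define y where "y \<alpha> = x \<alpha> \<otimes>\<^bsub>Grp (J 0) \<alpha>\<^esub> w \<alpha>" for \<alpha>
  have y: "y \<alpha> \<in> carrier (Grp (J 0) \<alpha>)" if "\<alpha> \<in> Ob C" for \<alpha>
    using x wc that monoid.m_closed[OF group.is_monoid[OF J_group]] by (simp add: y_def cochain_def chain_0)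
  have "cobd C (J 0) (\<lambda>\<alpha> l. y \<alpha>) \<alpha> l = \<one>\<^bsub>Grp (J 0) \<alpha>\<^esub>" if l: "chain C (Suc 0) \<alpha> l" for \<alpha> l
  proof -
    have ic: "cochain C (J 0) 0 (\<lambda>\<alpha> l. inv\<^bsub>Grp (J 0) \<alpha>\<^esub> Aug R \<alpha> (\<kappa> \<alpha> l))"
      using \<kappa>0 group.inv_closed[OF J_group] by (simp add: cochain_def chain_0)
    have "cobd C (J 0) (\<lambda>\<alpha> l. w \<alpha>) \<alpha> l = cobd C (J 0) (\<lambda>\<alpha> l. inv\<^bsub>Grp (J 0) \<alpha>\<^esub> Aug R \<alpha> (\<kappa> \<alpha> l)) \<alpha> l"
      by (rule cobd_cong[OF J wc _ l]) (simp add: w_def chain_0)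
    also have "\<dots> = inv\<^bsub>Grp (J 0) \<alpha>\<^esub> cobd C (J 0) (\<lambda>\<alpha> l. Aug R \<alpha> (\<kappa> \<alpha> l)) \<alpha> l"
      by (rule cobd_inv[OF J cochain_aug[OF \<kappa>(1)] l])
    also have "cobd C (J 0) (\<lambda>\<alpha> l. Aug R \<alpha> (\<kappa> \<alpha> l)) \<alpha> l = cobd C (J 0) (\<lambda>\<alpha> l. x \<alpha>) \<alpha> l"
      using cobd_nat[OF F J aug_nat \<kappa>(1) l] \<kappa>(2)[OF l] eq[OF l] by simp
    finally show ?thesis
      unfolding y_def using cobd_mult[OF J xc wc l]
        group.r_inv[OF J_group[OF chain_Ob[OF l]] cobd_closed[OF J xc l]] by simp
  qed
  then have yl: "(\<lambda>\<alpha>\<in>Ob C. y \<alpha>) \<in> carrier (lim_J 0)"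
    using lim_iff_cobd[OF J y] by blast
  have "d 0 \<alpha> (y \<alpha>) = z \<alpha>" if \<alpha>: "\<alpha> \<in> Ob C" for \<alpha>
  proof -
    interpret group_hom "Grp (J 0) \<alpha>" "Grp (J (Suc 0)) \<alpha>" "d 0 \<alpha>" using d_group_hom[OF \<alpha>] .
    show ?thesis
      using x[OF \<alpha>] \<kappa>0[OF \<alpha>] lim_J_closed[OF z \<alpha>] d_aug[OF \<alpha> \<kappa>0(1)[OF \<alpha>]] by (simp add: y_def w_def)
  qed
  then have "lim_map (opposite C) (d 0) (\<lambda>\<alpha>\<in>Ob C. y \<alpha>) = (\<lambda>\<alpha>\<in>Ob C. z \<alpha>)"
    by (auto simp: lim_map_def)
  then show "z \<in> lim_coboundaries (opposite C) R (Suc 0)"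
    using yl lim_J_restrict[OF z] by (auto simp: image_iff)
qed

text \<open>Transports \<open>\<Lambda>\<close> along the isomorphism between the first derived
  limit and bar cohomology. The description has a unique value once \<open>\<Lambda>\<close> is
  additive and kills exactly the coboundaries, as assumed for \<open>rep_unique\<close>.\<close>

definition lim1_map :: "(('p \<Rightarrow> 'b list \<Rightarrow> 'g) \<Rightarrow> 'k) \<Rightarrow> ('p \<Rightarrow> 'h) set \<Rightarrow> 'k" where
  "lim1_map \<Lambda> K = (THE m. \<exists>z\<in>K. \<exists>\<phi>. rep z \<phi> \<and> m = \<Lambda> \<phi>)"

lemma derived_lim_carrier:
  assumes "K \<in> carrier (derived_lim (opposite C) R n)"
  obtains z where "z \<in> lim_cocycles (opposite C) R n"
    "K = lim_coboundaries (opposite C) R n #>\<^bsub>cocycle_group n\<^esub> z"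
  using assms by (auto simp: derived_lim_def FactGroup_def RCOSETS_def)

lemma derived_lim_coset:
  assumes "z \<in> lim_cocycles (opposite C) R n"
  shows "lim_coboundaries (opposite C) R n #>\<^bsub>cocycle_group n\<^esub> z \<in> carrier (derived_lim (opposite C) R n)"
    and "z \<in> lim_coboundaries (opposite C) R n #>\<^bsub>cocycle_group n\<^esub> z"
proof -
  interpret Z: comm_group "cocycle_group n" by (rule cocycle_comm_group)
  show "lim_coboundaries (opposite C) R n #>\<^bsub>cocycle_group n\<^esub> z \<in> carrier (derived_lim (opposite C) R n)"
    using assms by (auto simp: derived_lim_def FactGroup_def RCOSETS_def)
  show "z \<in> lim_coboundaries (opposite C) R n #>\<^bsub>cocycle_group n\<^esub> z"
    using Z.rcos_self[OF _ coboundaries_subgroup] assms by simp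
qed

context
  fixes H :: "'k monoid" and \<Lambda> :: "('p \<Rightarrow> 'b list \<Rightarrow> 'g) \<Rightarrow> 'k"
  assumes H: "group H"
    and \<Lambda>_closed: "\<And>\<phi>. cocycle1 \<phi> \<Longrightarrow> \<Lambda> \<phi> \<in> carrier H"
    and \<Lambda>_mult: "\<And>\<phi> \<psi>. cocycle1 \<phi> \<Longrightarrow> cocycle1 \<psi> \<Longrightarrow> \<Lambda> (cmult \<phi> \<psi>) = \<Lambda> \<phi> \<otimes>\<^bsub>H\<^esub> \<Lambda> \<psi>"
    and \<Lambda>_one_iff: "\<And>\<phi>. cocycle1 \<phi> \<Longrightarrow> \<Lambda> \<phi> = \<one>\<^bsub>H\<^esub> \<longleftrightarrow> coboundary1 \<phi>"
begin

text \<open>Both cochains are multiplied by the inverse of \<open>\<phi>\<close>. The products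
  represent the coboundary \<open>b\<close> and the unit, so \<open>\<Lambda>\<close> sends both to
  the unit and cancellation applies.\<close>

lemma rep_unique:
  assumes r: "rep z \<phi>" and r': "rep z' \<phi>'" and z: "z \<in> lim_cocycles (opposite C) R (Suc 0)"
    and z': "z' = b \<otimes>\<^bsub>cocycle_group (Suc 0)\<^esub> z" and b: "b \<in> lim_coboundaries (opposite C) R (Suc 0)"
  shows "\<Lambda> \<phi> = \<Lambda> \<phi>'"
proof -
  interpret Z: comm_group "cocycle_group (Suc 0)" by (rule cocycle_comm_group)
  interpret H: group H by (rule H)
  note c = rep_cocycle[OF r] rep_cocycle[OF r'] rep_cocycle[OF rep_inv[OF r z]]
  have bz: "b \<in> lim_cocycles (opposite C) R (Suc 0)"
    using b coboundaries_le_cocycles by blast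
  have "z' \<otimes>\<^bsub>cocycle_group (Suc 0)\<^esub> inv\<^bsub>cocycle_group (Suc 0)\<^esub> z = b"
    using z bz z' Z.m_assoc[of b z "inv\<^bsub>cocycle_group (Suc 0)\<^esub> z"] Z.r_inv[of z] Z.r_one[of b]
      Z.inv_closed[of z] by simp
  then have rb: "rep b (cmult \<phi>' (cinv \<phi>))"
    using rep_mult[OF r' rep_inv[OF r z]] by simp
  then have 1: "\<Lambda> \<phi>' \<otimes>\<^bsub>H\<^esub> \<Lambda> (cinv \<phi>) = \<one>\<^bsub>H\<^esub>"
    using rep_coboundary_iff[OF rb] b bz \<Lambda>_one_iff[OF rep_cocycle[OF rb]] \<Lambda>_mult[OF c(2,3)]
    unfolding lim_cocycles_iff by metis
  have "z \<otimes>\<^bsub>cocycle_group (Suc 0)\<^esub> inv\<^bsub>cocycle_group (Suc 0)\<^esub> z = \<one>\<^bsub>lim_J (Suc 0)\<^esub>"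
    using Z.r_inv[of z] z by simp
  then have r1: "rep \<one>\<^bsub>lim_J (Suc 0)\<^esub> (cmult \<phi> (cinv \<phi>))"
    using rep_mult[OF r rep_inv[OF r z]] by simp
  have "\<one>\<^bsub>lim_J (Suc 0)\<^esub> \<in> lim_coboundaries (opposite C) R (Suc 0)"
    using subgroup.one_closed[OF coboundaries_subgroup, of "Suc 0"] by simp
  moreover have "\<one>\<^bsub>lim_J (Suc 0)\<^esub> \<in> carrier (lim_J (Suc 0))"
    using Z.one_closed by (simp add: lim_cocycles_iff)
  ultimately have 2: "\<Lambda> \<phi> \<otimes>\<^bsub>H\<^esub> \<Lambda> (cinv \<phi>) = \<one>\<^bsub>H\<^esub>"
    using rep_coboundary_iff[OF r1] \<Lambda>_one_iff[OF rep_cocycle[OF r1]] \<Lambda>_mult[OF c(1,3)] by metis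
  show ?thesis
    using 1 2 H.right_cancel[of "\<Lambda> (cinv \<phi>)" "\<Lambda> \<phi>" "\<Lambda> \<phi>'"] \<Lambda>_closed c by simp
qed

lemma lim1_map_eq:
  assumes K: "K \<in> carrier (derived_lim (opposite C) R (Suc 0))" and z: "z \<in> K" and r: "rep z \<phi>"
  shows "lim1_map \<Lambda> K = \<Lambda> \<phi>"
  unfolding lim1_map_def
proof (rule the_equality)
  show "\<exists>z\<in>K. \<exists>\<psi>. rep z \<psi> \<and> \<Lambda> \<phi> = \<Lambda> \<psi>" using z r by blast
  fix m assume "\<exists>z\<in>K. \<exists>\<psi>. rep z \<psi> \<and> m = \<Lambda> \<psi>"
  then obtain z' \<psi> where z': "z' \<in> K" "rep z' \<psi>" "m = \<Lambda> \<psi>" by blast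
  interpret Z: comm_group "cocycle_group (Suc 0)" by (rule cocycle_comm_group)
  obtain z0 where z0: "z0 \<in> lim_cocycles (opposite C) R (Suc 0)"
    "K = lim_coboundaries (opposite C) R (Suc 0) #>\<^bsub>cocycle_group (Suc 0)\<^esub> z0"
    using derived_lim_carrier[OF K] by blast
  obtain \<phi>0 where "rep z0 \<phi>0" using rep_ex[OF z0(1)] by blast
  moreover have "\<exists>b\<in>lim_coboundaries (opposite C) R (Suc 0). y = b \<otimes>\<^bsub>cocycle_group (Suc 0)\<^esub> z0" if "y \<in> K" for y
    using that unfolding z0(2) r_coset_def by blast
  ultimately have "\<Lambda> \<phi>0 = \<Lambda> \<phi>" "\<Lambda> \<phi>0 = \<Lambda> \<psi>"
    using rep_unique[OF _ r z0(1)] rep_unique[OF _ z'(2) z0(1)] z z' by blast+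
  then show "m = \<Lambda> \<phi>" using z' by simp
qed

text \<open>Injectivity reflects that \<open>\<Lambda>\<close> kills only coboundaries; the image is
  full because every bar cocycle represents some class, by \<open>rep_surj\<close>.\<close>

theorem lim1_map_mon: "lim1_map \<Lambda> \<in> mon (derived_lim (opposite C) R (Suc 0)) H"
  and lim1_map_image: "lim1_map \<Lambda> ` carrier (derived_lim (opposite C) R (Suc 0)) = \<Lambda> ` {\<phi>. cocycle1 \<phi>}"
proof -
  let ?D = "derived_lim (opposite C) R (Suc 0)" and ?B = "lim_coboundaries (opposite C) R (Suc 0)"
  interpret Z: comm_group "cocycle_group (Suc 0)" by (rule cocycle_comm_group)
  interpret N: normal ?B "cocycle_group (Suc 0)" by (rule coboundaries_normal)
  have val: "lim1_map \<Lambda> (?B #>\<^bsub>cocycle_group (Suc 0)\<^esub> z) = \<Lambda> \<phi>"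
    if "z \<in> lim_cocycles (opposite C) R (Suc 0)" "rep z \<phi>" for z \<phi>
    using lim1_map_eq[OF derived_lim_coset[OF that(1)] that(2)] .
  have hom: "lim1_map \<Lambda> \<in> hom ?D H"
  proof (rule homI)
    fix K assume K: "K \<in> carrier ?D"
    obtain z where z: "z \<in> lim_cocycles (opposite C) R (Suc 0)" "K = ?B #>\<^bsub>cocycle_group (Suc 0)\<^esub> z"
      using derived_lim_carrier[OF K] by blast
    obtain \<phi> where \<phi>: "rep z \<phi>" using rep_ex[OF z(1)] by blast
    show "lim1_map \<Lambda> K \<in> carrier H"
      using val[OF z(1) \<phi>] z(2) \<Lambda>_closed rep_cocycle[OF \<phi>] by simp
    fix K' assume K': "K' \<in> carrier ?D"
    obtain z' where z': "z' \<in> lim_cocycles (opposite C) R (Suc 0)" "K' = ?B #>\<^bsub>cocycle_group (Suc 0)\<^esub> z'"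
      using derived_lim_carrier[OF K'] by blast
    obtain \<phi>' where \<phi>': "rep z' \<phi>'" using rep_ex[OF z'(1)] by blast
    have zz: "z \<otimes>\<^bsub>cocycle_group (Suc 0)\<^esub> z' \<in> lim_cocycles (opposite C) R (Suc 0)"
      using Z.m_closed[of z z'] z z' by simp
    have "K \<otimes>\<^bsub>?D\<^esub> K' = ?B #>\<^bsub>cocycle_group (Suc 0)\<^esub> (z \<otimes>\<^bsub>cocycle_group (Suc 0)\<^esub> z')"
      using N.rcos_sum[of z z'] z z' by (simp add: derived_lim_def FactGroup_def)
    then show "lim1_map \<Lambda> (K \<otimes>\<^bsub>?D\<^esub> K') = lim1_map \<Lambda> K \<otimes>\<^bsub>H\<^esub> lim1_map \<Lambda> K'"
      using val[OF zz, of "cmult \<phi> \<phi>'"] rep_mult[OF \<phi> \<phi>'] val[OF z(1) \<phi>] val[OF z'(1) \<phi>'] z z'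
        \<Lambda>_mult rep_cocycle[OF \<phi>] rep_cocycle[OF \<phi>'] by simp
  qed
  interpret group_hom ?D H "lim1_map \<Lambda>"
    by (intro group_hom.intro group_hom_axioms.intro derived_lim_group H hom)
  have "inj_on (lim1_map \<Lambda>) (carrier ?D)"
    unfolding inj_on_one_iff
  proof (intro allI impI)
    fix K assume K: "K \<in> carrier ?D" and 1: "lim1_map \<Lambda> K = \<one>\<^bsub>H\<^esub>"
    obtain z where z: "z \<in> lim_cocycles (opposite C) R (Suc 0)" "K = ?B #>\<^bsub>cocycle_group (Suc 0)\<^esub> z"
      using derived_lim_carrier[OF K] by blast
    obtain \<phi> where \<phi>: "rep z \<phi>" using rep_ex[OF z(1)] by blast
    have "coboundary1 \<phi>"
      using val[OF z(1) \<phi>] z(2) 1 \<Lambda>_one_iff rep_cocycle[OF \<phi>] by simp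
    then have "z \<in> ?B"
      using rep_coboundary_iff[OF \<phi>] z(1) by (simp add: lim_cocycles_iff)
    then show "K = \<one>\<^bsub>?D\<^esub>"
      using N.rcos_const[OF Z.is_group] z(2) by (simp add: derived_lim_def FactGroup_def)
  qed
  with hom show "lim1_map \<Lambda> \<in> mon ?D H"
    by (simp add: mon_def)
  show "lim1_map \<Lambda> ` carrier ?D = \<Lambda> ` {\<phi>. cocycle1 \<phi>}"
  proof (intro equalityI subsetI)
    fix m assume "m \<in> lim1_map \<Lambda> ` carrier ?D"
    then obtain K where K: "K \<in> carrier ?D" "m = lim1_map \<Lambda> K" by blast
    obtain z where z: "z \<in> lim_cocycles (opposite C) R (Suc 0)" "K = ?B #>\<^bsub>cocycle_group (Suc 0)\<^esub> z"
      using derived_lim_carrier[OF K(1)] by blast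
    obtain \<phi> where \<phi>: "rep z \<phi>" using rep_ex[OF z(1)] by blast
    then show "m \<in> \<Lambda> ` {\<phi>. cocycle1 \<phi>}"
      using val[OF z(1) \<phi>] z(2) K(2) rep_cocycle[OF \<phi>] by blast
  next
    fix m assume "m \<in> \<Lambda> ` {\<phi>. cocycle1 \<phi>}"
    then obtain \<phi> where \<phi>: "cocycle1 \<phi>" "m = \<Lambda> \<phi>" by blast
    obtain z where z: "z \<in> lim_cocycles (opposite C) R (Suc 0)" "rep z \<phi>"
      using rep_surj[OF \<phi>(1)] by blast
    show "m \<in> lim1_map \<Lambda> ` carrier ?D"
      using val[OF z] derived_lim_coset(1)[OF z(1)] \<phi>(2) by (metis imageI)
  qed
qed

end

text \<open>\<open>\<Phi> 0\<close> carries the objectwise preimages for \<open>z\<close> to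
  preimages for its image, and compatibility with the augmentations then transports the
  cochain.\<close>

lemma rep_map:
  assumes "diagram_resolution C F' R'" and \<eta>: "is_ab_nat (opposite C) F F' \<eta>"
    and \<Phi>: "resolution_map (opposite C) F R R' \<eta> \<Phi>" and r: "rep z \<phi>" and z: "z \<in> carrier (lim_J (Suc 0))"
  shows "diagram_resolution.rep C F' R' (lim_map (opposite C) (\<Phi> (Suc 0)) z) (\<lambda>\<alpha> l. \<eta> \<alpha> (\<phi> \<alpha> l))"
proof -
  interpret R': diagram_resolution C F' R' by fact
  obtain x where x: "\<And>\<alpha>. \<alpha> \<in> Ob C \<Longrightarrow> x \<alpha> \<in> carrier (Grp (J 0) \<alpha>) \<and> d 0 \<alpha> (x \<alpha>) = z \<alpha>"
    and eq: "\<And>\<alpha> l. chain C (Suc 0) \<alpha> l \<Longrightarrow> Aug R \<alpha> (\<phi> \<alpha> l) = cobd C (J 0) (\<lambda>\<alpha> l. x \<alpha>) \<alpha> l"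
    and \<phi>: "cochain C F (Suc 0) \<phi>"
    using r by (auto simp: rep_def)
  have xc: "cochain C (J 0) 0 (\<lambda>\<alpha> l. x \<alpha>)" using x by (simp add: cochain_def chain_0)
  have n: "is_ab_nat (opposite C) (J k) (R'.J k) (\<Phi> k)" for k
    using \<Phi> by (simp add: resolution_map_def)
  have \<Phi>a: "\<Phi> 0 \<alpha> (Aug R \<alpha> y) = Aug R' \<alpha> (\<eta> \<alpha> y)" if "\<alpha> \<in> Ob C" "y \<in> carrier (Grp F \<alpha>)" for \<alpha> y
    using \<Phi> that by (simp add: resolution_map_def)
  have \<Phi>d: "\<Phi> (Suc k) \<alpha> (d k \<alpha> y) = R'.d k \<alpha> (\<Phi> k \<alpha> y)" if "\<alpha> \<in> Ob C" "y \<in> carrier (Grp (J k) \<alpha>)" for \<alpha> k y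
    using \<Phi> that by (simp add: resolution_map_def)
  have h: "\<Phi> k \<alpha> \<in> hom (Grp (J k) \<alpha>) (Grp (R'.J k) \<alpha>)" if "\<alpha> \<in> Ob C" for k \<alpha>
    using n that by (simp add: is_ab_nat_def)
  show ?thesis
    unfolding R'.rep_def
  proof (intro conjI exI[of _ "\<lambda>\<alpha>. \<Phi> 0 \<alpha> (x \<alpha>)"] ballI allI impI)
    show "cochain C F' (Suc 0) (\<lambda>\<alpha> l. \<eta> \<alpha> (\<phi> \<alpha> l))"
      unfolding cochain_def
    proof (intro allI impI)
      fix \<alpha> l assume l: "chain C (Suc 0) \<alpha> l"
      have "\<eta> \<alpha> \<in> hom (Grp F \<alpha>) (Grp F' \<alpha>)"
        using \<eta> chain_Ob[OF l] by (simp add: is_ab_nat_def)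
      then show "\<eta> \<alpha> (\<phi> \<alpha> l) \<in> carrier (Grp F' \<alpha>)"
        using \<phi> l by (auto simp: cochain_def intro: hom_in_carrier)
    qed
    fix \<alpha> assume \<alpha>: "\<alpha> \<in> Ob C"
    show "\<Phi> 0 \<alpha> (x \<alpha>) \<in> carrier (Grp (R'.J 0) \<alpha>)"
      using hom_in_carrier[OF h[OF \<alpha>]] x[OF \<alpha>] by simp
    show "R'.d 0 \<alpha> (\<Phi> 0 \<alpha> (x \<alpha>)) = lim_map (opposite C) (\<Phi> (Suc 0)) z \<alpha>"
      using \<Phi>d[OF \<alpha>, of "x \<alpha>" 0] x[OF \<alpha>] \<alpha> by (simp add: lim_map_def)
  next
    fix \<alpha> l assume l: "chain C (Suc 0) \<alpha> l"
    have "\<phi> \<alpha> l \<in> carrier (Grp F \<alpha>)" using \<phi> l by (simp add: cochain_def)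
    then show "Aug R' \<alpha> (\<eta> \<alpha> (\<phi> \<alpha> l)) = cobd C (R'.J 0) (\<lambda>\<alpha> l. \<Phi> 0 \<alpha> (x \<alpha>)) \<alpha> l"
      using \<Phi>a[OF chain_Ob[OF l], of "\<phi> \<alpha> l"] eq[OF l] cobd_nat[OF J R'.J n xc l] by simp
  qed
qed

text \<open>A map of resolutions preserves cocycles and coboundaries, so all members of
  \<open>K\<close> give the same coset, and the union in \<open>derived_lim_map\<close> is that
  coset.\<close>

lemma derived_lim_map_coset:
  assumes "diagram_resolution C F' R'"
    and \<Phi>: "resolution_map (opposite C) F R R' \<eta> \<Phi>" and K: "K \<in> carrier (derived_lim (opposite C) R (Suc 0))"
    and z: "z \<in> K"
  shows "derived_lim_map (opposite C) R' \<Phi> (Suc 0) K \<in> carrier (derived_lim (opposite C) R' (Suc 0))"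
    and "lim_map (opposite C) (\<Phi> (Suc 0)) z \<in> derived_lim_map (opposite C) R' \<Phi> (Suc 0) K"
proof -
  interpret R': diagram_resolution C F' R' by fact
  interpret Z: comm_group "cocycle_group (Suc 0)" by (rule cocycle_comm_group)
  interpret Z': comm_group "R'.cocycle_group (Suc 0)" by (rule R'.cocycle_comm_group)
  let ?B = "lim_coboundaries (opposite C) R (Suc 0)" and ?B' = "lim_coboundaries (opposite C) R' (Suc 0)"
  let ?f = "lim_map (opposite C) (\<Phi> (Suc 0))"
  have n: "is_ab_nat (opposite C) (J k) (R'.J k) (\<Phi> k)" for k
    using \<Phi> by (simp add: resolution_map_def)
  have \<Phi>d: "\<Phi> (Suc k) \<alpha> (d k \<alpha> y) = R'.d k \<alpha> (\<Phi> k \<alpha> y)" if "\<alpha> \<in> Ob C" "y \<in> carrier (Grp (J k) \<alpha>)" for \<alpha> k y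
    using \<Phi> that by (simp add: resolution_map_def)
  note fh = lim_map_hom[OF J n]
  have fcoc: "?f y \<in> lim_cocycles (opposite C) R' (Suc 0)" if y: "y \<in> lim_cocycles (opposite C) R (Suc 0)" for y
  proof -
    have yl: "y \<in> carrier (lim_J (Suc 0))" using y by (simp add: lim_cocycles_iff)
    have "R'.d (Suc 0) \<alpha> (\<Phi> (Suc 0) \<alpha> (y \<alpha>)) = \<one>\<^bsub>Grp (R'.J (Suc (Suc 0))) \<alpha>\<^esub>" if \<alpha>: "\<alpha> \<in> Ob C" for \<alpha>
    proof -
      have "\<Phi> (Suc (Suc 0)) \<alpha> \<in> hom (Grp (J (Suc (Suc 0))) \<alpha>) (Grp (R'.J (Suc (Suc 0))) \<alpha>)"
        using n \<alpha> by (simp add: is_ab_nat_def)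
      from hom_one[OF this J_group[OF \<alpha>] R'.J_group[OF \<alpha>]]
      show ?thesis
        using \<Phi>d[OF \<alpha> lim_J_closed[OF yl \<alpha>]] y \<alpha> by (simp add: lim_cocycles_iff)
    qed
    then show ?thesis
      using hom_in_carrier[OF fh yl] by (simp add: R'.lim_cocycles_iff lim_map_def)
  qed
  have fcob: "?f b \<in> ?B'" if b: "b \<in> ?B" for b
  proof -
    obtain y where y: "y \<in> carrier (lim_J 0)" "b = lim_map (opposite C) (d 0) y" using b by auto
    have "?f b = lim_map (opposite C) (R'.d 0) (lim_map (opposite C) (\<Phi> 0) y)"
      using \<Phi>d[OF _ lim_J_closed[OF y(1)]] y(2) by (auto simp: lim_map_def)
    then show ?thesis
      using hom_in_carrier[OF fh y(1)] by simp
  qed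
  have cos: "?B' #>\<^bsub>lim_group (opposite C) (R'.J (Suc 0))\<^esub> y = ?B' #>\<^bsub>R'.cocycle_group (Suc 0)\<^esub> y" for y
    by (simp add: r_coset_def)
  obtain z0 where z0: "z0 \<in> lim_cocycles (opposite C) R (Suc 0)" "K = ?B #>\<^bsub>cocycle_group (Suc 0)\<^esub> z0"
    using derived_lim_carrier[OF K] by blast
  have same: "?B' #>\<^bsub>R'.cocycle_group (Suc 0)\<^esub> ?f y = ?B' #>\<^bsub>R'.cocycle_group (Suc 0)\<^esub> ?f z0" if y: "y \<in> K" for y
  proof -
    obtain b where b: "b \<in> ?B" "y = b \<otimes>\<^bsub>lim_J (Suc 0)\<^esub> z0"
      using y unfolding z0(2) r_coset_def by auto
    have bc: "b \<in> lim_cocycles (opposite C) R (Suc 0)" using b coboundaries_le_cocycles by blast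
    have "?f y = ?f b \<otimes>\<^bsub>R'.cocycle_group (Suc 0)\<^esub> ?f z0"
      using hom_mult[OF fh[of "Suc 0"]] b(2) bc z0(1) by (simp add: lim_cocycles_iff)
    moreover have "?B' #>\<^bsub>R'.cocycle_group (Suc 0)\<^esub> (?f b \<otimes>\<^bsub>R'.cocycle_group (Suc 0)\<^esub> ?f z0)
        = (?B' #>\<^bsub>R'.cocycle_group (Suc 0)\<^esub> ?f b) #>\<^bsub>R'.cocycle_group (Suc 0)\<^esub> ?f z0"
      using Z'.coset_mult_assoc[of ?B' "?f b" "?f z0"] fcoc bc z0(1)
        subgroup.subset[OF R'.coboundaries_subgroup[of "Suc 0"]] by simp
    moreover have "?B' #>\<^bsub>R'.cocycle_group (Suc 0)\<^esub> ?f b = ?B'"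
      using subgroup.rcos_const[OF R'.coboundaries_subgroup Z'.is_group fcob[OF b(1)]] .
    ultimately show ?thesis by simp
  qed
  have "derived_lim_map (opposite C) R' \<Phi> (Suc 0) K = ?B' #>\<^bsub>R'.cocycle_group (Suc 0)\<^esub> ?f z0"
    unfolding derived_lim_map_def cos using same z by auto
  then show "derived_lim_map (opposite C) R' \<Phi> (Suc 0) K \<in> carrier (derived_lim (opposite C) R' (Suc 0))"
    and "?f z \<in> derived_lim_map (opposite C) R' \<Phi> (Suc 0) K"
    using R'.derived_lim_coset[OF fcoc[OF z0(1)]] same[OF z] R'.derived_lim_coset(2)[OF fcoc, of z] z z0 K
      subgroup.subset[OF coboundaries_subgroup[of "Suc 0"]] Z.r_coset_subset_G[of ?B z0]
    by (auto dest: subsetD)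
qed

end

section \<open>Small coproducts\<close>

text \<open>Chains live in a product type, while \<open>small\<close> speaks of subsets of
  \<open>'i\<close>; an injection into a small set bridges the two.\<close>

definition small_sized :: "('i set \<Rightarrow> bool) \<Rightarrow> 'j set \<Rightarrow> bool" where
  "small_sized small I \<longleftrightarrow> (\<exists>N. small N \<and> I \<lesssim> N)"

lemma small_sized_lepoll: "small_sized small J \<Longrightarrow> I \<lesssim> J \<Longrightarrow> small_sized small I"
  unfolding small_sized_def using lepoll_trans by blast

lemma small_sized_small: "small I \<Longrightarrow> small_sized small I"
  unfolding small_sized_def using lepoll_refl by blast

lemma lepoll_iff_ordLeq: "A \<lesssim> B \<longleftrightarrow> |A| \<le>o |B|"
  by (simp add: lepoll_def card_of_ordLeq)

lemma lepoll_linear: "A \<lesssim> B \<or> B \<lesssim> A"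
proof -
  have "|A| \<le>o |B| \<or> |B| \<le>o |A|"
    by (simp add: ordLeq_total)
  then show ?thesis
    by (simp add: lepoll_iff_ordLeq)
qed

text \<open>By comparability of cardinals one of finitely many small sets dominates the others. With
  an infinite small set among them the dominant one is infinite and absorbs its square.\<close>

lemma small_sized_times:
  assumes s: "smallness small" and I: "small_sized small I" and J: "small_sized small J"
  shows "small_sized small (I \<times> J)"
proof -
  obtain A B M where A: "small A" "I \<lesssim> A" and B: "small B" "J \<lesssim> B" and M: "small M" "infinite M"
    using I J s by (auto simp: small_sized_def smallness_def)
  obtain N1 where N1: "small N1" "A \<lesssim> N1" "B \<lesssim> N1"
    using lepoll_linear[of A B] A(1) B(1) lepoll_refl[of A] lepoll_refl[of B] by metis
  obtain N where N: "small N" "N1 \<lesssim> N" "M \<lesssim> N"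
    using lepoll_linear[of N1 M] N1(1) M(1) lepoll_refl[of N1] lepoll_refl[of M] by metis
  have "infinite N" using N(3) M(2) unfolding lepoll_def by (metis finite_imageD finite_subset)
  then have "N \<times> N \<lesssim> N"
    using card_of_Times_same_infinite ordIso_imp_ordLeq
    by (auto simp: lepoll_iff_ordLeq)
  moreover have "I \<times> J \<lesssim> N \<times> N"
    by (rule times_lepoll_mono[OF lepoll_trans[OF A(2) lepoll_trans[OF N1(2) N(2)]]
          lepoll_trans[OF B(2) lepoll_trans[OF N1(3) N(2)]]])
  ultimately show ?thesis
    unfolding small_sized_def using N(1) lepoll_trans by blast
qed

context category
begin

definition chains :: "nat \<Rightarrow> ('o \<times> 'a list) set" where
  "chains n = {(\<alpha>, l). chain C n \<alpha> l}"

lemma small_sized_chains: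
  assumes s: "smallness small" and Ob: "small_sized small (Ob C)" and arrows: "small_sized small (arrows C)"
  shows "small_sized small (chains n)"
proof (induction n)
  case 0
  have "chains 0 \<subseteq> (\<lambda>\<alpha>. (\<alpha>, [])) ` Ob C" by (auto simp: chains_def chain_0)
  then have "chains 0 \<lesssim> Ob C"
    using image_lepoll lepoll_trans subset_imp_lepoll by blast
  then show ?case
    by (rule small_sized_lepoll[OF Ob])
next
  case (Suc n)
  \<comment> \<open>The first arrow determines the start, which may therefore be dropped; what
    remains is a shorter chain together with its own start.\<close>
  let ?f = "\<lambda>(\<alpha> :: 'o, l). (hd l, (tgt C (hd l), tl l))"
  have "inj_on ?f (chains (Suc n))"
    by (rule inj_onI) (auto simp: chains_def chain_Suc dest: arr_unique)
  moreover have "a \<in> arrows C" if "arr C a \<alpha> \<beta>" for a \<alpha> \<beta>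
    using that by (auto simp: arrows_def arr_def)
  then have "?f ` chains (Suc n) \<subseteq> arrows C \<times> chains n"
    by (auto simp: chains_def chain_Suc tgt_eq)
  ultimately have "chains (Suc n) \<lesssim> arrows C \<times> chains n"
    unfolding lepoll_def by blast
  then show ?case
    by (rule small_sized_lepoll[OF small_sized_times[OF s arrows Suc.IH]])
qed

end

lemma coproduct_ex1:
  assumes "is_coproduct C I X P \<iota>" "Z \<in> Ob C" "\<forall>\<alpha>\<in>I. f \<alpha> \<in> Hom C (X \<alpha>) Z"
  shows "\<exists>!g. g \<in> Hom C P Z \<and> (\<forall>\<alpha>\<in>I. g \<cdot>\<^bsub>C\<^esub> \<iota> \<alpha> = f \<alpha>)"
  using assms unfolding is_coproduct_def by blast

context brown_phantom_category
begin

text \<open>The coproduct is formed over the image of \<open>I\<close> in \<open>'i\<close> and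
  reindexed. The last property is the surjective half of finiteness of \<open>W\<close>: a map to
  the coproduct is a finite sum of maps through summands.\<close>

lemma small_sized_coproduct:
  assumes I: "small_sized small I" and Y: "\<And>i. i \<in> I \<Longrightarrow> Y i \<in> Ob S"
  obtains P \<iota> where "is_coproduct S I Y P \<iota>"
    and "(\<And>i. i \<in> I \<Longrightarrow> Y i \<in> Fin) \<Longrightarrow> proj P"
    and "\<And>W x. W \<in> Fin \<Longrightarrow> arr S x W P \<Longrightarrow> \<exists>A y. finite A \<and> A \<subseteq> I \<and> (\<forall>i\<in>A. arr S (y i) W (Y i)) \<and>
        x = finprod (hom_group S W P) (\<lambda>i. \<iota> i \<cdot> y i) A"
proof -
  obtain N f where N: "small N" and f: "inj_on f I" "f ` I \<subseteq> N"
    using I by (auto simp: small_sized_def lepoll_def)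
  have sI: "small (f ` I)"
    using small N f(2) unfolding smallness_def by blast
  let ?Y = "\<lambda>k. Y (inv_into I f k)"
  have inv: "inv_into I f (f i) = i" if "i \<in> I" for i
    using f(1) that by simp
  have "\<forall>k\<in>f ` I. ?Y k \<in> Ob S" using Y inv by auto
  then obtain P \<iota> where P: "is_coproduct S (f ` I) ?Y P \<iota>"
    using small_coproducts[unfolded has_small_coproducts_def, THEN spec[of _ "f ` I"], THEN spec[of _ ?Y]] sI by auto
  have cop: "is_coproduct S I Y P (\<iota> \<circ> f)"
    unfolding is_coproduct_def
  proof (intro conjI ballI allI impI)
    show "P \<in> Ob S" using P by (simp add: is_coproduct_def)
    show "\<And>i. i \<in> I \<Longrightarrow> Y i \<in> Ob S" by (rule Y)
    show "\<And>i. i \<in> I \<Longrightarrow> (\<iota> \<circ> f) i \<in> Hom S (Y i) P"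
      using coproduct_incl[OF P] inv by (fastforce simp: arr_def)
    fix Z g assume Z: "Z \<in> Ob S" and g: "\<forall>i\<in>I. g i \<in> Hom S (Y i) Z"
    have "\<forall>k\<in>f ` I. g (inv_into I f k) \<in> Hom S (?Y k) Z"
      using g inv by auto
    then have "\<exists>!h. h \<in> Hom S P Z \<and> (\<forall>k\<in>f ` I. h \<cdot> \<iota> k = g (inv_into I f k))"
      by (rule coproduct_ex1[OF P Z])
    then show "\<exists>!h. h \<in> Hom S P Z \<and> (\<forall>i\<in>I. h \<cdot> (\<iota> \<circ> f) i = g i)"
      using inv by simp
  qed
  show thesis
  proof (rule that[OF cop])
    assume "\<And>i. i \<in> I \<Longrightarrow> Y i \<in> Fin"
    then have fin: "\<forall>k\<in>f ` I. ?Y k \<in> Fin" using inv by auto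
    have P0: "P \<in> Ob S" using P by (simp add: is_coproduct_def)
    have "is_retract S P P"
      unfolding is_retract_def using P0 id_hom[OF P0] comp_id_left[OF P0 P0 id_hom[OF P0]] by blast
    then have "P \<in> phantom_projectives small S"
      unfolding phantom_projectives_def
      by (intro CollectI conjI exI[of _ "f ` I"] exI[of _ ?Y] exI[of _ P] exI[of _ \<iota>])
        (use P0 sI fin P in auto)
    then show "proj P" using proj_iff by blast
  next
    fix W x assume W: "W \<in> Fin" and x: "arr S x W P"
    let ?G = "\<lambda>k. hom_group S W (?Y k)"
    have grp: "group (?G k)" if "k \<in> f ` I" for k
      using that Y inv finite_objects_Ob[OF W] by (auto intro: hom_group_group)
    have cg: "comm_group (hom_group S W P)"
      using hom_comm_group arr_Ob[OF x] by blast
    have "sum_map (f ` I) ?G (hom_group S W P) (\<lambda>k g. \<iota> k \<cdot> g) \<in> iso (sum_group (f ` I) ?G) (hom_group S W P)"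
      using W sI P unfolding finite_objects_def by blast
    then have "x \<in> sum_map (f ` I) ?G (hom_group S W P) (\<lambda>k g. \<iota> k \<cdot> g) ` carrier (sum_group (f ` I) ?G)"
      using arr_Hom[OF x] by (simp add: iso_def bij_betw_def)
    then obtain y where y: "y \<in> carrier (sum_group (f ` I) ?G)"
      and xy: "x = sum_map (f ` I) ?G (hom_group S W P) (\<lambda>k g. \<iota> k \<cdot> g) y" by blast
    define B where "B = {k \<in> f ` I. y k \<noteq> Zero S W (?Y k)}"
    have B: "finite B" using y grp by (auto simp: B_def carrier_sum_group)
    have ya: "arr S (y k) W (?Y k)" if "k \<in> f ` I" for k
      using y grp that finite_objects_Ob[OF W] Y inv by (auto simp: carrier_sum_group arr_def)
    define A where "A = {i \<in> I. f i \<in> B}"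
    have fA: "f ` A = B" by (auto simp: A_def B_def)
    have "x = finprod (hom_group S W P) (\<lambda>k. \<iota> k \<cdot> y k) (f ` A)"
      using xy by (simp add: sum_map_def fA B_def)
    also have "\<dots> = finprod (hom_group S W P) (\<lambda>i. \<iota> (f i) \<cdot> y (f i)) A"
    proof (rule comm_monoid.finprod_reindex[OF comm_group.axioms(1)[OF cg]])
      show "(\<lambda>k. \<iota> k \<cdot> y k) \<in> f ` A \<rightarrow> carrier (hom_group S W P)"
        using arr_Hom[OF arr_comp[OF ya coproduct_incl[OF P]]] fA by (auto simp: B_def)
      show "inj_on f A" using f(1) by (rule inj_on_subset) (auto simp: A_def)
    qed
    finally have "x = finprod (hom_group S W P) (\<lambda>i. (\<iota> \<circ> f) i \<cdot> y (f i)) A" by simp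
    moreover have "finite A"
    proof (rule finite_imageD[of f])
      show "finite (f ` A)" using B fA by simp
      show "inj_on f A" using f(1) by (rule inj_on_subset) (auto simp: A_def)
    qed
    moreover have "\<forall>i\<in>A. arr S (y (f i)) W (Y i)"
      using ya inv by (fastforce simp: A_def)
    moreover have "A \<subseteq> I" by (auto simp: A_def)
    ultimately show "\<exists>A y. finite A \<and> A \<subseteq> I \<and> (\<forall>i\<in>A. arr S (y i) W (Y i)) \<and>
        x = finprod (hom_group S W P) (\<lambda>i. (\<iota> \<circ> f) i \<cdot> y i) A"
      by (intro exI[of _ A] exI[of _ "\<lambda>i. y (f i)"] conjI)
  qed
qed

end

section \<open>Diagrams of maps into a fixed object\<close>

context additive_category
begin

lemma is_ab_diagram_contra_hom:
  fixes C :: "('p, 'b, 'y) category_data_scheme"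
  assumes C: "category C" and F: "is_functor C S Do Da" and Y: "Y \<in> Ob S"
  shows "is_ab_diagram (opposite C) (contra_hom_diagram S Do Da Y)"
proof -
  interpret C: category C by fact
  have Da: "arr S (Da a) (Do \<alpha>) (Do \<beta>)" if "arr C a \<alpha> \<beta>" for a \<alpha> \<beta>
    using F that by (simp add: is_functor_def arr_def)
  show ?thesis
    unfolding is_ab_diagram_def C.opposite_simps contra_hom_diagram_def ab_diagram.simps
  proof (intro conjI ballI)
    fix \<alpha> assume \<alpha>: "\<alpha> \<in> Ob C"
    have Do: "Do \<alpha> \<in> Ob S" using F \<alpha> by (simp add: is_functor_def)
    show "comm_group (hom_group S (Do \<alpha>) Y)"
      using hom_comm_group[OF Do Y] .
    show "f \<cdot> Da (Id C \<alpha>) = f" if "f \<in> carrier (hom_group S (Do \<alpha>) Y)" for f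
      using that F \<alpha> arr_id_right[of f "Do \<alpha>" Y] Do Y by (simp add: is_functor_def arr_def)
    fix \<beta> a assume \<beta>: "\<beta> \<in> Ob C" and a: "a \<in> Hom C \<beta> \<alpha>"
    then have aa: "arr C a \<beta> \<alpha>" using \<alpha> by (simp add: arr_def)
    show "(\<lambda>f. f \<cdot> Da a) \<in> hom (hom_group S (Do \<alpha>) Y) (hom_group S (Do \<beta>) Y)"
      using pre_hom[OF Da[OF aa] Y] .
    fix \<gamma> b f assume \<gamma>: "\<gamma> \<in> Ob C" and b: "b \<in> Hom C \<gamma> \<beta>" and f: "f \<in> carrier (hom_group S (Do \<alpha>) Y)"
    then have bb: "arr C b \<gamma> \<beta>" using \<beta> by (simp add: arr_def)
    have "Da (a \<cdot>\<^bsub>C\<^esub> b) = Da a \<cdot> Da b"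
      using F \<alpha> \<beta> \<gamma> a b by (simp add: is_functor_def)
    then show "f \<cdot> Da (a \<cdot>\<^bsub>C\<^esub> b) = (f \<cdot> Da a) \<cdot> Da b"
      using arr_assoc[OF Da[OF bb] Da[OF aa], of f Y] f Do Y by (simp add: arr_def)
  qed
qed

lemma is_ab_nat_contra_hom:
  fixes C :: "('p, 'b, 'y) category_data_scheme"
  assumes C: "category C" and F: "is_functor C S Do Da" and g: "arr S g Y Z"
  shows "is_ab_nat (opposite C) (contra_hom_diagram S Do Da Y) (contra_hom_diagram S Do Da Z) (\<lambda>\<alpha> f. g \<cdot> f)"
proof -
  interpret C: category C by fact
  have Da: "arr S (Da a) (Do \<alpha>) (Do \<beta>)" if "arr C a \<alpha> \<beta>" for a \<alpha> \<beta>
    using F that by (simp add: is_functor_def arr_def)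
  show ?thesis
    unfolding is_ab_nat_def C.opposite_simps contra_hom_diagram_def ab_diagram.simps
  proof (intro conjI ballI)
    fix \<alpha> assume \<alpha>: "\<alpha> \<in> Ob C"
    have Do: "Do \<alpha> \<in> Ob S" using F \<alpha> by (simp add: is_functor_def)
    show "(\<lambda>f. g \<cdot> f) \<in> hom (hom_group S (Do \<alpha>) Y) (hom_group S (Do \<alpha>) Z)"
      using post_hom[OF g Do] .
    fix \<beta> a f assume "\<beta> \<in> Ob C" "a \<in> Hom C \<beta> \<alpha>" and f: "f \<in> carrier (hom_group S (Do \<alpha>) Y)"
    then have "arr C a \<beta> \<alpha>" using \<alpha> by (simp add: arr_def)
    moreover have "arr S f (Do \<alpha>) Y" using f Do g by (simp add: arr_def)
    ultimately show "g \<cdot> f \<cdot> Da a = (g \<cdot> f) \<cdot> Da a"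
      using arr_assoc[OF Da _ g] by simp
  qed
qed

end

section \<open>Cones over finite parts of a filtered category\<close>

context category
begin

lemma filtered_bound:
  assumes f: "filtered C" and "finite V" "V \<subseteq> Ob C"
  shows "\<exists>\<gamma> e. \<gamma> \<in> Ob C \<and> (\<forall>v\<in>V. arr C (e v) v \<gamma>)"
  using assms(2,3)
proof (induction V rule: finite_induct)
  case empty
  then show ?case using f by (auto simp: filtered_def)
next
  case (insert v V)
  then obtain \<gamma> e where \<gamma>: "\<gamma> \<in> Ob C" "\<forall>v\<in>V. arr C (e v) v \<gamma>" by auto
  obtain \<delta> a b where "arr C a \<gamma> \<delta>" "arr C b v \<delta>"
    using f \<gamma>(1) insert.prems unfolding filtered_def arr_def by blast
  then have "\<delta> \<in> Ob C \<and> (\<forall>u\<in>insert v V. arr C ((\<lambda>u. if u = v then b else a \<cdot> e u) u) u \<delta>)"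
    using \<gamma>(2) arr_comp[of "e u" u \<gamma> a \<delta> for u] by (auto simp: arr_Ob)
  then show ?case by (intro exI)
qed

text \<open>Start from a common bound of the vertices and coequalise the relations one at a time;
  composing with a further arrow keeps those already achieved.\<close>

lemma filtered_cone:
  assumes f: "filtered C" and V: "finite V" "V \<subseteq> Ob C" and T: "finite T"
    and TV: "\<And>a \<alpha> \<beta>. (a, \<alpha>, \<beta>) \<in> T \<Longrightarrow> arr C a \<alpha> \<beta> \<and> \<alpha> \<in> V \<and> \<beta> \<in> V"
  shows "\<exists>\<gamma> e. (\<forall>v\<in>V. arr C (e v) v \<gamma>) \<and> (\<forall>(a, \<alpha>, \<beta>)\<in>T. e \<beta> \<cdot> a = e \<alpha>)"
  using T TV
proof (induction T rule: finite_induct)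
  case empty
  then show ?case using filtered_bound[OF f V] by auto
next
  case (insert t T)
  obtain a \<alpha> \<beta> where t: "t = (a, \<alpha>, \<beta>)" by (cases t)
  obtain \<gamma> e where e: "\<And>v. v \<in> V \<Longrightarrow> arr C (e v) v \<gamma>" and eT: "\<And>a \<alpha> \<beta>. (a, \<alpha>, \<beta>) \<in> T \<Longrightarrow> e \<beta> \<cdot> a = e \<alpha>"
    using insert.IH insert.prems by fastforce
  have a: "arr C a \<alpha> \<beta>" "\<alpha> \<in> V" "\<beta> \<in> V" using insert.prems[of a \<alpha> \<beta>] t by auto
  have "arr C (e \<beta> \<cdot> a) \<alpha> \<gamma>" "arr C (e \<alpha>) \<alpha> \<gamma>"
    using arr_comp[OF a(1) e[OF a(3)]] e[OF a(2)] by auto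
  then obtain \<delta> h where h: "arr C h \<gamma> \<delta>" "h \<cdot> (e \<beta> \<cdot> a) = h \<cdot> e \<alpha>"
    using f unfolding filtered_def arr_def by metis
  have "(h \<cdot> e \<beta>') \<cdot> a' = h \<cdot> e \<alpha>'" if "(a', \<alpha>', \<beta>') \<in> insert t T" for a' \<alpha>' \<beta>'
  proof -
    have a': "arr C a' \<alpha>' \<beta>'" "\<beta>' \<in> V" using insert.prems[OF that] by auto
    show ?thesis
      using arr_assoc[OF a'(1) e[OF a'(2)] h(1)] eT[of a' \<alpha>' \<beta>'] h(2) that t by auto
  qed
  moreover have "arr C (h \<cdot> e v) v \<delta>" if "v \<in> V" for v
    using arr_comp[OF e[OF that] h(1)] .
  ultimately show ?case
    by (intro exI[of _ \<delta>] exI[of _ "\<lambda>v. h \<cdot> e v"]) auto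
qed

definition endpoint :: "'o \<Rightarrow> 'a list \<Rightarrow> 'o" where
  "endpoint \<alpha> l = (if l = [] then \<alpha> else tgt C (last l))"

primrec steps :: "'o \<Rightarrow> 'a list \<Rightarrow> ('a \<times> 'o \<times> 'o) set" where
  "steps \<alpha> [] = {}"
| "steps \<alpha> (a # l) = insert (a, \<alpha>, tgt C a) (steps (tgt C a) l)"

definition vertices :: "'o \<Rightarrow> 'a list \<Rightarrow> 'o set" where
  "vertices \<alpha> l = insert \<alpha> (tgt C ` set l)"

lemma finite_steps: "finite (steps \<alpha> l)"
  by (induction l arbitrary: \<alpha>) auto

lemma vertices_Cons: "vertices \<alpha> (a # l) = insert \<alpha> (vertices (tgt C a) l)"
  by (simp add: vertices_def)

lemma endpoint_Cons: "arr C a \<alpha> \<beta> \<Longrightarrow> endpoint \<alpha> (a # l) = endpoint \<beta> l"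
  by (simp add: endpoint_def tgt_eq)

lemma endpoint_vertices: "endpoint \<alpha> l \<in> vertices \<alpha> l"
  by (simp add: endpoint_def vertices_def)

lemma endpoint_path: "path C \<alpha> l \<gamma> \<Longrightarrow> endpoint \<alpha> l = \<gamma>"
  by (induction l arbitrary: \<alpha>) (auto simp: endpoint_Cons, simp add: endpoint_def)

lemma path_append: "path C \<alpha> l \<gamma> \<Longrightarrow> arr C a \<gamma> \<delta> \<Longrightarrow> path C \<alpha> (l @ [a]) \<delta>"
  by (induction l arbitrary: \<alpha>) (auto simp: arr_def)

lemma chain_append: "chain C n \<alpha> l \<Longrightarrow> arr C a (endpoint \<alpha> l) \<delta> \<Longrightarrow> chain C (Suc n) \<alpha> (l @ [a])"
  using path_append endpoint_path unfolding chain_def by fastforce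

lemma vertices_Ob: "chain C n \<alpha> l \<Longrightarrow> vertices \<alpha> l \<subseteq> Ob C"
  by (induction n arbitrary: \<alpha> l) (auto simp: chain_0 chain_Suc vertices_Cons tgt_eq arr_Ob, auto simp: vertices_def)

lemma steps_arr: "chain C n \<alpha> l \<Longrightarrow> (a, \<delta>, \<epsilon>) \<in> steps \<alpha> l \<Longrightarrow> arr C a \<delta> \<epsilon> \<and> \<delta> \<in> vertices \<alpha> l \<and> \<epsilon> \<in> vertices \<alpha> l"
proof (induction n arbitrary: \<alpha> l)
  case (Suc n)
  then obtain b \<beta> k where l: "l = b # k" "arr C b \<alpha> \<beta>" "chain C n \<beta> k" by (auto simp: chain_Suc)
  then show ?case
    using Suc.IH[OF l(3)] Suc.prems by (auto simp: tgt_eq vertices_Cons) (simp add: vertices_def)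
qed (auto simp: chain_0)

text \<open>Dropping the last arrow moves the endpoint, the other faces keep it. Either way it stays
  among the vertices, over which the cone will be defined.\<close>

lemma endpoint_face:
  "chain C (Suc n) \<alpha> l \<Longrightarrow> l' \<in> Poly_Mapping.keys (bd C l) \<Longrightarrow> endpoint \<alpha> l' \<in> vertices \<alpha> l"
proof (induction l arbitrary: n \<alpha> l')
  case (Cons a t)
  show ?case
  proof (cases t)
    case Nil
    then show ?thesis using Cons.prems by (auto simp: endpoint_def vertices_def)
  next
    case (Cons b l)
    obtain m where n: "n = Suc m" using Cons Cons.prems(1) by (cases n) (auto simp: chain_def)
    obtain \<beta> \<gamma> where ab: "arr C a \<alpha> \<beta>" "arr C b \<beta> \<gamma>" "chain C m \<gamma> l"
      using Cons.prems(1) n Cons by (auto simp: chain_Cons)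
    have "l' = (b \<cdot> a) # l \<or> (\<exists>l''\<in>Poly_Mapping.keys (bd C t). l' = a # l'')"
      using Cons.prems(2) keys_consf Cons by (fastforce dest: keys_frag_diff)
    then show ?thesis
    proof
      assume l': "l' = (b \<cdot> a) # l"
      have "endpoint \<alpha> l' = endpoint \<gamma> l"
        unfolding l' by (rule endpoint_Cons[OF arr_comp[OF ab(1,2)]])
      then show ?thesis
        using endpoint_vertices[of \<gamma> l] ab Cons by (simp add: vertices_Cons tgt_eq)
    next
      assume "\<exists>l''\<in>Poly_Mapping.keys (bd C t). l' = a # l''"
      then obtain l'' where l'': "l'' \<in> Poly_Mapping.keys (bd C t)" "l' = a # l''" by blast
      have "chain C (Suc m) \<beta> t" using ab Cons by (auto simp: chain_Cons)
      from Cons.IH[OF this l''(1)] show ?thesis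
        using l'' ab by (simp add: endpoint_Cons vertices_Cons tgt_eq)
    qed
  qed
qed simp

text \<open>Coning off at the end. The face that composes the last arrow of \<open>l\<close> with
  the cone arrow is, by the cone relation, the cone on the face without that last arrow. The only
  other new face forgets the cone arrow and returns \<open>l\<close>, with sign (-1)^(n+1) for
  length n+1.\<close>

lemma bd_append:
  assumes "chain C (Suc n) \<alpha> l" and "\<And>a \<delta> \<epsilon>. (a, \<delta>, \<epsilon>) \<in> steps \<alpha> l \<Longrightarrow> e \<epsilon> \<cdot> a = e \<delta>"
  shows "bd C (l @ [e (endpoint \<alpha> l)]) =
    frag_extend (\<lambda>k. frag_of (k @ [e (endpoint \<alpha> k)])) (bd C l) + frag_cmul ((- 1) ^ Suc n) (frag_of l)"
  using assms
proof (induction n arbitrary: \<alpha> l)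
  case 0
  then obtain a \<beta> where l: "l = [a]" "arr C a \<alpha> \<beta>" by (auto simp: chain_Suc chain_0)
  then have "e \<beta> \<cdot> a = e \<alpha>" using 0(2) by (simp add: tgt_eq)
  then show ?case using l by (simp add: endpoint_def tgt_eq)
next
  case (Suc n)
  obtain a b \<beta> \<gamma> k where l: "l = a # b # k" and a: "arr C a \<alpha> \<beta>" and b: "arr C b \<beta> \<gamma>" and k: "chain C n \<gamma> k"
    using Suc.prems(1) by (auto simp: chain_Suc)
  have bk: "chain C (Suc n) \<beta> (b # k)" using b k by (auto simp: chain_Cons)
  let ?x = "\<lambda>\<alpha> k. frag_of (k @ [e (endpoint \<alpha> k)])"
  have IH: "bd C ((b # k) @ [e (endpoint \<beta> (b # k))]) =
      frag_extend (?x \<beta>) (bd C (b # k)) + frag_cmul ((- 1) ^ Suc n) (frag_of (b # k))"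
    using Suc.prems(2) by (intro Suc.IH[OF bk]) (simp add: l tgt_eq[OF a])
  have comm: "consf a (frag_extend (?x \<beta>) c) = frag_extend (?x \<alpha>) (consf a c)" for c
    by (rule free_Abelian_group_induct[OF subset_UNIV, of _ c])
      (simp_all add: frag_extend_diff endpoint_Cons[OF a])
  have e: "endpoint \<alpha> l = endpoint \<gamma> k" "endpoint \<beta> (b # k) = endpoint \<gamma> k" "endpoint \<alpha> ((b \<cdot> a) # k) = endpoint \<gamma> k"
    using endpoint_Cons a b arr_comp[OF a b] by (simp_all add: l)
  have "bd C (l @ [e (endpoint \<alpha> l)]) =
      frag_of (((b \<cdot> a) # k) @ [e (endpoint \<gamma> k)]) - consf a (bd C ((b # k) @ [e (endpoint \<beta> (b # k))]))"
    by (simp add: l e[unfolded l])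
  also have "\<dots> = frag_extend (?x \<alpha>) (frag_of ((b \<cdot> a) # k) - consf a (bd C (b # k)))
      + frag_cmul ((- 1) ^ Suc (Suc n)) (frag_of l)"
    unfolding IH by (simp add: l e frag_extend_diff frag_extend_add frag_extend_cmul comm flip: minus_frag_cmul)
  finally show ?case
    by (simp add: l)
qed

end

section \<open>The bar resolution of a minimal cone\<close>

text \<open>\<open>sum_map\<close> multiplies over a support that varies with \<open>x\<close>;
  \<open>gfinprod\<close> over the fixed index set gives the same value and is additive in
  \<open>x\<close>.\<close>

lemma sum_map_eq_gfinprod:
  assumes H: "comm_group H" and G: "\<And>i. i \<in> I \<Longrightarrow> group (G i)" and h: "\<And>i. i \<in> I \<Longrightarrow> h i \<in> hom (G i) H"
    and x: "x \<in> carrier (sum_group I G)"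
  shows "sum_map I G H h x = gfinprod H (\<lambda>i. h i (x i)) I"
proof -
  interpret H: comm_group H by fact
  let ?A = "{i \<in> I. x i \<noteq> \<one>\<^bsub>G i\<^esub>}"
  have A: "finite ?A" and xi: "\<And>i. i \<in> I \<Longrightarrow> h i (x i) \<in> carrier H"
    using x G hom_in_carrier[OF h] by (auto simp: carrier_sum_group)
  have "gfinprod H (\<lambda>i. h i (x i)) I = gfinprod H (\<lambda>i. h i (x i)) ?A"
    using hom_one[OF h G H.is_group] xi by (intro H.gfinprod_mono_neutral_cong_right) auto
  also have "\<dots> = finprod H (\<lambda>i. h i (x i)) ?A"
    using A xi by (intro H.gfinprod_eq_finprod) auto
  finally show ?thesis by (simp add: sum_map_def)
qed

lemma sum_map_hom:
  assumes H: "comm_group H" and G: "\<And>i. i \<in> I \<Longrightarrow> group (G i)" and h: "\<And>i. i \<in> I \<Longrightarrow> h i \<in> hom (G i) H"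
  shows "sum_map I G H h \<in> hom (sum_group I G) H"
proof -
  have g: "(\<lambda>x. gfinprod H (\<lambda>i. h i (x i)) I) \<in> hom (sum_group I G) H"
    by (rule comm_group.hom_group_sum[OF H h G])
  have eq: "sum_map I G H h x = gfinprod H (\<lambda>i. h i (x i)) I" if "x \<in> carrier (sum_group I G)" for x
    by (rule sum_map_eq_gfinprod[OF H G h that])
  show ?thesis
  proof (rule homI)
    fix x assume x: "x \<in> carrier (sum_group I G)"
    show "sum_map I G H h x \<in> carrier H"
      using hom_in_carrier[OF g x] eq[OF x] by simp
    fix y assume y: "y \<in> carrier (sum_group I G)"
    have xy: "x \<otimes>\<^bsub>sum_group I G\<^esub> y \<in> carrier (sum_group I G)"
      using monoid.m_closed[OF group.is_monoid[OF sum_group[OF G]] x y] .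
    show "sum_map I G H h (x \<otimes>\<^bsub>sum_group I G\<^esub> y) = sum_map I G H h x \<otimes>\<^bsub>H\<^esub> sum_map I G H h y"
      using hom_mult[OF g x y] eq[OF xy] eq[OF x] eq[OF y] by simp
  qed
qed

lemma sum_incl_closed:
  assumes G: "\<And>i. i \<in> I \<Longrightarrow> group (G i)" and "\<alpha> \<in> I" "x \<in> carrier (G \<alpha>)"
  shows "sum_incl I G \<alpha> x \<in> carrier (sum_group I G)"
proof -
  have "finite {i \<in> I. sum_incl I G \<alpha> x i \<noteq> \<one>\<^bsub>G i\<^esub>}"
    by (rule finite_subset[of _ "{\<alpha>}"]) (auto simp: sum_incl_def)
  moreover have "sum_incl I G \<alpha> x \<in> (\<Pi>\<^sub>E i\<in>I. carrier (G i))"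
    using assms by (auto simp: sum_incl_def group.is_monoid monoid.one_closed)
  ultimately show ?thesis
    using G by (simp add: carrier_sum_group)
qed

lemma sum_map_incl:
  assumes H: "comm_group H" and G: "\<And>i. i \<in> I \<Longrightarrow> group (G i)" and h: "\<And>i. i \<in> I \<Longrightarrow> h i \<in> hom (G i) H"
    and \<alpha>: "\<alpha> \<in> I" and x: "x \<in> carrier (G \<alpha>)"
  shows "sum_map I G H h (sum_incl I G \<alpha> x) = h \<alpha> x"
proof -
  interpret H: comm_group H by fact
  have "{i \<in> I. sum_incl I G \<alpha> x i \<noteq> \<one>\<^bsub>G i\<^esub>} = (if x = \<one>\<^bsub>G \<alpha>\<^esub> then {} else {\<alpha>})"
    using \<alpha> by (auto simp: sum_incl_def)
  then show ?thesis
    using hom_one[OF h[OF \<alpha>] G[OF \<alpha>] H.is_group] hom_in_carrier[OF h[OF \<alpha>] x] \<alpha>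
    by (auto simp: sum_map_def sum_incl_def)
qed

locale minimal_cone_diagram = brown_phantom_category S small
  for S :: "('o, 'a, 'z) triangulated_data_scheme" (structure) and small :: "'i set \<Rightarrow> bool" +
  fixes C :: "('i, 'i) category_data" and Do :: "'i \<Rightarrow> 'o" and Da :: "'i \<Rightarrow> 'a" and X :: 'o and c :: "'i \<Rightarrow> 'a"
  assumes C_small: "small_category small C" and C_filtered: "filtered C"
    and diagram_functor: "is_functor C S Do Da"
    and Do_fin: "\<And>\<alpha>. \<alpha> \<in> Ob C \<Longrightarrow> Do \<alpha> \<in> Fin"
    and min_cone: "minimal_cone small C S Do Da X c"
begin

sublocale C: category C
  using C_small by (simp add: small_category_def)

lemma Do_Ob: "\<alpha> \<in> Ob C \<Longrightarrow> Do \<alpha> \<in> Ob S"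
  using finite_objects_Ob[OF Do_fin] .

lemma Da_arr: "arr C a \<alpha> \<beta> \<Longrightarrow> arr S (Da a) (Do \<alpha>) (Do \<beta>)"
  using diagram_functor by (simp add: is_functor_def arr_def)

lemma X_Ob: "X \<in> Ob S"
  using min_cone by (simp add: minimal_cone_def is_cone_def)

lemma c_arr: "\<alpha> \<in> Ob C \<Longrightarrow> arr S (c \<alpha>) (Do \<alpha>) X"
  using min_cone Do_Ob by (simp add: minimal_cone_def is_cone_def arr_def)

lemma c_comp: "arr C a \<alpha> \<beta> \<Longrightarrow> c \<beta> \<cdot> Da a = c \<alpha>"
  using min_cone by (simp add: minimal_cone_def is_cone_def arr_def)

lemma sus_diagram_functor: "is_functor C S (Sus S \<circ> Do) (SusMap S \<circ> Da)"
proof -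
  have "SusMap S (Da (b \<cdot>\<^bsub>C\<^esub> a)) = SusMap S (Da b) \<cdot> SusMap S (Da a)" if "arr C a \<alpha> \<beta>" "arr C b \<beta> \<gamma>" for a b \<alpha> \<beta> \<gamma>
  proof -
    have "Da (b \<cdot>\<^bsub>C\<^esub> a) = Da b \<cdot> Da a"
      using diagram_functor that unfolding is_functor_def arr_def by blast
    then show ?thesis
      using sus_comp[OF Da_arr[OF that(1)] Da_arr[OF that(2)]] by simp
  qed
  moreover have "SusMap S (Da (Id C \<alpha>)) = Id S (Sus S (Do \<alpha>))" if "\<alpha> \<in> Ob C" for \<alpha>
    using diagram_functor sus_map_id[OF Do_Ob] that by (simp add: is_functor_def)
  moreover have "SusMap S (Da a) \<in> Hom S (Sus S (Do \<alpha>)) (Sus S (Do \<beta>))" if "arr C a \<alpha> \<beta>" for a \<alpha> \<beta>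
    using arr_Hom[OF sus_arr[OF Da_arr[OF that]]] .
  ultimately show ?thesis
    unfolding is_functor_def arr_def using sus_Ob[OF Do_Ob] by simp
qed

abbreviation G :: "'o \<Rightarrow> ('i, 'i, 'a) ab_diagram" where
  "G \<equiv> contra_hom_diagram S Do Da"

abbreviation F :: "'o \<Rightarrow> ('i, 'i, 'a) ab_diagram" where
  "F \<equiv> contra_hom_diagram S (Sus S \<circ> Do) (SusMap S \<circ> Da)"

lemma G_diagram: "Z \<in> Ob S \<Longrightarrow> is_ab_diagram (opposite C) (G Z)"
  using is_ab_diagram_contra_hom[OF C.category_axioms diagram_functor] .

lemma F_diagram: "Z \<in> Ob S \<Longrightarrow> is_ab_diagram (opposite C) (F Z)"
  using is_ab_diagram_contra_hom[OF C.category_axioms sus_diagram_functor] .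

lemma G_simps [simp]: "Grp (G Z) \<alpha> = hom_group S (Do \<alpha>) Z" "Map (G Z) a f = f \<cdot> Da a"
  by (simp_all add: contra_hom_diagram_def)

lemma F_simps [simp]: "Grp (F Z) \<alpha> = hom_group S (Sus S (Do \<alpha>)) Z" "Map (F Z) a f = f \<cdot> SusMap S (Da a)"
  by (simp_all add: contra_hom_diagram_def)

lemma small_sized_chains: "small_sized small (C.chains n)"
  using C.small_sized_chains[OF small] C_small small_sized_small
  by (auto simp: small_category_def)

text \<open>Object and injections are chosen as one pair, together with the properties used later,
  so that \<open>P\<close> and \<open>incp\<close> always belong together.\<close>

definition bar :: "nat \<Rightarrow> 'o \<times> ('i \<times> 'i list \<Rightarrow> 'a)" where
  "bar n = (SOME (P, \<iota>). is_coproduct S (C.chains n) (\<lambda>\<sigma>. Do (fst \<sigma>)) P \<iota> \<and> proj P \<and>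
     (\<forall>W\<in>Fin. \<forall>x. arr S x W P \<longrightarrow> (\<exists>A y. finite A \<and> A \<subseteq> C.chains n \<and> (\<forall>\<sigma>\<in>A. arr S (y \<sigma>) W (Do (fst \<sigma>))) \<and>
        x = finprod (hom_group S W P) (\<lambda>\<sigma>. \<iota> \<sigma> \<cdot> y \<sigma>) A)))"

abbreviation P :: "nat \<Rightarrow> 'o" where "P n \<equiv> fst (bar n)"
abbreviation incp :: "nat \<Rightarrow> 'i \<times> 'i list \<Rightarrow> 'a" where "incp n \<equiv> snd (bar n)"
abbreviation inc :: "nat \<Rightarrow> 'i \<Rightarrow> 'i list \<Rightarrow> 'a" where "inc n \<alpha> l \<equiv> incp n (\<alpha>, l)"

lemma bar_properties:
  shows P_coproduct: "is_coproduct S (C.chains n) (\<lambda>\<sigma>. Do (fst \<sigma>)) (P n) (incp n)"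
    and P_proj: "proj (P n)"
    and P_sum: "W \<in> Fin \<Longrightarrow> arr S x W (P n) \<Longrightarrow> \<exists>A y. finite A \<and> A \<subseteq> C.chains n \<and>
        (\<forall>\<sigma>\<in>A. arr S (y \<sigma>) W (Do (fst \<sigma>))) \<and> x = finprod (hom_group S W (P n)) (\<lambda>\<sigma>. incp n \<sigma> \<cdot> y \<sigma>) A"
proof -
  have Ob: "fst \<sigma> \<in> Ob C" if "\<sigma> \<in> C.chains n" for \<sigma>
    using that chain_Ob by (auto simp: C.chains_def)
  obtain P' \<iota> where 1: "is_coproduct S (C.chains n) (\<lambda>\<sigma>. Do (fst \<sigma>)) P' \<iota>"
    and proj: "(\<And>\<sigma>. \<sigma> \<in> C.chains n \<Longrightarrow> Do (fst \<sigma>) \<in> Fin) \<Longrightarrow> proj P'"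
    and 2: "\<And>W x. W \<in> Fin \<Longrightarrow> arr S x W P' \<Longrightarrow> \<exists>A y. finite A \<and> A \<subseteq> C.chains n \<and> (\<forall>\<sigma>\<in>A. arr S (y \<sigma>) W (Do (fst \<sigma>))) \<and>
        x = finprod (hom_group S W P') (\<lambda>\<sigma>. \<iota> \<sigma> \<cdot> y \<sigma>) A"
    by (rule small_sized_coproduct[OF small_sized_chains[of n], of "\<lambda>\<sigma>. Do (fst \<sigma>)"]) (use Do_Ob[OF Ob] in blast)+
  have 3: "proj P'" using proj Do_fin[OF Ob] by blast
  have "(\<lambda>(P, \<iota>). is_coproduct S (C.chains n) (\<lambda>\<sigma>. Do (fst \<sigma>)) P \<iota> \<and> proj P \<and>
     (\<forall>W\<in>Fin. \<forall>x. arr S x W P \<longrightarrow> (\<exists>A y. finite A \<and> A \<subseteq> C.chains n \<and> (\<forall>\<sigma>\<in>A. arr S (y \<sigma>) W (Do (fst \<sigma>))) \<and>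
        x = finprod (hom_group S W P) (\<lambda>\<sigma>. \<iota> \<sigma> \<cdot> y \<sigma>) A))) (bar n)"
    unfolding bar_def by (rule someI[of _ "(P', \<iota>)"]) (use 1 2 3 in simp)
  then show "is_coproduct S (C.chains n) (\<lambda>\<sigma>. Do (fst \<sigma>)) (P n) (incp n)" "proj (P n)"
    "W \<in> Fin \<Longrightarrow> arr S x W (P n) \<Longrightarrow> \<exists>A y. finite A \<and> A \<subseteq> C.chains n \<and>
        (\<forall>\<sigma>\<in>A. arr S (y \<sigma>) W (Do (fst \<sigma>))) \<and> x = finprod (hom_group S W (P n)) (\<lambda>\<sigma>. incp n \<sigma> \<cdot> y \<sigma>) A"
    by (auto simp: case_prod_unfold)
qed

lemma P_Ob: "P n \<in> Ob S"
  using P_proj by (simp add: proj_def)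

lemma inc_arr: "chain C n \<alpha> l \<Longrightarrow> arr S (inc n \<alpha> l) (Do \<alpha>) (P n)"
  using coproduct_incl[OF P_coproduct, of "(\<alpha>, l)" n] by (simp add: C.chains_def)

lemma P_eqI: "arr S f (P n) Z \<Longrightarrow> arr S g (P n) Z \<Longrightarrow>
    (\<And>\<alpha> l. chain C n \<alpha> l \<Longrightarrow> f \<cdot> inc n \<alpha> l = g \<cdot> inc n \<alpha> l) \<Longrightarrow> f = g"
  using coproduct_eqI[OF P_coproduct] by (auto simp: C.chains_def)

lemma P_induced:
  assumes Z: "Z \<in> Ob S" and \<phi>: "cochain C (G Z) n \<phi>"
  obtains g where "arr S g (P n) Z" "\<And>\<alpha> l. chain C n \<alpha> l \<Longrightarrow> g \<cdot> inc n \<alpha> l = \<phi> \<alpha> l"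
proof -
  have "arr S (\<phi> (fst \<sigma>) (snd \<sigma>)) (Do (fst \<sigma>)) Z" if "\<sigma> \<in> C.chains n" for \<sigma>
    using \<phi> that Z Do_Ob chain_Ob[of C n] by (auto simp: cochain_def C.chains_def arr_def)
  then obtain g where "arr S g (P n) Z" "\<And>\<sigma>. \<sigma> \<in> C.chains n \<Longrightarrow> g \<cdot> incp n \<sigma> = \<phi> (fst \<sigma>) (snd \<sigma>)"
    using coproduct_induced[OF P_coproduct Z, where f="\<lambda>\<sigma>. \<phi> (fst \<sigma>) (snd \<sigma>)"] by blast
  then show thesis
    using that[of g] by (auto simp: C.chains_def)
qed

lemma cochain_G_arr: "Z \<in> Ob S \<Longrightarrow> cochain C (G Z) n \<phi> \<longleftrightarrow> (\<forall>\<alpha> l. chain C n \<alpha> l \<longrightarrow> arr S (\<phi> \<alpha> l) (Do \<alpha>) Z)"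
  using Do_Ob chain_Ob by (fastforce simp: cochain_def arr_def)

lemma cochain_F_arr: "Z \<in> Ob S \<Longrightarrow> cochain C (F Z) n \<phi> \<longleftrightarrow> (\<forall>\<alpha> l. chain C n \<alpha> l \<longrightarrow> arr S (\<phi> \<alpha> l) (Sus S (Do \<alpha>)) Z)"
  using sus_Ob[OF Do_Ob] chain_Ob by (fastforce simp: cochain_def arr_def)

lemma cochain_inc: "cochain C (G (P n)) n (inc n)"
  using inc_arr by (simp add: cochain_G_arr P_Ob)

lemma comp_cobd:
  assumes f: "arr S f Y Z" and "cochain C (G Y) n \<phi>" "chain C (Suc n) \<alpha> l"
  shows "f \<cdot> cobd C (G Y) \<phi> \<alpha> l = cobd C (G Z) (\<lambda>\<alpha> l. f \<cdot> \<phi> \<alpha> l) \<alpha> l"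
  using C.cobd_nat[OF G_diagram[OF arr_Ob(1)[OF f]] G_diagram[OF arr_Ob(2)[OF f]]
      is_ab_nat_contra_hom[OF C.category_axioms diagram_functor f] assms(2,3)] .

text \<open>A cochain with values in maps to \<open>Z\<close> is the same as a map out of
  \<open>P n\<close>, and \<open>inc n\<close> is the universal cochain. \<open>D n\<close> is the
  map given by its coboundary, so precomposition with \<open>D n\<close> is \<open>cobd\<close>, see
  \<open>comp_D\<close>.\<close>

definition D :: "nat \<Rightarrow> 'a" where
  "D n = (SOME g. arr S g (P (Suc n)) (P n) \<and>
     (\<forall>\<alpha> l. chain C (Suc n) \<alpha> l \<longrightarrow> g \<cdot> inc (Suc n) \<alpha> l = cobd C (G (P n)) (inc n) \<alpha> l))"

lemma D_properties:
  shows D_arr: "arr S (D n) (P (Suc n)) (P n)"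
    and D_inc: "chain C (Suc n) \<alpha> l \<Longrightarrow> D n \<cdot> inc (Suc n) \<alpha> l = cobd C (G (P n)) (inc n) \<alpha> l"
proof -
  obtain g where "arr S g (P (Suc n)) (P n)"
    "\<And>\<alpha> l. chain C (Suc n) \<alpha> l \<Longrightarrow> g \<cdot> inc (Suc n) \<alpha> l = cobd C (G (P n)) (inc n) \<alpha> l"
    using P_induced[OF P_Ob C.cochain_cobd[OF G_diagram[OF P_Ob] cochain_inc]] by blast
  then have "\<exists>g. arr S g (P (Suc n)) (P n) \<and>
     (\<forall>\<alpha> l. chain C (Suc n) \<alpha> l \<longrightarrow> g \<cdot> inc (Suc n) \<alpha> l = cobd C (G (P n)) (inc n) \<alpha> l)"
    by (intro exI[of _ g]) simp
  from someI_ex[OF this, folded D_def]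
  show "arr S (D n) (P (Suc n)) (P n)"
    "chain C (Suc n) \<alpha> l \<Longrightarrow> D n \<cdot> inc (Suc n) \<alpha> l = cobd C (G (P n)) (inc n) \<alpha> l"
    by auto
qed

lemma comp_D:
  assumes f: "arr S f (P n) Z" and l: "chain C (Suc n) \<alpha> l"
  shows "(f \<cdot> D n) \<cdot> inc (Suc n) \<alpha> l = cobd C (G Z) (\<lambda>\<alpha> l. f \<cdot> inc n \<alpha> l) \<alpha> l"
  using arr_assoc[OF inc_arr[OF l] D_arr f] D_inc[OF l] comp_cobd[OF f cochain_inc l] by simp

lemma D_D: "D n \<cdot> D (Suc n) = Zero S (P (Suc (Suc n))) (P n)"
proof (rule P_eqI)
  show "arr S (D n \<cdot> D (Suc n)) (P (Suc (Suc n))) (P n)"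
    using arr_comp[OF D_arr D_arr] .
  show "arr S (Zero S (P (Suc (Suc n))) (P n)) (P (Suc (Suc n))) (P n)"
    using arr_zero[OF P_Ob P_Ob] .
  fix \<alpha> l assume l: "chain C (Suc (Suc n)) \<alpha> l"
  have "(D n \<cdot> D (Suc n)) \<cdot> inc (Suc (Suc n)) \<alpha> l = cobd C (G (P n)) (\<lambda>\<alpha> l. D n \<cdot> inc (Suc n) \<alpha> l) \<alpha> l"
    by (rule comp_D[OF D_arr l])
  also have "\<dots> = cobd C (G (P n)) (cobd C (G (P n)) (inc n)) \<alpha> l"
    using C.cochain_cobd[OF G_diagram[OF P_Ob] cochain_inc]
    by (intro C.cobd_cong[OF G_diagram[OF P_Ob] _ D_inc l]) (simp add: cochain_def D_inc)
  also have "\<dots> = Zero S (Do \<alpha>) (P n)"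
    using C.cobd_cobd[OF G_diagram[OF P_Ob] cochain_inc l] by simp
  finally show "(D n \<cdot> D (Suc n)) \<cdot> inc (Suc (Suc n)) \<alpha> l = Zero S (P (Suc (Suc n))) (P n) \<cdot> inc (Suc (Suc n)) \<alpha> l"
    using comp_zero_left[OF inc_arr[OF l] P_Ob] by simp
qed

text \<open>The homotopy identity in \<open>bar_exact\<close> is available only on a finite set
  \<open>A\<close> of chains; a map assembled from these summands does not see the others.\<close>

lemma P_sum_agree:
  assumes W: "W \<in> Ob S" and f: "arr S f (P n) Z" and g: "arr S g (P n) Z" and A: "A \<subseteq> C.chains n"
    and eq: "\<And>\<sigma>. \<sigma> \<in> A \<Longrightarrow> f \<cdot> incp n \<sigma> = g \<cdot> incp n \<sigma>"
    and y: "\<And>\<sigma>. \<sigma> \<in> A \<Longrightarrow> arr S (y \<sigma>) W (Do (fst \<sigma>))"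
  shows "f \<cdot> finprod (hom_group S W (P n)) (\<lambda>\<sigma>. incp n \<sigma> \<cdot> y \<sigma>) A
    = g \<cdot> finprod (hom_group S W (P n)) (\<lambda>\<sigma>. incp n \<sigma> \<cdot> y \<sigma>) A"
proof -
  have Z: "Z \<in> Ob S" using f by (simp add: arr_def)
  have i: "arr S (incp n \<sigma>) (Do (fst \<sigma>)) (P n)" if "\<sigma> \<in> A" for \<sigma>
    using coproduct_incl[OF P_coproduct] A that by blast
  have iy: "(\<lambda>\<sigma>. incp n \<sigma> \<cdot> y \<sigma>) \<in> A \<rightarrow> carrier (hom_group S W (P n))"
    using arr_Hom[OF arr_comp[OF y i]] by simp
  have "h \<cdot> finprod (hom_group S W (P n)) (\<lambda>\<sigma>. incp n \<sigma> \<cdot> y \<sigma>) A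
      = finprod (hom_group S W Z) (\<lambda>\<sigma>. h \<cdot> incp n \<sigma> \<cdot> y \<sigma>) A" if h: "arr S h (P n) Z" for h
    using hom_finprod[OF hom_comm_group[OF W P_Ob] hom_comm_group[OF W Z] post_hom[OF h W] iy] .
  moreover have "finprod (hom_group S W Z) (\<lambda>\<sigma>. f \<cdot> incp n \<sigma> \<cdot> y \<sigma>) A = finprod (hom_group S W Z) (\<lambda>\<sigma>. g \<cdot> incp n \<sigma> \<cdot> y \<sigma>) A"
  proof (rule comm_monoid.finprod_cong'[OF comm_group.axioms(1)[OF hom_comm_group[OF W Z]] refl])
    show "(\<lambda>\<sigma>. g \<cdot> incp n \<sigma> \<cdot> y \<sigma>) \<in> A \<rightarrow> carrier (hom_group S W Z)"
      using arr_Hom[OF arr_comp[OF arr_comp[OF y i] g]] by simp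
    show "f \<cdot> incp n \<sigma> \<cdot> y \<sigma> = g \<cdot> incp n \<sigma> \<cdot> y \<sigma>" if "\<sigma> \<in> A" for \<sigma>
      using arr_assoc[OF y[OF that] i[OF that] f] arr_assoc[OF y[OF that] i[OF that] g] eq[OF that] by simp
  qed
  ultimately show ?thesis using f g by simp
qed

text \<open>A cone over the finitely many chains in the support of \<open>x\<close> gives a contracting homotopy on them.\<close>

theorem bar_exact:
  assumes W: "W \<in> Fin" and x: "arr S x W (P (Suc m))" and Dx: "D m \<cdot> x = Zero S W (P m)"
  obtains y where "arr S y W (P (Suc (Suc m)))" "D (Suc m) \<cdot> y = x"
proof -
  have W0: "W \<in> Ob S" using W by (rule finite_objects_Ob)
  let ?n = "Suc m"
  obtain A u where A: "finite A" "A \<subseteq> C.chains ?n" and u: "\<And>\<sigma>. \<sigma> \<in> A \<Longrightarrow> arr S (u \<sigma>) W (Do (fst \<sigma>))"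
    and xu: "x = finprod (hom_group S W (P ?n)) (\<lambda>\<sigma>. incp ?n \<sigma> \<cdot> u \<sigma>) A"
    using P_sum[OF W x] by blast
  \<comment> \<open>Only vertices and arrows of the chains that occur in \<open>x\<close> matter;
    being finite in number, they have a cone in the filtered category.\<close>
  define V where "V = (\<Union>(\<alpha>, l)\<in>A. C.vertices \<alpha> l)"
  define T where "T = (\<Union>(\<alpha>, l)\<in>A. C.steps \<alpha> l)"
  have ch: "chain C ?n \<alpha> l" if "(\<alpha>, l) \<in> A" for \<alpha> l
    using A(2) that by (auto simp: C.chains_def)
  have V: "finite V" "V \<subseteq> Ob C"
    using A(1) C.vertices_Ob[OF ch] by (auto simp: V_def C.vertices_def)
  have inV: "v \<in> V" if "(\<alpha>, l) \<in> A" "v \<in> C.vertices \<alpha> l" for v \<alpha> l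
    unfolding V_def by (rule UN_I[OF that(1)]) (use that(2) in simp)
  have T: "finite T" "\<And>a \<alpha> \<beta>. (a, \<alpha>, \<beta>) \<in> T \<Longrightarrow> arr C a \<alpha> \<beta> \<and> \<alpha> \<in> V \<and> \<beta> \<in> V"
    using A(1) C.finite_steps C.steps_arr[OF ch] by (auto simp: T_def intro: inV)
  obtain \<gamma> e where e: "\<And>v. v \<in> V \<Longrightarrow> arr C (e v) v \<gamma>" and eT: "\<And>a \<alpha> \<beta>. (a, \<alpha>, \<beta>) \<in> T \<Longrightarrow> e \<beta> \<cdot>\<^bsub>C\<^esub> a = e \<alpha>"
    using C.filtered_cone[OF C_filtered V T] by fastforce
  let ?ext = "\<lambda>\<alpha> l. l @ [e (C.endpoint \<alpha> l)]"
  have "\<exists>h. arr S h (P k) (P (Suc k)) \<and> (\<forall>\<alpha> l. chain C k \<alpha> l \<longrightarrow> C.endpoint \<alpha> l \<in> V \<longrightarrow>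
      h \<cdot> inc k \<alpha> l = inc (Suc k) \<alpha> (?ext \<alpha> l))" for k
  proof -
    \<comment> \<open>The cone arrow can be appended to chains that end in \<open>V\<close>; on the
      others the homotopy is set to zero.\<close>
    let ?\<phi> = "\<lambda>\<alpha> l. if C.endpoint \<alpha> l \<in> V then inc (Suc k) \<alpha> (?ext \<alpha> l) else Zero S (Do \<alpha>) (P (Suc k))"
    have "cochain C (G (P (Suc k))) k ?\<phi>"
      using inc_arr[OF C.chain_append[OF _ e]] arr_zero[OF Do_Ob[OF chain_Ob] P_Ob]
      by (auto simp: cochain_G_arr P_Ob)
    from P_induced[OF P_Ob this] obtain h where "arr S h (P k) (P (Suc k))"
      "\<And>\<alpha> l. chain C k \<alpha> l \<Longrightarrow> h \<cdot> inc k \<alpha> l = ?\<phi> \<alpha> l" by blast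
    then show ?thesis by (intro exI[of _ h]) simp
  qed
  then obtain h where h: "\<And>k. arr S (h k) (P k) (P (Suc k))"
    and h_inc: "\<And>k \<alpha> l. chain C k \<alpha> l \<Longrightarrow> C.endpoint \<alpha> l \<in> V \<Longrightarrow> h k \<cdot> inc k \<alpha> l = inc (Suc k) \<alpha> (?ext \<alpha> l)"
    by metis
  let ?K = "hom_group S (P ?n) (P ?n)"
  have IdP: "arr S (Id S (P ?n)) (P ?n) (P ?n)" using arr_id[OF P_Ob] .
  \<comment> \<open>The sign of the leftover face in \<open>bd_append\<close>: a chain of length n
    contributes (-1)^n times itself to \<open>bd\<close>, and \<open>cobd\<close> inverts
    this.\<close>
  define s where "s = (if even ?n then neg (P ?n) (P ?n) (Id S (P ?n)) else Id S (P ?n))"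
  have s: "arr S s (P ?n) (P ?n)"
    using IdP arr_neg[OF IdP] by (simp add: s_def)
  have Dh: "arr S (D ?n \<cdot> h ?n) (P ?n) (P ?n)" and hD: "arr S (h m \<cdot> D m) (P ?n) (P ?n)"
    using arr_comp[OF h D_arr] arr_comp[OF D_arr h] by auto
  \<comment> \<open>The homotopy formula D h = h D + s, valid on the chains in \<open>A\<close>
    because these and all their faces end in \<open>V\<close>.\<close>
  have key: "(D ?n \<cdot> h ?n) \<cdot> inc ?n \<alpha> l = Add S (h m \<cdot> D m) s \<cdot> inc ?n \<alpha> l" if \<sigma>: "(\<alpha>, l) \<in> A" for \<alpha> l
  proof -
    note l = ch[OF \<sigma>]
    obtain a \<beta> k where lk: "l = a # k" and a: "arr C a \<alpha> \<beta>" and k: "chain C m \<beta> k"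
      using l by (auto simp: chain_Suc)
    have vV: "v \<in> V" if "v \<in> C.vertices \<alpha> l" for v
      using inV[OF \<sigma> that] .
    let ?H = "hom_group S (Do \<alpha>) (P ?n)"
    interpret H: comm_group ?H
      using hom_comm_group[OF Do_Ob[OF chain_Ob[OF l]] P_Ob] .
    have endl: "C.endpoint \<alpha> l \<in> V" using vV C.endpoint_vertices by blast
    have endk: "C.endpoint \<beta> k = C.endpoint \<alpha> l" using C.endpoint_Cons[OF a] lk by simp
    have le: "chain C (Suc ?n) \<alpha> (?ext \<alpha> l)" using C.chain_append[OF l e[OF endl]] .
    have fc: "chain C m \<alpha> l'" "C.endpoint \<alpha> l' \<in> V" "chain C ?n \<alpha> (?ext \<alpha> l')"
      if "l' \<in> Poly_Mapping.keys (bd C l)" for l'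
    proof -
      show 1: "chain C m \<alpha> l'" using C.keys_bd[OF l that] .
      show 2: "C.endpoint \<alpha> l' \<in> V" using C.endpoint_face[OF l that] vV by blast
      show "chain C ?n \<alpha> (?ext \<alpha> l')" using C.chain_append[OF 1 e[OF 2]] .
    qed
    have il: "inc ?n \<alpha> l \<in> Hom S (Do \<alpha>) (P ?n)" using arr_Hom[OF inc_arr[OF l]] .
    define p where "p = h m \<cdot> D m \<cdot> inc ?n \<alpha> l"
    have cc: "cochain C (G (P ?n)) m (\<lambda>\<alpha> l. h m \<cdot> inc m \<alpha> l)"
      using arr_comp[OF inc_arr h] by (simp add: cochain_G_arr P_Ob)
    have p: "p = ((h m \<cdot> inc m \<beta> k) \<cdot> Da a) \<otimes>\<^bsub>?H\<^esub> inv\<^bsub>?H\<^esub> ev ?H (\<lambda>l. h m \<cdot> inc m \<alpha> l) (bd C l)"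
      using comp_cobd[OF h cochain_inc l] C.cobd_Cons[OF a, of "G (P ?n)" "\<lambda>\<alpha> l. h m \<cdot> inc m \<alpha> l" k] D_inc[OF l]
      by (simp add: p_def lk)
    define q where "q = (h m \<cdot> inc m \<beta> k) \<cdot> Da a"
    define r where "r = ev ?H (\<lambda>l. h m \<cdot> inc m \<alpha> l) (bd C l)"
    have qc: "q \<in> carrier ?H"
      using arr_Hom[OF arr_comp[OF Da_arr[OF a] arr_comp[OF inc_arr[OF k] h]]] by (simp add: q_def)
    have rc: "r \<in> carrier ?H"
      unfolding r_def using arr_Hom[OF arr_comp[OF inc_arr h]] fc by (intro H.ev_closed) auto
    have r2: "r = ev ?H (inc ?n \<alpha>) (frag_extend (\<lambda>l'. frag_of (?ext \<alpha> l')) (bd C l))"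
    proof -
      have "ev ?H (inc ?n \<alpha>) (frag_extend (\<lambda>l'. frag_of (?ext \<alpha> l')) (bd C l))
          = ev ?H (\<lambda>l'. ev ?H (inc ?n \<alpha>) (frag_of (?ext \<alpha> l'))) (bd C l)"
        using arr_Hom[OF inc_arr] fc(3) by (intro H.ev_frag_extend) auto
      also have "\<dots> = r"
        unfolding r_def
      proof (rule H.ev_cong)
        show "(\<lambda>l'. ev ?H (inc ?n \<alpha>) (frag_of (?ext \<alpha> l'))) \<in> Poly_Mapping.keys (bd C l) \<rightarrow> carrier ?H"
          using arr_Hom[OF inc_arr] fc(3) by (intro Pi_I H.ev_closed) auto
        show "ev ?H (inc ?n \<alpha>) (frag_of (?ext \<alpha> l')) = h m \<cdot> inc m \<alpha> l'" if "l' \<in> Poly_Mapping.keys (bd C l)" for l'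
          using h_inc[OF fc(1,2)[OF that]] H.ev_of[of "inc ?n \<alpha>" "?ext \<alpha> l'"] arr_Hom[OF inc_arr[OF fc(3)[OF that]]] by simp
      qed
      finally show ?thesis by simp
    qed
    have st: "e \<epsilon> \<cdot>\<^bsub>C\<^esub> b = e \<delta>" if "(b, \<delta>, \<epsilon>) \<in> C.steps \<alpha> l" for b \<delta> \<epsilon>
    proof (rule eT)
      show "(b, \<delta>, \<epsilon>) \<in> T"
        unfolding T_def by (rule UN_I[OF \<sigma>]) (use that in simp)
    qed
    have bd: "bd C (?ext \<alpha> l) = frag_extend (\<lambda>l'. frag_of (?ext \<alpha> l')) (bd C l) + frag_cmul ((- 1) ^ ?n) (frag_of l)"
      by (rule C.bd_append[where e=e, OF l st])
    define t where "t = ev ?H (inc ?n \<alpha>) (frag_cmul ((- 1) ^ ?n) (frag_of l))"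
    have tc: "t \<in> carrier ?H"
      unfolding t_def using il by (intro H.ev_closed) auto
    have st2: "s \<cdot> inc ?n \<alpha> l = inv\<^bsub>?H\<^esub> t"
    proof (cases "even ?n")
      case True
      then have "t = inc ?n \<alpha> l"
        using il H.ev_of[of "inc ?n \<alpha>" l] by (simp add: t_def)
      then show ?thesis
        using True comp_neg_left[OF inc_arr[OF l] IdP] arr_id_left[OF inc_arr[OF l]] by (simp add: s_def)
    next
      case False
      then have "t = inv\<^bsub>?H\<^esub> inc ?n \<alpha> l"
        using il H.ev_of[of "inc ?n \<alpha>" l] H.ev_minus[of "inc ?n \<alpha>" "frag_of l"] by (simp add: t_def)
      then show ?thesis
        using False il H.inv_inv arr_id_left[OF inc_arr[OF l]] by (simp add: s_def)
    qed
    have "(D ?n \<cdot> h ?n) \<cdot> inc ?n \<alpha> l = D ?n \<cdot> inc (Suc ?n) \<alpha> (?ext \<alpha> l)"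
      using arr_assoc[OF inc_arr[OF l] h D_arr] h_inc[OF l endl] by simp
    also have "\<dots> = cobd C (G (P ?n)) (inc ?n) \<alpha> (a # ?ext \<beta> k)"
      using D_inc[OF le] endk by (simp add: lk)
    also have "\<dots> = (inc ?n \<beta> (?ext \<beta> k) \<cdot> Da a) \<otimes>\<^bsub>?H\<^esub> inv\<^bsub>?H\<^esub> ev ?H (inc ?n \<alpha>) (bd C (?ext \<alpha> l))"
      using C.cobd_Cons[OF a, of "G (P ?n)" "inc ?n" "?ext \<beta> k"] endk by (simp add: lk)
    also have "inc ?n \<beta> (?ext \<beta> k) = h m \<cdot> inc m \<beta> k"
      using h_inc[OF k] endl endk by simp
    also have "ev ?H (inc ?n \<alpha>) (bd C (?ext \<alpha> l)) = r \<otimes>\<^bsub>?H\<^esub> t"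
      unfolding bd r2 t_def
    proof (rule H.ev_add)
      show "inc ?n \<alpha> \<in> Poly_Mapping.keys (frag_cmul ((- 1) ^ ?n) (frag_of l)) \<rightarrow> carrier ?H"
        using il by auto
      show "inc ?n \<alpha> \<in> Poly_Mapping.keys (frag_extend (\<lambda>l'. frag_of (?ext \<alpha> l')) (bd C l)) \<rightarrow> carrier ?H"
        using keys_frag_extend[of "\<lambda>l'. frag_of (?ext \<alpha> l')" "bd C l"] arr_Hom[OF inc_arr[OF fc(3)]] by fastforce
    qed
    finally have "(D ?n \<cdot> h ?n) \<cdot> inc ?n \<alpha> l = q \<otimes>\<^bsub>?H\<^esub> inv\<^bsub>?H\<^esub> (r \<otimes>\<^bsub>?H\<^esub> t)"
      by (simp add: q_def)
    also have "\<dots> = p \<otimes>\<^bsub>?H\<^esub> inv\<^bsub>?H\<^esub> t"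
      unfolding p using qc rc tc by (simp add: H.inv_mult H.m_assoc q_def[symmetric] r_def[symmetric] del: hom_group_simps)
    also have "\<dots> = Add S (h m \<cdot> D m) s \<cdot> inc ?n \<alpha> l"
      using arr_comp_add_left[OF inc_arr[OF l] hD s] st2 arr_assoc[OF inc_arr[OF l] D_arr h] by (simp add: p_def)
    finally show ?thesis .
  qed
  have "(D ?n \<cdot> h ?n) \<cdot> x = Add S (h m \<cdot> D m) s \<cdot> x"
    unfolding xu using key by (intro P_sum_agree[OF W0 Dh arr_add[OF hD s] A(2) _ u]) auto
  also have "\<dots> = s \<cdot> x"
    using arr_comp_add_left[OF x hD s] arr_assoc[OF x D_arr h] Dx comp_zero_right[OF h W0] add_zero_left[OF arr_comp[OF x s]]
    by simp
  finally have *: "D ?n \<cdot> h ?n \<cdot> x = s \<cdot> x"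
    using arr_assoc[OF x h D_arr] by simp
  note hx = arr_comp[OF x h]
  \<comment> \<open>\<open>D m\<close> kills \<open>x\<close>, so D h x = s x, and h x is a preimage
    of \<open>x\<close> up to sign.\<close>
  show thesis
  proof (cases "even ?n")
    case True
    then have "D ?n \<cdot> neg W (P (Suc ?n)) (h ?n \<cdot> x) = x"
      using * comp_neg_left[OF x IdP] arr_id_left[OF x] comp_neg_right[OF hx D_arr] neg_neg[OF x] by (simp add: s_def)
    then show thesis using that arr_neg[OF hx] by blast
  next
    case False
    then have "D ?n \<cdot> h ?n \<cdot> x = x"
      using * arr_id_left[OF x] by (simp add: s_def)
    then show thesis using that hx by blast
  qed
qed

end

lemma comm_group_sum_group:
  assumes "\<And>i. i \<in> I \<Longrightarrow> comm_group (G i)"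
  shows "comm_group (sum_group I G)"
proof -
  have grp: "group (G i)" if "i \<in> I" for i
    using assms[OF that] by (rule comm_group.axioms(2))
  have "x \<otimes>\<^bsub>sum_group I G\<^esub> y = y \<otimes>\<^bsub>sum_group I G\<^esub> x"
    if "x \<in> carrier (sum_group I G)" "y \<in> carrier (sum_group I G)" for x y
    using that by (auto simp: carrier_sum_group grp intro!: restrict_ext comm_monoid.m_comm comm_group.axioms(1) assms)
  then show ?thesis
    using sum_group[OF grp] by (intro group.group_comm_groupI) auto
qed

section \<open>The augmentation to the minimal cone\<close>

context minimal_cone_diagram
begin

definition aug :: 'a where
  "aug = (SOME g. arr S g (P 0) X \<and> (\<forall>\<alpha>\<in>Ob C. g \<cdot> inc 0 \<alpha> [] = c \<alpha>))"

lemma aug_properties: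
  shows aug_arr: "arr S aug (P 0) X" and aug_inc: "\<alpha> \<in> Ob C \<Longrightarrow> aug \<cdot> inc 0 \<alpha> [] = c \<alpha>"
proof -
  have "cochain C (G X) 0 (\<lambda>\<alpha> l. c \<alpha>)"
    using c_arr by (simp add: cochain_G_arr X_Ob chain_0)
  from P_induced[OF X_Ob this] obtain g where "arr S g (P 0) X" "\<And>\<alpha> l. chain C 0 \<alpha> l \<Longrightarrow> g \<cdot> inc 0 \<alpha> l = c \<alpha>"
    by blast
  then have "\<exists>g. arr S g (P 0) X \<and> (\<forall>\<alpha>\<in>Ob C. g \<cdot> inc 0 \<alpha> [] = c \<alpha>)"
    by (intro exI[of _ g]) (simp add: chain_0)
  from someI_ex[OF this, folded aug_def]
  show "arr S aug (P 0) X" "\<alpha> \<in> Ob C \<Longrightarrow> aug \<cdot> inc 0 \<alpha> [] = c \<alpha>"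
    by auto
qed

lemma inc0_arr: "\<alpha> \<in> Ob C \<Longrightarrow> arr S (inc 0 \<alpha> []) (Do \<alpha>) (P 0)"
  using inc_arr by (simp add: chain_0)

lemma P0_eqI: "arr S f (P 0) Z \<Longrightarrow> arr S g (P 0) Z \<Longrightarrow>
    (\<And>\<alpha>. \<alpha> \<in> Ob C \<Longrightarrow> f \<cdot> inc 0 \<alpha> [] = g \<cdot> inc 0 \<alpha> []) \<Longrightarrow> f = g"
  by (rule P_eqI) (auto simp: chain_0)

lemma D0_inc:
  assumes a: "arr C a \<alpha> \<beta>"
  shows "D 0 \<cdot> inc (Suc 0) \<alpha> [a] = Add S (inc 0 \<beta> [] \<cdot> Da a) (neg (Do \<alpha>) (P 0) (inc 0 \<alpha> []))"
proof -
  have l: "chain C (Suc 0) \<alpha> [a]" using a by (auto simp: chain_Suc chain_0 arr_def)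
  have "D 0 \<cdot> inc (Suc 0) \<alpha> [a] = cobd C (G (P 0)) (\<lambda>\<alpha> l. inc 0 \<alpha> []) \<alpha> [a]"
    unfolding D_inc[OF l] using inc0_arr
    by (intro C.cobd_cong[OF G_diagram[OF P_Ob] _ _ l]) (auto simp: cochain_G_arr P_Ob chain_0)
  also have "\<dots> = Add S (inc 0 \<beta> [] \<cdot> Da a) (neg (Do \<alpha>) (P 0) (inc 0 \<alpha> []))"
    using C.cobd_0[OF a G_diagram[OF P_Ob], of "\<lambda>\<alpha>. inc 0 \<alpha> []"] arr_Hom[OF inc0_arr] a by (simp add: arr_def)
  finally show ?thesis .
qed

lemma comp_D0_inc:
  assumes f: "arr S f (P 0) Z" and a: "arr C a \<alpha> \<beta>"
  shows "(f \<cdot> D 0) \<cdot> inc (Suc 0) \<alpha> [a] = Add S ((f \<cdot> inc 0 \<beta> []) \<cdot> Da a) (neg (Do \<alpha>) Z (f \<cdot> inc 0 \<alpha> []))"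
proof -
  have l: "chain C (Suc 0) \<alpha> [a]" using a by (auto simp: chain_Suc chain_0 arr_def)
  have i: "arr S (inc 0 \<alpha> []) (Do \<alpha>) (P 0)" "arr S (inc 0 \<beta> []) (Do \<beta>) (P 0)"
    using inc0_arr a by (auto simp: arr_def)
  note ia = arr_comp[OF Da_arr[OF a] i(2)]
  show ?thesis
    using arr_assoc[OF inc_arr[OF l] D_arr f] D0_inc[OF a] arr_comp_add_right[OF ia arr_neg[OF i(1)] f]
      arr_assoc[OF Da_arr[OF a] i(2) f] comp_neg_right[OF i(1) f] by simp
qed

text \<open>Maps out of \<open>P 0\<close> are families of maps out of the X_\<alpha>, and killing
  \<open>D 0\<close> is compatibility of the family.\<close>

lemma comp_D0_eq_zero_iff:
  assumes f: "arr S f (P 0) Z"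
  shows "f \<cdot> D 0 = Zero S (P (Suc 0)) Z \<longleftrightarrow> (\<forall>a \<alpha> \<beta>. arr C a \<alpha> \<beta> \<longrightarrow> (f \<cdot> inc 0 \<beta> []) \<cdot> Da a = f \<cdot> inc 0 \<alpha> [])"
    (is "?L \<longleftrightarrow> ?R")
proof -
  have Z: "Z \<in> Ob S" using f by (simp add: arr_def)
  have l: "chain C (Suc 0) \<alpha> [a]" if "arr C a \<alpha> \<beta>" for a \<alpha> \<beta>
    using that by (auto simp: chain_Suc chain_0 arr_def)
  have fi: "arr S ((f \<cdot> inc 0 \<beta> []) \<cdot> Da a) (Do \<alpha>) Z" "arr S (f \<cdot> inc 0 \<alpha> []) (Do \<alpha>) Z" if a: "arr C a \<alpha> \<beta>" for a \<alpha> \<beta>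
    using arr_comp[OF Da_arr[OF a] arr_comp[OF inc0_arr f]] arr_comp[OF inc0_arr f] a by (auto simp: arr_def)
  show ?thesis
  proof
    assume L: ?L
    show ?R
    proof (intro allI impI)
      fix a \<alpha> \<beta> assume a: "arr C a \<alpha> \<beta>"
      show "(f \<cdot> inc 0 \<beta> []) \<cdot> Da a = f \<cdot> inc 0 \<alpha> []"
        using comp_D0_inc[OF f a] L comp_zero_left[OF inc_arr[OF l[OF a]] Z] eq_if_diff_zero[OF fi[OF a]] by simp
    qed
  next
    assume R: ?R
    show ?L
    proof (rule P_eqI[OF arr_comp[OF D_arr f] arr_zero[OF P_Ob Z]])
      fix \<alpha> l assume "chain C (Suc 0) \<alpha> l"
      then obtain a \<beta> where la: "l = [a]" and a: "arr C a \<alpha> \<beta>" by (auto simp: chain_Suc chain_0)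
      show "(f \<cdot> D 0) \<cdot> inc (Suc 0) \<alpha> l = Zero S (P (Suc 0)) Z \<cdot> inc (Suc 0) \<alpha> l"
        using comp_D0_inc[OF f a] R a add_neg[OF fi(2)[OF a]] comp_zero_left[OF inc_arr[OF l[OF a]] Z] la by simp
    qed
  qed
qed

lemma aug_D: "aug \<cdot> D 0 = Zero S (P (Suc 0)) X"
  using comp_D0_eq_zero_iff[OF aug_arr] aug_inc c_comp by (simp add: arr_def)

text \<open>For finite \<open>W\<close> the direct sum of the groups S(W, X_\<alpha>) maps onto the
  group of maps W -> P_0, and the relations of the colimit come from maps W -> P_1. Minimality thus
  says that \<open>aug\<close> is a cokernel of \<open>D 0\<close> on finite objects.\<close>

lemma minimal_cone_exact:
  assumes W: "W \<in> Fin"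
  shows "arr S y W X \<Longrightarrow> \<exists>x. arr S x W (P 0) \<and> aug \<cdot> x = y"
    and "arr S x W (P 0) \<Longrightarrow> aug \<cdot> x = Zero S W X \<Longrightarrow> \<exists>z. arr S z W (P (Suc 0)) \<and> D 0 \<cdot> z = x"
proof -
  note [simp del] = mult_sum_group one_sum_group inv_sum_group
  have W0: "W \<in> Ob S" using W by (rule finite_objects_Ob)
  let ?G = "cov_hom_diagram S W Do Da"
  have G: "Grp ?G = (\<lambda>\<alpha>. hom_group S W (Do \<alpha>))" "Map ?G = (\<lambda>a f. Da a \<cdot> f)"
    by (simp_all add: cov_hom_diagram_def)
  let ?S = "sum_group (Ob C) (Grp ?G)"
  have grp: "group (Grp ?G \<alpha>)" "comm_group (Grp ?G \<alpha>)" if "\<alpha> \<in> Ob C" for \<alpha>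
    using hom_group_group[OF W0 Do_Ob[OF that]] hom_comm_group[OF W0 Do_Ob[OF that]] by (simp_all add: G)
  interpret S: comm_group ?S
    using comm_group_sum_group[of "Ob C" "Grp ?G"] grp by simp
  let ?P = "hom_group S W (P 0)" and ?X = "hom_group S W X"
  interpret HP: comm_group ?P using hom_comm_group[OF W0 P_Ob] .
  interpret HX: comm_group ?X using hom_comm_group[OF W0 X_Ob] .
  interpret H1: comm_group "hom_group S W (P (Suc 0))" using hom_comm_group[OF W0 P_Ob] .
  let ?i = "\<lambda>\<alpha> f. inc 0 \<alpha> [] \<cdot> f" and ?c = "\<lambda>\<alpha> f. c \<alpha> \<cdot> f"
  define Ti where "Ti = sum_map (Ob C) (Grp ?G) ?P ?i"
  define Tc where "Tc = sum_map (Ob C) (Grp ?G) ?X ?c"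
  have ih: "?i \<alpha> \<in> hom (Grp ?G \<alpha>) ?P" and ch: "?c \<alpha> \<in> hom (Grp ?G \<alpha>) ?X" if "\<alpha> \<in> Ob C" for \<alpha>
    using post_hom[OF inc0_arr[OF that] W0] post_hom[OF c_arr[OF that] W0] by (simp_all add: G)
  have Ti: "Ti \<in> hom ?S ?P" and Tc: "Tc \<in> hom ?S ?X"
    unfolding Ti_def Tc_def
    by (rule sum_map_hom[OF HP.comm_group_axioms]; use grp(1) ih in auto)
      (rule sum_map_hom[OF HX.comm_group_axioms]; use grp(1) ch in auto)
  have Ti_incl: "Ti (sum_incl (Ob C) (Grp ?G) \<alpha> x) = inc 0 \<alpha> [] \<cdot> x" if "\<alpha> \<in> Ob C" "arr S x W (Do \<alpha>)" for \<alpha> x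
    unfolding Ti_def by (rule sum_map_incl[OF HP.comm_group_axioms grp(1) ih that(1)]) (use arr_Hom[OF that(2)] in \<open>simp_all add: G\<close>)
  have arrS: "arr S (s \<alpha>) W (Do \<alpha>)" if "s \<in> carrier ?S" "\<alpha> \<in> Ob C" for s \<alpha>
    using that grp(1) W0 Do_Ob by (auto simp: carrier_sum_group G arr_def)
  have TiTc: "aug \<cdot> Ti s = Tc s" if s: "s \<in> carrier ?S" for s
  proof -
    let ?A = "{\<alpha> \<in> Ob C. s \<alpha> \<noteq> \<one>\<^bsub>Grp ?G \<alpha>\<^esub>}"
    have "aug \<cdot> Ti s = finprod ?X (\<lambda>\<alpha>. aug \<cdot> inc 0 \<alpha> [] \<cdot> s \<alpha>) ?A"
      unfolding Ti_def sum_map_def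
      using arr_Hom[OF arr_comp[OF arrS[OF s] inc0_arr]]
      by (intro hom_finprod[OF HP.comm_group_axioms HX.comm_group_axioms post_hom[OF aug_arr W0]]) auto
    also have "\<dots> = Tc s"
      unfolding Tc_def sum_map_def
    proof (rule HX.finprod_cong'[OF refl])
      show "(\<lambda>\<alpha>. c \<alpha> \<cdot> s \<alpha>) \<in> ?A \<rightarrow> carrier ?X"
        using arr_Hom[OF arr_comp[OF arrS[OF s] c_arr]] by auto
      show "aug \<cdot> inc 0 \<alpha> [] \<cdot> s \<alpha> = c \<alpha> \<cdot> s \<alpha>" if "\<alpha> \<in> ?A" for \<alpha>
        using that arr_assoc[OF arrS[OF s] inc0_arr aug_arr, of \<alpha>] aug_inc by simp
    qed
    finally show ?thesis .
  qed
  let ?R = "colim_relations C ?G"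
  let ?B = "{sum_incl (Ob C) (Grp ?G) \<alpha> x \<otimes>\<^bsub>?S\<^esub> inv\<^bsub>?S\<^esub> sum_incl (Ob C) (Grp ?G) \<beta> (Map ?G a x)
      | \<alpha> \<beta> a x. \<alpha> \<in> Ob C \<and> \<beta> \<in> Ob C \<and> a \<in> Hom C \<alpha> \<beta> \<and> x \<in> carrier (Grp ?G \<alpha>)}"
  have incl: "sum_incl (Ob C) (Grp ?G) \<alpha> x \<in> carrier ?S" if "\<alpha> \<in> Ob C" "arr S x W (Do \<alpha>)" for \<alpha> x
    by (rule sum_incl_closed[OF grp(1) that(1)]) (use arr_Hom[OF that(2)] in \<open>simp_all add: G\<close>)
  have gen: "b \<in> carrier ?S \<and> (\<exists>z. arr S z W (P (Suc 0)) \<and> D 0 \<cdot> z = Ti b)" if bB: "b \<in> ?B" for b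
  proof -
    obtain \<alpha> \<beta> a x where b: "b = sum_incl (Ob C) (Grp ?G) \<alpha> x \<otimes>\<^bsub>?S\<^esub> inv\<^bsub>?S\<^esub> sum_incl (Ob C) (Grp ?G) \<beta> (Da a \<cdot> x)"
      and a: "arr C a \<alpha> \<beta>" and x: "arr S x W (Do \<alpha>)"
      using bB W0 Do_Ob by (auto simp: G arr_def)
    have Ob: "\<alpha> \<in> Ob C" "\<beta> \<in> Ob C" using a by (auto simp: arr_def)
    note ax = arr_comp[OF x Da_arr[OF a]]
    note i = incl[OF Ob(1) x] incl[OF Ob(2) ax]
    have l: "chain C (Suc 0) \<alpha> [a]" using a by (auto simp: chain_Suc chain_0 arr_def)
    note il = inc_arr[OF l]
    note ix = arr_comp[OF x inc0_arr[OF Ob(1)]] and iax = arr_comp[OF ax inc0_arr[OF Ob(2)]]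
    have Tib: "Ti b = Add S (inc 0 \<alpha> [] \<cdot> x) (neg W (P 0) (inc 0 \<beta> [] \<cdot> Da a \<cdot> x))"
      unfolding b using hom_mult[OF Ti i(1) S.inv_closed[OF i(2)]] Ti_incl[OF Ob(1) x] Ti_incl[OF Ob(2) ax]
        group_hom.hom_inv[OF group_hom.intro[OF S.is_group HP.is_group group_hom_axioms.intro[OF Ti]] i(2)] by simp
    \<comment> \<open>The relation subtracts the value at \<beta> from that at \<alpha>, whereas
      \<open>D 0\<close> subtracts in the other order; hence the sign.\<close>
    let ?z = "neg W (P (Suc 0)) (inc (Suc 0) \<alpha> [a] \<cdot> x)"
    have "D 0 \<cdot> inc (Suc 0) \<alpha> [a] \<cdot> x = Add S ((inc 0 \<beta> [] \<cdot> Da a) \<cdot> x) (neg W (P 0) (inc 0 \<alpha> [] \<cdot> x))"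
      using arr_assoc[OF x il D_arr] D0_inc[OF a] comp_neg_left[OF x inc0_arr[OF Ob(1)]]
        arr_comp_add_left[OF x arr_comp[OF Da_arr[OF a] inc0_arr[OF Ob(2)]] arr_neg[OF inc0_arr[OF Ob(1)]]]
      by simp
    then have "D 0 \<cdot> ?z = neg W (P 0) (Add S (inc 0 \<beta> [] \<cdot> Da a \<cdot> x) (neg W (P 0) (inc 0 \<alpha> [] \<cdot> x)))"
      using comp_neg_right[OF arr_comp[OF x il] D_arr] arr_assoc[OF x Da_arr[OF a] inc0_arr[OF Ob(2)]] by simp
    also have "\<dots> = Ti b"
      unfolding Tib using HP.inv_mult[of "inc 0 \<beta> [] \<cdot> Da a \<cdot> x" "neg W (P 0) (inc 0 \<alpha> [] \<cdot> x)"]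
        HP.m_comm[of "inc 0 \<alpha> [] \<cdot> x" "neg W (P 0) (inc 0 \<beta> [] \<cdot> Da a \<cdot> x)"]
        arr_Hom[OF ix] arr_Hom[OF iax] arr_Hom[OF arr_neg[OF ix]] arr_Hom[OF arr_neg[OF iax]] neg_neg[OF ix] by simp
    finally show ?thesis
      using arr_neg[OF arr_comp[OF x il]] i S.inv_closed[OF i(2)] S.m_closed b by blast
  qed
  have R_gen: "?R = generate ?S ?B" by (simp add: colim_relations_def)
  have R_sub: "subgroup ?R ?S"
    unfolding R_gen using gen by (intro S.generate_is_subgroup) blast
  have R: "\<exists>z. arr S z W (P (Suc 0)) \<and> D 0 \<cdot> z = Ti r" if "r \<in> ?R" for r
  proof -
    have "r \<in> generate ?S ?B" using that R_gen by simp
    then show ?thesis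
    proof (induction rule: generate.induct)
      case one
      then show ?case
        using hom_one[OF Ti S.is_group HP.is_group] comp_zero_right[OF D_arr[of 0] W0] arr_zero[OF W0 P_Ob[of "Suc 0"]]
        by (intro exI[of _ "Zero S W (P (Suc 0))"]) simp
    next
      case (incl h)
      then show ?case using gen by blast
    next
      case (inv h)
      then obtain z where z: "arr S z W (P (Suc 0))" "D 0 \<cdot> z = Ti h" and h: "h \<in> carrier ?S"
        using gen by blast
      then show ?case
        using arr_neg[OF z(1)] comp_neg_right[OF z(1) D_arr]
          group_hom.hom_inv[OF group_hom.intro[OF S.is_group HP.is_group group_hom_axioms.intro[OF Ti]] h] by force
    next
      case (eng h1 h2)
      then obtain z1 z2 where z: "arr S z1 W (P (Suc 0))" "D 0 \<cdot> z1 = Ti h1" "arr S z2 W (P (Suc 0))" "D 0 \<cdot> z2 = Ti h2"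
        by blast
      have "h1 \<in> carrier ?S" "h2 \<in> carrier ?S"
        using eng(1,2) R_gen subgroup.mem_carrier[OF R_sub] by simp_all
      then have "D 0 \<cdot> Add S z1 z2 = Ti (h1 \<otimes>\<^bsub>?S\<^esub> h2)"
        using hom_mult[OF Ti, of h1 h2] arr_comp_add_right[OF z(1,3) D_arr] z by simp
      then show ?case using arr_add[OF z(1,3)] by blast
    qed
  qed
  have TcR: "Tc r = Zero S W X" if r: "r \<in> ?R" for r
  proof -
    obtain z where z: "arr S z W (P (Suc 0))" "D 0 \<cdot> z = Ti r" using R[OF r] by blast
    then show ?thesis
      using TiTc[OF subgroup.mem_carrier[OF R_sub r]] arr_assoc[OF z(1) D_arr aug_arr] aug_D
        comp_zero_left[OF z(1) X_Ob] by simp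
  qed
  let ?T = "colim_induced C ?G ?X ?c"
  have iso: "?T \<in> iso (colim_group C ?G) ?X"
    using min_cone W by (simp add: minimal_cone_def)
  have cosets: "?R #>\<^bsub>?S\<^esub> s \<in> carrier (colim_group C ?G)" if "s \<in> carrier ?S" for s
    using that by (auto simp: colim_group_def FactGroup_def RCOSETS_def)
  have T: "?T (?R #>\<^bsub>?S\<^esub> s) = Tc s" if s: "s \<in> carrier ?S" for s
  proof -
    have "Tc ` (?R #>\<^bsub>?S\<^esub> s) = {Tc s}"
    proof (intro subset_antisym subsetI)
      fix t assume "t \<in> Tc ` (?R #>\<^bsub>?S\<^esub> s)"
      then obtain r where r: "r \<in> ?R" "t = Tc (r \<otimes>\<^bsub>?S\<^esub> s)" by (auto simp: r_coset_def)
      then show "t \<in> {Tc s}"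
        using hom_mult[OF Tc subgroup.mem_carrier[OF R_sub r(1)] s] TcR[OF r(1)] hom_in_carrier[OF Tc s] HX.l_one
        by simp
    next
      fix t assume "t \<in> {Tc s}"
      then show "t \<in> Tc ` (?R #>\<^bsub>?S\<^esub> s)"
        using S.rcos_self[OF s R_sub] by blast
    qed
    then show ?thesis by (simp add: colim_induced_def Tc_def)
  qed
  show "\<exists>x. arr S x W (P 0) \<and> aug \<cdot> x = y" if y: "arr S y W X"
  proof -
    have "?T ` carrier (colim_group C ?G) = Hom S W X"
      using iso by (auto simp: iso_def bij_betw_def)
    then have "y \<in> ?T ` carrier (colim_group C ?G)" using arr_Hom[OF y] by simp
    then obtain K where "K \<in> carrier (colim_group C ?G)" "?T K = y" by (elim imageE) simp
    then obtain s where s: "s \<in> carrier ?S" "Tc s = y"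
      using T by (auto simp: colim_group_def FactGroup_def RCOSETS_def)
    then show ?thesis
      using TiTc[OF s(1)] hom_in_carrier[OF Ti s(1)] W0 P_Ob by (auto simp: arr_def)
  qed
  show "\<exists>z. arr S z W (P (Suc 0)) \<and> D 0 \<cdot> z = x" if x: "arr S x W (P 0)" and ax: "aug \<cdot> x = Zero S W X"
  proof -
    obtain A u where A: "finite A" "A \<subseteq> C.chains 0" and u: "\<And>\<sigma>. \<sigma> \<in> A \<Longrightarrow> arr S (u \<sigma>) W (Do (fst \<sigma>))"
      and xu: "x = finprod ?P (\<lambda>\<sigma>. incp 0 \<sigma> \<cdot> u \<sigma>) A"
      using P_sum[OF W x] by blast
    have AOb: "fst \<sigma> \<in> Ob C" "incp 0 \<sigma> = inc 0 (fst \<sigma>) []" if "\<sigma> \<in> A" for \<sigma>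
      using that A(2) by (auto simp: C.chains_def chain_0)
    let ?u = "\<lambda>\<sigma>. sum_incl (Ob C) (Grp ?G) (fst \<sigma>) (u \<sigma>)"
    define s where "s = finprod ?S ?u A"
    have uS: "?u \<in> A \<rightarrow> carrier ?S" using incl AOb(1) u by auto
    then have s: "s \<in> carrier ?S" unfolding s_def by (rule S.finprod_closed)
    have "Ti s = finprod ?P (\<lambda>\<sigma>. Ti (?u \<sigma>)) A"
      unfolding s_def by (rule hom_finprod[OF S.comm_group_axioms HP.comm_group_axioms Ti uS])
    also have "\<dots> = x"
      unfolding xu using Ti_incl AOb u arr_Hom[OF arr_comp[OF u inc0_arr[OF AOb(1)]]]
      by (intro HP.finprod_cong') auto
    finally have Tis: "Ti s = x" .
    \<comment> \<open>This makes the class of \<open>s\<close> in the colimit trivial, so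
      \<open>s\<close> is a relation, and \<open>R\<close> provides the preimage.\<close>
    have "Tc s = Zero S W X" using TiTc[OF s] Tis ax by simp
    then have "?T (?R #>\<^bsub>?S\<^esub> s) = ?T (?R #>\<^bsub>?S\<^esub> \<one>\<^bsub>?S\<^esub>)"
      using T[OF s] T[OF S.one_closed] hom_one[OF Tc S.is_group HX.is_group] by simp
    then have "?R #>\<^bsub>?S\<^esub> s = ?R #>\<^bsub>?S\<^esub> \<one>\<^bsub>?S\<^esub>"
      using iso cosets[OF s] cosets[OF S.one_closed] by (auto simp: iso_def bij_betw_def dest: inj_onD)
    moreover have "?R #>\<^bsub>?S\<^esub> \<one>\<^bsub>?S\<^esub> = ?R"
      using S.coset_mult_one subgroup.subset[OF R_sub] by blast
    ultimately have "s \<in> ?R" using S.rcos_self[OF s R_sub] by simp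
    then show ?thesis using R Tis by auto
  qed
qed

lemma aug_fin_epi: "fin_epi aug (P 0) X"
  using aug_arr minimal_cone_exact(1) by (auto simp: fin_epi_def)

end

section \<open>Contraction of the suspended bar complex\<close>

context minimal_cone_diagram
begin

text \<open>\<open>bar_exact\<close> lifts maps out of finite objects only. Since
  \<open>P (Suc m)\<close> is a coproduct of objects X_\<alpha>, lifts are chosen summand by summand
  and assembled.\<close>

lemma fin_exact_lift:
  assumes \<pi>: "arr S \<pi> (P (Suc m)) (P (Suc m))" and D\<pi>: "D m \<cdot> \<pi> = Zero S (P (Suc m)) (P m)"
  obtains u where "arr S u (P (Suc m)) (P (Suc (Suc m)))" "D (Suc m) \<cdot> u = \<pi>"
proof -
  have "\<exists>y. arr S y (Do \<alpha>) (P (Suc (Suc m))) \<and> D (Suc m) \<cdot> y = \<pi> \<cdot> inc (Suc m) \<alpha> l"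
    if l: "chain C (Suc m) \<alpha> l" for \<alpha> l
  proof -
    note i = inc_arr[OF l]
    have "D m \<cdot> \<pi> \<cdot> inc (Suc m) \<alpha> l = Zero S (Do \<alpha>) (P m)"
      using arr_assoc[OF i \<pi> D_arr] D\<pi> comp_zero_left[OF i P_Ob] by simp
    then show ?thesis
      using bar_exact[OF Do_fin[OF chain_Ob[OF l]] arr_comp[OF i \<pi>]] by blast
  qed
  then obtain y where y: "\<And>\<alpha> l. chain C (Suc m) \<alpha> l \<Longrightarrow> arr S (y \<alpha> l) (Do \<alpha>) (P (Suc (Suc m)))"
    "\<And>\<alpha> l. chain C (Suc m) \<alpha> l \<Longrightarrow> D (Suc m) \<cdot> y \<alpha> l = \<pi> \<cdot> inc (Suc m) \<alpha> l"
    by metis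
  have "cochain C (G (P (Suc (Suc m)))) (Suc m) y"
    using y(1) by (simp add: cochain_G_arr P_Ob)
  from P_induced[OF P_Ob this] obtain u where u: "arr S u (P (Suc m)) (P (Suc (Suc m)))"
    "\<And>\<alpha> l. chain C (Suc m) \<alpha> l \<Longrightarrow> u \<cdot> inc (Suc m) \<alpha> l = y \<alpha> l" by blast
  have "D (Suc m) \<cdot> u = \<pi>"
  proof (rule P_eqI[OF arr_comp[OF u(1) D_arr] \<pi>])
    fix \<alpha> l assume l: "chain C (Suc m) \<alpha> l"
    show "(D (Suc m) \<cdot> u) \<cdot> inc (Suc m) \<alpha> l = \<pi> \<cdot> inc (Suc m) \<alpha> l"
      using arr_assoc[OF inc_arr[OF l] u(1) D_arr] u(2)[OF l] y(2)[OF l] by simp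
  qed
  then show thesis using that u(1) by blast
qed

text \<open>
  The cycles of the bar complex split off in every degree: already \<open>Q\<close>, the desuspended cofibre of
  the augmentation, is projective, because every phantom map out of a cofibre of a phantom cover is
  zero.
\<close>

lemma syzygy:
  obtains Q q t s u where "Q \<in> Ob S" "phantom q X (Sus S Q)" "arr S t (P (Suc 0)) Q" "arr S s Q (P (Suc 0))"
    "arr S u (P (Suc 0)) (P (Suc (Suc 0)))" "t \<cdot> s = Id S Q" "t \<cdot> D (Suc 0) = Zero S (P (Suc (Suc 0))) Q"
    "Id S (P (Suc 0)) = Add S (s \<cdot> t) (D (Suc 0) \<cdot> u)"
    "\<And>k Y. arr S k X Y \<Longrightarrow> k \<cdot> aug = Zero S (P 0) Y \<Longrightarrow> \<exists>\<theta>. arr S \<theta> (Sus S Q) Y \<and> \<theta> \<cdot> q = k"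
    "\<And>\<theta> Y. arr S \<theta> (Sus S Q) Y \<Longrightarrow>
      \<theta> \<cdot> q = Zero S X Y \<longleftrightarrow> (\<exists>m. arr S m (Sus S (P 0)) Y \<and> m \<cdot> SusMap S (D 0) = \<theta> \<cdot> SusMap S t)"
    "\<exists>\<pi>. arr S \<pi> (P (Suc 0)) (P (Suc 0)) \<and> D 0 \<cdot> \<pi> = Zero S (P (Suc 0)) (P 0) \<and>
      (\<forall>W\<in>Fin. \<forall>x. arr S x W (P (Suc 0)) \<longrightarrow> D 0 \<cdot> x = Zero S W (P 0) \<longrightarrow> \<pi> \<cdot> x = x)"
proof -
  \<comment> \<open>With \<open>aug\<close> as first map the triangle ends in \<Sigma>Q; the
    desuspended third map j : Q -> P 0 then plays the kernel of \<open>aug\<close>.\<close>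
  obtain Z q w where TZ: "exact_triangle S (P 0) X Z aug q w"
    using triangle_extend[OF P_Ob X_Ob arr_Hom[OF aug_arr]] by blast
  then have "Z \<in> Ob S" using triangle_arr(2)[OF TZ] by (simp add: arr_def)
  then obtain Q where Q: "Q \<in> Ob S" "Sus S Q = Z" using sus_Ob_ex by blast
  have "arr S w (Sus S Q) (Sus S (P 0))" using triangle_arr(3)[OF TZ] Q(2) by simp
  then obtain j where j: "arr S j Q (P 0)" and w: "w = SusMap S j"
    using sus_arr_ex[OF _ Q(1) P_Ob] by blast
  have T: "exact_triangle S (P 0) X (Sus S Q) aug q (SusMap S j)" using TZ Q(2) w by simp
  have q: "phantom q X (Sus S Q)" using fin_epi_triangle[OF T] aug_fin_epi by simp
  then have qa: "arr S q X (Sus S Q)" by (simp add: phantom_def)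
  have SQ: "Sus S Q \<in> Ob S" using sus_Ob[OF Q(1)] .
  \<comment> \<open>After suspension, a phantom out of \<open>Q\<close> starts at the cofibre of the
    phantom cover \<open>aug\<close>.\<close>
  have noph: "g = Zero S Q Y" if g: "phantom g Q Y" for g Y
  proof -
    have "arr S g Q Y" using g by (simp add: phantom_def)
    moreover have "SusMap S g = Zero S (Sus S Q) (Sus S Y)"
      using phantom_from_resolution[OF T P_proj q phantom_sus[OF g]] .
    ultimately show ?thesis by (rule sus_eq_zero)
  qed
  have lift: "\<exists>z. arr S z A Q \<and> j \<cdot> z = x" if x: "arr S x A (P 0)" and ax: "aug \<cdot> x = Zero S A X" for x A
  proof -
    have A: "A \<in> Ob S" using x by (simp add: arr_def)
    have "SusMap S aug \<cdot> SusMap S x = Zero S (Sus S A) (Sus S X)"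
      using sus_comp[OF x aug_arr] ax sus_zero[OF A X_Ob] by simp
    then obtain z where z: "arr S z (Sus S A) (Sus S Q)" "SusMap S j \<cdot> z = SusMap S x"
      using triangle_lift3[OF T sus_arr[OF x]] by blast
    then obtain z' where z': "arr S z' A Q" "z = SusMap S z'"
      using sus_arr_ex[OF z(1) A Q(1)] by blast
    then have "j \<cdot> z' = x"
      using z(2) sus_comp[OF z'(1) j] sus_arr_inj[OF arr_comp[OF z'(1) j] x] by simp
    then show ?thesis using z'(1) by blast
  qed
  \<comment> \<open>If j x = 0, then \<Sigma>x factors through the phantom \<open>q\<close> and
    starts at a finite object.\<close>
  have mono: "x = Zero S W Q" if W: "W \<in> Fin" and x: "arr S x W Q" and jx: "j \<cdot> x = Zero S W (P 0)" for W x
  proof -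
    have W0: "W \<in> Ob S" using W by (rule finite_objects_Ob)
    have "SusMap S j \<cdot> SusMap S x = Zero S (Sus S W) (Sus S (P 0))"
      using sus_comp[OF x j] jx sus_zero[OF W0 P_Ob] by simp
    then obtain y where "arr S y (Sus S W) X" "q \<cdot> y = SusMap S x"
      using triangle_lift2[OF T sus_arr[OF x]] by blast
    then have "SusMap S x = Zero S (Sus S W) (Sus S Q)"
      using q finite_objects_sus[OF W] by (auto simp: phantom_def)
    then show ?thesis using sus_eq_zero[OF x] by blast
  qed
  \<comment> \<open>\<open>aug\<close> kills \<open>D 0\<close>, which therefore factors through
    \<open>j\<close>; exactness in degree 0 will make the factor \<open>t\<close> surjective on
    finite objects.\<close>
  obtain t where t: "arr S t (P (Suc 0)) Q" "j \<cdot> t = D 0"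
    using lift[OF D_arr aug_D] by blast
  have aj: "aug \<cdot> j = Zero S Q X"
    using triangle_comp3[OF T] sus_comp[OF j aug_arr] by (intro sus_eq_zero[OF arr_comp[OF j aug_arr]]) simp
  have t_epi: "fin_epi t (P (Suc 0)) Q"
    unfolding fin_epi_def
  proof (intro conjI ballI allI impI)
    show "arr S t (P (Suc 0)) Q" by fact
    fix W y assume W: "W \<in> Fin" and y: "arr S y W Q"
    have W0: "W \<in> Ob S" using W by (rule finite_objects_Ob)
    have "aug \<cdot> j \<cdot> y = Zero S W X"
      using arr_assoc[OF y j aug_arr] aj comp_zero_left[OF y X_Ob] by simp
    from minimal_cone_exact(2)[OF W arr_comp[OF y j] this]
    obtain z where z: "arr S z W (P (Suc 0))" "D 0 \<cdot> z = j \<cdot> y" by blast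
    note tz = arr_comp[OF z(1) t(1)]
    have jtz: "j \<cdot> t \<cdot> z = j \<cdot> y" using arr_assoc[OF z(1) t(1) j] t(2) z(2) by simp
    have "j \<cdot> Add S (t \<cdot> z) (neg W Q y) = Zero S W (P 0)"
      using arr_comp_add_right[OF tz arr_neg[OF y] j] comp_neg_right[OF y j] jtz
        add_neg[OF arr_comp[OF y j]] by simp
    from mono[OF W arr_add[OF tz arr_neg[OF y]] this] have "t \<cdot> z = y"
      using eq_if_diff_zero[OF tz y] by simp
    then show "\<exists>x. arr S x W (P (Suc 0)) \<and> t \<cdot> x = y" using z(1) by blast
  qed
  obtain N f g where Tt: "exact_triangle S (P (Suc 0)) Q N t f g"
    using triangle_extend[OF P_Ob Q(1) arr_Hom[OF t(1)]] by blast
  \<comment> \<open>The cofibre map of \<open>t\<close> is a phantom out of \<open>Q\<close>, hence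
    zero, and \<open>t\<close> splits.\<close>
  have "phantom f Q N" using fin_epi_triangle[OF Tt] t_epi by simp
  then have "f \<cdot> Id S Q = Zero S Q N"
    using noph arr_id_right[OF triangle_arr(2)[OF Tt]] by simp
  then obtain s where s: "arr S s Q (P (Suc 0))" "t \<cdot> s = Id S Q"
    using triangle_lift1[OF Tt arr_id[OF Q(1)]] by blast
  \<comment> \<open>j t D vanishes, so t D vanishes on finite objects by \<open>mono\<close>, and
    altogether because its source is projective.\<close>
  have tD: "t \<cdot> D (Suc 0) = Zero S (P (Suc (Suc 0))) Q"
  proof -
    note tD = arr_comp[OF D_arr t(1)]
    have "phantom (t \<cdot> D (Suc 0)) (P (Suc (Suc 0))) Q"
      unfolding phantom_def
    proof (intro conjI ballI allI impI)
      show "arr S (t \<cdot> D (Suc 0)) (P (Suc (Suc 0))) Q" by fact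
      fix W x assume W: "W \<in> Fin" and x: "arr S x W (P (Suc (Suc 0)))"
      have "j \<cdot> (t \<cdot> D (Suc 0)) \<cdot> x = (D 0 \<cdot> D (Suc 0)) \<cdot> x"
        using arr_assoc[OF x tD j] arr_assoc[OF D_arr t(1) j] t(2) by simp
      also have "\<dots> = Zero S W (P 0)" using D_D comp_zero_left[OF x P_Ob] by simp
      finally show "(t \<cdot> D (Suc 0)) \<cdot> x = Zero S W Q"
        by (rule mono[OF W arr_comp[OF x tD]])
    qed
    then show ?thesis using P_proj by (auto simp: proj_def)
  qed
  note st = arr_comp[OF t(1) s(1)]
  note Id1 = arr_id[OF P_Ob[of "Suc 0"]]
  \<comment> \<open>The projection complementary to s t: it lands in the cycles and fixes the cycles
    given by finite objects.\<close>
  define \<pi> where "\<pi> = Add S (Id S (P (Suc 0))) (neg (P (Suc 0)) (P (Suc 0)) (s \<cdot> t))"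
  have \<pi>: "arr S \<pi> (P (Suc 0)) (P (Suc 0))"
    unfolding \<pi>_def by (rule arr_add[OF Id1 arr_neg[OF st]])
  have "D 0 \<cdot> s \<cdot> t = D 0"
    using arr_assoc[OF st t(1) j] arr_assoc[OF t(1) s(1) t(1)] s(2) arr_id_left[OF t(1)] t(2) by simp
  then have D\<pi>: "D 0 \<cdot> \<pi> = Zero S (P (Suc 0)) (P 0)"
    unfolding \<pi>_def
    using arr_comp_add_right[OF Id1 arr_neg[OF st] D_arr] comp_neg_right[OF st D_arr] arr_id_right[OF D_arr]
      add_neg[OF D_arr] by simp
  have \<pi>x: "\<pi> \<cdot> x = x" if W: "W \<in> Fin" and x: "arr S x W (P (Suc 0))" and Dx: "D 0 \<cdot> x = Zero S W (P 0)" for W x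
  proof -
    have W0: "W \<in> Ob S" using W by (rule finite_objects_Ob)
    have "j \<cdot> t \<cdot> x = Zero S W (P 0)" using arr_assoc[OF x t(1) j] t(2) Dx by simp
    then have "t \<cdot> x = Zero S W Q" by (rule mono[OF W arr_comp[OF x t(1)]])
    then have "(s \<cdot> t) \<cdot> x = Zero S W (P (Suc 0))"
      using arr_assoc[OF x t(1) s(1)] comp_zero_right[OF s(1) W0] by simp
    then show ?thesis
      unfolding \<pi>_def
      using arr_comp_add_left[OF x Id1 arr_neg[OF st]] comp_neg_left[OF x st] arr_id_left[OF x]
        neg_zero[OF W0 P_Ob] add_zero_right[OF x] by simp
  qed
  obtain u where u: "arr S u (P (Suc 0)) (P (Suc (Suc 0)))" "D (Suc 0) \<cdot> u = \<pi>"
    using fin_exact_lift[OF \<pi> D\<pi>] by blast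
  interpret H: comm_group "hom_group S (P (Suc 0)) (P (Suc 0))"
    using hom_comm_group[OF P_Ob P_Ob] .
  have Id_split: "Id S (P (Suc 0)) = Add S (s \<cdot> t) (D (Suc 0) \<cdot> u)"
    unfolding u(2) \<pi>_def
    using H.m_lcomm[of "s \<cdot> t" "Id S (P (Suc 0))" "neg (P (Suc 0)) (P (Suc 0)) (s \<cdot> t)"]
      arr_Hom[OF st] arr_Hom[OF Id1] arr_Hom[OF arr_neg[OF st]] add_neg[OF st] add_zero_right[OF Id1] by simp
  have ext: "\<exists>\<theta>. arr S \<theta> (Sus S Q) Y \<and> \<theta> \<cdot> q = k" if "arr S k X Y" "k \<cdot> aug = Zero S (P 0) Y" for k Y
    using triangle_extend1[OF T that] by blast
  note Sj = sus_arr[OF j] and St = sus_arr[OF t(1)] and Ss = sus_arr[OF s(1)]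
  \<comment> \<open>By exactness \<theta> q = 0 iff \<theta> factors through \<Sigma>j. Composing
    with \<Sigma>t, which has the right inverse \<Sigma>s, turns this into a condition on
    \<open>D 0\<close>.\<close>
  have iff: "\<theta> \<cdot> q = Zero S X Y \<longleftrightarrow> (\<exists>m. arr S m (Sus S (P 0)) Y \<and> m \<cdot> SusMap S (D 0) = \<theta> \<cdot> SusMap S t)"
    if \<theta>: "arr S \<theta> (Sus S Q) Y" for \<theta> Y
  proof
    assume "\<theta> \<cdot> q = Zero S X Y"
    then obtain m where m: "arr S m (Sus S (P 0)) Y" "m \<cdot> SusMap S j = \<theta>"
      using triangle_extend2[OF T \<theta>] by blast
    then show "\<exists>m. arr S m (Sus S (P 0)) Y \<and> m \<cdot> SusMap S (D 0) = \<theta> \<cdot> SusMap S t"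
      using arr_assoc[OF St Sj m(1)] sus_comp[OF t(1) j] t(2) by (intro exI[of _ m]) simp
  next
    assume "\<exists>m. arr S m (Sus S (P 0)) Y \<and> m \<cdot> SusMap S (D 0) = \<theta> \<cdot> SusMap S t"
    then obtain m where m: "arr S m (Sus S (P 0)) Y" "m \<cdot> SusMap S (D 0) = \<theta> \<cdot> SusMap S t" by blast
    have mj: "arr S (m \<cdot> SusMap S j) (Sus S Q) Y" using arr_comp[OF Sj m(1)] .
    have Sts: "SusMap S t \<cdot> SusMap S s = Id S (Sus S Q)"
      using sus_comp[OF s(1) t(1)] s(2) sus_map_id[OF Q(1)] by simp
    have mjt: "(m \<cdot> SusMap S j) \<cdot> SusMap S t = \<theta> \<cdot> SusMap S t"
      using m(2) arr_assoc[OF St Sj m(1)] sus_comp[OF t(1) j] t(2) by simp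
    have "m \<cdot> SusMap S j = (m \<cdot> SusMap S j) \<cdot> SusMap S t \<cdot> SusMap S s"
      unfolding Sts by (rule arr_id_right[OF mj, symmetric])
    also have "\<dots> = (\<theta> \<cdot> SusMap S t) \<cdot> SusMap S s"
      unfolding mjt[symmetric] by (rule arr_assoc[OF Ss St mj, symmetric])
    also have "\<dots> = \<theta>"
      unfolding arr_assoc[OF Ss St \<theta>] Sts by (rule arr_id_right[OF \<theta>])
    finally have "m \<cdot> SusMap S j = \<theta>" .
    then show "\<theta> \<cdot> q = Zero S X Y"
      using arr_assoc[OF qa Sj m(1)] triangle_comp2[OF T] comp_zero_right[OF m(1) X_Ob] by simp
  qed
  show thesis
    by (rule that[OF Q(1) q t(1) s(1) u(1) s(2) tD Id_split ext iff]) (use \<pi> D\<pi> \<pi>x in blast)+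
qed

text \<open>The induction carries an endomorphism \<open>\<pi>\<close> of \<open>P (Suc m)\<close>
  that lands in the cycles and fixes every cycle from a finite object. Lifting it along D gives u
  with D u = \<pi>, and 1 - u D has the same property one degree higher. \<open>syzygy\<close>
  starts the induction.\<close>

lemma contraction:
  "\<exists>u v. arr S u (P (Suc m)) (P (Suc (Suc m))) \<and> arr S v (P (Suc (Suc m))) (P (Suc (Suc (Suc m)))) \<and>
    Id S (P (Suc (Suc m))) = Add S (u \<cdot> D (Suc m)) (D (Suc (Suc m)) \<cdot> v)"
proof -
  let ?Q = "\<lambda>m \<pi>. arr S \<pi> (P (Suc m)) (P (Suc m)) \<and> D m \<cdot> \<pi> = Zero S (P (Suc m)) (P m) \<and>
    (\<forall>W\<in>Fin. \<forall>x. arr S x W (P (Suc m)) \<longrightarrow> D m \<cdot> x = Zero S W (P m) \<longrightarrow> \<pi> \<cdot> x = x)"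
  have step: "\<exists>u \<pi>'. arr S u (P (Suc m)) (P (Suc (Suc m))) \<and> ?Q (Suc m) \<pi>' \<and>
      Id S (P (Suc (Suc m))) = Add S (u \<cdot> D (Suc m)) \<pi>'" if Q: "?Q m \<pi>" for m \<pi>
  proof -
    have \<pi>: "arr S \<pi> (P (Suc m)) (P (Suc m))" and D\<pi>: "D m \<cdot> \<pi> = Zero S (P (Suc m)) (P m)"
      and \<pi>x: "\<And>W x. W \<in> Fin \<Longrightarrow> arr S x W (P (Suc m)) \<Longrightarrow> D m \<cdot> x = Zero S W (P m) \<Longrightarrow> \<pi> \<cdot> x = x"
      using Q by auto
    obtain u where u: "arr S u (P (Suc m)) (P (Suc (Suc m)))" "D (Suc m) \<cdot> u = \<pi>"
      using fin_exact_lift[OF \<pi> D\<pi>] by blast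
    let ?P = "P (Suc (Suc m))"
    note Id1 = arr_id[OF P_Ob[of "Suc (Suc m)"]] and uD = arr_comp[OF D_arr u(1)]
    define \<pi>' where "\<pi>' = Add S (Id S ?P) (neg ?P ?P (u \<cdot> D (Suc m)))"
    have \<pi>': "arr S \<pi>' ?P ?P" unfolding \<pi>'_def by (rule arr_add[OF Id1 arr_neg[OF uD]])
    interpret H: comm_group "hom_group S ?P ?P" using hom_comm_group[OF P_Ob P_Ob] .
    have split: "Id S ?P = Add S (u \<cdot> D (Suc m)) \<pi>'"
      unfolding \<pi>'_def
      using H.m_lcomm[of "u \<cdot> D (Suc m)" "Id S ?P" "neg ?P ?P (u \<cdot> D (Suc m))"]
        arr_Hom[OF uD] arr_Hom[OF Id1] arr_Hom[OF arr_neg[OF uD]] add_neg[OF uD] add_zero_right[OF Id1] by simp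
    note \<pi>D = arr_comp[OF D_arr \<pi>]
    \<comment> \<open>\<open>\<pi>\<close> fixes boundaries on finite objects, and hence exactly,
      because a phantom out of a projective object vanishes.\<close>
    have "phantom (Add S (\<pi> \<cdot> D (Suc m)) (neg ?P (P (Suc m)) (D (Suc m)))) ?P (P (Suc m))"
    proof (rule phantom_diff[OF \<pi>D D_arr])
      fix W x assume W: "W \<in> Fin" and x: "arr S x W ?P"
      have "D m \<cdot> D (Suc m) \<cdot> x = Zero S W (P m)"
        using arr_assoc[OF x D_arr D_arr] D_D comp_zero_left[OF x P_Ob] by simp
      then show "(\<pi> \<cdot> D (Suc m)) \<cdot> x = D (Suc m) \<cdot> x"
        using \<pi>x[OF W arr_comp[OF x D_arr]] arr_assoc[OF x D_arr \<pi>] by simp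
    qed
    then have "\<pi> \<cdot> D (Suc m) = D (Suc m)"
      using P_proj eq_if_diff_zero[OF \<pi>D D_arr] by (auto simp: proj_def)
    then have "D (Suc m) \<cdot> u \<cdot> D (Suc m) = D (Suc m)"
      using arr_assoc[OF D_arr u(1) D_arr] u(2) by simp
    then have D\<pi>': "D (Suc m) \<cdot> \<pi>' = Zero S ?P (P (Suc m))"
      unfolding \<pi>'_def
      using arr_comp_add_right[OF Id1 arr_neg[OF uD] D_arr] comp_neg_right[OF uD D_arr] arr_id_right[OF D_arr]
        add_neg[OF D_arr] by simp
    have "\<pi>' \<cdot> x = x" if W: "W \<in> Fin" and x: "arr S x W ?P" and Dx: "D (Suc m) \<cdot> x = Zero S W (P (Suc m))" for W x
    proof -
      have W0: "W \<in> Ob S" using W by (rule finite_objects_Ob)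
      have "(u \<cdot> D (Suc m)) \<cdot> x = Zero S W ?P"
        using arr_assoc[OF x D_arr u(1)] Dx comp_zero_right[OF u(1) W0] by simp
      then show ?thesis
        unfolding \<pi>'_def
        using arr_comp_add_left[OF x Id1 arr_neg[OF uD]] comp_neg_left[OF x uD] arr_id_left[OF x]
          neg_zero[OF W0 P_Ob] add_zero_right[OF x] by simp
    qed
    then show ?thesis using u(1) \<pi>' D\<pi>' split by blast
  qed
  have ex: "\<exists>\<pi>. ?Q m \<pi>" for m
  proof (induction m)
    case 0
    show ?case by (rule syzygy)
  next
    case (Suc m)
    then show ?case using step by blast
  qed
  obtain \<pi> where "?Q m \<pi>" using ex by blast
  from step[OF this] obtain u \<pi>' where u: "arr S u (P (Suc m)) (P (Suc (Suc m)))" and \<pi>': "?Q (Suc m) \<pi>'"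
    and split: "Id S (P (Suc (Suc m))) = Add S (u \<cdot> D (Suc m)) \<pi>'" by blast
  obtain v where "arr S v (P (Suc (Suc m))) (P (Suc (Suc (Suc m))))" "D (Suc (Suc m)) \<cdot> v = \<pi>'"
    using fin_exact_lift[of \<pi>' "Suc m"] \<pi>' by blast
  then show ?thesis
    using u split by blast
qed

section \<open>Bar cochains as maps out of the suspended complex\<close>

lemma SP_coproduct:
  "is_coproduct S (C.chains n) (\<lambda>\<sigma>. Sus S (Do (fst \<sigma>))) (Sus S (P n)) (\<lambda>\<sigma>. SusMap S (incp n \<sigma>))"
  by (rule coproduct_sus[OF P_coproduct])

lemma SP_eqI: "arr S f (Sus S (P n)) Z \<Longrightarrow> arr S g (Sus S (P n)) Z \<Longrightarrow>
    (\<And>\<alpha> l. chain C n \<alpha> l \<Longrightarrow> f \<cdot> SusMap S (inc n \<alpha> l) = g \<cdot> SusMap S (inc n \<alpha> l)) \<Longrightarrow> f = g"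
  using coproduct_eqI[OF SP_coproduct] by (auto simp: C.chains_def)

text \<open>The map that represents a cochain with values in \<open>F Y\<close>; uniqueness is
  \<open>hat_eqI\<close>.\<close>

definition hat :: "'o \<Rightarrow> nat \<Rightarrow> ('i \<Rightarrow> 'i list \<Rightarrow> 'a) \<Rightarrow> 'a" where
  "hat Y n \<phi> = (SOME g. arr S g (Sus S (P n)) Y \<and> (\<forall>\<alpha> l. chain C n \<alpha> l \<longrightarrow> g \<cdot> SusMap S (inc n \<alpha> l) = \<phi> \<alpha> l))"

lemma hat_properties:
  assumes Y: "Y \<in> Ob S" and \<phi>: "cochain C (F Y) n \<phi>"
  shows hat_arr: "arr S (hat Y n \<phi>) (Sus S (P n)) Y"
    and hat_inc: "chain C n \<alpha> l \<Longrightarrow> hat Y n \<phi> \<cdot> SusMap S (inc n \<alpha> l) = \<phi> \<alpha> l"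
proof -
  have "arr S (\<phi> (fst \<sigma>) (snd \<sigma>)) (Sus S (Do (fst \<sigma>))) Y" if "\<sigma> \<in> C.chains n" for \<sigma>
    using \<phi> that Y by (auto simp: cochain_F_arr C.chains_def)
  then obtain g where "arr S g (Sus S (P n)) Y" "\<And>\<sigma>. \<sigma> \<in> C.chains n \<Longrightarrow> g \<cdot> SusMap S (incp n \<sigma>) = \<phi> (fst \<sigma>) (snd \<sigma>)"
    using coproduct_induced[OF SP_coproduct Y, where f="\<lambda>\<sigma>. \<phi> (fst \<sigma>) (snd \<sigma>)"] by blast
  then have "\<exists>g. arr S g (Sus S (P n)) Y \<and> (\<forall>\<alpha> l. chain C n \<alpha> l \<longrightarrow> g \<cdot> SusMap S (inc n \<alpha> l) = \<phi> \<alpha> l)"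
    by (intro exI[of _ g]) (auto simp: C.chains_def)
  from someI_ex[OF this, folded hat_def]
  show "arr S (hat Y n \<phi>) (Sus S (P n)) Y"
    "chain C n \<alpha> l \<Longrightarrow> hat Y n \<phi> \<cdot> SusMap S (inc n \<alpha> l) = \<phi> \<alpha> l" by auto
qed

lemma hat_eqI:
  "Y \<in> Ob S \<Longrightarrow> cochain C (F Y) n \<phi> \<Longrightarrow> arr S g (Sus S (P n)) Y \<Longrightarrow>
    (\<And>\<alpha> l. chain C n \<alpha> l \<Longrightarrow> g \<cdot> SusMap S (inc n \<alpha> l) = \<phi> \<alpha> l) \<Longrightarrow> hat Y n \<phi> = g"
  using hat_inc by (intro SP_eqI[OF hat_arr]) simp_all

lemma cochain_sus_inc: "arr S \<theta> (Sus S (P n)) Y \<Longrightarrow> cochain C (F Y) n (\<lambda>\<alpha> l. \<theta> \<cdot> SusMap S (inc n \<alpha> l))"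
  using arr_comp[OF sus_arr[OF inc_arr]] arr_Ob(2) by (fastforce simp: cochain_F_arr)

text \<open>Naturality of \<open>cobd\<close> along f \<mapsto> \<theta> \<Sigma>f, applied to the
  universal cochain \<open>inc n\<close>. It makes \<Sigma>P the bar complex of the suspended
  diagram.\<close>

lemma sus_comp_D:
  assumes \<theta>: "arr S \<theta> (Sus S (P n)) Y" and l: "chain C (Suc n) \<alpha> l"
  shows "(\<theta> \<cdot> SusMap S (D n)) \<cdot> SusMap S (inc (Suc n) \<alpha> l)
    = cobd C (F Y) (\<lambda>\<alpha> l. \<theta> \<cdot> SusMap S (inc n \<alpha> l)) \<alpha> l"
proof -
  have Y: "Y \<in> Ob S" using \<theta> by (simp add: arr_def)
  have nat: "is_ab_nat (opposite C) (G (P n)) (F Y) (\<lambda>\<alpha> f. \<theta> \<cdot> SusMap S f)"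
    unfolding is_ab_nat_def
  proof (intro conjI ballI)
    fix \<alpha> assume "\<alpha> \<in> Ob (opposite C)"
    then have \<alpha>: "\<alpha> \<in> Ob C" by simp
    show "(\<lambda>f. \<theta> \<cdot> SusMap S f) \<in> hom (Grp (G (P n)) \<alpha>) (Grp (F Y) \<alpha>)"
      unfolding F_simps G_simps
      using hom_compose[OF sus_hom[OF Do_Ob[OF \<alpha>] P_Ob] post_hom[OF \<theta> sus_Ob[OF Do_Ob[OF \<alpha>]]]]
      by (simp only: o_def)
  next
    fix \<alpha> \<beta> a f assume "\<alpha> \<in> Ob (opposite C)" "\<beta> \<in> Ob (opposite C)" "a \<in> Hom (opposite C) \<alpha> \<beta>"
      and "f \<in> carrier (Grp (G (P n)) \<alpha>)"
    then have a: "arr C a \<beta> \<alpha>" and f: "arr S f (Do \<alpha>) (P n)"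
      using Do_Ob P_Ob by (simp_all add: arr_def)
    show "\<theta> \<cdot> SusMap S (Map (G (P n)) a f) = Map (F Y) a (\<theta> \<cdot> SusMap S f)"
      using sus_comp[OF Da_arr[OF a] f] arr_assoc[OF sus_arr[OF Da_arr[OF a]] sus_arr[OF f] \<theta>] by simp
  qed
  show ?thesis
    using C.cobd_nat[OF G_diagram[OF P_Ob] F_diagram[OF Y] nat cochain_inc l] D_inc[OF l]
      arr_assoc[OF sus_arr[OF inc_arr[OF l]] sus_arr[OF D_arr] \<theta>] sus_comp[OF inc_arr[OF l] D_arr] by simp
qed

lemma hat_cocycle_iff:
  assumes Y: "Y \<in> Ob S" and \<phi>: "cochain C (F Y) n \<phi>"
  shows "(\<forall>\<alpha> l. chain C (Suc n) \<alpha> l \<longrightarrow> cobd C (F Y) \<phi> \<alpha> l = \<one>\<^bsub>Grp (F Y) \<alpha>\<^esub>)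
    \<longleftrightarrow> hat Y n \<phi> \<cdot> SusMap S (D n) = Zero S (Sus S (P (Suc n))) Y"
proof -
  note h = hat_arr[OF Y \<phi>] and hD = arr_comp[OF sus_arr[OF D_arr] hat_arr[OF Y \<phi>]]
  have eq: "(hat Y n \<phi> \<cdot> SusMap S (D n)) \<cdot> SusMap S (inc (Suc n) \<alpha> l) = cobd C (F Y) \<phi> \<alpha> l"
    if l: "chain C (Suc n) \<alpha> l" for \<alpha> l
    unfolding sus_comp_D[OF h l]
    by (rule C.cobd_cong[OF F_diagram[OF Y] cochain_sus_inc[OF h] hat_inc[OF Y \<phi>] l])
  have z: "Zero S (Sus S (P (Suc n))) Y \<cdot> SusMap S (inc (Suc n) \<alpha> l) = Zero S (Sus S (Do \<alpha>)) Y"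
    if l: "chain C (Suc n) \<alpha> l" for \<alpha> l
    using comp_zero_left[OF sus_arr[OF inc_arr[OF l]] Y] .
  show ?thesis
  proof
    assume "\<forall>\<alpha> l. chain C (Suc n) \<alpha> l \<longrightarrow> cobd C (F Y) \<phi> \<alpha> l = \<one>\<^bsub>Grp (F Y) \<alpha>\<^esub>"
    then show "hat Y n \<phi> \<cdot> SusMap S (D n) = Zero S (Sus S (P (Suc n))) Y"
      using eq z by (intro SP_eqI[OF hD arr_zero[OF sus_Ob[OF P_Ob] Y]]) simp
  next
    assume "hat Y n \<phi> \<cdot> SusMap S (D n) = Zero S (Sus S (P (Suc n))) Y"
    then show "\<forall>\<alpha> l. chain C (Suc n) \<alpha> l \<longrightarrow> cobd C (F Y) \<phi> \<alpha> l = \<one>\<^bsub>Grp (F Y) \<alpha>\<^esub>"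
      using eq z by simp
  qed
qed

lemma hat_coboundary_iff:
  assumes Y: "Y \<in> Ob S" and \<phi>: "cochain C (F Y) (Suc n) \<phi>"
  shows "(\<exists>\<kappa>. cochain C (F Y) n \<kappa> \<and> (\<forall>\<alpha> l. chain C (Suc n) \<alpha> l \<longrightarrow> \<phi> \<alpha> l = cobd C (F Y) \<kappa> \<alpha> l))
    \<longleftrightarrow> (\<exists>m. arr S m (Sus S (P n)) Y \<and> m \<cdot> SusMap S (D n) = hat Y (Suc n) \<phi>)"
proof
  assume "\<exists>\<kappa>. cochain C (F Y) n \<kappa> \<and> (\<forall>\<alpha> l. chain C (Suc n) \<alpha> l \<longrightarrow> \<phi> \<alpha> l = cobd C (F Y) \<kappa> \<alpha> l)"
  then obtain \<kappa> where \<kappa>: "cochain C (F Y) n \<kappa>" and eq: "\<And>\<alpha> l. chain C (Suc n) \<alpha> l \<Longrightarrow> \<phi> \<alpha> l = cobd C (F Y) \<kappa> \<alpha> l"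
    by blast
  note h = hat_arr[OF Y \<kappa>]
  have "hat Y (Suc n) \<phi> = hat Y n \<kappa> \<cdot> SusMap S (D n)"
  proof (rule hat_eqI[OF Y \<phi> arr_comp[OF sus_arr[OF D_arr] h]])
    fix \<alpha> l assume l: "chain C (Suc n) \<alpha> l"
    show "(hat Y n \<kappa> \<cdot> SusMap S (D n)) \<cdot> SusMap S (inc (Suc n) \<alpha> l) = \<phi> \<alpha> l"
      unfolding sus_comp_D[OF h l] eq[OF l]
      by (rule C.cobd_cong[OF F_diagram[OF Y] cochain_sus_inc[OF h] hat_inc[OF Y \<kappa>] l])
  qed
  then show "\<exists>m. arr S m (Sus S (P n)) Y \<and> m \<cdot> SusMap S (D n) = hat Y (Suc n) \<phi>" using h by auto
next
  assume "\<exists>m. arr S m (Sus S (P n)) Y \<and> m \<cdot> SusMap S (D n) = hat Y (Suc n) \<phi>"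
  then obtain m where m: "arr S m (Sus S (P n)) Y" "m \<cdot> SusMap S (D n) = hat Y (Suc n) \<phi>" by blast
  show "\<exists>\<kappa>. cochain C (F Y) n \<kappa> \<and> (\<forall>\<alpha> l. chain C (Suc n) \<alpha> l \<longrightarrow> \<phi> \<alpha> l = cobd C (F Y) \<kappa> \<alpha> l)"
    using cochain_sus_inc[OF m(1)] sus_comp_D[OF m(1)] hat_inc[OF Y \<phi>] m(2)
    by (intro exI[of _ "\<lambda>\<alpha> l. m \<cdot> SusMap S (inc n \<alpha> l)"]) simp
qed

text \<open>Apply the map represented by \<open>\<phi>\<close> to the suspension of 1 = u D + D v:
  the second summand vanishes because \<open>\<phi>\<close> is a cocycle, and the first exhibits a
  coboundary.\<close>

lemma cohomology_vanishes:
  assumes Y: "Y \<in> Ob S" and \<phi>: "cochain C (F Y) (Suc (Suc p)) \<phi>"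
    and cocycle: "\<And>\<alpha> l. chain C (Suc (Suc (Suc p))) \<alpha> l \<Longrightarrow> cobd C (F Y) \<phi> \<alpha> l = \<one>\<^bsub>Grp (F Y) \<alpha>\<^esub>"
  shows "\<exists>\<kappa>. cochain C (F Y) (Suc p) \<kappa> \<and> (\<forall>\<alpha> l. chain C (Suc (Suc p)) \<alpha> l \<longrightarrow> \<phi> \<alpha> l = cobd C (F Y) \<kappa> \<alpha> l)"
proof -
  let ?n = "Suc (Suc p)"
  let ?h = "hat Y ?n \<phi>"
  note h = hat_arr[OF Y \<phi>]
  have hD: "?h \<cdot> SusMap S (D ?n) = Zero S (Sus S (P (Suc ?n))) Y"
    using hat_cocycle_iff[OF Y \<phi>] cocycle by blast
  obtain u v where u: "arr S u (P (Suc p)) (P ?n)" and v: "arr S v (P ?n) (P (Suc ?n))"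
    and split: "Id S (P ?n) = Add S (u \<cdot> D (Suc p)) (D ?n \<cdot> v)"
    using contraction[of p] by blast
  note uD = arr_comp[OF D_arr u] and Dv = arr_comp[OF v D_arr]
  have "?h = ?h \<cdot> SusMap S (Id S (P ?n))"
    using sus_map_id[OF P_Ob] arr_id_right[OF h] by simp
  also have "\<dots> = ?h \<cdot> Add S (SusMap S u \<cdot> SusMap S (D (Suc p))) (SusMap S (D ?n) \<cdot> SusMap S v)"
    unfolding split using sus_map_add[OF P_Ob P_Ob arr_Hom[OF uD] arr_Hom[OF Dv]] sus_comp[OF D_arr u] sus_comp[OF v D_arr]
    by simp
  also have "\<dots> = Add S ((?h \<cdot> SusMap S u) \<cdot> SusMap S (D (Suc p))) ((?h \<cdot> SusMap S (D ?n)) \<cdot> SusMap S v)"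
    using arr_comp_add_right[OF arr_comp[OF sus_arr[OF D_arr] sus_arr[OF u]] arr_comp[OF sus_arr[OF v] sus_arr[OF D_arr]] h]
      arr_assoc[OF sus_arr[OF D_arr] sus_arr[OF u] h] arr_assoc[OF sus_arr[OF v] sus_arr[OF D_arr] h] by simp
  also have "\<dots> = (?h \<cdot> SusMap S u) \<cdot> SusMap S (D (Suc p))"
    using hD comp_zero_left[OF sus_arr[OF v] Y]
      add_zero_right[OF arr_comp[OF sus_arr[OF D_arr] arr_comp[OF sus_arr[OF u] h]]] by simp
  finally show ?thesis
    using hat_coboundary_iff[OF Y \<phi>] arr_comp[OF sus_arr[OF u] h] by metis
qed

end

section \<open>Maps out of a minimal cone\<close>

context minimal_cone_diagram
begin

text \<open>The condition \<open>cocycle1\<close> outside the locale of resolutions, so that the map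
  on cocycles can be built before a resolution is chosen.\<close>

definition cocycle :: "'o \<Rightarrow> ('i \<Rightarrow> 'i list \<Rightarrow> 'a) \<Rightarrow> bool" where
  "cocycle Y \<phi> \<longleftrightarrow> cochain C (F Y) (Suc 0) \<phi> \<and>
     (\<forall>\<alpha> l. chain C (Suc (Suc 0)) \<alpha> l \<longrightarrow> cobd C (F Y) \<phi> \<alpha> l = \<one>\<^bsub>Grp (F Y) \<alpha>\<^esub>)"

lemma cocycle_hat:
  assumes Y: "Y \<in> Ob S" and \<phi>: "cocycle Y \<phi>"
  shows "arr S (hat Y (Suc 0) \<phi>) (Sus S (P (Suc 0))) Y"
    "hat Y (Suc 0) \<phi> \<cdot> SusMap S (D (Suc 0)) = Zero S (Sus S (P (Suc (Suc 0)))) Y"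
  using \<phi> hat_arr[OF Y] hat_cocycle_iff[OF Y, of "Suc 0" \<phi>] by (auto simp: cocycle_def)

text \<open>
  With \<open>Q\<close>, \<open>q\<close>, \<open>s\<close> as above, the map attached to a 1-cocycle $\varphi$ is the composite of
  \<open>q\<close>, $\Sigma s$ and the map $\Sigma P_1 \to Y$ with components $\varphi$.
\<close>

theorem phantom_cocycles:
  obtains \<Lambda> where
    "\<And>Y \<phi>. Y \<in> Ob S \<Longrightarrow> cocycle Y \<phi> \<Longrightarrow> arr S (\<Lambda> Y \<phi>) X Y"
    "\<And>Y \<phi> \<psi>. Y \<in> Ob S \<Longrightarrow> cocycle Y \<phi> \<Longrightarrow> cocycle Y \<psi> \<Longrightarrow>
      \<Lambda> Y (\<lambda>\<alpha> l. Add S (\<phi> \<alpha> l) (\<psi> \<alpha> l)) = Add S (\<Lambda> Y \<phi>) (\<Lambda> Y \<psi>)"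
    "\<And>Y \<phi>. Y \<in> Ob S \<Longrightarrow> cocycle Y \<phi> \<Longrightarrow> \<Lambda> Y \<phi> = Zero S X Y \<longleftrightarrow>
      (\<exists>\<kappa>. cochain C (F Y) 0 \<kappa> \<and> (\<forall>\<alpha> l. chain C (Suc 0) \<alpha> l \<longrightarrow> \<phi> \<alpha> l = cobd C (F Y) \<kappa> \<alpha> l))"
    "\<And>Y. Y \<in> Ob S \<Longrightarrow> \<Lambda> Y ` {\<phi>. cocycle Y \<phi>} = {f. phantom f X Y}"
    "\<And>Y Y' g \<phi>. arr S g Y Y' \<Longrightarrow> cocycle Y \<phi> \<Longrightarrow> \<Lambda> Y' (\<lambda>\<alpha> l. g \<cdot> \<phi> \<alpha> l) = g \<cdot> \<Lambda> Y \<phi>"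
proof -
  obtain Q q t s u where Q: "Q \<in> Ob S" and q: "phantom q X (Sus S Q)" and t: "arr S t (P (Suc 0)) Q"
    and s: "arr S s Q (P (Suc 0))" and u: "arr S u (P (Suc 0)) (P (Suc (Suc 0)))" and ts: "t \<cdot> s = Id S Q"
    and tD: "t \<cdot> D (Suc 0) = Zero S (P (Suc (Suc 0))) Q"
    and split: "Id S (P (Suc 0)) = Add S (s \<cdot> t) (D (Suc 0) \<cdot> u)"
    and ext: "\<And>k Y. arr S k X Y \<Longrightarrow> k \<cdot> aug = Zero S (P 0) Y \<Longrightarrow> \<exists>\<theta>. arr S \<theta> (Sus S Q) Y \<and> \<theta> \<cdot> q = k"
    and iff: "\<And>\<theta> Y. arr S \<theta> (Sus S Q) Y \<Longrightarrow>
      \<theta> \<cdot> q = Zero S X Y \<longleftrightarrow> (\<exists>m. arr S m (Sus S (P 0)) Y \<and> m \<cdot> SusMap S (D 0) = \<theta> \<cdot> SusMap S t)"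
    by (rule syzygy) (rule that; assumption)
  have qa: "arr S q X (Sus S Q)" using q by (simp add: phantom_def)
  note St = sus_arr[OF t] and Ss = sus_arr[OF s] and Su = sus_arr[OF u] and SD = sus_arr[OF D_arr[of "Suc 0"]]
  define \<Lambda> where "\<Lambda> Y \<phi> = (hat Y (Suc 0) \<phi> \<cdot> SusMap S s) \<cdot> q" for Y \<phi>
  have \<theta>: "arr S (hat Y (Suc 0) \<phi> \<cdot> SusMap S s) (Sus S Q) Y" if "Y \<in> Ob S" "cocycle Y \<phi>" for Y \<phi>
    using arr_comp[OF Ss cocycle_hat(1)[OF that]] .
  have closed: "arr S (\<Lambda> Y \<phi>) X Y" if "Y \<in> Ob S" "cocycle Y \<phi>" for Y \<phi>
    unfolding \<Lambda>_def using arr_comp[OF qa \<theta>[OF that]] .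
  have mult: "\<Lambda> Y (\<lambda>\<alpha> l. Add S (\<phi> \<alpha> l) (\<psi> \<alpha> l)) = Add S (\<Lambda> Y \<phi>) (\<Lambda> Y \<psi>)"
    if Y: "Y \<in> Ob S" and \<phi>: "cocycle Y \<phi>" and \<psi>: "cocycle Y \<psi>" for Y \<phi> \<psi>
  proof -
    note h\<phi> = cocycle_hat(1)[OF Y \<phi>] and h\<psi> = cocycle_hat(1)[OF Y \<psi>]
    have c: "cochain C (F Y) (Suc 0) \<phi>" "cochain C (F Y) (Suc 0) \<psi>" using \<phi> \<psi> by (auto simp: cocycle_def)
    then have "cochain C (F Y) (Suc 0) (\<lambda>\<alpha> l. Add S (\<phi> \<alpha> l) (\<psi> \<alpha> l))"
      using arr_add by (simp add: cochain_F_arr[OF Y])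
    then have "hat Y (Suc 0) (\<lambda>\<alpha> l. Add S (\<phi> \<alpha> l) (\<psi> \<alpha> l)) = Add S (hat Y (Suc 0) \<phi>) (hat Y (Suc 0) \<psi>)"
      using arr_comp_add_left[OF sus_arr[OF inc_arr] h\<phi> h\<psi>] hat_inc[OF Y c(1)] hat_inc[OF Y c(2)]
      by (intro hat_eqI[OF Y _ arr_add[OF h\<phi> h\<psi>]]) simp_all
    then show ?thesis
      unfolding \<Lambda>_def using arr_comp_add_left[OF Ss h\<phi> h\<psi>] arr_comp_add_left[OF qa \<theta>[OF Y \<phi>] \<theta>[OF Y \<psi>]] by simp
  qed
  \<comment> \<open>The represented map kills \<Sigma>D in degree 1, so the splitting 1 = s t + D u
    shows that it factors through \<Sigma>t.\<close>
  have hst: "(hat Y (Suc 0) \<phi> \<cdot> SusMap S s) \<cdot> SusMap S t = hat Y (Suc 0) \<phi>" if Y: "Y \<in> Ob S" and \<phi>: "cocycle Y \<phi>" for Y \<phi>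
  proof -
    let ?h = "hat Y (Suc 0) \<phi>"
    note h = cocycle_hat(1)[OF Y \<phi>]
    have "?h = ?h \<cdot> SusMap S (Id S (P (Suc 0)))"
      using sus_map_id[OF P_Ob] arr_id_right[OF h] by simp
    also have "\<dots> = ?h \<cdot> Add S (SusMap S s \<cdot> SusMap S t) (SusMap S (D (Suc 0)) \<cdot> SusMap S u)"
      unfolding split using sus_map_add[OF P_Ob P_Ob arr_Hom[OF arr_comp[OF t s]] arr_Hom[OF arr_comp[OF u D_arr]]]
        sus_comp[OF t s] sus_comp[OF u D_arr] by simp
    also have "\<dots> = Add S ((?h \<cdot> SusMap S s) \<cdot> SusMap S t) ((?h \<cdot> SusMap S (D (Suc 0))) \<cdot> SusMap S u)"
      using arr_comp_add_right[OF arr_comp[OF St Ss] arr_comp[OF Su SD] h] arr_assoc[OF St Ss h] arr_assoc[OF Su SD h]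
      by simp
    also have "\<dots> = (?h \<cdot> SusMap S s) \<cdot> SusMap S t"
      using cocycle_hat(2)[OF Y \<phi>] comp_zero_left[OF Su Y] add_zero_right[OF arr_comp[OF St \<theta>[OF Y \<phi>]]] by simp
    finally show ?thesis by simp
  qed
  have ker: "\<Lambda> Y \<phi> = Zero S X Y \<longleftrightarrow>
      (\<exists>\<kappa>. cochain C (F Y) 0 \<kappa> \<and> (\<forall>\<alpha> l. chain C (Suc 0) \<alpha> l \<longrightarrow> \<phi> \<alpha> l = cobd C (F Y) \<kappa> \<alpha> l))"
    if Y: "Y \<in> Ob S" and \<phi>: "cocycle Y \<phi>" for Y \<phi>
  proof -
    have "cochain C (F Y) (Suc 0) \<phi>" using \<phi> by (simp add: cocycle_def)
    then show ?thesis
      unfolding \<Lambda>_def iff[OF \<theta>[OF Y \<phi>]] hst[OF Y \<phi>] using hat_coboundary_iff[OF Y] by blast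
  qed
  have image: "\<Lambda> Y ` {\<phi>. cocycle Y \<phi>} = {f. phantom f X Y}" if Y: "Y \<in> Ob S" for Y
  proof (intro subset_antisym subsetI)
    fix f assume "f \<in> \<Lambda> Y ` {\<phi>. cocycle Y \<phi>}"
    then show "f \<in> {f. phantom f X Y}"
      using phantom_comp_left[OF q \<theta>[OF Y]] by (auto simp: \<Lambda>_def)
  next
    fix f assume "f \<in> {f. phantom f X Y}"
    then have f: "phantom f X Y" "arr S f X Y" by (auto simp: phantom_def)
    \<comment> \<open>A phantom vanishes on the projective \<open>P 0\<close> and so factors through
      \<open>q\<close>; the factor, composed with \<Sigma>t, represents the required
      cocycle.\<close>
    have "f \<cdot> aug = Zero S (P 0) Y"
      using P_proj phantom_comp_right[OF f(1) aug_arr] by (auto simp: proj_def)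
    then obtain \<eta> where \<eta>: "arr S \<eta> (Sus S Q) Y" "\<eta> \<cdot> q = f" using ext[OF f(2)] by blast
    note \<eta>t = arr_comp[OF St \<eta>(1)]
    define \<phi> where "\<phi> = (\<lambda>\<alpha> l. (\<eta> \<cdot> SusMap S t) \<cdot> SusMap S (inc (Suc 0) \<alpha> l))"
    have c: "cochain C (F Y) (Suc 0) \<phi>" unfolding \<phi>_def by (rule cochain_sus_inc[OF \<eta>t])
    have h: "hat Y (Suc 0) \<phi> = \<eta> \<cdot> SusMap S t"
      by (rule hat_eqI[OF Y c \<eta>t]) (simp add: \<phi>_def)
    have "(\<eta> \<cdot> SusMap S t) \<cdot> SusMap S (D (Suc 0)) = Zero S (Sus S (P (Suc (Suc 0)))) Y"
      unfolding arr_assoc[OF SD St \<eta>(1)] sus_comp[OF D_arr t, symmetric] tD sus_zero[OF P_Ob Q]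
      by (rule comp_zero_right[OF \<eta>(1) sus_Ob[OF P_Ob]])
    then have \<phi>: "cocycle Y \<phi>" using c hat_cocycle_iff[OF Y c] h by (simp add: cocycle_def)
    have "(\<eta> \<cdot> SusMap S t) \<cdot> SusMap S s = \<eta>"
      using arr_assoc[OF Ss St \<eta>(1)] sus_comp[OF s t] ts sus_map_id[OF Q] arr_id_right[OF \<eta>(1)] by simp
    then have "\<Lambda> Y \<phi> = f" using \<eta>(2) h by (simp add: \<Lambda>_def)
    then show "f \<in> \<Lambda> Y ` {\<phi>. cocycle Y \<phi>}" using \<phi> by blast
  qed
  have nat: "\<Lambda> Y' (\<lambda>\<alpha> l. g \<cdot> \<phi> \<alpha> l) = g \<cdot> \<Lambda> Y \<phi>" if g: "arr S g Y Y'" and \<phi>: "cocycle Y \<phi>" for Y Y' g \<phi>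
  proof -
    have Y: "Y \<in> Ob S" "Y' \<in> Ob S" using g by (auto simp: arr_def)
    note h = cocycle_hat(1)[OF Y(1) \<phi>]
    have c: "cochain C (F Y) (Suc 0) \<phi>" using \<phi> by (simp add: cocycle_def)
    have "cochain C (F Y') (Suc 0) (\<lambda>\<alpha> l. g \<cdot> \<phi> \<alpha> l)"
      using c arr_comp[OF _ g] by (simp add: cochain_F_arr Y)
    then have "hat Y' (Suc 0) (\<lambda>\<alpha> l. g \<cdot> \<phi> \<alpha> l) = g \<cdot> hat Y (Suc 0) \<phi>"
      using hat_inc[OF Y(1) c] arr_assoc[OF sus_arr[OF inc_arr] h g]
      by (intro hat_eqI[OF Y(2) _ arr_comp[OF h g]]) simp_all
    then show ?thesis
      unfolding \<Lambda>_def using arr_assoc[OF Ss h g] arr_assoc[OF qa \<theta>[OF Y(1) \<phi>] g] by simp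
  qed
  show thesis by (rule that[OF closed mult ker image nat])
qed

section \<open>Restriction of maps along the cone\<close>

lemma restriction_hom:
  assumes Y: "Y \<in> Ob S"
  shows "cone_restriction C S c \<in> hom (hom_group S X Y) (lim_group (opposite C) (G Y))"
proof (rule homI)
  fix f assume "f \<in> carrier (hom_group S X Y)"
  then have f: "arr S f X Y" using X_Ob Y by (simp add: arr_def)
  have "(f \<cdot> c \<beta>) \<cdot> Da a = f \<cdot> c \<alpha>" if "arr C a \<alpha> \<beta>" for a \<alpha> \<beta>
    using arr_assoc[OF Da_arr[OF that] c_arr f] c_comp[OF that] that by (simp add: arr_def)
  then show "cone_restriction C S c f \<in> carrier (lim_group (opposite C) (G Y))"
    using arr_Hom[OF arr_comp[OF c_arr f]] by (auto simp: lim_group_simps cone_restriction_def arr_def)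
  fix g assume "g \<in> carrier (hom_group S X Y)"
  then have g: "arr S g X Y" using X_Ob Y by (simp add: arr_def)
  show "cone_restriction C S c (f \<otimes>\<^bsub>hom_group S X Y\<^esub> g)
      = cone_restriction C S c f \<otimes>\<^bsub>lim_group (opposite C) (G Y)\<^esub> cone_restriction C S c g"
    using arr_comp_add_left[OF c_arr f g] by (auto simp: lim_group_simps cone_restriction_def)
qed

text \<open>A map is trivial on all c \<alpha> iff it kills \<open>aug\<close>. Phantoms do so
  because \<open>P 0\<close> is projective; conversely, every map from a finite object to X passes
  through \<open>aug\<close>.\<close>

lemma restriction_eq_one_iff:
  assumes f: "arr S f X Y"
  shows "cone_restriction C S c f = \<one>\<^bsub>lim_group (opposite C) (G Y)\<^esub> \<longleftrightarrow> phantom f X Y"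
proof -
  have Y: "Y \<in> Ob S" using f by (simp add: arr_def)
  have fa: "(f \<cdot> aug) \<cdot> inc 0 \<alpha> [] = f \<cdot> c \<alpha>" if "\<alpha> \<in> Ob C" for \<alpha>
    using arr_assoc[OF inc0_arr[OF that] aug_arr f] aug_inc[OF that] by simp
  have "cone_restriction C S c f = \<one>\<^bsub>lim_group (opposite C) (G Y)\<^esub> \<longleftrightarrow> (\<forall>\<alpha>\<in>Ob C. f \<cdot> c \<alpha> = Zero S (Do \<alpha>) Y)"
    by (auto simp: lim_group_simps cone_restriction_def fun_eq_iff restrict_def)
  also have "\<dots> \<longleftrightarrow> f \<cdot> aug = Zero S (P 0) Y"
  proof
    assume "\<forall>\<alpha>\<in>Ob C. f \<cdot> c \<alpha> = Zero S (Do \<alpha>) Y"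
    then show "f \<cdot> aug = Zero S (P 0) Y"
      using fa comp_zero_left[OF inc0_arr Y] by (intro P0_eqI[OF arr_comp[OF aug_arr f] arr_zero[OF P_Ob Y]]) simp
  next
    assume "f \<cdot> aug = Zero S (P 0) Y"
    then show "\<forall>\<alpha>\<in>Ob C. f \<cdot> c \<alpha> = Zero S (Do \<alpha>) Y"
      using fa comp_zero_left[OF inc0_arr Y] by auto
  qed
  also have "\<dots> \<longleftrightarrow> phantom f X Y"
  proof
    assume fa: "f \<cdot> aug = Zero S (P 0) Y"
    have "f \<cdot> x = Zero S W Y" if W: "W \<in> Fin" and x: "arr S x W X" for W x
    proof -
      obtain y where y: "arr S y W (P 0)" "aug \<cdot> y = x" using minimal_cone_exact(1)[OF W x] by blast
      then show ?thesis using arr_assoc[OF y(1) aug_arr f] fa comp_zero_left[OF y(1) Y] by simp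
    qed
    then show "phantom f X Y" using f by (simp add: phantom_def)
  next
    assume "phantom f X Y"
    then show "f \<cdot> aug = Zero S (P 0) Y"
      using P_proj phantom_comp_right[OF _ aug_arr] by (auto simp: proj_def)
  qed
  finally show ?thesis .
qed

lemma restriction_kernel:
  assumes Y: "Y \<in> Ob S"
  shows "kernel (hom_group S X Y) (lim_group (opposite C) (G Y)) (cone_restriction C S c) = {f. phantom f X Y}"
  using restriction_eq_one_iff X_Ob Y by (auto simp: kernel_def arr_def phantom_def)

text \<open>A compatible family is a map out of \<open>P 0\<close> that kills \<open>D 0\<close>. By
  exactness it kills the kernel of \<open>aug\<close> on finite objects, and
  \<open>brown_factor\<close> extends it to X. Agreement on finite objects is enough, since every
  X_\<alpha> is finite.\<close>

lemma restriction_epi: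
  assumes Y: "Y \<in> Ob S"
  shows "cone_restriction C S c \<in> epi (hom_group S X Y) (lim_group (opposite C) (G Y))"
proof -
  have "\<exists>f. arr S f X Y \<and> cone_restriction C S c f = z" if z: "z \<in> carrier (lim_group (opposite C) (G Y))" for z
  proof -
    have za: "arr S (z \<alpha>) (Do \<alpha>) Y" if "\<alpha> \<in> Ob C" for \<alpha>
      using z that Do_Ob Y by (auto simp: lim_group_simps arr_def)
    have zl: "z \<beta> \<cdot> Da a = z \<alpha>" if "arr C a \<alpha> \<beta>" for a \<alpha> \<beta>
      using z that by (auto simp: lim_group_simps arr_def)
    have "cochain C (G Y) 0 (\<lambda>\<alpha> l. z \<alpha>)"
      using za by (simp add: cochain_G_arr Y chain_0)
    from P_induced[OF Y this] obtain m where m: "arr S m (P 0) Y" "\<And>\<alpha>. \<alpha> \<in> Ob C \<Longrightarrow> m \<cdot> inc 0 \<alpha> [] = z \<alpha>"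
      by (auto simp: chain_0)
    have mD: "m \<cdot> D 0 = Zero S (P (Suc 0)) Y"
      using comp_D0_eq_zero_iff[OF m(1)] m(2) zl by (simp add: arr_def)
    have "m \<cdot> x = Zero S W Y" if W: "W \<in> Fin" and x: "arr S x W (P 0)" and ax: "aug \<cdot> x = Zero S W X" for W x
    proof -
      obtain y where y: "arr S y W (P (Suc 0))" "D 0 \<cdot> y = x" using minimal_cone_exact(2)[OF W x ax] by blast
      then show ?thesis using arr_assoc[OF y(1) D_arr m(1)] mD comp_zero_left[OF y(1) Y] by simp
    qed
    from brown_factor[OF aug_fin_epi m(1) this] obtain f where f: "arr S f X Y"
      and fx: "\<And>W x. W \<in> Fin \<Longrightarrow> arr S x W (P 0) \<Longrightarrow> f \<cdot> aug \<cdot> x = m \<cdot> x" by blast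
    have "f \<cdot> c \<alpha> = z \<alpha>" if \<alpha>: "\<alpha> \<in> Ob C" for \<alpha>
      using fx[OF Do_fin[OF \<alpha>] inc0_arr[OF \<alpha>]] aug_inc[OF \<alpha>] m(2)[OF \<alpha>] by simp
    moreover have "z \<in> extensional (Ob C)" using z by (auto simp: lim_group_simps PiE_def)
    ultimately have "cone_restriction C S c f = z"
      by (auto simp: cone_restriction_def extensional_def)
    then show ?thesis using f by blast
  qed
  then have "cone_restriction C S c ` carrier (hom_group S X Y) = carrier (lim_group (opposite C) (G Y))"
    using hom_carrier[OF restriction_hom[OF Y]] arr_Hom by fastforce
  then show ?thesis using restriction_hom[OF Y] by (simp add: epi_def)
qed

lemma restriction_natural:
  assumes g: "arr S g Y Y'" and f: "arr S f X Y"
  shows "cone_restriction C S c (g \<cdot> f) = lim_map (opposite C) (\<lambda>\<alpha> h. g \<cdot> h) (cone_restriction C S c f)"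
  using arr_assoc[OF c_arr f g] by (auto simp: cone_restriction_def lim_map_def)

end

text \<open>Lists over an infinite type and their finite integral combinations are no more numerous
  than the type itself.\<close>

lemma fun_large:
  assumes "infinite (UNIV :: 'i set)"
  shows "(UNIV :: ('i list \<Rightarrow>\<^sub>0 int) set) \<lesssim> (UNIV :: ('i \<Rightarrow> 'm \<times> int) set)"
proof -
  have L: "infinite (UNIV :: 'i list set)"
    using assms infinite_UNIV_listI by blast
  have "(UNIV :: ('i list \<Rightarrow>\<^sub>0 int) set) \<approx> (UNIV :: 'i list set)"
    using eqpoll_free_Abelian_group_infinite[OF L] by (simp add: free_Abelian_group_def)
  also have "(UNIV :: 'i list set) \<lesssim> (UNIV :: 'i set)"
    using card_of_lists_infinite[OF assms] by (simp add: lepoll_iff_ordLeq ordIso_iff_ordLeq)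
  also have "(UNIV :: 'i set) \<lesssim> (UNIV :: ('i \<Rightarrow> 'm \<times> int) set)"
    unfolding lepoll_def
    \<comment> \<open>Each element goes to its indicator function; the first component is an
      arbitrary fixed value.\<close>
    by (rule exI[of _ "\<lambda>i j. (undefined, if i = j then 1 else 0)"]) (auto simp: inj_on_def fun_eq_iff split: if_splits)
  finally show ?thesis .
qed

context minimal_cone_diagram
begin

text \<open>\<delta> is the transport by \<open>lim1_map\<close> of the map \<open>\<Lambda>\<close>
  from cocycles onto phantoms, so its image is the kernel of restriction. Naturality reduces to that
  of \<open>\<Lambda>\<close>, because a representing cochain composed with \<open>g\<close>
  represents the image class.\<close>

theorem restriction_short_exact:
  fixes R :: "'o \<Rightarrow> ('i, 'i, 'a, 'h) resolution"
  assumes h: "(UNIV :: ('i list \<Rightarrow>\<^sub>0 int) set) \<lesssim> (UNIV :: 'h set)"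
    and R: "\<And>Y. Y \<in> Ob S \<Longrightarrow> injective_resolution (opposite C) (F Y) (R Y)"
  obtains \<delta> where
    "\<And>Y. Y \<in> Ob S \<Longrightarrow> short_exact (derived_lim (opposite C) (R Y) (Suc 0)) (\<delta> Y) (hom_group S X Y)
       (cone_restriction C S c) (lim_group (opposite C) (G Y))"
    "\<And>Y Y' g \<Phi> \<xi>. arr S g Y Y' \<Longrightarrow> resolution_map (opposite C) (F Y) (R Y) (R Y') (\<lambda>\<alpha> f. g \<cdot> f) \<Phi> \<Longrightarrow>
       \<xi> \<in> carrier (derived_lim (opposite C) (R Y) (Suc 0)) \<Longrightarrow>
       \<delta> Y' (derived_lim_map (opposite C) (R Y') \<Phi> (Suc 0) \<xi>) = g \<cdot> \<delta> Y \<xi>"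
proof -
  have DR: "diagram_resolution C (F Y) (R Y)" if "Y \<in> Ob S" for Y
    using that F_diagram R h by (intro diagram_resolution.intro diagram_resolution_axioms.intro C.category_axioms) auto
  obtain \<Lambda> where closed: "\<And>Y \<phi>. Y \<in> Ob S \<Longrightarrow> cocycle Y \<phi> \<Longrightarrow> arr S (\<Lambda> Y \<phi>) X Y"
    and mult: "\<And>Y \<phi> \<psi>. Y \<in> Ob S \<Longrightarrow> cocycle Y \<phi> \<Longrightarrow> cocycle Y \<psi> \<Longrightarrow>
      \<Lambda> Y (\<lambda>\<alpha> l. Add S (\<phi> \<alpha> l) (\<psi> \<alpha> l)) = Add S (\<Lambda> Y \<phi>) (\<Lambda> Y \<psi>)"
    and ker: "\<And>Y \<phi>. Y \<in> Ob S \<Longrightarrow> cocycle Y \<phi> \<Longrightarrow> \<Lambda> Y \<phi> = Zero S X Y \<longleftrightarrow>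
      (\<exists>\<kappa>. cochain C (F Y) 0 \<kappa> \<and> (\<forall>\<alpha> l. chain C (Suc 0) \<alpha> l \<longrightarrow> \<phi> \<alpha> l = cobd C (F Y) \<kappa> \<alpha> l))"
    and image: "\<And>Y. Y \<in> Ob S \<Longrightarrow> \<Lambda> Y ` {\<phi>. cocycle Y \<phi>} = {f. phantom f X Y}"
    and nat: "\<And>Y Y' g \<phi>. arr S g Y Y' \<Longrightarrow> cocycle Y \<phi> \<Longrightarrow> \<Lambda> Y' (\<lambda>\<alpha> l. g \<cdot> \<phi> \<alpha> l) = g \<cdot> \<Lambda> Y \<phi>"
    by (rule phantom_cocycles) (rule that; assumption)
  have cocycle1: "diagram_resolution.cocycle1 C (F Y) = cocycle Y" if "Y \<in> Ob S" for Y
    by (intro ext) (simp add: cocycle_def diagram_resolution.cocycle1_def[OF DR[OF that]])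
  have coboundary1: "diagram_resolution.coboundary1 C (F Y) \<phi> \<longleftrightarrow>
      (\<exists>\<kappa>. cochain C (F Y) 0 \<kappa> \<and> (\<forall>\<alpha> l. chain C (Suc 0) \<alpha> l \<longrightarrow> \<phi> \<alpha> l = cobd C (F Y) \<kappa> \<alpha> l))" if "Y \<in> Ob S" for Y \<phi>
    by (simp add: diagram_resolution.coboundary1_def[OF DR[OF that]])
  define \<delta> where "\<delta> Y = diagram_resolution.lim1_map C (F Y) (R Y) (\<Lambda> Y)" for Y
  have \<Lambda>: "group (hom_group S X Y)"
    "\<And>\<phi>. diagram_resolution.cocycle1 C (F Y) \<phi> \<Longrightarrow> \<Lambda> Y \<phi> \<in> carrier (hom_group S X Y)"
    "\<And>\<phi> \<psi>. diagram_resolution.cocycle1 C (F Y) \<phi> \<Longrightarrow> diagram_resolution.cocycle1 C (F Y) \<psi> \<Longrightarrow>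
      \<Lambda> Y (\<lambda>\<alpha> l. \<phi> \<alpha> l \<otimes>\<^bsub>Grp (F Y) \<alpha>\<^esub> \<psi> \<alpha> l) = \<Lambda> Y \<phi> \<otimes>\<^bsub>hom_group S X Y\<^esub> \<Lambda> Y \<psi>"
    "\<And>\<phi>. diagram_resolution.cocycle1 C (F Y) \<phi> \<Longrightarrow>
      \<Lambda> Y \<phi> = \<one>\<^bsub>hom_group S X Y\<^esub> \<longleftrightarrow> diagram_resolution.coboundary1 C (F Y) \<phi>"
    if Y: "Y \<in> Ob S" for Y
    unfolding cocycle1[OF Y] coboundary1[OF Y]
    using hom_group_group[OF X_Ob Y] arr_Hom[OF closed[OF Y]] mult[OF Y] ker[OF Y] by simp_all
  have "short_exact (derived_lim (opposite C) (R Y) (Suc 0)) (\<delta> Y) (hom_group S X Y)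
       (cone_restriction C S c) (lim_group (opposite C) (G Y))" if Y: "Y \<in> Ob S" for Y
    unfolding short_exact_def \<delta>_def
    using diagram_resolution.lim1_map_mon[OF DR[OF Y] \<Lambda>[OF Y]] restriction_epi[OF Y]
      diagram_resolution.lim1_map_image[OF DR[OF Y] \<Lambda>[OF Y]] image[OF Y] restriction_kernel[OF Y]
    by (simp add: cocycle1[OF Y])
  moreover have "\<delta> Y' (derived_lim_map (opposite C) (R Y') \<Phi> (Suc 0) \<xi>) = g \<cdot> \<delta> Y \<xi>"
    if g: "arr S g Y Y'" and \<Phi>: "resolution_map (opposite C) (F Y) (R Y) (R Y') (\<lambda>\<alpha> f. g \<cdot> f) \<Phi>"
      and \<xi>: "\<xi> \<in> carrier (derived_lim (opposite C) (R Y) (Suc 0))" for Y Y' g \<Phi> \<xi>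
  proof -
    have Y: "Y \<in> Ob S" "Y' \<in> Ob S" using g by (auto simp: arr_def)
    interpret A: diagram_resolution C "F Y" "R Y" by (rule DR[OF Y(1)])
    interpret B: diagram_resolution C "F Y'" "R Y'" by (rule DR[OF Y(2)])
    obtain z where z: "z \<in> lim_cocycles (opposite C) (R Y) (Suc 0)"
      "\<xi> = lim_coboundaries (opposite C) (R Y) (Suc 0) #>\<^bsub>A.cocycle_group (Suc 0)\<^esub> z"
      using A.derived_lim_carrier[OF \<xi>] by blast
    have z\<xi>: "z \<in> \<xi>" using A.derived_lim_coset(2)[OF z(1)] z(2) by simp
    obtain \<phi> where \<phi>: "A.rep z \<phi>" using A.rep_ex[OF z(1)] by blast
    have n: "is_ab_nat (opposite C) (F Y) (F Y') (\<lambda>\<alpha> f. g \<cdot> f)"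
      by (rule is_ab_nat_contra_hom[OF C.category_axioms sus_diagram_functor g])
    have zl: "z \<in> carrier (A.lim_J (Suc 0))" using z(1) by (simp add: A.lim_cocycles_iff)
    have "\<delta> Y' (derived_lim_map (opposite C) (R Y') \<Phi> (Suc 0) \<xi>) = \<Lambda> Y' (\<lambda>\<alpha> l. g \<cdot> \<phi> \<alpha> l)"
      unfolding \<delta>_def
      by (rule B.lim1_map_eq[OF \<Lambda>[OF Y(2)] A.derived_lim_map_coset[OF DR[OF Y(2)] \<Phi> \<xi> z\<xi>]
            A.rep_map[OF DR[OF Y(2)] n \<Phi> \<phi> zl]])
    also have "\<dots> = g \<cdot> \<Lambda> Y \<phi>"
      using nat[OF g] A.rep_cocycle[OF \<phi>] cocycle1[OF Y(1)] by simp
    also have "\<Lambda> Y \<phi> = \<delta> Y \<xi>"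
      unfolding \<delta>_def by (rule A.lim1_map_eq[OF \<Lambda>[OF Y(1)] \<xi> z\<xi> \<phi>, symmetric])
    finally show ?thesis .
  qed
  ultimately show thesis by (rule that)
qed

end

theorem corollary5p12:
  fixes small :: "'i set \<Rightarrow> bool"
    and S :: "('o, 'm) triangulated_data"
  assumes "smallness small"
    and "triangulated_category S"
    and "has_small_coproducts small S"
    and "brown_category small S"
    and "generating_phantom_projective_class small S"
  shows
    "(\<forall>X\<in>Ob S. \<forall>Y\<in>Ob S. \<forall>A.
        adams_resolution S (phantom_projectives small S) (phantom_maps small S) X A \<longrightarrow>
        ss_collapses_at (adams_couple S A Y) 2)
     \<and>
     (\<forall>X\<in>Ob S. \<forall>Y\<in>Ob S. \<forall>Z\<in>Ob S.
        \<forall>f\<in>Hom S X Y \<inter> phantom_maps small S. \<forall>g\<in>Hom S Y Z \<inter> phantom_maps small S.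
        g \<cdot>\<^bsub>S\<^esub> f = Zero S X Z)
     \<and>
     (\<forall>(C :: ('i, 'i) category_data) Do Da X c.
        small_category small C \<longrightarrow> filtered C \<longrightarrow> is_functor C S Do Da \<longrightarrow>
        (\<forall>\<alpha>\<in>Ob C. Do \<alpha> \<in> finite_objects small S) \<longrightarrow> minimal_cone small C S Do Da X c \<longrightarrow>
        (\<forall>Y\<in>Ob S.
           kernel (hom_group S X Y) (lim_group (opposite C) (contra_hom_diagram S Do Da Y))
             (cone_restriction C S c) = Hom S X Y \<inter> phantom_maps small S) \<and>
        (\<forall>R :: 'o \<Rightarrow> ('i, 'i, 'm, 'h) resolution.
           (UNIV :: ('i \<Rightarrow> 'm \<times> int) set) \<lesssim> (UNIV :: 'h set) \<longrightarrow>
           (\<forall>Y\<in>Ob S. injective_resolution (opposite C)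
              (contra_hom_diagram S (Sus S \<circ> Do) (SusMap S \<circ> Da) Y) (R Y)) \<longrightarrow>
           (\<exists>\<delta>.
              (\<forall>Y\<in>Ob S.
                 short_exact (derived_lim (opposite C) (R Y) 1) (\<delta> Y) (hom_group S X Y)
                   (cone_restriction C S c)
                   (lim_group (opposite C) (contra_hom_diagram S Do Da Y))) \<and>
              (\<forall>Y\<in>Ob S. \<forall>Y'\<in>Ob S. \<forall>g\<in>Hom S Y Y'.
                 (\<forall>\<phi>. resolution_map (opposite C)
                        (contra_hom_diagram S (Sus S \<circ> Do) (SusMap S \<circ> Da) Y) (R Y) (R Y')
                        (\<lambda>\<alpha> f. g \<cdot>\<^bsub>S\<^esub> f) \<phi> \<longrightarrow>
                    (\<forall>\<xi>\<in>carrier (derived_lim (opposite C) (R Y) 1).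
                       \<delta> Y' (derived_lim_map (opposite C) (R Y') \<phi> 1 \<xi>) = g \<cdot>\<^bsub>S\<^esub> \<delta> Y \<xi>)) \<and>
                 (\<forall>f\<in>Hom S X Y.
                    cone_restriction C S c (g \<cdot>\<^bsub>S\<^esub> f) =
                    lim_map (opposite C) (\<lambda>\<alpha> h. g \<cdot>\<^bsub>S\<^esub> h) (cone_restriction C S c f)))) \<and>
           (\<forall>Y\<in>Ob S. \<forall>i\<ge>2. trivial_group (derived_lim (opposite C) (R Y) i))))"
proof -
  interpret brown_phantom_category S small
    using assms by (intro brown_phantom_category.intro brown_phantom_category_axioms.intro)
  \<comment> \<open>\<open>smallness\<close> provides an infinite small set, so \<open>'i\<close> is
    infinite, as the comparison of cardinals requires.\<close>
  have inf: "infinite (UNIV :: 'i set)"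
    using assms(1) infinite_super[OF subset_UNIV] by (auto simp: smallness_def)
  show ?thesis
  proof (intro conjI allI ballI impI)
    fix X Y A assume "Y \<in> Ob S" "adams_resolution S (phantom_projectives small S) (phantom_maps small S) X A"
    then show "ss_collapses_at (adams_couple S A Y) 2" by (rule adams_collapse)
  next
    fix X Y Z f g assume "X \<in> Ob S" "Y \<in> Ob S" "Z \<in> Ob S"
      and "f \<in> Hom S X Y \<inter> phantom_maps small S" "g \<in> Hom S Y Z \<inter> phantom_maps small S"
    then have "phantom f X Y" "phantom g Y Z"
      using phantom_maps_iff[of f X Y] phantom_maps_iff[of g Y Z] by (simp_all add: arr_def)
    then show "g \<cdot>\<^bsub>S\<^esub> f = Zero S X Z" by (rule phantom_comp_phantom)
  next
    fix C :: "('i, 'i) category_data" and Do Da X c Y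
    assume "small_category small C" "filtered C" "is_functor C S Do Da"
      "\<forall>\<alpha>\<in>Ob C. Do \<alpha> \<in> Fin" "minimal_cone small C S Do Da X c" and Y: "Y \<in> Ob S"
    then interpret minimal_cone_diagram S small C Do Da X c
      by (intro minimal_cone_diagram.intro minimal_cone_diagram_axioms.intro brown_phantom_category_axioms) auto
    show "kernel (hom_group S X Y) (lim_group (opposite C) (contra_hom_diagram S Do Da Y))
      (cone_restriction C S c) = Hom S X Y \<inter> phantom_maps small S"
      unfolding restriction_kernel[OF Y]
      using phantom_maps_iff[of _ X Y] X_Ob Y by (auto simp: arr_def phantom_def)
  next
    fix C :: "('i, 'i) category_data" and Do Da X c and R :: "'o \<Rightarrow> ('i, 'i, 'm, 'h) resolution"
    assume "small_category small C" "filtered C" "is_functor C S Do Da"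
      "\<forall>\<alpha>\<in>Ob C. Do \<alpha> \<in> Fin" "minimal_cone small C S Do Da X c"
      and h: "(UNIV :: ('i \<Rightarrow> 'm \<times> int) set) \<lesssim> (UNIV :: 'h set)"
      and R: "\<forall>Y\<in>Ob S. injective_resolution (opposite C)
              (contra_hom_diagram S (Sus S \<circ> Do) (SusMap S \<circ> Da) Y) (R Y)"
    then interpret minimal_cone_diagram S small C Do Da X c
      by (intro minimal_cone_diagram.intro minimal_cone_diagram_axioms.intro brown_phantom_category_axioms) auto
    have emb: "(UNIV :: ('i list \<Rightarrow>\<^sub>0 int) set) \<lesssim> (UNIV :: 'h set)"
      by (rule lepoll_trans[OF fun_large[OF inf] h])
    obtain \<delta> where \<delta>: "\<And>Y. Y \<in> Ob S \<Longrightarrow> short_exact (derived_lim (opposite C) (R Y) (Suc 0)) (\<delta> Y) (hom_group S X Y)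
         (cone_restriction C S c) (lim_group (opposite C) (G Y))"
      "\<And>Y Y' g \<Phi> \<xi>. arr S g Y Y' \<Longrightarrow> resolution_map (opposite C) (F Y) (R Y) (R Y') (\<lambda>\<alpha> f. g \<cdot>\<^bsub>S\<^esub> f) \<Phi> \<Longrightarrow>
         \<xi> \<in> carrier (derived_lim (opposite C) (R Y) (Suc 0)) \<Longrightarrow>
         \<delta> Y' (derived_lim_map (opposite C) (R Y') \<Phi> (Suc 0) \<xi>) = g \<cdot>\<^bsub>S\<^esub> \<delta> Y \<xi>"
      using restriction_short_exact[OF emb, of R] R by blast
    show "\<exists>\<delta>. (\<forall>Y\<in>Ob S. short_exact (derived_lim (opposite C) (R Y) 1) (\<delta> Y) (hom_group S X Y)
          (cone_restriction C S c) (lim_group (opposite C) (contra_hom_diagram S Do Da Y))) \<and>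
        (\<forall>Y\<in>Ob S. \<forall>Y'\<in>Ob S. \<forall>g\<in>Hom S Y Y'.
           (\<forall>\<phi>. resolution_map (opposite C)
                  (contra_hom_diagram S (Sus S \<circ> Do) (SusMap S \<circ> Da) Y) (R Y) (R Y')
                  (\<lambda>\<alpha> f. g \<cdot>\<^bsub>S\<^esub> f) \<phi> \<longrightarrow>
              (\<forall>\<xi>\<in>carrier (derived_lim (opposite C) (R Y) 1).
                 \<delta> Y' (derived_lim_map (opposite C) (R Y') \<phi> 1 \<xi>) = g \<cdot>\<^bsub>S\<^esub> \<delta> Y \<xi>)) \<and>
           (\<forall>f\<in>Hom S X Y. cone_restriction C S c (g \<cdot>\<^bsub>S\<^esub> f) =
              lim_map (opposite C) (\<lambda>\<alpha> h. g \<cdot>\<^bsub>S\<^esub> h) (cone_restriction C S c f)))"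
    proof (rule exI[of _ \<delta>], unfold One_nat_def, intro conjI ballI allI impI)
      fix Y assume Y: "Y \<in> Ob S"
      then show "short_exact (derived_lim (opposite C) (R Y) (Suc 0)) (\<delta> Y) (hom_group S X Y)
          (cone_restriction C S c) (lim_group (opposite C) (contra_hom_diagram S Do Da Y))" by (rule \<delta>)
      fix Y' g assume "Y' \<in> Ob S" "g \<in> Hom S Y Y'"
      then have g: "arr S g Y Y'" using Y by (simp add: arr_def)
      fix \<phi> \<xi> assume "resolution_map (opposite C) (F Y) (R Y) (R Y') (\<lambda>\<alpha> f. g \<cdot>\<^bsub>S\<^esub> f) \<phi>"
        "\<xi> \<in> carrier (derived_lim (opposite C) (R Y) (Suc 0))"
      then show "\<delta> Y' (derived_lim_map (opposite C) (R Y') \<phi> (Suc 0) \<xi>) = g \<cdot>\<^bsub>S\<^esub> \<delta> Y \<xi>"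
        by (rule \<delta>(2)[OF g])
    next
      fix Y Y' g f assume "Y \<in> Ob S" "Y' \<in> Ob S" "g \<in> Hom S Y Y'" "f \<in> Hom S X Y"
      then show "cone_restriction C S c (g \<cdot>\<^bsub>S\<^esub> f) =
          lim_map (opposite C) (\<lambda>\<alpha> h. g \<cdot>\<^bsub>S\<^esub> h) (cone_restriction C S c f)"
        using X_Ob by (intro restriction_natural) (simp_all add: arr_def)
    qed
    fix Y and i :: nat assume Y: "Y \<in> Ob S" and i: "2 \<le> i"
    interpret A: diagram_resolution C "F Y" "R Y"
      using Y F_diagram R emb
      by (intro diagram_resolution.intro diagram_resolution_axioms.intro C.category_axioms) auto
    show "trivial_group (derived_lim (opposite C) (R Y) i)"
      by (rule A.derived_lim_trivial[OF _ i]) (rule cohomology_vanishes[OF Y])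
  qed
qed

end
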